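(* Let $p$ be a prime number and let $A(\mathcal{W}(p))$ be Zhu's algebra of the triplet vertex operator algebra $\mathcal{W}(p)$. Then for each $i\in\{1,\dots,p-1\}$ the ideal $\mathbb{I}_{h_{i,1}}\subset A(\mathcal{W}(p))$ is two-dimensional, and $$\dim A(\mathcal{W}(p))=6p-1.$$
   Context: Definition of $\mathcal{W}(p)$ (for an integer $p\ge2$). Let $L=\mathbb{Z}\alpha$ with $\langle\alpha,\alpha\rangle=2p$, and let $V_L=\mathcal{U}(\hat{\mathfrak h}_{<0})\otimes\mathbb{C}[L]$ be the lattice vertex algebra with vacuum $\mathbf 1$ and conformal vector $\omega=\frac{\alpha(-1)^2}{4p}\mathbf 1+\frac{p-1}{2p}\alpha(-2)\mathbf 1$ (central charge $1-\frac{6(p-1)^2}{p}$). Let $L^\circ=\mathbb{Z}\frac{\alpha}{2p}$ and let $V_{L^\circ}$ be the associated generalized vertex algebra. With $Y(e^{-\alpha/p},x)=\sum_{r\in\frac1p\mathbb{Z}}e^{-\alpha/p}_r x^{-r-1}$ put $\tilde Q=e^{-\alpha/p}_0:V_L\to V_{L^\circ}$. Then $\mathcal{W}(p)=\operatorname{Ker}(\tilde Q|_{V_L})$, a vertex operator algebra with conformal vector $\omega$. Zhu's algebra. For a vertex operator algebra $V$ and homogeneous $a\in V$, $b\in V$, set $a*b=\operatorname{Res}_x Y(a,x)\frac{(1+x)^{\mathrm{wt}(a)}}{x}b$ and $a\circ b=\operatorname{Res}_xY(a,x)\frac{(1+x)^{\mathrm{wt}(a)}}{x^2}b$, extended bilinearly.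 $O(V)$ is the span of all $a\circ b$, $A(V)=V/O(V)$ is a unital associative algebra under $*$, and $[v]$ is the image of $v\in V$. Weights: $h_{m,1}=\frac{(m-1)(m-2p+1)}{4p}$; note $h_{i,1}=h_{2p-i,1}$. The ideals $\mathbb{I}_{h_{i,1}}$. For $1\le i\le p-1$, let $f_i(x)=\prod_{1\le j\le 3p-1,\ j\ne i,\ j\ne 2p-i}(x-h_{j,1})$, $v_i=(\lambda_i[\omega]+\nu_i)f_i([\omega])\in A(\mathcal{W}(p))$ with $\lambda_i=-\frac{f_i'(h_{i,1})}{f_i(h_{i,1})^2}$, $\nu_i=\frac{1}{f_i(h_{i,1})}+\frac{h_{i,1}f_i'(h_{i,1})}{f_i(h_{i,1})^2}$, and $w_i=\prod_{1\le j\le 3p-1,\ j\ne i}([\omega]-h_{j,1})\in A(\mathcal{W}(p))$. Then $\mathbb{I}_{h_{i,1}}$ is the ideal of $A(\mathcal{W}(p))$ spanned by $v_i$ and $w_i$. *)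

theory Defs
  imports
    "Jordan_Normal_Form.VS_Connect"
    "HOL-Algebra.QuotRing"
    "HOL-Computational_Algebra.Polynomial"
    "HOL-Computational_Algebra.Primes"
    "HOL-Library.Multiset"
    "HOL-Library.Poly_Mapping"
begin

section \<open>Vertex operator algebras and Zhu's algebra\<close>

text \<open>
  Complex vector spaces are given with a basis \<open>'k\<close>, as the finitely supported functions
  \<open>'k \<Rightarrow>\<^sub>0 complex\<close>; a vertex operator algebra is a subspace of such a space.
  All infinite sums below are taken with \<^const>\<open>Sum_any\<close>, the sum over the
  support of the summand (0 if that is infinite); on the vectors in question only finitely
  many terms are nonzero.
\<close>

definition scale :: "complex \<Rightarrow> ('k \<Rightarrow>\<^sub>0 complex) \<Rightarrow> ('k \<Rightarrow>\<^sub>0 complex)"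
  where "scale c v = Poly_Mapping.map (\<lambda>x. c * x) v"

lemma lookup_scale: "Poly_Mapping.lookup (scale c v) k = c * Poly_Mapping.lookup v k"
  by (cases "Poly_Mapping.lookup v k = 0") (simp_all add: scale_def Poly_Mapping.map.rep_eq when_def)

global_interpretation pm: Vector_Spaces.vector_space scale
  by unfold_locales (auto intro!: poly_mapping_eqI simp: lookup_scale lookup_add algebra_simps)

definition lin_ext :: "('k \<Rightarrow> ('l \<Rightarrow>\<^sub>0 complex)) \<Rightarrow> ('k \<Rightarrow>\<^sub>0 complex) \<Rightarrow> ('l \<Rightarrow>\<^sub>0 complex)"
  where "lin_ext f v = (\<Sum>k\<in>Poly_Mapping.keys v. scale (Poly_Mapping.lookup v k) (f k))"

text \<open>
  \<open>mode V a n b\<close> is \<open>a\<^sub>n b\<close>, where \<open>Y(a,x) = \<Sum>n. a\<^sub>n x\<^sup>-\<^sup>n\<^sup>-\<^sup>1\<close>.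
\<close>

record 'k voa =
  space :: "('k \<Rightarrow>\<^sub>0 complex) set"
  mode :: "('k \<Rightarrow>\<^sub>0 complex) \<Rightarrow> int \<Rightarrow> ('k \<Rightarrow>\<^sub>0 complex) \<Rightarrow> ('k \<Rightarrow>\<^sub>0 complex)"
  vacuum :: "'k \<Rightarrow>\<^sub>0 complex"
  conformal :: "'k \<Rightarrow>\<^sub>0 complex"

text \<open>Homogeneous vectors of weight \<open>n\<close> are eigenvectors of \<open>L(0) = \<omega>\<^sub>1\<close>.\<close>

definition homogeneous :: "('k, 'm) voa_scheme \<Rightarrow> int \<Rightarrow> ('k \<Rightarrow>\<^sub>0 complex) \<Rightarrow> bool"
  where "homogeneous V n a \<longleftrightarrow> a \<in> space V \<and> mode V (conformal V) 1 a = scale (of_int n) a"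

definition components :: "('k, 'm) voa_scheme \<Rightarrow> ('k \<Rightarrow>\<^sub>0 complex) \<Rightarrow> int \<Rightarrow> ('k \<Rightarrow>\<^sub>0 complex)"
  where "components V a =
    (THE c. (\<forall>n. homogeneous V n (c n)) \<and> finite {n. c n \<noteq> 0} \<and> a = Sum_any c)"

text \<open>
  For \<open>a\<close> homogeneous of weight \<open>n\<close>, the inner sum is the residue of
  \<open>Y(a,x) (1+x)\<^sup>n x\<^sup>-\<^sup>s b\<close>; the outer sum is the extension by linearity in \<open>a\<close>.
\<close>

definition zhu_product ::
  "('k, 'm) voa_scheme \<Rightarrow> int \<Rightarrow> ('k \<Rightarrow>\<^sub>0 complex) \<Rightarrow> ('k \<Rightarrow>\<^sub>0 complex) \<Rightarrow> ('k \<Rightarrow>\<^sub>0 complex)"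
  where "zhu_product V s a b =
    Sum_any (\<lambda>n::int. Sum_any (\<lambda>j::nat.
      scale (of_int n gchoose j) (mode V (components V a n) (int j - s) b)))"

definition zhu_star ::
  "('k, 'm) voa_scheme \<Rightarrow> ('k \<Rightarrow>\<^sub>0 complex) \<Rightarrow> ('k \<Rightarrow>\<^sub>0 complex) \<Rightarrow> ('k \<Rightarrow>\<^sub>0 complex)"
  where "zhu_star V = zhu_product V 1"

definition zhu_circ ::
  "('k, 'm) voa_scheme \<Rightarrow> ('k \<Rightarrow>\<^sub>0 complex) \<Rightarrow> ('k \<Rightarrow>\<^sub>0 complex) \<Rightarrow> ('k \<Rightarrow>\<^sub>0 complex)"
  where "zhu_circ V = zhu_product V 2"

definition zhu_O :: "('k, 'm) voa_scheme \<Rightarrow> ('k \<Rightarrow>\<^sub>0 complex) set"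
  where "zhu_O V = pm.span {zhu_circ V a b | a b. a \<in> space V \<and> b \<in> space V}"

text \<open>
  The (in general nonassociative) algebra \<open>(V, *)\<close>, whose quotient by \<open>O(V)\<close> is Zhu's
  algebra. \<^const>\<open>FactRing\<close> only uses the operations of its argument, not the ring axioms.
\<close>

definition star_algebra :: "('k, 'm) voa_scheme \<Rightarrow> ('k \<Rightarrow>\<^sub>0 complex) ring"
  where "star_algebra V =
    \<lparr>carrier = space V, mult = zhu_star V, one = vacuum V, zero = 0, add = (+)\<rparr>"

definition zhu_class :: "('k, 'm) voa_scheme \<Rightarrow> ('k \<Rightarrow>\<^sub>0 complex) \<Rightarrow> ('k \<Rightarrow>\<^sub>0 complex) set"
  where "zhu_class V v = zhu_O V +>\<^bsub>star_algebra V\<^esub> v"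

definition zhu_algebra :: "('k, 'm) voa_scheme \<Rightarrow> (complex, ('k \<Rightarrow>\<^sub>0 complex) set) module"
  where "zhu_algebra V =
    ring.extend (star_algebra V Quot zhu_O V)
      (module.fields (\<lambda>c X. \<Union>v\<in>X. zhu_class V (scale c v)))"

definition alg_poly :: "(complex, 'a) module \<Rightarrow> complex poly \<Rightarrow> 'a \<Rightarrow> 'a"
  where "alg_poly A f a =
    (\<Oplus>\<^bsub>A\<^esub>k\<in>{..degree f}. coeff f k \<odot>\<^bsub>A\<^esub> (a [^]\<^bsub>A\<^esub> k))"


section \<open>The generalized lattice vertex algebra\<close>

text \<open>
  Let \<open>\<langle>\<alpha>,\<alpha>\<rangle> = 2p\<close>. The basis vector indexed by \<open>(M, b)\<close> is
  \<open>(\<Prod>i\<in>#M. \<alpha>(-i-1)) \<otimes> e\<^sup>b\<^sup>\<alpha>\<^sup>/\<^sup>2\<^sup>p\<close>; note the shift of indices, by which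
  \<open>i = 0\<close> stands for \<open>\<alpha>(-1)\<close>. The vectors with \<open>2p dvd b\<close> for all their indices
  \<open>(M, b)\<close> make up the lattice vertex algebra \<open>V\<^sub>L\<close>. As \<open>L\<close> is even of rank one,
  the cocycle is trivial.
\<close>

type_synonym fock = "(nat multiset \<times> int) \<Rightarrow>\<^sub>0 complex"

text \<open>
  The operator \<open>\<alpha>(n)\<close>, normalized by \<open>[\<alpha>(m), \<alpha>(n)] = 2p m \<delta>\<^sub>m\<^sub>+\<^sub>n\<^sub>,\<^sub>0\<close>. For
  \<open>n > 0\<close> it is \<open>2p n\<close> times the derivative with respect to \<open>\<alpha>(-n)\<close>, and
  \<open>\<langle>\<alpha>, b\<alpha>/2p\<rangle> = b\<close>.
\<close>

definition heis :: "nat \<Rightarrow> int \<Rightarrow> fock \<Rightarrow> fock"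
  where "heis p n = lin_ext (\<lambda>(M, b).
    if n < 0 then Poly_Mapping.single (add_mset (nat (- n - 1)) M, b) 1
    else if n = 0 then Poly_Mapping.single (M, b) (of_int b)
    else Poly_Mapping.single (M - {#nat (n - 1)#}, b)
           (2 * of_nat p * of_int n * of_nat (count M (nat (n - 1)))))"

definition charge_shift :: "int \<Rightarrow> fock \<Rightarrow> fock"
  where "charge_shift a = lin_ext (\<lambda>(M, b). Poly_Mapping.single (M, a + b) 1)"

text \<open>
  The coefficient of \<open>z\<^sup>n\<close> in \<open>exp (\<Sum>k\<ge>1. X\<^sub>k z\<^sup>k) = \<Sum>l. (\<Sum>k\<ge>1. X\<^sub>k z\<^sup>k)\<^sup>l / l!\<close>
  applied to \<open>v\<close>; the list \<open>ks\<close> selects one term from each of the \<open>l\<close> factors.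
\<close>

definition exp_coeff :: "(nat \<Rightarrow> fock \<Rightarrow> fock) \<Rightarrow> nat \<Rightarrow> fock \<Rightarrow> fock"
  where "exp_coeff X n v =
    (\<Sum>ks\<in>{ks. 0 \<notin> set ks \<and> sum_list ks = n}. scale (1 / fact (length ks)) (foldr X ks v))"

text \<open>
  The coefficient of \<open>x\<^sup>-\<^sup>r\<^sup>-\<^sup>1\<close> in
  \<open>Y(e\<^sup>\<gamma>, x) = exp (\<Sum>n\<ge>1. \<gamma>(-n)/n x\<^sup>n) exp (- \<Sum>n\<ge>1. \<gamma>(n)/n x\<^sup>-\<^sup>n) e\<^sub>\<gamma> x\<^sup>\<gamma>\<^sup>(\<^sup>0\<^sup>)\<close>
  for \<open>\<gamma> = a\<alpha>/2p\<close>; on \<open>e\<^sup>b\<^sup>\<alpha>\<^sup>/\<^sup>2\<^sup>p\<close>, \<open>x\<^sup>\<gamma>\<^sup>(\<^sup>0\<^sup>)\<close> is \<open>x\<close> to the power \<open>ab/2p\<close>.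
\<close>

definition exp_mode :: "nat \<Rightarrow> int \<Rightarrow> rat \<Rightarrow> fock \<Rightarrow> fock"
  where "exp_mode p a r = lin_ext (\<lambda>(M, b).
    Sum_any (\<lambda>(j, k).
      if of_nat j - of_nat k + of_int (a * b) / of_nat (2 * p) = - r - 1
      then exp_coeff (\<lambda>n v. scale (of_int a / of_nat (2 * p * n)) (heis p (- int n) v)) j
            (exp_coeff (\<lambda>n v. scale (- (of_int a / of_nat (2 * p * n))) (heis p (int n) v)) k
              (charge_shift a (Poly_Mapping.single (M, b) 1)))
      else 0))"

text \<open>
  Modes of \<open>\<alpha>(-i\<^sub>1-1) \<dots> \<alpha>(-i\<^sub>l-1) e\<^sup>a\<^sup>\<alpha>\<^sup>/\<^sup>2\<^sup>p\<close>, whose vertex operator is the normally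
  ordered product of \<open>Y(e\<^sup>a\<^sup>\<alpha>\<^sup>/\<^sup>2\<^sup>p, x)\<close> with the fields
  \<open>1/i! (d/dx)\<^sup>i \<alpha>(x) = \<Sum>k. (-k-1 gchoose i) \<alpha>(k) x\<^sup>-\<^sup>k\<^sup>-\<^sup>1\<^sup>-\<^sup>i\<close>:
  \<open>\<alpha>(k)\<close> acts last if \<open>k < 0\<close> and first if \<open>k \<ge> 0\<close>.
\<close>

fun monomial_mode :: "nat \<Rightarrow> nat list \<Rightarrow> int \<Rightarrow> rat \<Rightarrow> fock \<Rightarrow> fock"
  where
    "monomial_mode p [] a r v = exp_mode p a r v"
  | "monomial_mode p (i # is) a r v =
      Sum_any (\<lambda>k::int. scale (of_int (- k - 1) gchoose i)
        (let s = r - of_int k - of_nat i - 1 in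
          if k < 0 then heis p k (monomial_mode p is a s v)
          else monomial_mode p is a s (heis p k v)))"

definition lattice_mode :: "nat \<Rightarrow> fock \<Rightarrow> rat \<Rightarrow> fock \<Rightarrow> fock"
  where "lattice_mode p u r v =
    lin_ext (\<lambda>(M, a). monomial_mode p (sorted_list_of_multiset M) a r v) u"

definition lattice_voa :: "nat \<Rightarrow> (nat multiset \<times> int) voa"
  where "lattice_voa p =
    \<lparr>space = {v. \<forall>(M, b)\<in>Poly_Mapping.keys v. 2 * int p dvd b},
     mode = (\<lambda>u n v. lattice_mode p u (of_int n) v),
     vacuum = Poly_Mapping.single ({#}, 0) 1,
     conformal = Poly_Mapping.single ({#0, 0#}, 0) (1 / (4 * of_nat p))
       + Poly_Mapping.single ({#1#}, 0) ((of_nat p - 1) / (2 * of_nat p))\<rparr>"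


section \<open>The triplet vertex operator algebra\<close>

text \<open>\<open>e\<^sup>-\<^sup>\<alpha>\<^sup>/\<^sup>p\<close> has index \<open>({#}, -2)\<close>.\<close>

definition screening :: "nat \<Rightarrow> fock \<Rightarrow> fock"
  where "screening p v = lattice_mode p (Poly_Mapping.single ({#}, - 2) 1) 0 v"

definition triplet :: "nat \<Rightarrow> (nat multiset \<times> int) voa"
  where "triplet p =
    (lattice_voa p)\<lparr>space := {v \<in> space (lattice_voa p). screening p v = 0}\<rparr>"

abbreviation A_triplet :: "nat \<Rightarrow> (complex, fock set) module"
  where "A_triplet p \<equiv> zhu_algebra (triplet p)"

definition omega_class :: "nat \<Rightarrow> fock set"
  where "omega_class p = zhu_class (triplet p) (conformal (triplet p))"

text \<open>\<open>h_wt p m\<close> is \<open>h\<^sub>m\<^sub>,\<^sub>1\<close>.\<close>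

definition h_wt :: "nat \<Rightarrow> nat \<Rightarrow> complex"
  where "h_wt p m = (of_nat m - 1) * (of_nat m - 2 * of_nat p + 1) / (4 * of_nat p)"

definition f_poly :: "nat \<Rightarrow> nat \<Rightarrow> complex poly"
  where "f_poly p i = (\<Prod>j\<in>{1..3 * p - 1} - {i, 2 * p - i}. [:- h_wt p j, 1:])"

definition lambda_coeff :: "nat \<Rightarrow> nat \<Rightarrow> complex"
  where "lambda_coeff p i =
    - (poly (pderiv (f_poly p i)) (h_wt p i) / (poly (f_poly p i) (h_wt p i))\<^sup>2)"

definition nu_coeff :: "nat \<Rightarrow> nat \<Rightarrow> complex"
  where "nu_coeff p i =
    1 / poly (f_poly p i) (h_wt p i)
    + h_wt p i * poly (pderiv (f_poly p i)) (h_wt p i) / (poly (f_poly p i) (h_wt p i))\<^sup>2"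

definition v_elem :: "nat \<Rightarrow> nat \<Rightarrow> fock set"
  where "v_elem p i =
    (lambda_coeff p i \<odot>\<^bsub>A_triplet p\<^esub> omega_class p
      \<oplus>\<^bsub>A_triplet p\<^esub> nu_coeff p i \<odot>\<^bsub>A_triplet p\<^esub> \<one>\<^bsub>A_triplet p\<^esub>)
    \<otimes>\<^bsub>A_triplet p\<^esub> alg_poly (A_triplet p) (f_poly p i) (omega_class p)"

definition w_elem :: "nat \<Rightarrow> nat \<Rightarrow> fock set"
  where "w_elem p i =
    alg_poly (A_triplet p) (\<Prod>j\<in>{1..3 * p - 1} - {i}. [:- h_wt p j, 1:]) (omega_class p)"

definition I_ideal :: "nat \<Rightarrow> nat \<Rightarrow> fock set set"
  where "I_ideal p i =
    LinearCombinations.module.span class_ring (A_triplet p) {v_elem p i, w_elem p i}"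

end

theory Submission
 imports Defs "HOL-Computational_Algebra.Formal_Power_Series"
begin

text \<open>
  Let \<open>F = e\<^sup>-\<^sup>\<alpha>\<close>, \<open>H = QF\<close>, \<open>E = Q\<^sup>2F\<close>, where the derivation \<open>Q = e\<^sup>\<alpha>\<^sub>0\<close> preserves \<open>W(p)\<close>. Together with \<open>\<omega>\<close>
  they strongly generate \<open>W(p)\<close>: if \<open>u\<close> is outside of what they generate, of least weight \<open>N\<close> and then of
  least charge, then so is some \<open>E\<^sub>m F\<^sub>n u\<close>, as a mode of \<open>E\<close> maps \<open>F\<close> to a nonzero multiple of the vacuum; the
  third order singular vector equation of \<open>E\<close> gives an integer \<open>e\<close> with \<open>(e - p)\<^sup>2 = (p - 1)\<^sup>2 + 4pN\<close>, and
  primality of \<open>p\<close> forces \<open>N \<le> 1\<close>. Hence \<open>1, H, E, F\<close> span \<open>A(W(p))\<close> over the polynomials in \<open>[\<omega>]\<close>.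

  The eigenvalues \<open>ev b\<close> of zero modes on \<open>e\<^sup>b\<^sup>\<alpha>\<^sup>/\<^sup>2\<^sup>p\<close>, \<open>-p \<le> b \<le> 2p - 1\<close>, vanish on \<open>O(W(p))\<close>, and so do the differences
  of \<open>b\<close>-derivatives at two such points of equal weight. By \<open>H \<circ> F\<close> and \<open>H * H\<close>, the polynomial with roots \<open>h\<^sub>j\<^sub>,\<^sub>1\<close>,
  \<open>2p \<le> j < 3p\<close>, kills \<open>H, E, F\<close> and the one with roots \<open>h\<^sub>j\<^sub>,\<^sub>1\<close>, \<open>1 \<le> j < 3p\<close>, kills 1; the functionals exclude further
  relations. So the dimension is \<open>(3p - 1) + 3p\<close>, and on the ideal, generated by \<open>f\<^sub>i([\<omega>])\<close>, \<open>H, E, F\<close> act by 0 and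
  \<open>[\<omega>]\<close> by a Jordan block of size two.
\<close>

text \<open>The modes are explicit normally ordered sums, so the vertex algebra axioms have to be
  derived too. The defect of the Borcherds identity is covariant under the Heisenberg operators, so
  it vanishes once its vacuum coefficient does for three exponentials; there the identity is the
  residue theorem for \<open>t^x (t-1)^z\<close>.

  For two generators the roots of the cubic indicial polynomial are the weights 0,
  \<open>2p-1\<close> and \<open>6p-2\<close>, so the Virasoro action determines the products
  \<open>a_m b\<close> with \<open>m >= -2p\<close> from two of them. One induction over an abstract
  family of subspaces serves for vanishing, strong generation and reduction modulo
  \<open>O(W(p))\<close>.

  Eigenvalues cannot see a double root. Instead of building logarithmic modules, the proof
  differentiates in \<open>b\<close>: the charge enters a residue through \<open>(1+x)^(kb)\<close>,
  whose derivative contains \<open>k log(1+x)\<close>. The factor \<open>x\<close> of the logarithm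
  turns the \<open>x^(-2)\<close> of \<open>O(W(p))\<close> into \<open>x^(-1)\<close>, so
  derivatives become evaluations on \<open>W(p)\<close>, equal at the two points.

  The relation from \<open>H \<circ> F\<close> is shown to be nonzero at \<open>b = -p-1\<close>,
  just outside the range where the evaluations vanish.\<close>

abbreviation "psmult \<equiv> Polynomial.smult"
abbreviation "lookup \<equiv> Poly_Mapping.lookup"
abbreviation "single \<equiv> Poly_Mapping.single"
abbreviation "keys \<equiv> Poly_Mapping.keys"

section \<open>Linear maps between spaces of finitely supported functions\<close>

definition lin :: "(('k \<Rightarrow>\<^sub>0 complex) => ('l \<Rightarrow>\<^sub>0 complex)) => bool"
 where "lin f \<longleftrightarrow> (\<forall>x y. f (x + y) = f x + f y) \<and> (\<forall>c x. f (scale c x) = scale c (f x))"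

lemma lin_add: "lin f ==> f (x + y) = f x + f y"
 and lin_scale: "lin f ==> f (scale c x) = scale c (f x)"
 by (auto simp: lin_def)

lemma lin_0: "lin f ==> f 0 = 0"
 using lin_scale[of f 0 0] by simp

lemma lin_minus: "lin f ==> f (- x) = - f x"
 using lin_scale[of f "-1" x] by (simp add: pm.scale_minus_left)

lemma lin_diff: "lin f ==> f (x - y) = f x - f y"
 using lin_add[of f x "- y"] by (simp add: lin_minus)

lemma lin_sum: "lin f ==> f (sum g A) = (\<Sum>a\<in>A. f (g a))"
 by (induction A rule: infinite_finite_induct) (simp_all add: lin_0 lin_add)

lemmas lin_simps = lin_add lin_scale lin_0 lin_minus lin_diff lin_sum

lemma lin_id: "lin (%x. x)" and lin_comp: "lin f ==> lin g ==> lin (%x. f (g x))"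
 by (auto simp: lin_def)

lemma lin_zero: "lin (%x. 0)" by (auto simp: lin_def)

lemma lin_plus: "lin f ==> lin g ==> lin (%x. f x + g x)"
 by (auto simp: lin_def pm.scale_right_distrib)

lemma lin_sub: "lin f ==> lin g ==> lin (%x. f x - g x)"
 by (auto simp: lin_def pm.scale_right_diff_distrib)

lemma lin_scl: "lin f ==> lin (%x. scale c (f x))"
 by (auto simp: lin_def pm.scale_right_distrib mult.commute)

lemma lin_sm: "(!!a. a \<in> A ==> lin (f a)) ==> lin (%x. \<Sum>a\<in>A. f a x)"
 by (induction A rule: infinite_finite_induct) (auto intro!: lin_zero lin_plus)

lemma poly_mapping_decomp: "v = (\<Sum>k\<in>keys v. scale (lookup v k) (single k 1))"
proof (rule poly_mapping_eqI)
 fix j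
 have "lookup (\<Sum>k\<in>keys v. scale (lookup v k) (single k 1)) j
  = (\<Sum>k\<in>keys v. if k = j then lookup v k else 0)"
  by (simp add: lookup_sum lookup_scale lookup_single when_def if_distrib cong: if_cong)
 also have "... = lookup v j"
  by (simp add: sum.delta' in_keys_iff)
 finally show "lookup v j = lookup (\<Sum>k\<in>keys v. scale (lookup v k) (single k 1)) j" by simp
qed

lemma lin_ext_superset:
 assumes "finite A" "keys v \<subseteq> A"
 shows "lin_ext f v = (\<Sum>k\<in>A. scale (lookup v k) (f k))"
 unfolding lin_ext_def using assms by (intro sum.mono_neutral_left) (auto simp: in_keys_iff)

lemma lin_lin_ext [simp]: "lin (lin_ext f)"
 unfolding lin_def
proof (intro conjI allI)
 fix x y :: "'a \<Rightarrow>\<^sub>0 complex" and c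
 let ?A = "keys x \<union> keys y"
 have "keys (x + y) \<subseteq> ?A" by (rule keys_add)
 thus "lin_ext f (x + y) = lin_ext f x + lin_ext f y"
  by (simp add: lin_ext_superset[of ?A] lookup_add pm.scale_left_distrib sum.distrib)
 have "keys (scale c x) \<subseteq> keys x" by (auto simp: in_keys_iff lookup_scale)
 thus "lin_ext f (scale c x) = scale c (lin_ext f x)"
  by (simp add: lin_ext_superset[of "keys x"] lookup_scale pm.scale_sum_right)
qed

lemma lin_ext_single [simp]: "lin_ext f (single k c) = scale c (f k)"
 by (subst lin_ext_superset[of "{k}"]) (auto simp: lookup_single)

lemma lin_eq_on:
 assumes "lin f" "lin g" "!!k. k \<in> keys v ==> f (single k 1) = g (single k 1)"
 shows "f v = g v"
 by (subst (1 2) poly_mapping_decomp[of v]) (simp add: assms lin_sum lin_scale)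

lemma lin_eqI:
 assumes "lin f" "lin g" "!!k. f (single k 1) = g (single k 1)"
 shows "f v = g v"
 using lin_eq_on assms by metis

section \<open>Sums of sequences that vanish eventually\<close>

definition ez :: "(nat => 'a::zero) => bool" where "ez f \<longleftrightarrow> (\<exists>N. \<forall>j\<ge>N. f j = 0)"

lemma ezI: "(!!j. j >= N ==> f j = 0) ==> ez f" by (auto simp: ez_def)

lemma ez_finite: "ez f ==> finite {j. f j ~= 0}"
 unfolding ez_def by (metis (mono_tags, lifting) finite_nat_set_iff_bounded mem_Collect_eq not_le)

lemma ez_add: "ez f ==> ez g ==> ez (%j. f j + g j :: 'a::monoid_add)"
 unfolding ez_def by (metis add.right_neutral le_trans nat_le_linear)

lemma ez_scale: "ez f ==> ez (%j. scale (c j) (f j))"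
 unfolding ez_def by (metis pm.scale_zero_right)

lemma ez_lin: "(!!j. lin (T j)) ==> ez f ==> ez (%j. T j (f j))"
 unfolding ez_def by (metis lin_0)

lemma ez_shift: "ez f ==> ez (%j. f (j + k))"
 unfolding ez_def by (metis trans_le_add1)

lemma ez_shift': "ez f ==> ez (%j. f (k + j))"
 unfolding ez_def by (metis trans_le_add2)

lemma Sum_any_lessThan: "(!!j. j >= N ==> f j = 0) ==> Sum_any f = sum f {..<(N::nat)}"
 by (rule Sum_any.expand_superset) (auto simp: not_le[symmetric])

lemma Sum_any_add: "ez f ==> ez g ==> Sum_any (%j. f j + g j) = Sum_any f + Sum_any g"
 by (intro Sum_any.distrib ez_finite)

text \<open>\<open>Sum_any\<close> is 0 on an infinite support, so every rearrangement of sums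
  carries an \<open>ez\<close> hypothesis. On the naturals this is finiteness of the support, in a
  form that passes through operators depending on the index.\<close>

lemma Sum_any_lin:
 assumes "lin T" "ez f" shows "T (Sum_any f) = Sum_any (%j. T (f j))"
proof -
 obtain N where N: "!!j. j >= N ==> f j = 0" using assms(2) by (auto simp: ez_def)
 show ?thesis
  by (simp add: Sum_any_lessThan[OF N] lin_sum[OF assms(1)] Sum_any_lessThan[of N "%j. T (f j)"] N lin_0[OF assms(1)])
qed

lemma Sum_any_scale: "ez f ==> scale c (Sum_any f) = Sum_any (%j. scale c (f j))"
 by (rule Sum_any_lin[of "scale c"]) (auto simp: lin_def pm.scale_right_distrib mult.commute)

lemma Sum_any_uminus: "ez f ==> - Sum_any f = Sum_any (%j. - (f j) :: 'k \<Rightarrow>\<^sub>0 complex)"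
 by (rule Sum_any_lin[of uminus]) (auto simp: lin_def)

lemma Sum_any_sub: "ez f ==> ez g ==> Sum_any (%j. f j - g j :: 'k \<Rightarrow>\<^sub>0 complex) = Sum_any f - Sum_any g"
 using Sum_any_add[of f "%j. - g j"] Sum_any_uminus[of g] by (auto simp: ez_def)

lemma Sum_any_swap_nat:
 fixes N M :: nat
 assumes "!!j q. j >= N \<or> q >= M ==> f j q = 0"
 shows "Sum_any (%j. Sum_any (%q. f j q)) = Sum_any (%q. Sum_any (%j. f j q))"
proof -
 have 1: "Sum_any (%q. f j q) = sum (f j) {..<M}" for j
  by (rule Sum_any_lessThan) (simp add: assms)
 have 2: "Sum_any (%j. f j q) = sum (%j. f j q) {..<N}" for q
  by (rule Sum_any_lessThan) (simp add: assms)
 have "Sum_any (%j. sum (f j) {..<M}) = (\<Sum>j<N. sum (f j) {..<M})"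
  by (rule Sum_any_lessThan) (simp add: assms)
 moreover have "Sum_any (%q. sum (%j. f j q) {..<N}) = (\<Sum>q<M. sum (%j. f j q) {..<N})"
  by (rule Sum_any_lessThan) (simp add: assms)
 ultimately show ?thesis by (simp add: 1 2 sum.swap[of _ "{..<N}"])
qed

lemma Sum_any_finsum_swap:
 assumes "finite A" "!!a. a \<in> A ==> ez (f a)"
 shows "Sum_any (%j. \<Sum>a\<in>A. f a j) = (\<Sum>a\<in>A. Sum_any (f a))"
 using assms
proof (induction A rule: finite_induct)
 case (insert x F)
 have "finite F ==> (!!a. a \<in> F ==> ez (f a)) ==> ez (%j. \<Sum>a\<in>F. f a j)" for F
 proof (induction F rule: finite_induct)
  case empty show ?case by (simp add: ez_def)
 next
  case (insert x F)
  thus ?case by (simp add: ez_add)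
 qed
 hence "ez (%j. \<Sum>a\<in>F. f a j)" using insert by simp
 with insert show ?case by (simp add: Sum_any_add)
qed simp

text \<open>Cauchy product: the vectors depend on \<open>j + q\<close> only, so the two coefficient
  sequences convolve. With binomial coefficients, Vandermonde then collapses the
  convolution.\<close>

lemma Sum_any_conv:
 assumes "ez g"
 shows "Sum_any (%j. Sum_any (%q. scale (a j * b q) (g (j + q)))) = Sum_any (%J. scale (\<Sum>j\<le>J. a j * b (J - j)) (g J))"
proof -
 obtain N where N: "!!j. j >= N ==> g j = 0" using assms by (auto simp: ez_def)
 have "Sum_any (%j. Sum_any (%q. scale (a j * b q) (g (j + q)))) = (\<Sum>j<N. \<Sum>q<N. scale (a j * b q) (g (j + q)))"
  by (subst Sum_any_lessThan[of N]; (subst Sum_any_lessThan[of N])?) (auto simp: N)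
 also have "... = (\<Sum>j<N. \<Sum>q<N - j. scale (a j * b q) (g (j + q)))"
  by (intro sum.cong refl sum.mono_neutral_right) (auto simp: N)
 also have "... = (\<Sum>(j,q)\<in>(SIGMA j:{..<N}. {..<N - j}). scale (a j * b q) (g (j + q)))"
  by (simp add: sum.Sigma)
 also have "... = (\<Sum>(J,j)\<in>(SIGMA J:{..<N}. {..J}). scale (a j * b (J - j)) (g J))"
  by (rule sum.reindex_bij_witness[of _ "%(J,j). (j, J - j)" "%(j,q). (j + q, j)"]) auto
 also have "... = (\<Sum>J<N. \<Sum>j\<le>J. scale (a j * b (J - j)) (g J))"
  by (simp add: sum.Sigma)
 also have "... = Sum_any (%J. scale (\<Sum>j\<le>J. a j * b (J - j)) (g J))"
  by (subst Sum_any_lessThan[of N]) (auto simp: N pm.scale_sum_left)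
 finally show ?thesis .
qed

lemma Sum_any_shift:
 assumes "ez g" "!!j. j < k ==> g j = (0::'a::comm_monoid_add)"
 shows "Sum_any g = Sum_any (%j. g (j + k))"
proof -
 obtain N where N: "!!j. j >= N ==> g j = 0" using assms(1) by (auto simp: ez_def)
 have "Sum_any g = sum g {..<N + k}" by (rule Sum_any_lessThan) (simp add: N)
 also have "... = sum g {k..<N + k}" by (rule sum.mono_neutral_right) (auto simp: assms(2))
 also have "... = sum (%j. g (j + k)) {0..<N}"
  by (metis add_0 sum.shift_bounds_nat_ivl)
 also have "... = Sum_any (%j. g (j + k))"
  by (subst Sum_any_lessThan[of N]) (auto simp: N atLeast0LessThan)
 finally show ?thesis .
qed

lemma Sum_any_Suc:
 fixes g :: "nat => 'a::comm_monoid_add"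
 assumes "ez g" shows "Sum_any g = g 0 + Sum_any (%j. g (Suc j))"
proof -
 obtain N where N: "!!j. j >= N ==> g j = 0" using assms(1) by (auto simp: ez_def)
 have "Sum_any g = sum g {..<Suc N}" by (rule Sum_any_lessThan) (simp add: N)
 also have "... = g 0 + (\<Sum>j<N. g (Suc j))" by (rule sum.lessThan_Suc_shift)
 also have "(\<Sum>j<N. g (Suc j)) = Sum_any (%j. g (Suc j))"
  by (subst Sum_any_lessThan[of N]) (auto simp: N)
 finally show ?thesis .
qed

text \<open>Normal ordering treats negative and nonnegative modes differently; each half becomes a
  sum over the naturals, to which \<open>ez\<close> applies.\<close>

lemma Sum_any_int_split:
 fixes g :: "int => 'a::comm_monoid_add"
 assumes "ez (%j. g (int j))" "ez (%j. g (- int j - 1))"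
 shows "Sum_any g = Sum_any (%j::nat. g (- int j - 1)) + Sum_any (%j::nat. g (int j))"
proof -
 obtain N where N: "!!j. j >= N ==> g (int j) = 0" using assms(1) by (auto simp: ez_def)
 obtain M where M: "!!j. j >= M ==> g (- int j - 1) = 0" using assms(2) by (auto simp: ez_def)
 let ?A = "(%j. - int j - 1) ` {..<M}" and ?B = "int ` {..<N}"
 have "{k. g k ~= 0} \<subseteq> ?A \<union> ?B"
 proof
  fix k assume k: "k \<in> {k. g k ~= 0}"
  show "k \<in> ?A \<union> ?B"
  proof (cases "k >= 0")
   case True hence "k = int (nat k)" by simp
   moreover have "nat k < N" using k N[of "nat k"] True by force
   ultimately show ?thesis by blast
  next
   case False hence "k = - int (nat (- k - 1)) - 1" by simp
   moreover have "nat (- k - 1) < M" using k M[of "nat (- k - 1)"] False by force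
   ultimately show ?thesis by blast
  qed
 qed
 hence "Sum_any g = sum g (?A \<union> ?B)" by (intro Sum_any.expand_superset) auto
 also have "... = sum g ?A + sum g ?B" by (rule sum.union_disjoint) auto
 also have "sum g ?A = (\<Sum>j<M. g (- int j - 1))" by (subst sum.reindex) (auto simp: inj_on_def)
 also have "sum g ?B = (\<Sum>j<N. g (int j))" by (subst sum.reindex) (auto simp: inj_on_def)
 finally show ?thesis by (simp add: Sum_any_lessThan[of M "%j. g (- int j - 1)"] M Sum_any_lessThan[of N "%j. g (int j)"] N)
qed

lemma Sum_any_single: "(!!j. j ~= i ==> f j = 0) ==> Sum_any f = f i"
 by (subst Sum_any.expand_superset[of "{i}"]) auto

abbreviation bc :: "int => nat => complex" where "bc m j \<equiv> (of_int m) gchoose j"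

lemma bc_Vandermonde: "(\<Sum>j\<le>J. bc m j * bc l (J - j)) = bc (m + l) J"
 using gbinomial_Vandermonde[of "of_int m :: complex" "of_int l" J] by (simp add: atLeast0AtMost)

section \<open>Level and charge on the Fock space\<close>

definition lev :: "nat multiset => nat" where "lev M = (\<Sum>i\<in>#M. Suc i)"

lemma lev_simps [simp]: "lev {#} = 0" "lev (add_mset i M) = Suc i + lev M"
 by (simp_all add: lev_def)

lemma lev_diff: "i \<in># M ==> lev M = Suc i + lev (M - {#i#})"
 by (metis insert_DiffM lev_simps(2))

abbreviation st :: "nat multiset => int => fock" where "st M b \<equiv> single (M, b) 1"

text \<open>The level counts the depths of the oscillators; the conformal weight also depends on the
  charge. It is an integer so that operators may lower it below 0, where \<open>hm_neg\<close>
  yields most of the vanishing statements.\<close>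

definition hm :: "int => int => fock => bool"
 where "hm m b v \<longleftrightarrow> (\<forall>M c. lookup v (M, c) ~= 0 \<longrightarrow> int (lev M) = m \<and> c = b)"

lemma hm_0 [simp]: "hm m b 0" by (simp add: hm_def)
lemma hm_scale: "hm m b v ==> hm m b (scale c v)" by (auto simp: hm_def lookup_scale)
lemma hm_add: "hm m b v ==> hm m b w ==> hm m b (v + w)"
 unfolding hm_def lookup_add by (metis add.right_neutral)
lemma hm_minus: "hm m b v ==> hm m b (- v)" by (simp add: hm_def)
lemma hm_sum: "(!!a. a \<in> A ==> hm m b (f a)) ==> hm m b (sum f A)"
 by (induction A rule: infinite_finite_induct) (auto intro: hm_add)
lemma hm_Sum_any: "(!!a. hm m b (f a)) ==> hm m b (Sum_any f)"
 by (simp add: Sum_any.expand_set hm_sum)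
lemma hm_st: "hm (int (lev M)) b (st M b)" by (simp add: hm_def lookup_single when_def)
lemma hm_neg: "hm m b v ==> m < 0 ==> v = 0"
 by (rule poly_mapping_eqI) (auto simp: hm_def)

lemma hm_lin:
 assumes "hm m b v" "lin f" "!!M. int (lev M) = m ==> hm m' b' (f (st M b))"
 shows "hm m' b' (f v)"
proof -
 have "f v = (\<Sum>k\<in>keys v. scale (lookup v k) (f (single k 1)))"
  by (subst poly_mapping_decomp[of v]) (simp add: lin_sum[OF assms(2)] lin_scale[OF assms(2)])
 moreover have "hm m' b' (scale (lookup v k) (f (single k 1)))" if "k \<in> keys v" for k
 proof -
  obtain M c where k: "k = (M, c)" by force
  hence "int (lev M) = m" "c = b" using assms(1) that unfolding hm_def in_keys_iff by blast+
  thus ?thesis using assms(3)[of M] k by (simp add: hm_scale)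
 qed
 ultimately show ?thesis by (simp add: hm_sum)
qed

lemma hm_eq:
 assumes "hm m b v" "lin f" "lin g" "!!M. int (lev M) = m ==> f (st M b) = g (st M b)"
 shows "f v = g v"
proof (rule lin_eq_on[OF assms(2,3)])
 fix k assume *: "k \<in> keys v"
 obtain M c where k: "k = (M, c)" by force
 hence "int (lev M) = m" "c = b" using assms(1) * unfolding hm_def in_keys_iff by blast+
 thus "f (single k 1) = g (single k 1)" using assms(4)[of M] k by simp
qed

section \<open>The Heisenberg operators\<close>

lemma heis_lin [simp]: "lin (heis p n)" by (simp add: heis_def)
lemmas heis_0 = lin_0[OF heis_lin] and heis_add = lin_add[OF heis_lin] and heis_scale = lin_scale[OF heis_lin]

lemma heis_neg: "n < 0 ==> heis p n (st M b) = st (add_mset (nat (- n - 1)) M) b"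
 by (simp add: heis_def)
lemma heis_zero: "heis p 0 (st M b) = scale (of_int b) (st M b)"
 by (simp add: heis_def, rule poly_mapping_eqI) (simp add: lookup_scale lookup_single when_def)
lemma heis_pos: "n > 0 ==> heis p n (st M b)
  = scale (2 * of_nat p * of_int n * of_nat (count M (nat (n - 1)))) (st (M - {#nat (n - 1)#}) b)"
 by (simp add: heis_def, rule poly_mapping_eqI) (simp add: lookup_scale lookup_single when_def)

lemma heis_create: "heis p (- int i - 1) (st M b) = st (add_mset i M) b"
 by (subst heis_neg) auto

lemma heis_hm: assumes "hm m b v" shows "hm (m - n) b (heis p n v)"
proof (rule hm_lin[OF assms])
 fix M assume M: "int (lev M) = m"
 consider "n < 0" | "n = 0" | "n > 0" "nat (n - 1) \<in># M" | "n > 0" "nat (n - 1) \<notin># M" by linarith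
 thus "hm (m - n) b (heis p n (st M b))"
 proof cases
  case 1 thus ?thesis using M hm_st[of "add_mset (nat (- n - 1)) M" b] by (simp add: heis_neg)
 next
  case 2 thus ?thesis using M hm_st[of M b] by (simp add: heis_zero hm_scale)
 next
  case 3
  hence "int (lev (M - {#nat (n - 1)#})) = m - n" using lev_diff[OF 3(2)] M by simp
  thus ?thesis using 3 hm_st[of "M - {#nat (n - 1)#}" b] by (simp add: heis_pos hm_scale)
 next
  case 4 thus ?thesis by (simp add: heis_pos not_in_iff)
 qed
qed simp

lemma heis_0_hm: "hm m b v ==> heis p 0 v = scale (of_int b) v"
 by (rule hm_eq[of m b v]) (auto simp: heis_zero intro: lin_scl lin_id)

lemma heis_comm:
 "heis p m (heis p n v) = heis p n (heis p m v) + scale (if m + n = 0 then 2 * of_nat p * of_int m else 0) v"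
proof (rule lin_eqI[of "%v. heis p m (heis p n v)" "%v. heis p n (heis p m v) + scale (if m + n = 0 then 2 * of_nat p * of_int m else 0) v"])
 show "lin (%v. heis p m (heis p n v))" by (rule lin_comp) auto
 show "lin (%v. heis p n (heis p m v) + scale (if m + n = 0 then 2 * of_nat p * of_int m else 0) v)"
  by (intro lin_plus lin_scl lin_id lin_comp[OF heis_lin] heis_lin)
 fix k :: "nat multiset \<times> int"
 obtain M b where k: "k = (M, b)" by force
 \<comment> \<open>The only case with a central term; the opposite order of signs is this one with
   \<open>m\<close> and \<open>n\<close> exchanged.\<close>
 have cross: "heis p m (heis p n (st M b)) = heis p n (heis p m (st M b)) + scale (if m + n = 0 then 2 * of_nat p * of_int m else 0) (st M b)"
  if "m > 0" "n < 0" for m n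
 proof (cases "m + n = 0")
  case True
  hence x: "nat (- n - 1) = nat (m - 1)" by simp
  let ?x = "nat (m - 1)"
  have L: "heis p m (heis p n (st M b)) = scale (2 * of_nat p * of_int m * of_nat (count M ?x) + 2 * of_nat p * of_int m) (st M b)"
   using that x by (simp add: heis_pos heis_neg ring_distribs)
  have R: "heis p n (heis p m (st M b)) = scale (2 * of_nat p * of_int m * of_nat (count M ?x)) (st M b)"
   using that x by (cases "?x \<in># M") (simp_all add: heis_pos heis_neg lin_simps[OF heis_lin] not_in_iff)
  show ?thesis using True by (simp only: L R pm.scale_left_distrib) simp
 next
  case False
  let ?x = "nat (m - 1)" and ?y = "nat (- n - 1)"
  have ne: "?x ~= ?y" using that False by auto
  have L: "heis p m (heis p n (st M b)) = scale (2 * of_nat p * of_int m * of_nat (count M ?x)) (st (add_mset ?y M - {#?x#}) b)"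
   using that ne by (simp add: heis_pos heis_neg)
  have R: "heis p n (heis p m (st M b)) = scale (2 * of_nat p * of_int m * of_nat (count M ?x)) (st (add_mset ?y (M - {#?x#})) b)"
   using that by (simp add: heis_pos heis_neg lin_simps[OF heis_lin])
  show ?thesis using False by (simp add: L R diff_union_swap[OF ne])
 qed
 consider "m = 0 \<or> n = 0" | "m < 0" "n < 0" | "m > 0" "n > 0" "m ~= n" | "m > 0" "m = n" | "m > 0" "n < 0" | "m < 0" "n > 0"
  by linarith
 hence "heis p m (heis p n (st M b)) = heis p n (heis p m (st M b)) + scale (if m + n = 0 then 2 * of_nat p * of_int m else 0) (st M b)"
 proof cases
  case 1
  have *: "heis p 0 (heis p l (st M b)) = heis p l (heis p 0 (st M b))" for l
   by (simp only: heis_zero heis_scale heis_0_hm[OF heis_hm[OF hm_st]])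
  show ?thesis using 1 *[of m] *[of n] by (elim disjE) simp_all
 next
  case 2 thus ?thesis by (simp add: heis_neg add_mset_commute)
 next
  case 3
  hence "nat (m - 1) ~= nat (n - 1)" by auto
  with 3 show ?thesis
   by (auto simp: heis_pos lin_simps[OF heis_lin] diff_diff_add_mset add_mset_commute mult_ac)
 next
  case 4 thus ?thesis by simp
 next
  case 5 thus ?thesis by (rule cross)
 next
  case 6
  show ?thesis
  proof (cases "m + n = 0")
   case True
   hence "n = - m" by simp
   thus ?thesis using cross[OF 6(2,1)] by (simp add: pm.scale_minus_left)
  next
   case False
   thus ?thesis using cross[OF 6(2,1)] by (simp add: add.commute)
  qed
 qed
 thus "heis p m (heis p n (single k 1)) = heis p n (heis p m (single k 1))
   + scale (if m + n = 0 then 2 * of_nat p * of_int m else 0) (single k 1)"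
  by (simp add: k)
qed

lemma charge_shift_lin [simp]: "lin (charge_shift a)" by (simp add: charge_shift_def)
lemma charge_shift_st [simp]: "charge_shift a (st M b) = st M (a + b)" by (simp add: charge_shift_def)

lemma charge_shift_hm: "hm m b v ==> hm m (a + b) (charge_shift a v)"
 by (rule hm_lin) (use hm_st in auto)

lemma charge_shift_heis: "l ~= 0 ==> charge_shift a (heis p l v) = heis p l (charge_shift a v)"
proof (rule lin_eqI[of "%v. charge_shift a (heis p l v)" "%v. heis p l (charge_shift a v)"])
 fix k :: "nat multiset \<times> int" assume "l ~= 0"
 obtain M b where k: "k = (M, b)" by force
 show "charge_shift a (heis p l (single k 1)) = heis p l (charge_shift a (single k 1))"
  using \<open>l ~= 0\<close> by (cases "l > 0") (auto simp: k heis_pos heis_neg lin_simps[OF charge_shift_lin])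
qed (auto intro: lin_comp)

subsection \<open>Exponentials\<close>

text \<open>The coefficient of \<open>z^n\<close> in the \<open>l\<close>-th power of the series
  with coefficients \<open>X k\<close>, \<open>k >= 1\<close>, obtained by splitting off the
  leftmost factor.\<close>

fun epw :: "(nat => fock => fock) => nat => nat => fock => fock" where
 "epw X 0 n v = (if n = 0 then v else 0)"
| "epw X (Suc l) n v = (\<Sum>k\<in>{1..n}. X k (epw X l (n - k) v))"

lemma epw_lin:
 assumes X: "!!k. lin (X k)" shows "lin (epw X l n)"
proof (induction l arbitrary: n)
 case 0 thus ?case by (cases "n = 0") (simp_all add: lin_id lin_zero)
next
 case (Suc l) thus ?case by (simp add: lin_sm lin_comp[OF X])
qed

lemma epw_lists:
 assumes X: "!!k. lin (X k)"
 shows "(\<Sum>ks\<in>{ks. 0 \<notin> set ks \<and> sum_list ks = n \<and> length ks = l}. foldr X ks v) = epw X l n v"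
proof (induction l arbitrary: n)
 case 0
 have "{ks. 0 \<notin> set ks \<and> sum_list ks = n \<and> length ks = 0} = (if n = 0 then {[]} else {})" by auto
 thus ?case by simp
next
 case (Suc l)
 let ?L = "%(n::nat) l. {ks. 0 \<notin> set ks \<and> sum_list ks = n \<and> length ks = (l::nat)}"
 have fin: "finite (?L n l)" for n l
 proof (rule finite_subset)
  show "?L n l \<subseteq> {ks. set ks \<subseteq> {..n} \<and> length ks = l}" using member_le_sum_list by auto
  show "finite {ks. set ks \<subseteq> {..n} \<and> length ks = l}" by (rule finite_lists_length_eq) simp
 qed
 have "?L n (Suc l) = (%(k,ks). k # ks) ` (SIGMA k:{1..n}. ?L (n - k) l)"
  by (auto simp: length_Suc_conv image_iff Bex_def)
 hence "(\<Sum>ks\<in>?L n (Suc l). foldr X ks v) = (\<Sum>(k,ks)\<in>(SIGMA k:{1..n}. ?L (n - k) l). X k (foldr X ks v))"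
  by (simp add: sum.reindex inj_on_def split_beta)
 also have "... = (\<Sum>k\<in>{1..n}. \<Sum>ks\<in>?L (n - k) l. X k (foldr X ks v))"
  by (subst sum.Sigma) (auto simp: fin)
 also have "... = epw X (Suc l) n v"
  by (simp add: Suc.IH[symmetric] lin_sum[OF X])
 finally show ?case .
qed

lemma sum_triangle_swap:
 "(\<Sum>k\<in>{1..n::nat}. \<Sum>j\<in>{1..n - k}. f k j) = (\<Sum>j\<in>{1..n}. \<Sum>k\<in>{1..n - j}. f k j)"
proof -
 have "(\<Sum>(k,j)\<in>(SIGMA k:{1..n}. {1..n - k}). f k j) = (\<Sum>(j,k)\<in>(SIGMA j:{1..n}. {1..n - j}). f k j)"
  by (rule sum.reindex_bij_witness[of _ "%(j,k). (k,j)" "%(k,j). (j,k)"]) auto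
 thus ?thesis by (simp add: sum.Sigma)
qed

text \<open>The commutator of \<open>D\<close> with \<open>X k0\<close> is the scalar
  \<open>c\<close>, and \<open>D\<close> commutes with the other \<open>X k\<close>; so by the
  Leibniz rule \<open>D\<close> removes one factor \<open>X k0\<close>, in each of the
  \<open>l\<close> positions.\<close>

lemma epw_deriv:
 assumes X: "!!k. lin (X k)" and D: "lin D" and k0: "k0 >= 1"
  and DX: "!!k y. k >= 1 ==> D (X k y) = X k (D y) + scale (if k = k0 then c else 0) y"
 shows "D (epw X l n v) = epw X l n (D v) + scale (of_nat l * c) (if k0 <= n then epw X (l - 1) (n - k0) v else 0)"
proof (induction l arbitrary: n)
 case 0 thus ?case by (simp add: lin_0[OF D])
next
 case (Suc l)
 let ?g = "%k. X k (if k0 <= n - k then epw X (l - 1) (n - k - k0) v else 0)"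
 have "D (epw X (Suc l) n v) = (\<Sum>k\<in>{1..n}. X k (epw X l (n - k) (D v)) + scale (of_nat l * c) (?g k)
   + scale (if k = k0 then c else 0) (epw X l (n - k) v))"
  by (simp add: lin_sum[OF D] DX Suc.IH lin_add[OF X] lin_scale[OF X])
 also have "... = epw X (Suc l) n (D v) + scale (of_nat l * c) (\<Sum>k\<in>{1..n}. ?g k)
   + (\<Sum>k\<in>{1..n}. scale (if k = k0 then c else 0) (epw X l (n - k) v))"
  by (simp add: sum.distrib pm.scale_sum_right)
 also have "(\<Sum>k\<in>{1..n}. scale (if k = k0 then c else 0) (epw X l (n - k) v))
   = (\<Sum>k\<in>{1..n}. if k = k0 then scale c (epw X l (n - k) v) else 0)"
  by (intro sum.cong) auto
 also have "... = scale c (if k0 <= n then epw X l (n - k0) v else 0)"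
  using k0 by (simp add: sum.delta)
 also have "scale (of_nat l * c) (\<Sum>k\<in>{1..n}. ?g k) = scale (of_nat l * c) (if k0 <= n then epw X l (n - k0) v else 0)"
 proof (cases l)
  case (Suc l')
  have "(\<Sum>k\<in>{1..n}. ?g k) = (\<Sum>k\<in>{1..n - k0}. ?g k)"
   by (rule sum.mono_neutral_right) (use k0 in "auto simp: lin_0[OF X]")
  also have "... = (\<Sum>k\<in>{1..n - k0}. X k (epw X (l - 1) (n - k0 - k) v))"
   by (intro sum.cong refl) (auto simp: add.commute)
  finally show ?thesis using Suc k0 by (auto simp: lin_0[OF X] intro!: arg_cong[of _ _ "scale _"] sum.neutral)
 qed simp
 finally show ?case by (simp add: ring_distribs pm.scale_left_distrib)
qed

lemma length_le_sum_list: "0 \<notin> set ks ==> length ks <= sum_list (ks :: nat list)"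
 by (induction ks) auto

text \<open>The bound \<open>N\<close> is free because the \<open>l\<close>-th power of a series
  without constant term starts in degree \<open>l\<close>. A common bound lets coefficients of
  different degrees be compared termwise.\<close>

lemma exp_coeff_epw:
 assumes X: "!!k. lin (X k)" and N: "N >= n"
 shows "exp_coeff X n v = (\<Sum>l\<le>N. scale (1 / fact l) (epw X l n v))"
proof -
 let ?S = "{ks. 0 \<notin> set ks \<and> sum_list ks = n}"
 have "finite ?S"
 proof (rule finite_subset)
  show "?S \<subseteq> {ks. set ks \<subseteq> {..n} \<and> length ks <= n}" using member_le_sum_list length_le_sum_list by auto
  show "finite {ks. set ks \<subseteq> {..n} \<and> length ks <= n}" by (rule finite_lists_length_le) simp
 qed
 hence "exp_coeff X n v = (\<Sum>l\<le>N. \<Sum>ks\<in>{ks\<in>?S. length ks = l}. scale (1 / fact (length ks)) (foldr X ks v))"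
  unfolding exp_coeff_def using N
  by (intro sum.group[symmetric]) (auto dest: length_le_sum_list)
 also have "... = (\<Sum>l\<le>N. scale (1 / fact l) (epw X l n v))"
  by (intro sum.cong refl) (simp add: epw_lists[OF X, symmetric] pm.scale_sum_right conj_assoc)
 finally show ?thesis .
qed

lemma exp_coeff_deriv:
 assumes X: "!!k. lin (X k)" and D: "lin D" and k0: "k0 >= 1"
  and DX: "!!k y. k >= 1 ==> D (X k y) = X k (D y) + scale (if k = k0 then c else 0) y"
 shows "D (exp_coeff X n v) = exp_coeff X n (D v) + scale c (if k0 <= n then exp_coeff X (n - k0) v else 0)"
proof -
 have "D (exp_coeff X n v) = (\<Sum>l\<le>Suc n. scale (1 / fact l) (epw X l n (D v)) +
   scale (of_nat l * c / fact l) (if k0 <= n then epw X (l - 1) (n - k0) v else 0))"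
  by (simp add: exp_coeff_epw[OF X, of n "Suc n"] lin_sum[OF D] lin_add[OF D] lin_scale[OF D]
    epw_deriv[OF X D k0 DX] pm.scale_right_distrib del: sum.atMost_Suc)
 also have "... = exp_coeff X n (D v) + (\<Sum>l\<le>Suc n. scale (of_nat l * c / fact l) (if k0 <= n then epw X (l - 1) (n - k0) v else 0))"
  by (simp add: sum.distrib exp_coeff_epw[OF X, of n "Suc n"] del: sum.atMost_Suc)
 also have "(\<Sum>l\<le>Suc n. scale (of_nat l * c / fact l) (if k0 <= n then epw X (l - 1) (n - k0) v else 0))
   = (\<Sum>l\<le>n. scale c (scale (1 / fact l) (if k0 <= n then epw X l (n - k0) v else 0)))"
  by (subst sum.atMost_Suc_shift) (simp add: field_simps del: of_nat_Suc cong: if_cong)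
 also have "... = scale c (if k0 <= n then exp_coeff X (n - k0) v else 0)"
  by (simp add: pm.scale_sum_right exp_coeff_epw[OF X, of "n - k0" n])
 finally show ?thesis .
qed

lemma exp_coeff_commute:
 assumes X: "!!k. lin (X k)" and D: "lin D"
  and DX: "!!k y. k >= 1 ==> D (X k y) = X k (D y)"
 shows "D (exp_coeff X n v) = exp_coeff X n (D v)"
 using exp_coeff_deriv[where ?k0.0 = 1 and c = 0, OF X D] DX by simp

lemma exp_coeff_lin: "(!!k. lin (X k)) ==> lin (exp_coeff X n)"
proof -
 assume X: "!!k. lin (X k)"
 have "exp_coeff X n = (%v. \<Sum>l\<le>n. scale (1 / fact l) (epw X l n v))"
  by (rule ext) (simp add: exp_coeff_epw[OF X, of n n])
 thus ?thesis by (auto intro!: lin_sm lin_scl epw_lin[OF X])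
qed

lemma exp_coeff_0: "(!!k. lin (X k)) ==> exp_coeff X 0 v = v"
 by (subst exp_coeff_epw[of X 0 0]) auto

text \<open>The operator \<open>z d/dz\<close> applied to the power \<open>l + 1\<close>: the
  factors commute, so the differentiated one can be moved to the front.\<close>

lemma epw_euler:
 assumes X: "!!k. lin (X k)" and comm: "!!j k y. X j (X k y) = X k (X j y)"
 shows "scale (of_nat n) (epw X (Suc l) n v) = scale (of_nat (Suc l)) (\<Sum>k\<in>{1..n}. scale (of_nat k) (X k (epw X l (n - k) v)))"
proof (induction l arbitrary: n)
 case 0
 have "(\<Sum>k\<in>{1..n}. scale (of_nat n) (X k (epw X 0 (n - k) v))) = (\<Sum>k\<in>{1..n}. scale (of_nat k) (X k (epw X 0 (n - k) v)))"
  by (intro sum.cong refl) (auto simp: lin_0[OF X])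
 thus ?case by (simp add: pm.scale_sum_right)
next
 case (Suc l)
 let ?e = "%l n. epw X l n v"
 have "scale (of_nat n) (?e (Suc (Suc l)) n) = (\<Sum>k\<in>{1..n}. scale (of_nat k) (X k (?e (Suc l) (n - k))) + X k (scale (of_nat (n - k)) (?e (Suc l) (n - k))))"
  unfolding epw.simps(2)[of X "Suc l" n] pm.scale_sum_right
 proof (intro sum.cong refl)
  fix k assume "k \<in> {1..n}"
  hence "of_nat n = (of_nat k + of_nat (n - k) :: complex)" by (simp flip: of_nat_add)
  thus "scale (of_nat n) (X k (?e (Suc l) (n - k))) = scale (of_nat k) (X k (?e (Suc l) (n - k))) + X k (scale (of_nat (n - k)) (?e (Suc l) (n - k)))"
   by (simp only: lin_scale[OF X] pm.scale_left_distrib)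
 qed
 also have "... = (\<Sum>k\<in>{1..n}. scale (of_nat k) (X k (?e (Suc l) (n - k)))
   + scale (of_nat (Suc l)) (\<Sum>j\<in>{1..n - k}. scale (of_nat j) (X j (X k (?e l (n - k - j))))))"
 proof (intro sum.cong refl arg_cong2[of _ _ _ _ "(+)"])
  fix k assume "k \<in> {1..n}"
  have "X k (scale (of_nat (n - k)) (?e (Suc l) (n - k))) = scale (of_nat (Suc l)) (\<Sum>j\<in>{1..n - k}. scale (of_nat j) (X k (X j (?e l (n - k - j)))))"
   by (simp only: Suc.IH lin_scale[OF X] lin_sum[OF X])
  also have "... = scale (of_nat (Suc l)) (\<Sum>j\<in>{1..n - k}. scale (of_nat j) (X j (X k (?e l (n - k - j)))))"
   by (intro arg_cong[of _ _ "scale _"] sum.cong refl) (rule comm)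
  finally show "X k (scale (of_nat (n - k)) (?e (Suc l) (n - k))) = scale (of_nat (Suc l)) (\<Sum>j\<in>{1..n - k}. scale (of_nat j) (X j (X k (?e l (n - k - j)))))" .
 qed
 also have "... = (\<Sum>k\<in>{1..n}. scale (of_nat k) (X k (?e (Suc l) (n - k))))
   + scale (of_nat (Suc l)) (\<Sum>k\<in>{1..n}. \<Sum>j\<in>{1..n - k}. scale (of_nat j) (X j (X k (?e l (n - k - j)))))"
  by (simp only: sum.distrib pm.scale_sum_right)
 also have "(\<Sum>k\<in>{1..n}. \<Sum>j\<in>{1..n - k}. scale (of_nat j) (X j (X k (?e l (n - k - j)))))
   = (\<Sum>j\<in>{1..n}. \<Sum>k\<in>{1..n - j}. scale (of_nat j) (X j (X k (?e l (n - j - k)))))"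
  by (subst sum_triangle_swap) (simp only: diff_commute)
 also have "... = (\<Sum>j\<in>{1..n}. scale (of_nat j) (X j (?e (Suc l) (n - j))))"
  by (simp only: epw.simps lin_sum[OF X] pm.scale_sum_right)
 finally show ?case by (simp only: of_nat_Suc[of "Suc l"] pm.scale_left_distrib pm.scale_one)
qed

text \<open>\<open>z d/dz exp X = (z dX/dz) exp X\<close>, a recursion without powers and factorials
  that determines the coefficients of an exponential. Comparing it with the recursion of binomial
  coefficients replaces the expansion of Schur polynomials.\<close>

lemma exp_coeff_euler:
 assumes X: "!!k. lin (X k)" and comm: "!!j k y. X j (X k y) = X k (X j y)"
 shows "scale (of_nat n) (exp_coeff X n v) = (\<Sum>k\<in>{1..n}. scale (of_nat k) (X k (exp_coeff X (n - k) v)))"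
proof -
 have "scale (of_nat n) (exp_coeff X n v) = (\<Sum>l\<le>Suc n. scale (1 / fact l) (scale (of_nat n) (epw X l n v)))"
  by (simp add: exp_coeff_epw[OF X, of n "Suc n"] pm.scale_sum_right mult.commute del: sum.atMost_Suc)
 also have "... = (\<Sum>l\<le>n. scale (1 / fact (Suc l)) (scale (of_nat n) (epw X (Suc l) n v)))"
  by (subst sum.atMost_Suc_shift) (simp del: epw.simps(2))
 also have "... = (\<Sum>l\<le>n. scale (1 / fact l) (\<Sum>k\<in>{1..n}. scale (of_nat k) (X k (epw X l (n - k) v))))"
  unfolding epw_euler[OF X comm] by (intro sum.cong refl) (simp add: divide_simps del: of_nat_Suc)
 also have "... = (\<Sum>k\<in>{1..n}. scale (of_nat k) (X k (\<Sum>l\<le>n. scale (1 / fact l) (epw X l (n - k) v))))"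
  by (simp add: pm.scale_sum_right lin_sum[OF X] lin_scale[OF X] sum.swap[of _ "{..n}"] mult.commute)
 also have "... = (\<Sum>k\<in>{1..n}. scale (of_nat k) (X k (exp_coeff X (n - k) v)))"
  by (intro sum.cong refl) (subst exp_coeff_epw[OF X, of _ n], auto)
 finally show ?thesis .
qed

subsection \<open>The modes of exponentials\<close>

definition crx :: "nat => int => nat => fock => fock"
 where "crx p a n v = scale (of_int a / of_nat (2 * p * n)) (heis p (- int n) v)"
definition anx :: "nat => int => nat => fock => fock"
 where "anx p a n v = scale (- (of_int a / of_nat (2 * p * n))) (heis p (int n) v)"

lemma crx_lin: "lin (crx p a n)" and anx_lin: "lin (anx p a n)"
 unfolding crx_def[abs_def] anx_def[abs_def] by (intro lin_scl heis_lin)+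

text \<open>Integer degrees, with 0 in negative degree, make the index shifts in the commutation
  rules valid without case distinctions.\<close>

definition cre :: "nat => int => int => fock => fock"
 where "cre p a j v = (if j < 0 then 0 else exp_coeff (crx p a) (nat j) v)"
definition ann :: "nat => int => int => fock => fock"
 where "ann p a j v = (if j < 0 then 0 else exp_coeff (anx p a) (nat j) v)"

lemma cre_lin: "lin (cre p a j)" and ann_lin: "lin (ann p a j)"
 unfolding cre_def[abs_def] ann_def[abs_def]
 by (cases "j < 0"; simp add: lin_zero exp_coeff_lin crx_lin anx_lin)+
lemmas cre_lin_0 = lin_0[OF cre_lin]

lemma cre_0 [simp]: "cre p a 0 v = v" and ann_0 [simp]: "ann p a 0 v = v"
 by (simp_all add: cre_def ann_def exp_coeff_0 crx_lin anx_lin)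

lemma cre_heis:
 assumes p: "p > 0"
 shows "heis p l (cre p a j v) = cre p a j (heis p l v) + (if l > 0 then scale (of_int a) (cre p a (j - l) v) else 0)"
proof (cases "j < 0")
 case False
 have *: "heis p l (crx p a k y) = crx p a k (heis p l y) + scale (if k = nat l then (if l > 0 then of_int a else 0) else 0) y"
  if "k >= 1" for k y
  using that p by (auto simp: crx_def lin_simps[OF heis_lin] heis_comm[of p l "- int k"] pm.scale_right_distrib)
 show ?thesis
 proof (cases "l > 0")
  case True
  thus ?thesis using False exp_coeff_deriv[of "crx p a" "heis p l" "nat l" "of_int a" "nat j" v] *
   by (auto simp: cre_def crx_lin nat_diff_distrib' zero_less_nat_eq Suc_le_eq)
 next
  case l: False
  thus ?thesis using False exp_coeff_commute[of "crx p a" "heis p l" "nat j" v] *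
   by (auto simp: cre_def crx_lin)
 qed
qed (auto simp: cre_def lin_0)

lemma ann_heis:
 assumes p: "p > 0"
 shows "heis p l (ann p a j v) = ann p a j (heis p l v) + (if l < 0 then scale (of_int a) (ann p a (j + l) v) else 0)"
proof (cases "j < 0")
 case False
 have *: "heis p l (anx p a k y) = anx p a k (heis p l y) + scale (if k = nat (- l) then (if l < 0 then of_int a else 0) else 0) y"
  if "k >= 1" for k y
  using that p by (auto simp: anx_def lin_simps[OF heis_lin] heis_comm[of p l "int k"] pm.scale_right_distrib)
 show ?thesis
 proof (cases "l < 0")
  case True
  thus ?thesis using False exp_coeff_deriv[of "anx p a" "heis p l" "nat (- l)" "of_int a" "nat j" v] *
    nat_diff_distrib'[of j "- l"]
   by (auto simp: ann_def anx_lin Suc_le_eq)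
 next
  case l: False
  thus ?thesis using False exp_coeff_commute[of "anx p a" "heis p l" "nat j" v] *
   by (auto simp: ann_def anx_lin)
 qed
qed (auto simp: ann_def lin_0)

lemma epw_hm:
 assumes "!!k m v. hm m b v ==> hm (m + s * int k) b (X k v)" "hm m b v"
 shows "hm (m + s * int n) b (epw X l n v)"
proof (induction l arbitrary: n)
 case 0 thus ?case using assms(2) by auto
next
 case (Suc l)
 have "hm (m + s * int n) b (X k (epw X l (n - k) v))" if "k \<in> {1..n}" for k
  using assms(1)[OF Suc[of "n - k"], of k] that by (simp add: algebra_simps of_nat_diff)
 thus ?case by (auto intro: hm_sum)
qed

lemma cre_hm: assumes "hm m b v" shows "hm (m + j) b (cre p a j v)"
proof -
 have "hm (m + int k) b (crx p a k v)" if "hm m b v" for k m v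
  using heis_hm[OF that, of "- int k" p] by (simp add: crx_def hm_scale)
 thus ?thesis using epw_hm[of b 1 "crx p a" m v "nat j"] assms
  by (auto simp: cre_def exp_coeff_epw[OF crx_lin, of "nat j" "nat j"] intro!: hm_sum hm_scale)
qed

lemma ann_hm: assumes "hm m b v" shows "hm (m - j) b (ann p a j v)"
proof -
 have "hm (m - int k) b (anx p a k v)" if "hm m b v" for k m v
  using heis_hm[OF that, of "int k" p] by (simp add: anx_def hm_scale hm_minus)
 thus ?thesis using epw_hm[of b "-1" "anx p a" m v "nat j"] assms
  by (auto simp: ann_def exp_coeff_epw[OF anx_lin, of "nat j" "nat j"] intro!: hm_sum hm_scale)
qed

definition em :: "nat => int => int => fock => fock"
 where "em p a n v = exp_mode p a (of_int n) v"

lemma em_lin [simp]: "lin (em p a n)" by (simp add: em_def[abs_def] exp_mode_def)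

text \<open>\<open>t\<close> stands for the exponent \<open>ab/2p\<close> of \<open>x\<close> that
  the zero mode contributes. As a parameter it gives an operator on the whole space, whose
  commutation with Heisenberg modes involves no divisibility.\<close>

definition em' :: "nat => int => int => int => fock => fock"
 where "em' p a t n v = Sum_any (%k. cre p a (int k - n - 1 - t) (ann p a (int k) (charge_shift a v)))"

lemma ann_ez: "hm m b v ==> ez (%k. ann p a (int k) v)"
proof (rule ezI[of "nat (m + 1)"])
 fix j assume "hm m b v" "nat (m + 1) <= j"
 thus "ann p a (int j) v = 0" by (intro hm_neg[OF ann_hm[of m b v "int j" p a]]) auto
qed

lemma em_st:
 assumes p: "p > 0"
 shows "em p a n (st M b) = (if 2 * int p dvd a * b then em' p a (a * b div (2 * int p)) n (st M b) else 0)"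
proof (cases "2 * int p dvd a * b")
 case True
 define t where "t = a * b div (2 * int p)"
 have "(of_int (a * b) / of_nat (2 * p) :: rat) = of_int t"
 proof -
  have "a * b = t * (2 * int p)" using True by (simp add: t_def)
  hence "(of_int (a * b) :: rat) = of_int t * of_nat (2 * p)" by (metis of_int_mult of_int_of_nat_eq of_nat_mult of_nat_numeral)
  thus ?thesis using p by (simp add: field_simps)
 qed
 hence *: "of_nat j - of_nat k + of_int (a * b) / of_nat (2 * p) = - of_int n - (1::rat) \<longleftrightarrow> int j = int k - n - 1 - t" for j k :: nat
 proof -
  have "of_nat j - of_nat k + of_int t = - of_int n - (1::rat) \<longleftrightarrow> (of_int (int j - int k + t) = (of_int (- n - 1) :: rat))" by simp
  also have "... \<longleftrightarrow> int j = int k - n - 1 - t" by (simp only: of_int_eq_iff) linarith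
  finally show ?thesis using \<open>_ = of_int t\<close> by simp
 qed
 let ?f = "%k. ann p a (int k) (charge_shift a (st M b))"
 have "ez ?f" by (rule ann_ez[OF charge_shift_hm[OF hm_st]])
 then obtain N where N: "!!k. k >= N ==> ?f k = 0" unfolding ez_def by blast
 let ?h = "%k. int k - n - 1 - t"
 have c: "(%n v. scale (of_int a / of_nat (2 * p * n)) (heis p (- int n) v)) = crx p a" by (intro ext) (simp only: crx_def)
 have d: "(%n v. scale (- (of_int a / of_nat (2 * p * n))) (heis p (int n) v)) = anx p a" by (intro ext) (simp only: anx_def)
 have c': "exp_coeff (crx p a) j = cre p a (int j)" and d': "exp_coeff (anx p a) j = ann p a (int j)" for j
  by (simp_all add: fun_eq_iff cre_def ann_def)
 have "em p a n (st M b) = Sum_any (%(j, k). if int j = ?h k then cre p a (int j) (?f k) else 0)"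
  by (simp only: em_def exp_mode_def lin_ext_single pm.scale_one prod.case c d * c' d')
 also have "... = (\<Sum>(j, k)\<in>(%k. (nat (?h k), k)) ` {..<N}. if int j = ?h k then cre p a (int j) (?f k) else 0)"
 proof (rule Sum_any.expand_superset)
  show "{x. (case x of (j, k) => if int j = ?h k then cre p a (int j) (?f k) else 0) ~= 0} \<subseteq> (%k. (nat (?h k), k)) ` {..<N}"
  proof (rule subsetI, clarify)
   fix j k assume *: "(if int j = ?h k then cre p a (int j) (?f k) else 0) ~= 0"
   hence "int j = ?h k" by presburger
   moreover have "k < N"
   proof (rule ccontr)
    assume "\<not> k < N"
    hence "?f k = 0" using N by (simp only: not_less)
    hence "(if int j = ?h k then cre p a (int j) (?f k) else 0) = 0" by (simp only: cre_lin_0 if_cancel)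
    thus False using * by (rule notE[rotated])
   qed
   ultimately show "(j, k) \<in> (%k. (nat (?h k), k)) ` {..<N}" by (intro image_eqI[of _ _ k]) auto
  qed
 qed simp
 also have "... = (\<Sum>k<N. if int (nat (?h k)) = ?h k then cre p a (int (nat (?h k))) (?f k) else 0)"
  by (subst sum.reindex) (simp_all add: inj_on_def del: int_nat_eq)
 also have "... = (\<Sum>k<N. cre p a (?h k) (?f k))"
  by (intro sum.cong refl) (auto simp: cre_def)
 also have "... = em' p a t n (st M b)"
  unfolding em'_def by (rule Sum_any_lessThan[symmetric]) (simp add: N cre_lin_0 del: charge_shift_st)
 finally show ?thesis using True by (simp add: t_def)
next
 case False
 have "(of_int (a * b) / of_nat (2 * p) :: rat) ~= of_int m" for m
 proof
  assume "(of_int (a * b) / of_nat (2 * p) :: rat) = of_int m"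
  hence "(of_int (a * b) :: rat) = of_int (m * (2 * int p))" using p by (simp add: field_simps)
  hence "a * b = m * (2 * int p)" by (simp only: of_int_eq_iff)
  thus False using False by simp
 qed
 note nint = this
 have *: "of_nat j - of_nat k + of_int (a * b) / of_nat (2 * p) ~= - of_int n - (1::rat)" for j k :: nat
 proof (rule notI)
  assume "of_nat j - of_nat k + of_int (a * b) / of_nat (2 * p) = - of_int n - (1::rat)"
  hence "(of_int (a * b) / of_nat (2 * p) :: rat) = of_int (int k - int j - n - 1)"
   unfolding of_int_diff of_int_of_nat_eq of_int_1 by linarith
  thus False using nint by blast
 qed
 show ?thesis using False by (simp add: em_def exp_mode_def * del: of_int_mult of_nat_mult)
qed

lemma ez_sum: "finite A ==> (!!a. a \<in> A ==> ez (f a)) ==> ez (%j. \<Sum>a\<in>A. f a j :: 'a::comm_monoid_add)"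
 by (induction A rule: finite_induct) (auto intro: ez_add ezI)

lemma ez_all:
 assumes "!!k. lin (T k)" "!!x. ez (%k. T k (single x 1))"
 shows "ez (%k. T k v)"
proof -
 have "(%k. T k v) = (%k. \<Sum>x\<in>keys v. scale (lookup v x) (T k (single x 1)))"
  by (rule ext, subst poly_mapping_decomp[of v]) (simp add: lin_sum[OF assms(1)] lin_scale[OF assms(1)])
 thus ?thesis using assms(2) by (simp add: ez_sum ez_scale)
qed

lemma lin_Sum_any:
 assumes "!!k. lin (T k)" "!!v. ez (%k. T k v)"
 shows "lin (%v. Sum_any (%k. T k v))"
 unfolding lin_def by (auto simp: lin_simps[OF assms(1)] Sum_any_add assms(2) Sum_any_scale[OF assms(2)])

lemma ann_ez_all: "ez (%k. ann p a (int k) v)"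
proof (rule ez_all[OF ann_lin])
 fix x :: "nat multiset \<times> int"
 show "ez (%k. ann p a (int k) (single x 1))"
  using ann_ez[OF hm_st[of "fst x" "snd x"]] by simp
qed

lemma em'_lin: "lin (em' p a t n)"
 unfolding em'_def[abs_def]
 by (intro lin_Sum_any lin_comp[OF cre_lin] lin_comp[OF ann_lin] charge_shift_lin ez_lin[OF cre_lin] ann_ez_all)

lemma em_hm_eq:
 assumes "p > 0" "hm m b v"
 shows "em p a n v = (if 2 * int p dvd a * b then em' p a (a * b div (2 * int p)) n v else 0)"
proof (rule hm_eq[OF assms(2)])
 show "lin (%v. if 2 * int p dvd a * b then em' p a (a * b div (2 * int p)) n v else 0)"
  by (cases "2 * int p dvd a * b") (simp_all add: em'_lin lin_zero)
qed (simp_all add: em_st[OF assms(1)])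

lemma em_hm:
 assumes "p > 0" "hm m b v"
 shows "hm (m - n - 1 - a * b div (2 * int p)) (a + b) (em p a n v)"
proof -
 define t where "t = a * b div (2 * int p)"
 have "hm (m - n - 1 - t) (a + b) (cre p a (int k - n - 1 - t) (ann p a (int k) (charge_shift a v)))" for k
  using cre_hm[OF ann_hm[OF charge_shift_hm[OF assms(2), of a], of "int k" p a], of "int k - n - 1 - t" p a] by (simp add: algebra_simps)
 hence "hm (m - n - 1 - t) (a + b) (em' p a t n v)" unfolding em'_def by (intro hm_Sum_any)
 thus ?thesis by (simp add: em_hm_eq[OF assms] t_def)
qed

text \<open>For \<open>l > 0\<close> only the creation exponential fails to commute with
  \<alpha>(l), for \<open>l < 0\<close> only the annihilation one. Either way the extra term is the
  same mode shifted by \<open>l\<close>, in the second case after reindexing the sum.\<close>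

lemma em'_comm:
 assumes p: "p > 0" and l: "l ~= 0"
 shows "heis p l (em' p a t n v) = em' p a t n (heis p l v) + scale (of_int a) (em' p a t (n + l) v)"
proof -
 let ?w = "charge_shift a v"
 let ?B = "%k. ann p a k ?w"
 have ez1: "ez (%k. cre p a (c k) (ann p a (int k) y))" for c y by (intro ez_lin[OF cre_lin] ann_ez_all)
 have "heis p l (em' p a t n v) = Sum_any (%k. heis p l (cre p a (int k - n - 1 - t) (?B (int k))))"
  unfolding em'_def by (rule Sum_any_lin[OF heis_lin ez1])
 also have "... = em' p a t n (heis p l v) + scale (of_int a) (em' p a t (n + l) v)"
 proof (cases "l > 0")
  case True
  have "heis p l (cre p a (int k - n - 1 - t) (?B (int k))) = cre p a (int k - n - 1 - t) (ann p a (int k) (charge_shift a (heis p l v)))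
    + scale (of_int a) (cre p a (int k - (n + l) - 1 - t) (?B (int k)))" for k
   using True by (simp add: cre_heis[OF p] ann_heis[OF p] charge_shift_heis algebra_simps)
  thus ?thesis by (simp add: em'_def Sum_any_add Sum_any_scale ez1 ez_scale)
 next
  case False
  define q where "q = nat (- l)"
  have q: "l = - int q" "q > 0" using False l by (auto simp: q_def)
  have e: "heis p l (cre p a (int k - n - 1 - t) (?B (int k))) = cre p a (int k - n - 1 - t) (ann p a (int k) (charge_shift a (heis p l v)))
    + scale (of_int a) (cre p a (int k - n - 1 - t) (?B (int k - int q)))" for k
   using q by (simp add: cre_heis[OF p] ann_heis[OF p] charge_shift_heis lin_add[OF cre_lin] lin_scale[OF cre_lin])
  have ez2: "ez (%k. cre p a (int k - n - 1 - t) (?B (int k - int q)))"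
  proof -
   obtain N where N: "!!k. k >= N ==> ?B (int k) = 0" using ann_ez_all[of p a ?w] by (auto simp: ez_def)
   show ?thesis
   proof (rule ezI[of "N + q"])
    fix k assume "k >= N + q"
    hence "?B (int k - int q) = 0" using N[of "k - q"] by (simp add: of_nat_diff)
    thus "cre p a (int k - n - 1 - t) (?B (int k - int q)) = 0" by (simp add: cre_lin_0)
   qed
  qed
  have "Sum_any (%k. cre p a (int k - n - 1 - t) (?B (int k - int q)))
    = Sum_any (%k. cre p a (int (k + q) - n - 1 - t) (?B (int (k + q) - int q)))"
   by (rule Sum_any_shift[OF ez2]) (simp add: ann_def cre_lin_0)
  also have "... = em' p a t (n + l) v" unfolding em'_def q by (simp add: algebra_simps)
  finally show ?thesis by (simp add: e em'_def Sum_any_add Sum_any_scale[symmetric] ez1 ez2 ez_scale)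
 qed
 finally show ?thesis .
qed

lemma em_comm:
 assumes p: "p > 0"
 shows "heis p l (em p a n v) = em p a n (heis p l v) + scale (of_int a) (em p a (n + l) v)"
proof (rule lin_eqI[of "%v. heis p l (em p a n v)" "%v. em p a n (heis p l v) + scale (of_int a) (em p a (n + l) v)"])
 show "lin (%v. em p a n (heis p l v) + scale (of_int a) (em p a (n + l) v))"
  by (intro lin_plus lin_scl em_lin lin_comp[OF em_lin heis_lin])
 show "lin (%v. heis p l (em p a n v))" by (intro lin_comp[OF heis_lin] em_lin)
 fix k :: "nat multiset \<times> int"
 obtain M b where k: "k = (M, b)" by force
 note s = hm_st[of M b]
 show "heis p l (em p a n (single k 1)) = em p a n (heis p l (single k 1)) + scale (of_int a) (em p a (n + l) (single k 1))"
 proof (cases "l = 0")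
  case True
  show ?thesis unfolding k True heis_0_hm[OF em_hm[OF p s]] heis_0_hm[OF s] lin_scale[OF em_lin]
   by (simp add: pm.scale_left_distrib)
 next
  case False
  show ?thesis unfolding k em_hm_eq[OF p s] em_hm_eq[OF p heis_hm[OF s]]
   by (simp add: em'_comm[OF p False] lin_0)
 qed
qed

lemma em_top:
 assumes p: "p > 0" and d: "2 * int p dvd a * b"
 shows "em p a n (st {#} b) = cre p a (- n - 1 - a * b div (2 * int p)) (st {#} (a + b))"
proof -
 have "ann p a (int k) (st {#} (a + b)) = 0" if "k ~= 0" for k
  using ann_hm[OF hm_st[of "{#}" "a + b"], of "int k" p a] that by (auto dest: hm_neg)
 thus ?thesis using d
  by (simp add: em_st[OF p] em'_def Sum_any_single[of 0] cre_lin_0)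
qed

subsection \<open>Fields and normally ordered products\<close>

definition fld :: "(int => fock => fock) => bool"
 where "fld A \<longleftrightarrow> (\<forall>n. lin (A n)) \<and> (\<forall>n v. ez (%k. A (n + int k) v))"

lemma fld_lin: "fld A ==> lin (A n)" and fld_ez: "fld A ==> ez (%k. A (n + int k) v)"
 by (auto simp: fld_def)

lemma fld_ez_shift: assumes "fld A" "!!k. f k = n + int k" shows "ez (%k. A (f k) v)"
 using fld_ez[OF assms(1), of n v] by (simp add: assms(2))

lemma fld_shift: "fld A ==> fld (%n. A (n + s))"
 using fld_ez_shift[of A "%k. n + int k + s" "n + s" v for n v] fld_lin[of A] by (auto simp: fld_def)

lemma fld_sum: "finite J ==> (!!j. j \<in> J ==> fld (A j)) ==> fld (%n v. \<Sum>j\<in>J. A j n v)"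
 unfolding fld_def by (auto intro!: lin_sm ez_sum)

lemma fld_scale: "fld A ==> fld (%n v. scale c (A n v))"
 unfolding fld_def by (auto intro!: lin_scl ez_scale)

lemma fld_bound: assumes "fld A" obtains R where "!!n. n >= R ==> A n v = 0"
proof -
 obtain N where N: "!!k. k >= N ==> A (0 + int k) v = 0"
  using fld_ez[OF assms, of 0 v] unfolding ez_def by blast
 show ?thesis
 proof (rule that[of "int N"])
  fix n assume "int N <= n" thus "A n v = 0" using N[of "nat n"] by simp
 qed
qed

lemma ez_unif:
 assumes "!!k::nat. k < K ==> ez (f k)"
 obtains N where "!!k j. k < K ==> j >= N ==> f k j = 0"
proof -
 have "\<exists>N. \<forall>k<K. \<forall>j\<ge>N. f k j = 0" using assms
 proof (induction K)
  case (Suc K)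
  from Suc.prems have "!!k. k < K ==> ez (f k)" by simp
  from Suc.IH[OF this] obtain N where N: "!!k j. k < K ==> j >= N ==> f k j = 0" by blast
  obtain M where M: "!!j. j >= M ==> f K j = 0" using Suc.prems[of K] by (auto simp: ez_def)
  have "f k j = 0" if "k < Suc K" "j >= max M N" for k j
   using that N[of k j] M[of j] by (cases "k = K") auto
  thus ?case by blast
 qed simp
 thus ?thesis using that by blast
qed

lemma heis_ez: "ez (%k. heis p (int k) v)"
proof (rule ez_all[OF heis_lin])
 fix x :: "nat multiset \<times> int"
 show "ez (%k. heis p (int k) (single x 1))"
 proof (rule ezI[of "Suc (lev (fst x))"])
  fix j assume "Suc (lev (fst x)) <= j"
  thus "heis p (int j) (single x 1) = 0"
   using hm_neg[OF heis_hm[OF hm_st[of "fst x" "snd x"], of "int j" p]] by simp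
 qed
qed

definition nopt :: "nat => nat => (int => fock => fock) => int => fock => int => fock"
 where "nopt p i A n v k = scale (bc (- k - 1) i)
  (if k < 0 then heis p k (A (n - k - int i - 1) v) else A (n - k - int i - 1) (heis p k v))"

definition nop :: "nat => nat => (int => fock => fock) => int => fock => fock"
 where "nop p i A n v = Sum_any (nopt p i A n v)"

text \<open>The terms \<open>k = - g - 1\<close> of the normally ordered product, where the binomial
  coefficient becomes \<open>g choose i\<close>; \<open>nopa\<close> collects the terms with
  \<open>k >= 0\<close>.\<close>

definition nopc :: "nat => nat => (int => fock => fock) => int => fock => nat => fock"
 where "nopc p i A n v g = scale (bc (int g) i) (heis p (- int g - 1) (A (n + int g - int i) v))"
definition nopa :: "nat => nat => (int => fock => fock) => int => fock => nat => fock"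
 where "nopa p i A n v k = scale (bc (- int k - 1) i) (A (n - int k - int i - 1) (heis p (int k) v))"

lemma nopc_ez: assumes "fld A" shows "ez (nopc p i A n v)"
 unfolding nopc_def[abs_def]
 by (intro ez_scale ez_lin[OF heis_lin] fld_ez_shift[OF assms, of _ "n - int i"]) auto

lemma nopa_ez: assumes "fld A" shows "ez (nopa p i A n v)"
 unfolding nopa_def[abs_def]
 by (intro ez_scale ez_lin[OF fld_lin[OF assms]] heis_ez)

lemma nop_split: assumes "fld A"
 shows "nop p i A n v = Sum_any (nopc p i A n v) + Sum_any (nopa p i A n v)"
proof -
 have c: "(%j. nopt p i A n v (- int j - 1)) = nopc p i A n v"
  by (rule ext) (simp add: nopt_def nopc_def algebra_simps)
 have a: "(%j. nopt p i A n v (int j)) = nopa p i A n v"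
  by (rule ext) (simp add: nopt_def nopa_def)
 show ?thesis
  using Sum_any_int_split[of "nopt p i A n v"] nopc_ez[OF assms] nopa_ez[OF assms] unfolding nop_def c a by blast
qed

lemma nopt_finite: assumes "fld A" shows "finite {k. nopt p i A n v k ~= 0}"
proof -
 have c: "(%j. nopt p i A n v (- int j - 1)) = nopc p i A n v"
  by (rule ext) (simp add: nopt_def nopc_def algebra_simps)
 have a: "(%j. nopt p i A n v (int j)) = nopa p i A n v"
  by (rule ext) (simp add: nopt_def nopa_def)
 have "{k. nopt p i A n v k ~= 0} \<subseteq> (%j. - int j - 1) ` {j. nopc p i A n v j ~= 0} \<union> int ` {j. nopa p i A n v j ~= 0}"
 proof
  fix k assume k: "k \<in> {k. nopt p i A n v k ~= 0}"
  show "k \<in> (%j. - int j - 1) ` {j. nopc p i A n v j ~= 0} \<union> int ` {j. nopa p i A n v j ~= 0}"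
  proof (cases "k >= 0")
   case True thus ?thesis using k fun_cong[OF a, of "nat k"] by (intro UnI2 image_eqI[of _ _ "nat k"]) auto
  next
   case False thus ?thesis using k fun_cong[OF c, of "nat (- k - 1)"] by (intro UnI1 image_eqI[of _ _ "nat (- k - 1)"]) auto
  qed
 qed
 thus ?thesis using ez_finite[OF nopc_ez[OF assms]] ez_finite[OF nopa_ez[OF assms]]
  by (meson finite_UnI finite_imageI finite_subset)
qed

lemma fld_nop: assumes A: "fld A" shows "fld (nop p i A)"
 unfolding fld_def
proof (intro conjI allI)
 fix n
 have c: "lin (%v. nopc p i A n v g)" for g
  unfolding nopc_def by (rule lin_scl, rule lin_comp[OF heis_lin], rule fld_lin[OF A])
 have a: "lin (%v. nopa p i A n v g)" for g
  unfolding nopa_def by (rule lin_scl, rule lin_comp[OF fld_lin[OF A]], rule heis_lin)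
 have "lin (%v. Sum_any (%g. nopc p i A n v g) + Sum_any (%g. nopa p i A n v g))"
  by (rule lin_plus; rule lin_Sum_any; (rule c a nopc_ez[OF A] nopa_ez[OF A]))
 moreover have "nop p i A n = (%v. Sum_any (nopc p i A n v) + Sum_any (nopa p i A n v))"
  by (rule ext) (rule nop_split[OF A])
 ultimately show "lin (nop p i A n)" by simp
next
 fix n v
 obtain R where R: "!!n. n >= R ==> A n v = 0" using fld_bound[OF A] by metis
 have 1: "ez (%k. Sum_any (nopc p i A (n + int k) v))"
 proof (rule ezI[of "nat (R + int i - n)"])
  fix j assume "nat (R + int i - n) <= j"
  hence "nopc p i A (n + int j) v g = 0" for g by (simp add: nopc_def R lin_0)
  thus "Sum_any (nopc p i A (n + int j) v) = 0" by simp
 qed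
 obtain K where K: "!!k. k >= K ==> heis p (int k) v = 0" using heis_ez[of p v] unfolding ez_def by blast
 have "Sum_any (nopa p i A (n + int j) v) = (\<Sum>k<K. nopa p i A (n + int j) v k)" for j
  by (rule Sum_any_lessThan) (simp add: nopa_def K lin_0[OF fld_lin[OF A]])
 moreover have "ez (%j. \<Sum>k<K. nopa p i A (n + int j) v k)"
  unfolding nopa_def by (intro ez_sum ez_scale fld_ez_shift[OF A]) auto
 ultimately have "ez (%j. Sum_any (nopa p i A (n + int j) v))" by simp
 with 1 show "ez (%k. nop p i A (n + int k) v)" unfolding nop_split[OF A] by (rule ez_add)
qed

lemma Sum_any_cong_swap:
 fixes N M :: nat
 assumes "!!j q. j >= N \<or> q >= M ==> f j q = 0" "!!j q. f j q = g q j"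
 shows "Sum_any (%j. Sum_any (%q. f j q)) = Sum_any (%q. Sum_any (%j. g q j))"
 using Sum_any_swap_nat[of N M f, OF assms(1)] by (simp add: assms(2))

text \<open>Basis vectors are indexed by multisets, but modes are defined along a sorted list.
  Independence of the order makes a creation operator on the state correspond to one more normally
  ordered factor, whatever its position in the list.\<close>

lemma nop_comm: assumes A: "fld A" shows "nop p i (nop p j A) n v = nop p j (nop p i A) n v"
proof -
 \<comment> \<open>Both factors split into a creation and an annihilation part. Exchanging
   \<open>i\<close> and \<open>j\<close> swaps the two mixed sums and preserves the other
   two.\<close>
 have ex: "nop p i (nop p j A) n v
  = Sum_any (%g. Sum_any (%g'. scale (bc (int g) i) (heis p (- int g - 1) (nopc p j A (n + int g - int i) v g'))))
  + Sum_any (%g. Sum_any (%k. scale (bc (int g) i) (heis p (- int g - 1) (nopa p j A (n + int g - int i) v k))))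
  + (Sum_any (%k. Sum_any (%g. scale (bc (- int k - 1) i) (nopc p j A (n - int k - int i - 1) (heis p (int k) v) g)))
  + Sum_any (%k. Sum_any (%k'. scale (bc (- int k - 1) i) (nopa p j A (n - int k - int i - 1) (heis p (int k) v) k'))))" for i j
 proof -
  have c: "nopc p i (nop p j A) n v g = Sum_any (%g'. scale (bc (int g) i) (heis p (- int g - 1) (nopc p j A (n + int g - int i) v g')))
    + Sum_any (%k. scale (bc (int g) i) (heis p (- int g - 1) (nopa p j A (n + int g - int i) v k)))" for g
   by (simp add: nopc_def[of p i "nop p j A"] nop_split[OF A] heis_add pm.scale_right_distrib
    Sum_any_lin[OF heis_lin] Sum_any_scale nopc_ez nopa_ez A ez_lin[OF heis_lin])
  have a: "nopa p i (nop p j A) n v k = Sum_any (%g. scale (bc (- int k - 1) i) (nopc p j A (n - int k - int i - 1) (heis p (int k) v) g))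
    + Sum_any (%k'. scale (bc (- int k - 1) i) (nopa p j A (n - int k - int i - 1) (heis p (int k) v) k'))" for k
   by (simp add: nopa_def[of p i "nop p j A"] nop_split[OF A] pm.scale_right_distrib Sum_any_scale nopc_ez nopa_ez A)
  obtain R where R: "!!n. n >= R ==> A n v = 0" using fld_bound[OF A] by metis
  obtain K where K: "!!k. k >= K ==> heis p (int k) v = 0" using heis_ez[of p v] unfolding ez_def by blast
  have 1: "ez (%g. Sum_any (%g'. scale (bc (int g) i) (heis p (- int g - 1) (nopc p j A (n + int g - int i) v g'))))"
  proof (rule ezI[of "nat (R + int i + int j - n)"])
   fix g assume "nat (R + int i + int j - n) <= g"
   hence "nopc p j A (n + int g - int i) v g' = 0" for g' by (simp add: nopc_def R lin_0)
   thus "Sum_any (%g'. scale (bc (int g) i) (heis p (- int g - 1) (nopc p j A (n + int g - int i) v g'))) = 0"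
    by (simp add: heis_0)
  qed
  have "ez (%g. Sum_any (nopa p j A (n + int g - int i) v))"
  proof -
   have "Sum_any (nopa p j A (n + int g - int i) v) = (\<Sum>k<K. nopa p j A (n + int g - int i) v k)" for g
    by (rule Sum_any_lessThan) (simp add: nopa_def K lin_0[OF fld_lin[OF A]])
   moreover have "ez (%g. \<Sum>k<K. nopa p j A (n + int g - int i) v k)"
    unfolding nopa_def by (intro ez_sum ez_scale fld_ez_shift[OF A, of _ "n - int i - int _ - int j - 1"]) auto
   ultimately show ?thesis by simp
  qed
  hence 2: "ez (%g. Sum_any (%k. scale (bc (int g) i) (heis p (- int g - 1) (nopa p j A (n + int g - int i) v k))))"
   by (simp add: Sum_any_scale[symmetric] Sum_any_lin[OF heis_lin, symmetric] nopa_ez A ez_lin[OF heis_lin] ez_scale)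
  have 3: "ez (%k. Sum_any (%g. scale (bc (- int k - 1) i) (nopc p j A (n - int k - int i - 1) (heis p (int k) v) g)))"
   by (rule ezI[of K]) (simp add: K nopc_def lin_0[OF fld_lin[OF A]] heis_0)
  have 4: "ez (%k. Sum_any (%k'. scale (bc (- int k - 1) i) (nopa p j A (n - int k - int i - 1) (heis p (int k) v) k')))"
   by (rule ezI[of K]) (simp add: K nopa_def lin_0[OF fld_lin[OF A]] heis_0)
  show ?thesis unfolding nop_split[OF fld_nop[OF A]]
   by (simp only: c[abs_def] a[abs_def] Sum_any_add[OF 1 2] Sum_any_add[OF 3 4])
 qed
 obtain R where R: "!!n. n >= R ==> A n v = 0" using fld_bound[OF A] by metis
 obtain K where K: "!!k. k >= K ==> heis p (int k) v = 0" using heis_ez[of p v] unfolding ez_def by blast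
 have e1: "Sum_any (%g. Sum_any (%g'. scale (bc (int g) i) (heis p (- int g - 1) (nopc p j A (n + int g - int i) v g'))))
   = Sum_any (%g'. Sum_any (%g. scale (bc (int g') j) (heis p (- int g' - 1) (nopc p i A (n + int g' - int j) v g))))"
 proof (rule Sum_any_cong_swap[where N = "nat (R + int i + int j - n)" and M = "nat (R + int i + int j - n)"])
  fix g g' assume "nat (R + int i + int j - n) <= g \<or> nat (R + int i + int j - n) <= g'"
  hence "R <= n + int g - int i + int g' - int j" by auto
  thus "scale (bc (int g) i) (heis p (- int g - 1) (nopc p j A (n + int g - int i) v g')) = 0"
   by (simp add: nopc_def R lin_0)
 next
  fix g g'
  have "heis p (- int g - 1) (heis p (- int g' - 1) y) = heis p (- int g' - 1) (heis p (- int g - 1) y)" for y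
   by (subst heis_comm) simp
  thus "scale (bc (int g) i) (heis p (- int g - 1) (nopc p j A (n + int g - int i) v g'))
    = scale (bc (int g') j) (heis p (- int g' - 1) (nopc p i A (n + int g' - int j) v g))"
   by (simp add: nopc_def heis_scale algebra_simps)
 qed
 have K': "ez (%g. A (n + int g - int i - int k - int j - 1) (heis p (int k) v))" for k
  by (rule fld_ez_shift[OF A, of _ "n - int i - int k - int j - 1"]) simp
 \<comment> \<open>Only finitely many \<open>k\<close> survive, so one truncation bound serves for
   all of them.\<close>
 obtain N where N: "!!k g. k < K ==> g >= N ==> A (n + int g - int i - int k - int j - 1) (heis p (int k) v) = 0"
  using ez_unif[of K "%k g. A (n + int g - int i - int k - int j - 1) (heis p (int k) v)"] K' by metis
 have N': "A (n + int g - int i - int k - int j - 1) (heis p (int k) v) = 0" if "g >= N \<or> k >= K" for g k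
  using N[of k g] K[of k] that by (cases "k < K") (auto simp: lin_0[OF fld_lin[OF A]])
 have e2: "Sum_any (%g. Sum_any (%k. scale (bc (int g) i) (heis p (- int g - 1) (nopa p j A (n + int g - int i) v k))))
   = Sum_any (%k. Sum_any (%g. scale (bc (- int k - 1) j) (nopc p i A (n - int k - int j - 1) (heis p (int k) v) g)))"
 proof (rule Sum_any_cong_swap[where N = N and M = K])
  fix g k assume "N <= g \<or> K <= k"
  thus "scale (bc (int g) i) (heis p (- int g - 1) (nopa p j A (n + int g - int i) v k)) = 0"
   using N'[of g k] by (simp add: nopa_def lin_0 heis_0)
 qed (simp add: nopa_def nopc_def heis_scale algebra_simps)
 have e3: "Sum_any (%k. Sum_any (%g. scale (bc (- int k - 1) i) (nopc p j A (n - int k - int i - 1) (heis p (int k) v) g)))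
   = Sum_any (%g. Sum_any (%k. scale (bc (int g) j) (heis p (- int g - 1) (nopa p i A (n + int g - int j) v k))))"
 proof (rule Sum_any_cong_swap[where N = K and M = N])
  fix k g assume "K <= k \<or> N <= g"
  hence "A (n + int g - int i - int k - int j - 1) (heis p (int k) v) = 0" using N'[of g k] by blast
  hence "A (n - int k - int i - 1 + int g - int j) (heis p (int k) v) = 0" by (simp add: algebra_simps)
  thus "scale (bc (- int k - 1) i) (nopc p j A (n - int k - int i - 1) (heis p (int k) v) g) = 0"
   by (simp add: nopc_def heis_0)
 qed (simp add: nopa_def nopc_def heis_scale algebra_simps)
 have e4: "Sum_any (%k. Sum_any (%k'. scale (bc (- int k - 1) i) (nopa p j A (n - int k - int i - 1) (heis p (int k) v) k')))
   = Sum_any (%k'. Sum_any (%k. scale (bc (- int k' - 1) j) (nopa p i A (n - int k' - int j - 1) (heis p (int k') v) k)))"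
 proof -
  have h: "heis p (int k') (heis p (int k) v) = heis p (int k) (heis p (int k') v)" for k k'
   by (subst heis_comm) simp
  have z: "heis p (int k') (heis p (int k) v) = 0" if "K <= k \<or> K <= k'" for k k'
   using that K h[of k' k] by (metis heis_0)
  show ?thesis
  proof (rule Sum_any_cong_swap[where N = K and M = K])
   fix k k' assume "K <= k \<or> K <= k'"
   thus "scale (bc (- int k - 1) i) (nopa p j A (n - int k - int i - 1) (heis p (int k) v) k') = 0"
    by (simp add: nopa_def z lin_0[OF fld_lin[OF A]])
  qed (simp add: nopa_def h algebra_simps)
 qed
 show ?thesis unfolding ex[of i j] ex[of j i] e1 e2 e3 e4 by (simp add: add_ac)
qed

subsection \<open>Modes of arbitrary vectors\<close>

definition lm :: "nat => nat list => int => int => fock => fock"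
 where "lm p is a n v = monomial_mode p is a (of_int n) v"

lemma lm_Nil: "lm p [] a = em p a"
 by (intro ext) (simp add: lm_def em_def)

lemma lm_Cons: "lm p (i # is) a = nop p i (lm p is a)"
proof (intro ext)
 fix n v
 have s: "rat_of_int n - of_int k - of_nat i - 1 = of_int (n - k - int i - 1)" for k by simp
 show "lm p (i # is) a n v = nop p i (lm p is a) n v"
  unfolding lm_def nop_def nopt_def monomial_mode.simps s Let_def by (simp only: of_int_diff)
qed

lemma fld_em: assumes p: "p > 0" shows "fld (em p a)"
 unfolding fld_def
proof (intro conjI allI em_lin)
 fix n v
 show "ez (%k. em p a (n + int k) v)"
 proof (rule ez_all[of "%k. em p a (n + int k)"])
  fix x :: "nat multiset \<times> int"
  obtain M b where x: "x = (M, b)" by force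
  show "ez (%k. em p a (n + int k) (single x 1))"
  proof (rule ezI[of "nat (int (lev M) - n - a * b div (2 * int p))"])
   fix j assume "nat (int (lev M) - n - a * b div (2 * int p)) <= j"
   thus "em p a (n + int j) (single x 1) = 0"
    unfolding x by (intro hm_neg[OF em_hm[OF p hm_st[of M b]]]) auto
  qed
 qed simp
qed

lemma fld_lm: "p > 0 ==> fld (lm p is a)"
 by (induction "is") (simp_all add: lm_Nil lm_Cons fld_em fld_nop)

lemma lm_insort: assumes p: "p > 0" shows "lm p (insort i is) a = nop p i (lm p is a)"
proof (induction "is")
 case (Cons j js)
 show ?case
 proof (cases "i <= j")
  case False
  have "lm p (insort i (j # js)) a = nop p j (nop p i (lm p js a))" using False by (simp add: lm_Cons Cons.IH)
  also have "... = nop p i (nop p j (lm p js a))" by (intro ext) (rule nop_comm[OF fld_lm[OF p]])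
  finally show ?thesis by (simp add: lm_Cons)
 qed (simp add: lm_Cons)
qed (simp add: lm_Cons)

definition Z :: "nat => fock => int => fock => fock"
 where "Z p u n v = lattice_mode p u (of_int n) v"

lemma Z_lin_ext: "Z p u n v = lin_ext (%(M, a). lm p (sorted_list_of_multiset M) a n v) u"
 by (simp add: Z_def lattice_mode_def lm_def)

lemma Z_lin1: "lin (%u. Z p u n v)" by (simp add: Z_lin_ext)
lemmas Z1_add = lin_add[OF Z_lin1] and Z1_scale = lin_scale[OF Z_lin1]

lemma Z_st: "Z p (st M a) = lm p (sorted_list_of_multiset M) a"
 by (intro ext) (simp add: Z_lin_ext)

lemma Z_exp: "Z p (st {#} a) = em p a" by (simp add: Z_st lm_Nil)

lemma Z_st_add: "p > 0 ==> Z p (st (add_mset i M) a) = nop p i (Z p (st M a))"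
 by (simp add: Z_st lm_insort)

lemma fld_Z: assumes p: "p > 0" shows "fld (Z p u)"
proof -
 have "Z p u = (%n v. \<Sum>k\<in>keys u. scale (lookup u k) (lm p (sorted_list_of_multiset (fst k)) (snd k) n v))"
  by (intro ext) (simp add: Z_lin_ext lin_ext_def split_beta)
 thus ?thesis by (simp add: fld_sum fld_scale fld_lm[OF p])
qed

lemma Z_lin2: "p > 0 ==> lin (Z p u n)" by (rule fld_lin[OF fld_Z])

lemma Z_ez: "p > 0 ==> (!!k. f k = n + int k) ==> ez (%k. Z p u (f k) v)"
 by (rule fld_ez_shift[OF fld_Z])

lemma Z_0 [simp]: "Z p 0 n v = 0" by (rule lin_0[OF Z_lin1])

lemma nop_lin1: assumes p: "p > 0" shows "lin (%u. nop p i (Z p u) n v)"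
proof -
 have c: "lin (%u. nopc p i (Z p u) n v g)" for g
  unfolding nopc_def by (rule lin_scl, rule lin_comp[OF heis_lin], rule Z_lin1)
 have a: "lin (%u. nopa p i (Z p u) n v g)" for g
  unfolding nopa_def by (rule lin_scl, rule Z_lin1)
 have "lin (%u. Sum_any (%g. nopc p i (Z p u) n v g) + Sum_any (%g. nopa p i (Z p u) n v g))"
  by (rule lin_plus; rule lin_Sum_any; (rule c a nopc_ez[OF fld_Z[OF p]] nopa_ez[OF fld_Z[OF p]]))
 thus ?thesis by (simp add: nop_split[OF fld_Z[OF p]])
qed

lemma Z_create: assumes p: "p > 0" shows "Z p (heis p (- int i - 1) u) n v = nop p i (Z p u) n v"
proof (rule lin_eqI[of "%u. Z p (heis p (- int i - 1) u) n v" "%u. nop p i (Z p u) n v"])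
 show "lin (%u. Z p (heis p (- int i - 1) u) n v)" by (rule lin_comp[OF Z_lin1 heis_lin])
 show "lin (%u. nop p i (Z p u) n v)" by (rule nop_lin1[OF p])
 fix k :: "nat multiset \<times> int"
 obtain M a where k: "k = (M, a)" by force
 show "Z p (heis p (- int i - 1) (single k 1)) n v = nop p i (Z p (single k 1)) n v"
  unfolding k heis_create Z_st_add[OF p] ..
qed

lemma Z_hm_st:
 assumes p: "p > 0" and v: "hm m b v"
 shows "hm (m + int (lev M) - n - 1 - a * b div (2 * int p)) (a + b) (Z p (st M a) n v)"
 using v
proof (induction M arbitrary: m n v)
 case empty
 thus ?case using em_hm[OF p empty, of n a] by (simp add: Z_exp)
next
 case (add i M)
 show ?case unfolding Z_st_add[OF p] nop_def nopt_def
 proof (intro hm_Sum_any hm_scale)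
  fix k
  let ?q = "m + int (lev (add_mset i M)) - n - 1 - a * b div (2 * int p)"
  have "hm ?q (a + b) (heis p k (Z p (st M a) (n - k - int i - 1) v))"
   using heis_hm[OF add.IH[OF add.prems, of "n - k - int i - 1"], of k p] by (simp add: algebra_simps)
  moreover have "hm ?q (a + b) (Z p (st M a) (n - k - int i - 1) (heis p k v))"
   using add.IH[OF heis_hm[OF add.prems, of k p], of "n - k - int i - 1"] by (simp add: algebra_simps)
  ultimately show "hm ?q (a + b) (if k < 0 then heis p k (Z p (st M a) (n - k - int i - 1) v)
   else Z p (st M a) (n - k - int i - 1) (heis p k v))" by simp
 qed
qed

lemma Z_hm:
 assumes p: "p > 0" and u: "hm l a u" and v: "hm m b v"
 shows "hm (m + l - n - 1 - a * b div (2 * int p)) (a + b) (Z p u n v)"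
 by (rule hm_lin[OF u Z_lin1]) (use Z_hm_st[OF p v] in blast)

lemma nopt_sum:
 "finite J ==> (!!j. j \<in> J ==> fld (A j)) ==>
  nop p i (%n v. \<Sum>j\<in>J. scale (c j) (A j n v)) n v = (\<Sum>j\<in>J. scale (c j) (nop p i (A j) n v))"
proof -
 assume J: "finite J" and A: "!!j. j \<in> J ==> fld (A j)"
 have t: "nopt p i (%n v. \<Sum>j\<in>J. scale (c j) (A j n v)) n v k = (\<Sum>j\<in>J. scale (c j) (nopt p i (A j) n v k))" for k
  by (simp add: nopt_def lin_sum[OF heis_lin] heis_scale pm.scale_sum_right mult.commute)
 let ?S = "\<Union>j\<in>J. {k. nopt p i (A j) n v k ~= 0}"
 have S: "finite ?S" using J A nopt_finite by blast
 have "Sum_any (%k. \<Sum>j\<in>J. scale (c j) (nopt p i (A j) n v k)) = (\<Sum>k\<in>?S. \<Sum>j\<in>J. scale (c j) (nopt p i (A j) n v k))"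
 proof (rule Sum_any.expand_superset[OF S], rule subsetI, rule ccontr)
  fix k assume *: "k \<in> {k. (\<Sum>j\<in>J. scale (c j) (nopt p i (A j) n v k)) ~= 0}" "k \<notin> ?S"
  hence "(\<Sum>j\<in>J. scale (c j) (nopt p i (A j) n v k)) = 0" by (intro sum.neutral) auto
  thus False using * by simp
 qed
 also have "... = (\<Sum>j\<in>J. scale (c j) (\<Sum>k\<in>?S. nopt p i (A j) n v k))"
  by (subst sum.swap) (simp add: pm.scale_sum_right)
 also have "... = (\<Sum>j\<in>J. scale (c j) (nop p i (A j) n v))"
  unfolding nop_def by (intro sum.cong refl arg_cong[of _ _ "scale _"] Sum_any.expand_superset[symmetric, OF S]) auto
 finally show ?thesis by (simp add: nop_def t[abs_def])
qed

lemma nop_shift: "nop p i (%n. A (n + s)) n v = nop p i A (n + s) v"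
proof -
 have e: "n - k - int i - 1 + s = n + s - k - int i - 1" for k by simp
 have "nopt p i (%n. A (n + s)) n v = nopt p i A (n + s) v"
  by (rule ext) (simp only: nopt_def e)
 thus ?thesis by (simp only: nop_def)
qed

lemma bc_absorb: "of_int l * bc (l - 1) i = of_nat (Suc i) * bc l (Suc i)"
 using gbinomial_absorption[of i "of_int l :: complex"] by (simp add: mult.commute)

text \<open>Induction on the monomial. Moving \<alpha>(l) past the new normally ordered factor
  leaves one central term, \<open>dl\<close>; by the absorption identity for binomial coefficients
  it is the contribution of \<alpha>(i+1) acting on the new oscillator \<alpha>(-i-1).\<close>

lemma heis_Z_st:
 assumes p: "p > 0"
 shows "heis p l (Z p (st M a) n v) = Z p (st M a) n (heis p l v)
  + Sum_any (%j. scale (bc l j) (Z p (heis p (int j) (st M a)) (n + l - int j) v))"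
proof (induction M arbitrary: n v)
 case empty
 have h0: "heis p (int j) (st {#} a) = 0" if "j ~= 0" for j
  using that by (intro hm_neg[OF heis_hm[OF hm_st]]) auto
 have "Sum_any (%j. scale (bc l j) (Z p (heis p (int j) (st {#} a)) (n + l - int j) v)) = scale (of_int a) (em p a (n + l) v)"
  by (subst Sum_any_single[of 0]) (auto simp: h0 heis_zero Z1_scale Z_exp)
 thus ?case by (simp add: Z_exp em_comm[OF p])
next
 case (add i M)
 let ?u = "st M a" and ?A = "Z p (st M a)"
 have A: "fld ?A" by (rule fld_Z[OF p])
 obtain J where J: "!!j. j >= J ==> heis p (int j) ?u = 0" using heis_ez[of p ?u] by (auto simp: ez_def)
 define C where "C = (%m v. \<Sum>j<J. scale (bc l j) (Z p (heis p (int j) ?u) (m + l - int j) v))"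
 have IH: "heis p l (?A m v) = ?A m (heis p l v) + C m v" for m v
  unfolding add.IH C_def by (subst Sum_any_lessThan[of J]) (auto simp: J)
 have fC0: "fld (%m. Z p (heis p (int j) ?u) (m + l - int j))" for j
  using fld_shift[OF fld_Z[OF p], of _ "l - int j"] by (simp add: algebra_simps)
 have fC: "fld C" unfolding C_def by (intro fld_sum fld_scale fC0) simp
 have nC: "nop p i C n v = (\<Sum>j<J. scale (bc l j) (nop p i (Z p (heis p (int j) ?u)) (n + l - int j) v))"
  unfolding C_def
  by (subst nopt_sum) (auto simp: fC0 nop_shift[where s = "l - int _", simplified add_diff_eq])
 define dl where "dl = (%k. scale (bc (- k - 1) i) (scale (if l + k = 0 then 2 * of_nat p * of_int l else 0) (?A (n - k - int i - 1) v)))"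
 have t: "heis p l (nopt p i ?A n v k) = nopt p i ?A n (heis p l v) k + nopt p i C n v k + dl k" for k
 proof (cases "k < 0")
  case True
  show ?thesis using True
   by (simp add: nopt_def dl_def heis_scale heis_comm[of p l k] IH heis_add pm.scale_right_distrib)
 next
  case False
  have "heis p l (?A m (heis p k v)) = ?A m (heis p k (heis p l v)) + ?A m (scale (if l + k = 0 then 2 * of_nat p * of_int l else 0) v) + C m (heis p k v)" for m
   by (simp only: IH heis_comm[of p l k v] lin_add[OF fld_lin[OF A]])
  thus ?thesis using False
   by (simp add: nopt_def dl_def heis_scale lin_scale[OF fld_lin[OF A]] pm.scale_right_distrib)
 qed
 have f1: "finite {k. nopt p i ?A n (heis p l v) k + nopt p i C n v k ~= 0}"
  by (rule finite_subset[OF _ finite_UnI[OF nopt_finite[OF A, of p i n "heis p l v"] nopt_finite[OF fC, of p i n v]]]) auto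
 have fd: "finite {k. dl k ~= 0}"
  by (rule finite_subset[of _ "{- l}"]) (auto simp: dl_def)
 have "heis p l (nop p i ?A n v) = Sum_any (%k. heis p l (nopt p i ?A n v k))"
 proof -
  let ?S = "{k. nopt p i ?A n v k ~= 0}"
  have "heis p l (nop p i ?A n v) = (\<Sum>k\<in>?S. heis p l (nopt p i ?A n v k))"
   by (simp add: nop_def Sum_any.expand_set lin_sum[OF heis_lin])
  also have "... = Sum_any (%k. heis p l (nopt p i ?A n v k))"
   by (rule Sum_any.expand_superset[symmetric]) (auto simp: nopt_finite[OF A] heis_0)
  finally show ?thesis .
 qed
 also have "... = nop p i ?A n (heis p l v) + nop p i C n v + Sum_any dl"
  by (simp only: t nop_def Sum_any.distrib[OF f1 fd] Sum_any.distrib[OF nopt_finite[OF A] nopt_finite[OF fC]])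
 also have "Sum_any dl = scale (of_nat (Suc i) * bc l (Suc i) * (2 * of_nat p)) (?A (n + l - int i - 1) v)"
 proof -
  have "Sum_any dl = dl (- l)" by (rule Sum_any_single) (auto simp: dl_def)
  also have "... = scale (of_int l * bc (l - 1) i * (2 * of_nat p)) (?A (n + l - int i - 1) v)"
   by (simp add: dl_def mult_ac)
  finally show ?thesis by (simp only: bc_absorb)
 qed
 finally have L: "heis p l (Z p (st (add_mset i M) a) n v) = Z p (st (add_mset i M) a) n (heis p l v)
   + nop p i C n v + scale (of_nat (Suc i) * bc l (Suc i) * (2 * of_nat p)) (?A (n + l - int i - 1) v)"
  by (simp only: Z_st_add[OF p])
 have hj: "heis p (int j) (st (add_mset i M) a) = heis p (- int i - 1) (heis p (int j) ?u)
   + (if j = Suc i then scale (2 * of_nat p * of_nat (Suc i)) ?u else 0)" for j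
  unfolding heis_create[of p, symmetric] heis_comm[of p "int j" "- int i - 1"] by auto
 have "Sum_any (%j. scale (bc l j) (Z p (heis p (int j) (st (add_mset i M) a)) (n + l - int j) v))
   = (\<Sum>j<J + i + 2. scale (bc l j) (Z p (heis p (int j) (st (add_mset i M) a)) (n + l - int j) v))"
  by (rule Sum_any_lessThan) (auto simp: hj J heis_0)
 also have "... = (\<Sum>j<J + i + 2. scale (bc l j) (nop p i (Z p (heis p (int j) ?u)) (n + l - int j) v)
   + (if j = Suc i then scale (of_nat (Suc i) * bc l (Suc i) * (2 * of_nat p)) (?A (n + l - int i - 1) v) else 0))"
  by (intro sum.cong refl) (auto simp: hj Z1_add Z1_scale Z_create[OF p] pm.scale_right_distrib mult_ac algebra_simps)
 also have "... = (\<Sum>j<J + i + 2. scale (bc l j) (nop p i (Z p (heis p (int j) ?u)) (n + l - int j) v))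
   + scale (of_nat (Suc i) * bc l (Suc i) * (2 * of_nat p)) (?A (n + l - int i - 1) v)"
  by (simp add: sum.distrib sum.delta)
 also have "(\<Sum>j<J + i + 2. scale (bc l j) (nop p i (Z p (heis p (int j) ?u)) (n + l - int j) v)) = nop p i C n v"
  unfolding nC by (rule sum.mono_neutral_right) (auto simp: J Z_create[OF p, symmetric] heis_0)
 finally show ?case by (simp only: L add.assoc)
qed

lemma heis_Z_ez: assumes p: "p > 0" shows "ez (%j. Z p (heis p (int j) u) (f j) v)"
proof -
 obtain J where J: "!!j. j >= J ==> heis p (int j) u = 0" using heis_ez[of p u] by (auto simp: ez_def)
 show ?thesis by (rule ezI[of J]) (simp add: J)
qed

text \<open>The commutator formula for \<alpha>, obtained ahead of the Borcherds identity because
  the covariance of the latter rests on it.\<close>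

theorem heis_Z:
 assumes p: "p > 0"
 shows "heis p l (Z p u n v) = Z p u n (heis p l v) + Sum_any (%j. scale (bc l j) (Z p (heis p (int j) u) (n + l - int j) v))"
proof (rule lin_eqI[of "%u. heis p l (Z p u n v)" "%u. Z p u n (heis p l v) + Sum_any (%j. scale (bc l j) (Z p (heis p (int j) u) (n + l - int j) v))"])
 show "lin (%u. heis p l (Z p u n v))" by (rule lin_comp[OF heis_lin Z_lin1])
 have "lin (%u. Sum_any (%j. scale (bc l j) (Z p (heis p (int j) u) (n + l - int j) v)))"
  by (rule lin_Sum_any, rule lin_scl, rule lin_comp[OF Z_lin1 heis_lin], rule ez_scale, rule heis_Z_ez[OF p])
 thus "lin (%u. Z p u n (heis p l v) + Sum_any (%j. scale (bc l j) (Z p (heis p (int j) u) (n + l - int j) v)))"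
  by (rule lin_plus[OF Z_lin1])
 fix k :: "nat multiset \<times> int"
 obtain M a where k: "k = (M, a)" by force
 show "heis p l (Z p (single k 1) n v) = Z p (single k 1) n (heis p l v)
   + Sum_any (%j. scale (bc l j) (Z p (heis p (int j) (single k 1)) (n + l - int j) v))"
  unfolding k by (rule heis_Z_st[OF p])
qed

subsection \<open>The Borcherds identity\<close>

text \<open>The iterate and the two orders of composition in the Borcherds identity, which reads
  \<open>B1 = B2 - (-1)^n B3\<close>; \<open>BD\<close> below is its defect.\<close>

definition B1 where "B1 p u v w m k n = Sum_any (%j. scale (bc m j) (Z p (Z p u (n + int j) v) (m + k - int j) w))"
definition B2 where "B2 p u v w m k n = Sum_any (%j. scale ((-1) ^ j * bc n j) (Z p u (m + n - int j) (Z p v (k + int j) w)))"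
definition B3 where "B3 p u v w m k n = Sum_any (%j. scale ((-1) ^ j * bc n j) (Z p v (n + k - int j) (Z p u (m + int j) w)))"

definition sg :: "int => complex" where "sg n = (if even n then 1 else - 1)"

lemma sg_diff: "sg (n - int t) = sg n * (-1) ^ t"
 by (auto simp: sg_def uminus_power_if)

definition BD where "BD p u v w m k n = B1 p u v w m k n - B2 p u v w m k n + scale (sg n) (B3 p u v w m k n)"

lemma conv_bc: "ez g ==> Sum_any (%j. Sum_any (%q. scale (bc m j * bc l q) (g (j + q)))) = Sum_any (%J. scale (bc (m + l) J) (g J))"
 by (simp only: Sum_any_conv bc_Vandermonde)

lemma conv_sg: assumes "ez g"
 shows "Sum_any (%j. Sum_any (%q. scale (((-1) ^ j * bc m j) * ((-1) ^ q * bc l q)) (g (j + q)))) = Sum_any (%J. scale ((-1) ^ J * bc (m + l) J) (g J))"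
proof -
 have "(\<Sum>j\<le>J. ((-1) ^ j * bc m j) * ((-1) ^ (J - j) * bc l (J - j))) = (-1) ^ J * bc (m + l) J" for J
 proof -
  have "(\<Sum>j\<le>J. ((-1) ^ j * bc m j) * ((-1) ^ (J - j) * bc l (J - j))) = (\<Sum>j\<le>J. (-1) ^ J * (bc m j * bc l (J - j)))"
  proof (intro sum.cong refl)
   fix j assume "j \<in> {..J}"
   hence "(-1::complex) ^ J = (-1) ^ j * (-1) ^ (J - j)" by (simp flip: power_add)
   thus "((-1) ^ j * bc m j) * ((-1) ^ (J - j) * bc l (J - j)) = (-1) ^ J * (bc m j * bc l (J - j))" by simp
  qed
  thus ?thesis by (simp only: sum_distrib_left[symmetric] bc_Vandermonde)
 qed
 thus ?thesis by (simp only: Sum_any_conv[OF assms])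
qed

lemma bc_neg: "bc (- int r - 1) t = (-1) ^ t * of_nat ((r + t) choose t)"
proof -
 have e: "(of_int (- int r - 1) :: complex) = - of_nat (r + 1)" by simp
 have "(- of_nat (r + 1) :: complex) gchoose t = (-1) ^ t * (of_nat (r + t) gchoose t)"
  by (subst gbinomial_minus) simp
 thus ?thesis by (simp only: e binomial_gbinomial)
qed

lemma bc_nat: "bc (int r) t = of_nat (r choose t)"
 by (simp add: binomial_gbinomial)

text \<open>Trinomial revision. Both sides vanish for \<open>q < j\<close>; beyond that the right
  side is a signed binomial coefficient in \<open>q - j\<close>, ready for Vandermonde after a shift
  of the summation index.\<close>

lemma bc_shift2: "bc (- int q - 1) i * bc (int q) j
  = (if q >= j then bc (- int j - 1) i * ((-1) ^ (q - j) * bc (- int (i + j) - 1) (q - j)) else 0)"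
proof (cases "q >= j")
 case True
 have "(q + i choose i) * (q choose j) = (j + i choose i) * (i + j + (q - j) choose (q - j))"
 proof -
  have "(q + i choose (i + j)) * ((i + j) choose i) = (q + i choose i) * ((q + i - i) choose (i + j - i))"
   using choose_mult[of i "i + j" "q + i"] True by simp
  moreover have "(q + i choose (i + j)) = (i + j + (q - j) choose (q - j))"
   using binomial_symmetric[of "i + j" "q + i"] True by (simp add: add.commute)
  ultimately show ?thesis using True by (simp add: add.commute mult.commute)
 qed
 hence "(of_nat (q + i choose i) * of_nat (q choose j) :: complex) = of_nat (j + i choose i) * of_nat (i + j + (q - j) choose (q - j))"
  by (metis of_nat_mult)
 thus ?thesis using True unfolding bc_nat bc_neg by simp
next
 case False
 thus ?thesis unfolding bc_nat by (simp add: binomial_eq_0)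
qed

lemma heis_Z_fin:
 assumes p: "p > 0" and I: "\<forall>i\<ge>I. heis p (int i) u = 0"
 shows "heis p l (Z p u n v) = Z p u n (heis p l v) + (\<Sum>i<I. scale (bc l i) (Z p (heis p (int i) u) (n + l - int i) v))"
 unfolding heis_Z[OF p] by (subst Sum_any_lessThan[of I]) (auto simp: I)

context
 fixes p :: nat
 assumes p: "p > 0"
begin

lemma B1_ez: "ez (%j. scale (c j) (Z p (Z p u (n + int j) v) (f j) w))"
proof -
 have "ez (%j. Z p u (n + int j) v)" by (rule Z_ez[OF p]) simp
 thus ?thesis by (intro ez_scale ez_lin[where T = "%j x. Z p x (f j) w", OF Z_lin1])
qed

lemma B23_ez: "ez (%j. scale (c j) (Z p u (f j) (Z p v (k + int j) w)))"
proof -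
 have "ez (%j. Z p v (k + int j) w)" by (rule Z_ez[OF p]) simp
 thus ?thesis by (intro ez_scale ez_lin[where T = "%j x. Z p u (f j) x", OF Z_lin2[OF p]])
qed

lemma B_lin: "lin (%w. B1 p u v w m k n)" "lin (%w. B2 p u v w m k n)" "lin (%w. B3 p u v w m k n)"
 unfolding B1_def B2_def B3_def
  apply (rule lin_Sum_any, rule lin_scl, rule Z_lin2[OF p], rule B1_ez)
  apply (rule lin_Sum_any, rule lin_scl, rule lin_comp[OF Z_lin2[OF p] Z_lin2[OF p]], rule B23_ez)
 apply (rule lin_Sum_any, rule lin_scl, rule lin_comp[OF Z_lin2[OF p] Z_lin2[OF p]], rule B23_ez)
 done

lemma B_lin_u: "lin (%u. B1 p u v w m k n)" "lin (%u. B2 p u v w m k n)" "lin (%u. B3 p u v w m k n)"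
 unfolding B1_def B2_def B3_def
  apply (rule lin_Sum_any, rule lin_scl, rule lin_comp[OF Z_lin1 Z_lin1], rule B1_ez)
  apply (rule lin_Sum_any, rule lin_scl, rule Z_lin1, rule B23_ez)
 apply (rule lin_Sum_any, rule lin_scl, rule lin_comp[OF Z_lin2[OF p] Z_lin1], rule B23_ez)
 done

lemma B_lin_v: "lin (%v. B1 p u v w m k n)" "lin (%v. B2 p u v w m k n)" "lin (%v. B3 p u v w m k n)"
 unfolding B1_def B2_def B3_def
  apply (rule lin_Sum_any, rule lin_scl, rule lin_comp[OF Z_lin1 Z_lin2[OF p]], rule B1_ez)
  apply (rule lin_Sum_any, rule lin_scl, rule lin_comp[OF Z_lin2[OF p] Z_lin1], rule B23_ez)
 apply (rule lin_Sum_any, rule lin_scl, rule Z_lin1, rule B23_ez)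
 done

lemma BD_lin: "lin (%w. BD p u v w m k n)" "lin (%v. BD p u v w m k n)" "lin (%u. BD p u v w m k n)"
 unfolding BD_def by (intro lin_plus lin_sub lin_scl B_lin B_lin_u B_lin_v)+

text \<open>Each \<alpha>(i) produced by the commutator lands on \<open>u\<close> or on
  \<open>v\<close> and shifts \<open>m\<close> or \<open>k\<close> by \<open>l - i\<close>. The
  three sums transform in the same way, so their defect does too.\<close>

lemma B23_cov:
 assumes Iu: "\<forall>i\<ge>I. heis p (int i) u = 0" and Iv: "\<forall>i\<ge>I. heis p (int i) v = 0"
 shows "heis p l (B2 p u v w m k n) = B2 p u v (heis p l w) m k n
   + (\<Sum>i<I. scale (bc l i) (B2 p (heis p (int i) u) v w (m + l - int i) k n))
   + (\<Sum>i<I. scale (bc l i) (B2 p u (heis p (int i) v) w m (k + l - int i) n))"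
  and "heis p l (B3 p u v w m k n) = B3 p u v (heis p l w) m k n
   + (\<Sum>i<I. scale (bc l i) (B3 p (heis p (int i) u) v w (m + l - int i) k n))
   + (\<Sum>i<I. scale (bc l i) (B3 p u (heis p (int i) v) w m (k + l - int i) n))"
proof -
 have gen: "heis p l (Sum_any (%j. scale (c j) (Z p x (f j) (Z p y (g + int j) w))))
  = Sum_any (%j. scale (c j) (Z p x (f j) (Z p y (g + int j) (heis p l w))))
  + (\<Sum>i<I. scale (bc l i) (Sum_any (%j. scale (c j) (Z p (heis p (int i) x) (f j + l - int i) (Z p y (g + int j) w)))))
  + (\<Sum>i<I. scale (bc l i) (Sum_any (%j. scale (c j) (Z p x (f j) (Z p (heis p (int i) y) (g + l - int i + int j) w)))))"
  if Ix: "\<forall>i\<ge>I. heis p (int i) x = 0" and Iy: "\<forall>i\<ge>I. heis p (int i) y = 0" for x y c f g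
 proof -
  have 1: "heis p l (scale (c j) (Z p x (f j) (Z p y (g + int j) w))) = scale (c j) (Z p x (f j) (Z p y (g + int j) (heis p l w)))
   + (\<Sum>i<I. scale (bc l i) (scale (c j) (Z p (heis p (int i) x) (f j + l - int i) (Z p y (g + int j) w))))
   + (\<Sum>i<I. scale (bc l i) (scale (c j) (Z p x (f j) (Z p (heis p (int i) y) (g + l - int i + int j) w))))" for j
  proof -
   have a: "g + int j + l - int i = g + l - int i + int j" for i by simp
   show ?thesis unfolding heis_scale heis_Z_fin[OF p Ix] heis_Z_fin[OF p Iy] lin_add[OF Z_lin2[OF p]] lin_sum[OF Z_lin2[OF p]] lin_scale[OF Z_lin2[OF p]] a
    by (simp add: pm.scale_right_distrib pm.scale_sum_right mult.commute add_ac)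
  qed
  show ?thesis unfolding Sum_any_lin[OF heis_lin B23_ez] 1
   by (simp add: Sum_any_add Sum_any_finsum_swap Sum_any_scale B23_ez ez_sum ez_scale ez_add)
 qed
 have a: "m + n - int j + l - int i = m + l - int i + n - int j" and b: "n + k - int j + l - int i = n + (k + l - int i) - int j" for i j by simp_all
 show "heis p l (B2 p u v w m k n) = B2 p u v (heis p l w) m k n
   + (\<Sum>i<I. scale (bc l i) (B2 p (heis p (int i) u) v w (m + l - int i) k n))
   + (\<Sum>i<I. scale (bc l i) (B2 p u (heis p (int i) v) w m (k + l - int i) n))"
  unfolding B2_def gen[OF Iu Iv] a ..
 show "heis p l (B3 p u v w m k n) = B3 p u v (heis p l w) m k n
   + (\<Sum>i<I. scale (bc l i) (B3 p (heis p (int i) u) v w (m + l - int i) k n))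
   + (\<Sum>i<I. scale (bc l i) (B3 p u (heis p (int i) v) w m (k + l - int i) n))"
  unfolding B3_def gen[OF Iv Iu] b by (simp only: add_ac)
qed

text \<open>Here \<alpha>(q) has to pass through the inner product as well. Trinomial revision
  separates the two binomial coefficients, and Vandermonde recombines the outer ones into the upper
  index \<open>m + l - s\<close>.\<close>

lemma B1_cov:
 assumes Iu: "\<forall>i\<ge>I. heis p (int i) u = 0" and Iv: "\<forall>i\<ge>I. heis p (int i) v = 0"
 shows "heis p l (B1 p u v w m k n) = B1 p u v (heis p l w) m k n
   + (\<Sum>i<I. scale (bc l i) (B1 p (heis p (int i) u) v w (m + l - int i) k n))
   + (\<Sum>i<I. scale (bc l i) (B1 p u (heis p (int i) v) w m (k + l - int i) n))"
proof -
 define g where "g = (%s J. Z p (Z p (heis p (int s) u) (n + int J - int s) v) (m + k + l - int J) w)"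
 have gez: "ez (g s)" for s unfolding g_def
  by (rule ez_lin[where T = "%J x. Z p x (m + k + l - int J) w", OF Z_lin1], rule Z_ez[OF p, of _ "n - int s"]) simp
 have gez': "ez (%q. g s (j + q))" for s j using ez_shift'[OF gez] .
 define f where "f = (%j q. Z p (Z p u (n + int j) (heis p (int q) v)) (m + k - int j + l - int q) w)"
 have fez: "ez (%q. f j q)" for j unfolding f_def
  by (rule ez_lin[where T = "%q x. Z p x (m + k - int j + l - int q) w", OF Z_lin1],
    rule ez_lin[where T = "%q x. Z p u (n + int j) x", OF Z_lin2[OF p]], rule heis_ez)
 have 1: "heis p l (Z p (Z p u (n + int j) v) (m + k - int j) w) = Z p (Z p u (n + int j) v) (m + k - int j) (heis p l w)
   + Sum_any (%q. scale (bc l q) (f j q)) + Sum_any (%q. \<Sum>s<I. scale (bc l q * bc (int q) s) (g s (j + q)))" for j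
 proof -
  have "scale (bc l q) (Z p (heis p (int q) (Z p u (n + int j) v)) (m + k - int j + l - int q) w)
    = scale (bc l q) (f j q) + (\<Sum>s<I. scale (bc l q * bc (int q) s) (g s (j + q)))" for q
  proof -
   have a: "n + int j + int q - int s = n + int (j + q) - int s" "m + k - int j + l - int q = m + k + l - int (j + q)" for s by simp_all
   show ?thesis unfolding heis_Z_fin[OF p Iu] f_def g_def Z1_add lin_sum[OF Z_lin1] Z1_scale a
    by (simp only: pm.scale_right_distrib pm.scale_sum_right pm.scale_scale)
  qed
  hence "Sum_any (%q. scale (bc l q) (Z p (heis p (int q) (Z p u (n + int j) v)) (m + k - int j + l - int q) w))
    = Sum_any (%q. scale (bc l q) (f j q) + (\<Sum>s<I. scale (bc l q * bc (int q) s) (g s (j + q))))" by simp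
  also have "... = Sum_any (%q. scale (bc l q) (f j q)) + Sum_any (%q. \<Sum>s<I. scale (bc l q * bc (int q) s) (g s (j + q)))"
   by (intro Sum_any_add ez_scale ez_sum fez gez') simp
  finally show ?thesis unfolding heis_Z[OF p] by (simp only: add.assoc)
 qed
 have 2: "Sum_any (%q. scale (bc l q) (f j q)) = (\<Sum>q<I. scale (bc l q) (f j q))" for j
  by (rule Sum_any_lessThan) (simp add: f_def Iv lin_0[OF Z_lin2[OF p]])
 have 3: "Sum_any (%q. \<Sum>s<I. scale (bc l q * bc (int q) s) (g s (j + q)))
   = (\<Sum>s<I. scale (bc l s) (Sum_any (%q. scale (bc (l - int s) q) (g s (s + (j + q))))))" for j
 proof -
  have "Sum_any (%q. scale (bc l q * bc (int q) s) (g s (j + q))) = scale (bc l s) (Sum_any (%q. scale (bc (l - int s) q) (g s (s + (j + q)))))" for s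
  proof -
   have "Sum_any (%q. scale (bc l q * bc (int q) s) (g s (j + q))) = Sum_any (%q. scale (bc l (q + s) * bc (int (q + s)) s) (g s (j + (q + s))))"
    by (rule Sum_any_shift) (auto intro!: ez_scale gez' simp: bc_nat binomial_eq_0 simp del: of_int_of_nat_eq)
   also have "... = Sum_any (%q. scale (bc l s) (scale (bc (l - int s) q) (g s (s + (j + q)))))"
   proof (intro arg_cong[of _ _ Sum_any] ext)
    fix q
    have "bc l (q + s) * bc (int (q + s)) s = bc l s * bc (l - int s) q"
     using gbinomial_trinomial_revision[of s "q + s" "of_int l :: complex"] by simp
    thus "scale (bc l (q + s) * bc (int (q + s)) s) (g s (j + (q + s))) = scale (bc l s) (scale (bc (l - int s) q) (g s (s + (j + q))))"
     by (simp only: pm.scale_scale add_ac)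
   qed
   also have "... = scale (bc l s) (Sum_any (%q. scale (bc (l - int s) q) (g s (s + (j + q)))))"
    by (rule Sum_any_scale[symmetric], rule ez_scale) (use gez'[of s "s + j"] in "simp add: add.assoc")
   finally show ?thesis .
  qed
  thus ?thesis by (subst Sum_any_finsum_swap) (auto intro!: ez_scale gez')
 qed
 have 4: "heis p l (B1 p u v w m k n) = B1 p u v (heis p l w) m k n
  + (\<Sum>q<I. scale (bc l q) (Sum_any (%j. scale (bc m j) (f j q))))
  + (\<Sum>s<I. scale (bc l s) (Sum_any (%j. scale (bc m j) (Sum_any (%q. scale (bc (l - int s) q) (g s (s + (j + q))))))))"
 proof -
  have e1: "ez (%j. f j q)" for q
   unfolding f_def by (rule ez_lin[where T = "%j x. Z p x (m + k - int j + l - int q) w", OF Z_lin1], rule Z_ez[OF p, of _ n]) simp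
  have e2: "ez (%j. Sum_any (%q. scale (bc (l - int s) q) (g s (s + (j + q)))))" for s
  proof -
   obtain N where N: "!!J. J >= N ==> g s J = 0" using gez[of s] by (auto simp: ez_def)
   show ?thesis by (rule ezI[of N]) (simp add: N)
  qed
  have E0: "ez (%j. scale (bc m j) (Z p (Z p u (n + int j) v) (m + k - int j) (heis p l w)))"
   by (rule B1_ez)
  have E1: "ez (%j. \<Sum>q<I. scale (bc l q) (scale (bc m j) (f j q)))"
   by (intro ez_sum ez_scale e1) simp
  have E2: "ez (%j. \<Sum>s<I. scale (bc l s) (scale (bc m j) (Sum_any (%q. scale (bc (l - int s) q) (g s (s + (j + q)))))))"
   by (intro ez_sum ez_scale e2) simp
  have "heis p l (B1 p u v w m k n) = Sum_any (%j. scale (bc m j) (Z p (Z p u (n + int j) v) (m + k - int j) (heis p l w))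
    + (\<Sum>q<I. scale (bc l q) (scale (bc m j) (f j q)))
    + (\<Sum>s<I. scale (bc l s) (scale (bc m j) (Sum_any (%q. scale (bc (l - int s) q) (g s (s + (j + q))))))))"
   unfolding B1_def Sum_any_lin[OF heis_lin B1_ez] heis_scale 1 2 3
   by (simp only: pm.scale_right_distrib pm.scale_sum_right pm.scale_left_commute)
  also have "... = B1 p u v (heis p l w) m k n
    + Sum_any (%j. \<Sum>q<I. scale (bc l q) (scale (bc m j) (f j q)))
    + Sum_any (%j. \<Sum>s<I. scale (bc l s) (scale (bc m j) (Sum_any (%q. scale (bc (l - int s) q) (g s (s + (j + q)))))))"
   unfolding B1_def
   by (simp only: Sum_any_add[OF ez_add[OF E0 E1] E2] Sum_any_add[OF E0 E1])
  also have "Sum_any (%j. \<Sum>q<I. scale (bc l q) (scale (bc m j) (f j q))) = (\<Sum>q<I. scale (bc l q) (Sum_any (%j. scale (bc m j) (f j q))))"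
   by (subst Sum_any_finsum_swap, simp, intro ez_scale e1, rule sum.cong[OF refl], rule Sum_any_scale[symmetric], intro ez_scale e1)
  also have "Sum_any (%j. \<Sum>s<I. scale (bc l s) (scale (bc m j) (Sum_any (%q. scale (bc (l - int s) q) (g s (s + (j + q)))))))
   = (\<Sum>s<I. scale (bc l s) (Sum_any (%j. scale (bc m j) (Sum_any (%q. scale (bc (l - int s) q) (g s (s + (j + q))))))))"
   by (subst Sum_any_finsum_swap, simp, intro ez_scale e2, rule sum.cong[OF refl], rule Sum_any_scale[symmetric], intro ez_scale e2)
  finally show ?thesis .
 qed
 have 5: "Sum_any (%j. scale (bc m j) (f j q)) = B1 p u (heis p (int q) v) w m (k + l - int q) n" for q
  unfolding B1_def f_def by (simp add: algebra_simps)
 have 6: "Sum_any (%j. scale (bc m j) (Sum_any (%q. scale (bc (l - int s) q) (g s (s + (j + q)))))) = B1 p (heis p (int s) u) v w (m + l - int s) k n" for s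
 proof -
  have gs: "ez (%J. g s (s + J))" using ez_shift'[OF gez] .
  have "Sum_any (%j. scale (bc m j) (Sum_any (%q. scale (bc (l - int s) q) (g s (s + (j + q))))))
    = Sum_any (%j. Sum_any (%q. scale (bc m j * bc (l - int s) q) (g s (s + (j + q)))))"
  proof (intro arg_cong[of _ _ Sum_any] ext)
   fix j
   have "ez (%q. g s (s + (j + q)))" using ez_shift'[OF gs] .
   thus "scale (bc m j) (Sum_any (%q. scale (bc (l - int s) q) (g s (s + (j + q))))) = Sum_any (%q. scale (bc m j * bc (l - int s) q) (g s (s + (j + q))))"
    by (subst Sum_any_scale) (auto intro: ez_scale)
  qed
  also have "... = Sum_any (%J. scale (bc (m + (l - int s)) J) (g s (s + J)))"
   by (rule conv_bc[OF gs])
  also have "... = B1 p (heis p (int s) u) v w (m + l - int s) k n"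
  proof -
   have "n + int (s + J) - int s = n + int J" "m + k + l - int (s + J) = m + l - int s + k - int J" "m + (l - int s) = m + l - int s" for J by simp_all
   thus ?thesis unfolding B1_def g_def by (simp only:)
  qed
  finally show ?thesis .
 qed
 show ?thesis unfolding 4 5 6 by (simp only: add_ac)
qed

end

lemma BD_cov:
 assumes p: "p > 0" and Iu: "\<forall>i\<ge>I. heis p (int i) u = 0" and Iv: "\<forall>i\<ge>I. heis p (int i) v = 0"
 shows "heis p l (BD p u v w m k n) = BD p u v (heis p l w) m k n
   + (\<Sum>i<I. scale (bc l i) (BD p (heis p (int i) u) v w (m + l - int i) k n))
   + (\<Sum>i<I. scale (bc l i) (BD p u (heis p (int i) v) w m (k + l - int i) n))"
 unfolding BD_def heis_add lin_diff[OF heis_lin] heis_scale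
  B1_cov[OF p Iu Iv] B23_cov[OF p Iu Iv]
 by (simp add: pm.scale_right_distrib pm.scale_right_diff_distrib sum.distrib sum_subtractf pm.scale_sum_right pm.scale_left_commute[of "sg n"] mult.commute[of "sg n"])

section \<open>Charge, and the coefficient of the top vector\<close>

definition ch :: "int => fock => bool"
 where "ch a u \<longleftrightarrow> (\<forall>M c. lookup u (M, c) ~= 0 \<longrightarrow> c = a)"

lemma ch_0 [simp]: "ch a 0" by (simp add: ch_def)
lemma ch_scale: "ch a v ==> ch a (scale c v)" by (auto simp: ch_def lookup_scale)
lemma ch_add: "ch a v ==> ch a w ==> ch a (v + w)"
 unfolding ch_def lookup_add by (metis add.right_neutral)
lemma ch_minus: "ch a v ==> ch a (- v)" by (simp add: ch_def)
lemma ch_diff: "ch a v ==> ch a w ==> ch a (v - w)"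
 using ch_add[of a v "- w"] ch_minus by simp
lemma ch_sum: "(!!x. x \<in> A ==> ch a (f x)) ==> ch a (sum f A)"
 by (induction A rule: infinite_finite_induct) (auto intro: ch_add)
lemma ch_Sum_any: "(!!x. ch a (f x)) ==> ch a (Sum_any f)"
 by (simp add: Sum_any.expand_set ch_sum)
lemma hm_ch: "hm m b v ==> ch b v" by (auto simp: hm_def ch_def)
lemma ch_st: "ch b (st M b)" by (rule hm_ch[OF hm_st])

lemma ch_lin:
 assumes "ch b v" "lin f" "!!M. ch b' (f (st M b))"
 shows "ch b' (f v)"
proof -
 have "f v = (\<Sum>k\<in>keys v. scale (lookup v k) (f (single k 1)))"
  by (subst poly_mapping_decomp[of v]) (simp add: lin_sum[OF assms(2)] lin_scale[OF assms(2)])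
 moreover have "ch b' (scale (lookup v k) (f (single k 1)))" if "k \<in> keys v" for k
 proof -
  obtain M c where k: "k = (M, c)" by force
  hence "c = b" using assms(1) that unfolding ch_def in_keys_iff by blast
  thus ?thesis using assms(3)[of M] k by (simp add: ch_scale)
 qed
 ultimately show ?thesis by (simp add: ch_sum)
qed

lemma ch_eq:
 assumes "ch b v" "lin f" "lin g" "!!M. f (st M b) = g (st M b)"
 shows "f v = g v"
proof (rule lin_eq_on[OF assms(2,3)])
 fix k assume *: "k \<in> keys v"
 obtain M c where k: "k = (M, c)" by force
 hence "c = b" using assms(1) * unfolding ch_def in_keys_iff by blast
 thus "f (single k 1) = g (single k 1)" using assms(4)[of M] k by simp
qed

lemma ch_heis: "ch b v ==> ch b (heis p n v)"
 by (rule ch_lin[OF _ heis_lin]) (auto intro: hm_ch heis_hm hm_st)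

lemma ch_Z: assumes p: "p > 0" and u: "ch a u" and v: "ch b v" shows "ch (a + b) (Z p u n v)"
proof (rule ch_lin[OF u Z_lin1])
 fix M show "ch (a + b) (Z p (st M a) n v)"
  by (rule ch_lin[OF v Z_lin2[OF p]]) (rule hm_ch[OF Z_hm_st[OF p hm_st]])
qed

definition Tp :: "int => fock => fock" where "Tp c y = scale (lookup y ({#}, c)) (st {#} c)"

lemma Tp_lin: "lin (Tp c)"
 by (auto simp: lin_def Tp_def lookup_add lookup_scale pm.scale_left_distrib)
lemmas Tp_0 = lin_0[OF Tp_lin] and Tp_add = lin_add[OF Tp_lin] and Tp_scale = lin_scale[OF Tp_lin] and Tp_sum = lin_sum[OF Tp_lin] and Tp_diff = lin_diff[OF Tp_lin]

lemma Tp_heis_neg: "k < 0 ==> Tp c (heis p k y) = 0"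
proof (rule lin_eqI[of "%y. Tp c (heis p k y)" "%y. 0"])
 show "lin (%y. Tp c (heis p k y))" by (rule lin_comp[OF Tp_lin heis_lin])
 fix x :: "nat multiset \<times> int" assume k: "k < 0"
 obtain M b where x: "x = (M, b)" by force
 show "Tp c (heis p k (single x 1)) = 0" using k by (simp add: x heis_neg Tp_def lookup_single)
qed (rule lin_zero)

lemma st_nz [simp]: "st M c ~= 0"
 by (metis lookup_single_eq lookup_zero zero_neq_one)

lemma Tp_0_iff: "Tp c y = 0 \<longleftrightarrow> lookup y ({#}, c) = 0"
 by (simp add: Tp_def)

text \<open>Annihilation operators read off coefficients: a vector is determined by the top
  coefficients of its images under them.\<close>

lemma lookup_heis_pos:
 "lookup (heis p (int i + 1) y) (M, c)
  = 2 * of_nat p * of_nat (Suc i) * of_nat (Suc (count M i)) * lookup y (add_mset i M, c)"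
proof -
 let ?F = "%y. scale (lookup (heis p (int i + 1) y) (M, c)) (st {#} 0)"
 define K :: complex where "K = 2 * of_nat p * of_nat (Suc i) * of_nat (Suc (count M i))"
 let ?G = "%y. scale (K * lookup y (add_mset i M, c)) (st {#} 0)"
 have "?F y = ?G y"
 proof (rule lin_eqI[of ?F ?G])
  show "lin ?F" unfolding lin_def by (simp add: heis_add heis_scale lookup_add lookup_scale pm.scale_left_distrib)
  show "lin ?G" unfolding lin_def by (simp add: lookup_add lookup_scale pm.scale_left_distrib ring_distribs mult_ac)
  fix x :: "nat multiset \<times> int"
  obtain N b where x: "x = (N, b)" by force
  show "?F (single x 1) = ?G (single x 1)"
  proof (cases "i \<in># N")
   case True
   then obtain N' where N: "N = add_mset i N'" by (metis insert_DiffM)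
   show ?thesis by (simp add: x N heis_pos lookup_scale lookup_single when_def add.commute K_def)
  next
   case False
   hence "add_mset i M ~= N" by auto
   thus ?thesis using False by (auto simp: x heis_pos lookup_scale lookup_single when_def not_in_iff)
  qed
 qed
 thus ?thesis unfolding K_def[symmetric] by (metis lookup_single_eq lookup_scale mult.right_neutral)
qed

context
 fixes p :: nat
 assumes p: "p > 0"
begin

text \<open>Two covariance arguments reduce the identity to the coefficient of the top vector when the
  third argument is a top vector.\<close>

lemma BD_zero_top:
 assumes top: "!!u v m k n. ch a u ==> ch a' v ==> lookup (BD p u v (st {#} b) m k n) ({#}, c) = 0"
 shows "ch a u ==> ch a' v ==> lookup (BD p u v (st {#} b) m k n) (M, c) = 0"
proof (induction M arbitrary: u v m k n)
 case empty thus ?case by (rule top)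
next
 case (add i M)
 obtain I1 where I1: "!!j. j >= I1 ==> heis p (int j) u = 0" using heis_ez[of p u] unfolding ez_def by blast
 obtain I2 where I2: "!!j. j >= I2 ==> heis p (int j) v = 0" using heis_ez[of p v] unfolding ez_def by blast
 have I: "\<forall>j\<ge>max I1 I2. heis p (int j) u = 0" "\<forall>j\<ge>max I1 I2. heis p (int j) v = 0" using I1 I2 by auto
 have w: "heis p (int i + 1) (st {#} b) = 0" by (rule hm_neg[OF heis_hm[OF hm_st]]) simp
 have "lookup (heis p (int i + 1) (BD p u v (st {#} b) m k n)) (M, c) = 0"
  unfolding BD_cov[OF p I] w
  by (simp add: lookup_add lookup_sum lookup_scale lin_0[OF BD_lin(1)[OF p]] add.IH ch_heis add.prems)
 thus ?case using p unfolding lookup_heis_pos by (auto simp del: of_nat_Suc)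
qed

lemma BD_hm0: "ch a u ==> ch a' v ==> ch b w ==> ch (a + a' + b) (BD p u v w m k n)"
proof -
 assume u: "ch a u" and v: "ch a' v" and w: "ch b w"
 have "ch (a + a' + b) (Z p u x (Z p v y w))" for x y using ch_Z[OF p u ch_Z[OF p v w]] by (simp add: add.assoc)
 moreover have "ch (a + a' + b) (Z p v x (Z p u y w))" for x y using ch_Z[OF p v ch_Z[OF p u w]] by (simp add: add_ac)
 moreover have "ch (a + a' + b) (Z p (Z p u x v) y w)" for x y using ch_Z[OF p ch_Z[OF p u v] w] by (simp add: add_ac)
 ultimately show ?thesis unfolding BD_def B1_def B2_def B3_def by (intro ch_add ch_diff ch_scale ch_Sum_any)
qed

lemma BD_zero:
 assumes top: "!!u v m k n. ch a u ==> ch a' v ==> lookup (BD p u v (st {#} b) m k n) ({#}, a + a' + b) = 0"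
  and u: "ch a u" and v: "ch a' v" and w: "ch b w"
 shows "BD p u v w m k n = 0"
proof (rule ch_eq[OF w BD_lin(1)[OF p] lin_zero])
 fix M
 show "BD p u v (st M b) m k n = 0" using u v
 proof (induction M arbitrary: u v m k n)
  case empty
  show ?case
  proof (rule poly_mapping_eqI)
   fix x :: "nat multiset \<times> int"
   obtain M c where x: "x = (M, c)" by force
   show "lookup (BD p u v (st {#} b) m k n) x = lookup 0 x"
    using BD_zero_top[of a a' b "a + a' + b", OF top empty] BD_hm0[OF empty ch_st, of b "{#}" m k n]
    unfolding x ch_def by (cases "c = a + a' + b") auto
  qed
 next
  case (add i M)
  obtain I1 where I1: "!!j. j >= I1 ==> heis p (int j) u = 0" using heis_ez[of p u] unfolding ez_def by blast
  obtain I2 where I2: "!!j. j >= I2 ==> heis p (int j) v = 0" using heis_ez[of p v] unfolding ez_def by blast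
  have I: "\<forall>j\<ge>max I1 I2. heis p (int j) u = 0" "\<forall>j\<ge>max I1 I2. heis p (int j) v = 0" using I1 I2 by auto
  show ?case using BD_cov[OF p I, of "- int i - 1" "st M b" m k n]
   by (simp add: heis_create add.IH ch_heis add.prems heis_0)
 qed
qed

text \<open>The vectors depend on \<open>s + q\<close> only, so \<open>bc_shift2\<close> and
  Vandermonde leave a single sum. The upper index drops by \<open>i + j + 1\<close>, the shift of
  \<open>n\<close> in the recursions for the top coefficient.\<close>

lemma conv_top:
 assumes g: "ez g"
 shows "Sum_any (%s. scale ((-1) ^ s * bc n s) (Sum_any (%q. scale (bc (- int q - 1) i * bc (int q) j) (g (s + q)))))
  = scale (bc (- int j - 1) i) (Sum_any (%J. scale ((-1) ^ J * bc (n - int i - int j - 1) J) (g (j + J))))"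
proof -
 have gs: "ez (%q. g (s + q))" for s using ez_shift'[OF g] .
 have gj: "ez (%q. g (s + (j + q)))" for s using ez_shift'[OF gs] .
 have gj': "ez (%q. g (j + q))" using ez_shift'[OF g] .
 have 1: "Sum_any (%q. scale (bc (- int q - 1) i * bc (int q) j) (g (s + q)))
   = scale (bc (- int j - 1) i) (Sum_any (%q. scale ((-1) ^ q * bc (- int (i + j) - 1) q) (g (j + (s + q)))))" for s
 proof -
  have "Sum_any (%q. scale (bc (- int q - 1) i * bc (int q) j) (g (s + q)))
    = Sum_any (%q. scale (bc (- int (q + j) - 1) i * bc (int (q + j)) j) (g (s + (q + j))))"
   by (rule Sum_any_shift[OF ez_scale[OF gs]]) (simp only: bc_shift2, simp)
  also have "... = Sum_any (%q. scale (bc (- int j - 1) i) (scale ((-1) ^ q * bc (- int (i + j) - 1) q) (g (j + (s + q)))))"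
  proof (intro arg_cong[of _ _ Sum_any] ext)
   fix q
   show "scale (bc (- int (q + j) - 1) i * bc (int (q + j)) j) (g (s + (q + j))) = scale (bc (- int j - 1) i) (scale ((-1) ^ q * bc (- int (i + j) - 1) q) (g (j + (s + q))))"
    unfolding bc_shift2 by (simp add: add_ac)
  qed
  also have "... = scale (bc (- int j - 1) i) (Sum_any (%q. scale ((-1) ^ q * bc (- int (i + j) - 1) q) (g (j + (s + q)))))"
   by (rule Sum_any_scale[symmetric], rule ez_scale) (use gj[of s] in "simp add: add_ac")
  finally show ?thesis .
 qed
 have gj2: "ez (%q. g (j + (s + q)))" for s using gj[of s] by (simp add: add_ac)
 have 2: "ez (%s. Sum_any (%q. scale (((-1) ^ s * bc n s) * ((-1) ^ q * bc (- int (i + j) - 1) q)) (g (j + (s + q)))))"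
 proof -
  obtain N where N: "!!J. J >= N ==> g J = 0" using g by (auto simp: ez_def)
  show ?thesis by (rule ezI[of N]) (simp add: N)
 qed
 have "Sum_any (%s. scale ((-1) ^ s * bc n s) (Sum_any (%q. scale (bc (- int q - 1) i * bc (int q) j) (g (s + q)))))
  = Sum_any (%s. scale (bc (- int j - 1) i) (Sum_any (%q. scale (((-1) ^ s * bc n s) * ((-1) ^ q * bc (- int (i + j) - 1) q)) (g (j + (s + q))))))"
 proof (intro arg_cong[of _ _ Sum_any] ext)
  fix s
  have "scale ((-1) ^ s * bc n s) (Sum_any (%q. scale ((-1) ^ q * bc (- int (i + j) - 1) q) (g (j + (s + q)))))
   = Sum_any (%q. scale (((-1) ^ s * bc n s) * ((-1) ^ q * bc (- int (i + j) - 1) q)) (g (j + (s + q))))"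
   by (subst Sum_any_scale[OF ez_scale[OF gj2]]) (simp only: pm.scale_scale)
  thus "scale ((-1) ^ s * bc n s) (Sum_any (%q. scale (bc (- int q - 1) i * bc (int q) j) (g (s + q))))
   = scale (bc (- int j - 1) i) (Sum_any (%q. scale (((-1) ^ s * bc n s) * ((-1) ^ q * bc (- int (i + j) - 1) q)) (g (j + (s + q)))))"
   unfolding 1 by (metis pm.scale_left_commute)
 qed
 also have "... = scale (bc (- int j - 1) i) (Sum_any (%s. Sum_any (%q. scale (((-1) ^ s * bc n s) * ((-1) ^ q * bc (- int (i + j) - 1) q)) (g (j + (s + q))))))"
  by (rule Sum_any_scale[OF 2, symmetric])
 also have "... = scale (bc (- int j - 1) i) (Sum_any (%J. scale ((-1) ^ J * bc (n + (- int (i + j) - 1)) J) (g (j + J))))"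
  by (simp only: conv_sg[OF gj'])
 also have "n + (- int (i + j) - 1) = n - int i - int j - 1" by simp
 finally show ?thesis .
qed

lemma conv_top0:
 assumes g: "ez g"
 shows "Sum_any (%s. scale ((-1) ^ s * bc n s) (Sum_any (%q. scale (bc (int q) j) (g (s + q)))))
  = Sum_any (%J. scale ((-1) ^ J * bc (n - int j - 1) J) (g (j + J)))"
 using conv_top[OF g, of n 0 j] by simp

lemma conv_top1:
 assumes g: "ez g"
 shows "Sum_any (%s. scale (bc m s) (Sum_any (%q. scale ((-1) ^ q * bc (int q) i) (g (s + q)))))
  = scale ((-1) ^ i) (Sum_any (%J. scale (bc (m - int i - 1) J) (g (i + J))))"
proof -
 define g' where "g' = (%J. scale ((-1) ^ J) (g J))"
 have g': "ez g'" unfolding g'_def by (rule ez_scale[OF g])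
 have a: "scale ((-1) ^ s * bc m s) (Sum_any (%q. scale (bc (int q) i) (g' (s + q)))) = scale (bc m s) (Sum_any (%q. scale ((-1) ^ q * bc (int q) i) (g (s + q))))" for s
 proof -
  have gs: "ez (%q. g (s + q))" using ez_shift'[OF g] .
  have "Sum_any (%q. scale (bc (int q) i) (g' (s + q))) = Sum_any (%q. scale ((-1) ^ s) (scale ((-1) ^ q * bc (int q) i) (g (s + q))))"
   unfolding g'_def by (intro arg_cong[of _ _ Sum_any] ext) (simp add: power_add mult_ac)
  also have "... = scale ((-1) ^ s) (Sum_any (%q. scale ((-1) ^ q * bc (int q) i) (g (s + q))))"
   by (rule Sum_any_scale[symmetric, OF ez_scale[OF gs]])
  finally show ?thesis by (simp add: mult_ac flip: power_add mult.assoc)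
 qed
 have "Sum_any (%J. scale ((-1) ^ J * bc (m - int i - 1) J) (g' (i + J))) = Sum_any (%J. scale ((-1) ^ i) (scale (bc (m - int i - 1) J) (g (i + J))))"
  unfolding g'_def by (intro arg_cong[of _ _ Sum_any] ext) (simp add: power_add minus_one_power_iff)
 also have "... = scale ((-1) ^ i) (Sum_any (%J. scale (bc (m - int i - 1) J) (g (i + J))))"
  by (rule Sum_any_scale[symmetric, OF ez_scale[OF ez_shift'[OF g]]])
 finally show ?thesis using conv_top0[OF g', of m i] unfolding a by simp
qed

end

section \<open>Recursions for the top coefficient\<close>

context
 fixes p :: nat
 assumes p: "p > 0"
begin

lemma heis_top: "heis p (int q) (st {#} b) = (if q = 0 then scale (of_int b) (st {#} b) else 0)"
proof (cases "q = 0")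
 case False
 thus ?thesis by (auto intro: hm_neg[OF heis_hm[OF hm_st]])
qed (simp add: heis_zero)

lemma bc_m1: "bc (- 1) i = (-1) ^ i"
 using bc_neg[of 0 i] by simp

text \<open>Images of creation operators have no top coefficient, so only the annihilation half of
  the normally ordered product survives.\<close>

lemma Tp_Z_create:
 "Tp c (Z p (heis p (- int i - 1) u) r y)
  = Sum_any (%q. scale (bc (- int q - 1) i) (Tp c (Z p u (r - int i - 1 - int q) (heis p (int q) y))))"
proof -
 have "Sum_any (%g. Tp c (nopc p i (Z p u) r y g)) = 0"
  by (simp add: nopc_def Tp_scale Tp_heis_neg)
 hence "Tp c (Z p (heis p (- int i - 1) u) r y) = Sum_any (%q. Tp c (nopa p i (Z p u) r y q))"
  by (simp add: Z_create[OF p] nop_split[OF fld_Z[OF p]] Tp_add Sum_any_lin[OF Tp_lin] nopc_ez nopa_ez fld_Z[OF p])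
 also have "r - int q - int i - 1 = r - int i - 1 - int q" for q by simp
 hence "(%q. Tp c (nopa p i (Z p u) r y q)) = (%q. scale (bc (- int q - 1) i) (Tp c (Z p u (r - int i - 1 - int q) (heis p (int q) y))))"
  by (simp only: nopa_def Tp_scale)
 finally show ?thesis .
qed

lemma Z_create_top:
 "Z p (heis p (- int i - 1) u) r (st {#} b)
  = Sum_any (%g. scale (bc (int g) i) (heis p (- int g - 1) (Z p u (r - int i + int g) (st {#} b))))
  + scale ((-1) ^ i * of_int b) (Z p u (r - int i - 1) (st {#} b))"
proof -
 have "Sum_any (nopa p i (Z p u) r (st {#} b)) = nopa p i (Z p u) r (st {#} b) 0"
  using p by (intro Sum_any_single) (simp add: nopa_def heis_top lin_0[OF Z_lin2] del: of_int_of_nat_eq)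
 also have "... = scale ((-1) ^ i * of_int b) (Z p u (r - int i - 1) (st {#} b))"
  using bc_m1[of i] by (simp add: nopa_def heis_zero lin_scale[OF Z_lin2[OF p]])
 finally have "Sum_any (nopa p i (Z p u) r (st {#} b)) = scale ((-1) ^ i * of_int b) (Z p u (r - int i - 1) (st {#} b))" .
 moreover have "nopc p i (Z p u) r (st {#} b) = (%g. scale (bc (int g) i) (heis p (- int g - 1) (Z p u (r - int i + int g) (st {#} b))))"
  by (rule ext) (simp add: nopc_def algebra_simps)
 ultimately show ?thesis by (simp add: Z_create[OF p] nop_split[OF fld_Z[OF p]])
qed

lemma Z_create_top_ez:
 "ez (%g. scale (bc (int g) i) (heis p (- int g - 1) (Z p u (r - int i + int g) (st {#} b))))"
 by (rule ez_scale, rule ez_lin[where T = "%g. heis p (- int g - 1)", OF heis_lin], rule Z_ez[OF p]) simp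

lemma Tp_Z_top_create:
 "Tp c (Z p (heis p (- int i - 1) x) r (st {#} b)) = scale ((-1) ^ i * of_int b) (Tp c (Z p x (r - int i - 1) (st {#} b)))"
 unfolding Z_create_top Tp_add Tp_scale Sum_any_lin[OF Tp_lin Z_create_top_ez]
 by (simp add: Tp_scale Tp_heis_neg)

lemma Tp_Z_heis_neg:
 assumes J: "\<forall>j\<ge>J. heis p (int j) v = 0" and l: "l < 0"
 shows "Tp c (Z p v K (heis p l x)) = - (\<Sum>j<J. scale (bc l j) (Tp c (Z p (heis p (int j) v) (K + l - int j) x)))"
proof -
 have "Tp c (heis p l (Z p v K x)) = 0" by (rule Tp_heis_neg[OF l])
 thus ?thesis unfolding heis_Z_fin[OF p J] Tp_add Tp_sum Tp_scale
  by (simp add: eq_neg_iff_add_eq_0)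
qed

lemma TZZ_ez: "ez (%J. Tp c (Z p u (f J) (Z p v (k + int J) w)))"
proof -
 have "ez (%j. Z p v (k + int j) w)" by (rule Z_ez[OF p]) simp
 thus ?thesis by (intro ez_lin[where T = "%j. Tp c", OF Tp_lin] ez_lin[where T = "%j x. Z p u (f j) x", OF Z_lin2[OF p]])
qed

lemma Tp_B2: "Tp c (B2 p u v w m k n) = Sum_any (%j. scale ((-1) ^ j * bc n j) (Tp c (Z p u (m + n - int j) (Z p v (k + int j) w))))"
 and Tp_B3: "Tp c (B3 p u v w m k n) = Sum_any (%j. scale ((-1) ^ j * bc n j) (Tp c (Z p v (n + k - int j) (Z p u (m + int j) w))))"
 unfolding B2_def B3_def by (simp_all only: Sum_any_lin[OF Tp_lin B23_ez[OF p]] Tp_scale)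

lemma Tp_B1: "Tp c (B1 p u v w m k n) = Sum_any (%j. scale (bc m j) (Tp c (Z p (Z p u (n + int j) v) (m + k - int j) w)))"
 unfolding B1_def by (simp only: Sum_any_lin[OF Tp_lin B1_ez[OF p]] Tp_scale)

text \<open>One oscillator is removed from \<open>u\<close>: the annihilation modes left by
  \<open>Tp_Z_create\<close> either hit the top vector, which gives the first term, or act on
  \<open>v\<close>. The other two sums satisfy recursions of the same shape, and
  \<open>recBD\<close> combines them.\<close>

lemma recB2:
 assumes J: "\<forall>j\<ge>J. heis p (int j) v = 0"
 shows "Tp c (B2 p (heis p (- int i - 1) u) v (st {#} b) m k n)
  = scale ((-1) ^ i * of_int b) (Tp c (B2 p u v (st {#} b) (m - int i - 1) k n))
  + (\<Sum>j<J. scale (bc (- int j - 1) i) (Tp c (B2 p u (heis p (int j) v) (st {#} b) m k (n - int i - int j - 1))))"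
proof -
 let ?e = "st {#} b"
 define g where "g = (%j q. Tp c (Z p u (m + n - int i - 1 - int q) (Z p (heis p (int j) v) (k - int j + int q) ?e)))"
 have gez: "ez (g j)" for j unfolding g_def by (rule TZZ_ez)
 have 1: "Tp c (Z p (heis p (- int i - 1) u) (m + n - int s) (Z p v (k + int s) ?e))
   = scale ((-1) ^ i * of_int b) (Tp c (Z p u (m - int i - 1 + n - int s) (Z p v (k + int s) ?e)))
   + (\<Sum>j<J. Sum_any (%q. scale (bc (- int q - 1) i * bc (int q) j) (g j (s + q))))" for s
 proof -
  let ?f = "%q. Tp c (Z p u (m + n - int s - int i - 1 - int q) (if q = 0 then scale (of_int b) (Z p v (k + int s) ?e) else 0))"
  have "scale (bc (- int q - 1) i) (Tp c (Z p u (m + n - int s - int i - 1 - int q) (heis p (int q) (Z p v (k + int s) ?e))))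
    = scale (bc (- int q - 1) i) (?f q) + (\<Sum>j<J. scale (bc (- int q - 1) i * bc (int q) j) (g j (s + q)))" for q
  proof -
   have h: "heis p (int q) (Z p v (k + int s) ?e) = (if q = 0 then scale (of_int b) (Z p v (k + int s) ?e) else 0)
     + (\<Sum>j<J. scale (bc (int q) j) (Z p (heis p (int j) v) (k + int s + int q - int j) ?e))"
    unfolding heis_Z_fin[OF p J] heis_top by (simp add: lin_scale[OF Z_lin2[OF p]] lin_0[OF Z_lin2[OF p]])
   have a: "m + n - int s - int i - 1 - int q = m + n - int i - 1 - int (s + q)" "k + int s + int q - int j = k - int j + int (s + q)" for j by simp_all
   show ?thesis unfolding h g_def lin_add[OF Z_lin2[OF p]] Tp_add lin_sum[OF Z_lin2[OF p]] Tp_sum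
     lin_scale[OF Z_lin2[OF p]] Tp_scale a
    by (simp only: pm.scale_right_distrib pm.scale_sum_right pm.scale_scale)
  qed
  moreover have "ez (%q. scale (bc (- int q - 1) i) (?f q))"
   by (rule ezI[of 1]) (simp add: lin_0[OF Z_lin2[OF p]] Tp_0)
  moreover have "ez (%q. \<Sum>j<J. scale (bc (- int q - 1) i * bc (int q) j) (g j (s + q)))"
   by (intro ez_sum ez_scale ez_shift'[OF gez]) simp
  moreover have "Sum_any (%q. scale (bc (- int q - 1) i) (?f q)) = scale ((-1) ^ i * of_int b) (Tp c (Z p u (m - int i - 1 + n - int s) (Z p v (k + int s) ?e)))"
  proof -
   have a: "m + n - int s - int i - 1 - int 0 = m - int i - 1 + n - int s" by simp
   have "Sum_any (%q. scale (bc (- int q - 1) i) (?f q)) = scale (bc (- int 0 - 1) i) (?f 0)"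
    by (rule Sum_any_single) (simp add: lin_0[OF Z_lin2[OF p]] Tp_0)
   also have "... = scale ((-1) ^ i * of_int b) (Tp c (Z p u (m - int i - 1 + n - int s) (Z p v (k + int s) ?e)))"
    unfolding a using bc_m1[of i] by (simp add: lin_scale[OF Z_lin2[OF p]] Tp_scale)
   finally show ?thesis .
  qed
  moreover have "Sum_any (%q. \<Sum>j<J. scale (bc (- int q - 1) i * bc (int q) j) (g j (s + q))) = (\<Sum>j<J. Sum_any (%q. scale (bc (- int q - 1) i * bc (int q) j) (g j (s + q))))"
   by (rule Sum_any_finsum_swap) (auto intro!: ez_scale ez_shift'[OF gez])
  ultimately show ?thesis unfolding Tp_Z_create by (simp only: Sum_any_add)
 qed
 define h where "h = (%j s. Sum_any (%q. scale (bc (- int q - 1) i * bc (int q) j) (g j (s + q))))"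
 have hez: "ez (h j)" for j
 proof -
  obtain N where N: "!!J. J >= N ==> g j J = 0" using gez[of j] by (auto simp: ez_def)
  show ?thesis unfolding h_def by (rule ezI[of N]) (simp add: N)
 qed
 have e1: "ez (%s. scale ((-1) ^ s * bc n s) (scale ((-1) ^ i * of_int b) (Tp c (Z p u (m - int i - 1 + n - int s) (Z p v (k + int s) ?e)))))"
  by (intro ez_scale TZZ_ez)
 have "Tp c (B2 p (heis p (- int i - 1) u) v ?e m k n)
  = Sum_any (%s. scale ((-1) ^ s * bc n s) (scale ((-1) ^ i * of_int b) (Tp c (Z p u (m - int i - 1 + n - int s) (Z p v (k + int s) ?e))))
    + (\<Sum>j<J. scale ((-1) ^ s * bc n s) (h j s)))"
  unfolding Tp_B2 1 h_def by (simp only: pm.scale_right_distrib pm.scale_sum_right)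
 also have "... = Sum_any (%s. scale ((-1) ^ s * bc n s) (scale ((-1) ^ i * of_int b) (Tp c (Z p u (m - int i - 1 + n - int s) (Z p v (k + int s) ?e)))))
    + (\<Sum>j<J. Sum_any (%s. scale ((-1) ^ s * bc n s) (h j s)))"
  by (subst Sum_any_add[OF e1], intro ez_sum ez_scale hez, simp, subst Sum_any_finsum_swap, simp, intro ez_scale hez, rule refl)
 also have "Sum_any (%s. scale ((-1) ^ s * bc n s) (scale ((-1) ^ i * of_int b) (Tp c (Z p u (m - int i - 1 + n - int s) (Z p v (k + int s) ?e)))))
   = scale ((-1) ^ i * of_int b) (Tp c (B2 p u v ?e (m - int i - 1) k n))"
  unfolding Tp_B2 by (subst Sum_any_scale, intro ez_scale TZZ_ez, simp only: pm.scale_left_commute)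
 finally have F: "Tp c (B2 p (heis p (- int i - 1) u) v ?e m k n) = scale ((-1) ^ i * of_int b) (Tp c (B2 p u v ?e (m - int i - 1) k n))
    + (\<Sum>j<J. Sum_any (%s. scale ((-1) ^ s * bc n s) (h j s)))" .
 have Hj: "Sum_any (%s. scale ((-1) ^ s * bc n s) (h j s)) = scale (bc (- int j - 1) i) (Tp c (B2 p u (heis p (int j) v) ?e m k (n - int i - int j - 1)))" for j
 proof -
  have a: "m + n - int i - 1 - int (j + q) = m + (n - int i - int j - 1) - int q" "k - int j + int (j + q) = k + int q" for q by simp_all
  show ?thesis unfolding h_def conv_top[OF p gez] Tp_B2 unfolding g_def a ..
 qed
 show ?thesis unfolding F Hj ..
qed

lemma recB3:
 assumes J: "\<forall>j\<ge>J. heis p (int j) v = 0"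
 shows "Tp c (B3 p (heis p (- int i - 1) u) v (st {#} b) m k n)
  = scale ((-1) ^ i * of_int b) (Tp c (B3 p u v (st {#} b) (m - int i - 1) k n))
  - (\<Sum>j<J. scale (bc (- int i - 1) j) (Tp c (B3 p u (heis p (int j) v) (st {#} b) m k (n - int i - int j - 1))))"
proof -
 let ?e = "st {#} b"
 define g where "g = (%j q. Tp c (Z p (heis p (int j) v) (n + k - 1 - int j - int q) (Z p u (m - int i + int q) ?e)))"
 have gez: "ez (g j)" for j unfolding g_def by (rule TZZ_ez)
 have 1: "Tp c (Z p v (n + k - int s) (Z p (heis p (- int i - 1) u) (m + int s) ?e))
   = scale ((-1) ^ i * of_int b) (Tp c (Z p v (n + k - int s) (Z p u (m - int i - 1 + int s) ?e)))
   - (\<Sum>j<J. Sum_any (%q. scale (bc (- int q - 1) j * bc (int q) i) (g j (s + q))))" for s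
 proof -
  have m: "m + int s - int i - 1 = m - int i - 1 + int s" by simp
  have "Tp c (Z p v (n + k - int s) (Sum_any (%g. scale (bc (int g) i) (heis p (- int g - 1) (Z p u (m + int s - int i + int g) ?e)))))
    = Sum_any (%q. - (\<Sum>j<J. scale (bc (- int q - 1) j * bc (int q) i) (g j (s + q))))"
  proof -
   have a: "n + k - int s + (- int q - 1) - int j = n + k - 1 - int j - int (s + q)" "m + int s - int i + int q = m - int i + int (s + q)" for q j by simp_all
   show ?thesis unfolding Sum_any_lin[OF Z_lin2[OF p] Z_create_top_ez] unfolding Sum_any_lin[OF Tp_lin ez_lin[where T = "%j. Z p v (n + k - int s)", OF Z_lin2[OF p] Z_create_top_ez]]
    unfolding lin_scale[OF Z_lin2[OF p]] Tp_scale
    by (intro arg_cong[of _ _ Sum_any] ext, subst Tp_Z_heis_neg[OF J], simp, unfold g_def a)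
      (simp add: pm.scale_minus_right pm.scale_sum_right mult.commute)
  qed
  also have "... = - Sum_any (%q. \<Sum>j<J. scale (bc (- int q - 1) j * bc (int q) i) (g j (s + q)))"
   by (rule Sum_any_uminus[symmetric]) (intro ez_sum ez_scale ez_shift'[OF gez], simp)
  also have "Sum_any (%q. \<Sum>j<J. scale (bc (- int q - 1) j * bc (int q) i) (g j (s + q))) = (\<Sum>j<J. Sum_any (%q. scale (bc (- int q - 1) j * bc (int q) i) (g j (s + q))))"
   by (rule Sum_any_finsum_swap) (auto intro!: ez_scale ez_shift'[OF gez])
  finally show ?thesis unfolding Z_create_top lin_add[OF Z_lin2[OF p]] Tp_add lin_scale[OF Z_lin2[OF p]] Tp_scale m by simp
 qed
 define h where "h = (%j s. Sum_any (%q. scale (bc (- int q - 1) j * bc (int q) i) (g j (s + q))))"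
 have hez: "ez (h j)" for j
 proof -
  obtain N where N: "!!J. J >= N ==> g j J = 0" using gez[of j] by (auto simp: ez_def)
  show ?thesis unfolding h_def by (rule ezI[of N]) (simp add: N)
 qed
 have e1: "ez (%s. scale ((-1) ^ s * bc n s) (scale ((-1) ^ i * of_int b) (Tp c (Z p v (n + k - int s) (Z p u (m - int i - 1 + int s) ?e)))))"
  by (intro ez_scale TZZ_ez)
 have e2: "ez (%s. \<Sum>j<J. scale ((-1) ^ s * bc n s) (h j s))" by (intro ez_sum ez_scale hez) simp
 have "Tp c (B3 p (heis p (- int i - 1) u) v ?e m k n)
  = Sum_any (%s. scale ((-1) ^ s * bc n s) (scale ((-1) ^ i * of_int b) (Tp c (Z p v (n + k - int s) (Z p u (m - int i - 1 + int s) ?e))))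
    - (\<Sum>j<J. scale ((-1) ^ s * bc n s) (h j s)))"
  unfolding Tp_B3 1 h_def by (simp only: pm.scale_right_diff_distrib pm.scale_sum_right)
 also have "... = Sum_any (%s. scale ((-1) ^ s * bc n s) (scale ((-1) ^ i * of_int b) (Tp c (Z p v (n + k - int s) (Z p u (m - int i - 1 + int s) ?e)))))
    - (\<Sum>j<J. Sum_any (%s. scale ((-1) ^ s * bc n s) (h j s)))"
  by (subst Sum_any_sub[OF e1 e2], subst Sum_any_finsum_swap, simp, intro ez_scale hez, rule refl)
 also have "Sum_any (%s. scale ((-1) ^ s * bc n s) (scale ((-1) ^ i * of_int b) (Tp c (Z p v (n + k - int s) (Z p u (m - int i - 1 + int s) ?e)))))
   = scale ((-1) ^ i * of_int b) (Tp c (B3 p u v ?e (m - int i - 1) k n))"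
  unfolding Tp_B3 by (subst Sum_any_scale, intro ez_scale TZZ_ez, simp only: pm.scale_left_commute)
 finally have F: "Tp c (B3 p (heis p (- int i - 1) u) v ?e m k n) = scale ((-1) ^ i * of_int b) (Tp c (B3 p u v ?e (m - int i - 1) k n))
    - (\<Sum>j<J. Sum_any (%s. scale ((-1) ^ s * bc n s) (h j s)))" .
 have Hj: "Sum_any (%s. scale ((-1) ^ s * bc n s) (h j s)) = scale (bc (- int i - 1) j) (Tp c (B3 p u (heis p (int j) v) ?e m k (n - int i - int j - 1)))" for j
 proof -
  have a: "n + k - 1 - int j - int (i + q) = n - int i - int j - 1 + k - int q" "m - int i + int (i + q) = m + int q" "n - int j - int i - 1 = n - int i - int j - 1" for q by simp_all
  show ?thesis unfolding h_def conv_top[OF p gez] Tp_B3 unfolding g_def a ..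
 qed
 show ?thesis unfolding F Hj ..
qed

lemma recB1:
 assumes J: "\<forall>j\<ge>J. heis p (int j) v = 0"
 shows "Tp c (B1 p (heis p (- int i - 1) u) v (st {#} b) m k n)
  = scale ((-1) ^ i * of_int b) (Tp c (B1 p u v (st {#} b) (m - int i - 1) k n))
  + (\<Sum>j<J. scale (bc (- int j - 1) i) (Tp c (B1 p u (heis p (int j) v) (st {#} b) m k (n - int i - int j - 1))))"
proof -
 let ?e = "st {#} b"
 let ?E = "%x r. Tp c (Z p x r ?e)"
 have Elin: "lin (%x. ?E x r)" for r by (rule lin_comp[OF Tp_lin Z_lin1])
 define g where "g = (%q. ?E (Z p u (n - int i + int q) v) (m + k - 1 - int q))"
 have gez: "ez g" unfolding g_def
  by (rule ez_lin[where T = "%q x. ?E x (m + k - 1 - int q)", OF Elin], rule Z_ez[OF p]) simp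
 define f where "f = (%j s. ?E (Z p u (n + int s - int i - 1 - int j) (heis p (int j) v)) (m + k - int s))"
 have fez: "ez (f j)" for j unfolding f_def
  by (rule ez_lin[where T = "%s x. ?E x (m + k - int s)", OF Elin], rule Z_ez[OF p, of _ "n - int i - 1 - int j"]) simp
 have 1: "?E (Z p (heis p (- int i - 1) u) (n + int s) v) (m + k - int s)
  = scale (of_int b) (Sum_any (%q. scale ((-1) ^ q * bc (int q) i) (g (s + q)))) + (\<Sum>j<J. scale (bc (- int j - 1) i) (f j s))" for s
 proof -
  have A: "Sum_any (%q. ?E (nopc p i (Z p u) (n + int s) v q) (m + k - int s)) = scale (of_int b) (Sum_any (%q. scale ((-1) ^ q * bc (int q) i) (g (s + q))))"
  proof -
   have "?E (nopc p i (Z p u) (n + int s) v q) (m + k - int s) = scale (of_int b) (scale ((-1) ^ q * bc (int q) i) (g (s + q)))" for q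
   proof -
    have a: "m + k - int s - int q - 1 = m + k - 1 - int (s + q)" "n + int s + int q - int i = n - int i + int (s + q)" by simp_all
    show ?thesis unfolding nopc_def lin_scale[OF Elin] Tp_Z_top_create g_def a by (simp add: mult_ac)
   qed
   thus ?thesis by (simp only: Sum_any_scale[OF ez_scale[OF ez_shift'[OF gez]]])
  qed
  have B: "Sum_any (%q. ?E (nopa p i (Z p u) (n + int s) v q) (m + k - int s)) = (\<Sum>j<J. scale (bc (- int j - 1) i) (f j s))"
  proof -
   have "?E (nopa p i (Z p u) (n + int s) v q) (m + k - int s) = scale (bc (- int q - 1) i) (f q s)" for q
   proof -
    have a: "n + int s - int q - int i - 1 = n + int s - int i - 1 - int q" by simp
    show ?thesis unfolding nopa_def lin_scale[OF Elin] f_def a ..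
   qed
   moreover have "f q s = 0" if "q >= J" for q
    using J that by (simp add: f_def lin_0[OF Z_lin2[OF p]] Tp_0)
   ultimately show ?thesis by (simp only:) (rule Sum_any_lessThan, simp)
  qed
  show ?thesis unfolding Z_create[OF p] nop_split[OF fld_Z[OF p]] lin_add[OF Elin]
    Sum_any_lin[OF Elin nopc_ez[OF fld_Z[OF p]]] Sum_any_lin[OF Elin nopa_ez[OF fld_Z[OF p]]] A B ..
 qed
 define h where "h = (%s. scale (bc m s) (Sum_any (%q. scale ((-1) ^ q * bc (int q) i) (g (s + q)))))"
 have hez: "ez h"
 proof -
  obtain N where N: "!!J. J >= N ==> g J = 0" using gez by (auto simp: ez_def)
  show ?thesis unfolding h_def by (rule ezI[of N]) (simp add: N)
 qed
 have "Tp c (B1 p (heis p (- int i - 1) u) v ?e m k n)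
   = Sum_any (%s. scale (of_int b) (h s) + (\<Sum>j<J. scale (bc (- int j - 1) i) (scale (bc m s) (f j s))))"
  unfolding Tp_B1 1 h_def by (simp only: pm.scale_right_distrib pm.scale_sum_right pm.scale_left_commute)
 also have "... = scale (of_int b) (Sum_any h) + (\<Sum>j<J. scale (bc (- int j - 1) i) (Sum_any (%s. scale (bc m s) (f j s))))"
  by (subst Sum_any_add[OF ez_scale[OF hez]], intro ez_sum ez_scale fez, simp, subst Sum_any_finsum_swap, simp, intro ez_scale fez,
    simp only: Sum_any_scale[OF hez] Sum_any_scale[OF ez_scale[OF fez]])
 finally have F: "Tp c (B1 p (heis p (- int i - 1) u) v ?e m k n)
   = scale (of_int b) (Sum_any h) + (\<Sum>j<J. scale (bc (- int j - 1) i) (Sum_any (%s. scale (bc m s) (f j s))))" .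
 have H: "Sum_any h = scale ((-1) ^ i) (Tp c (B1 p u v ?e (m - int i - 1) k n))"
 proof -
  have a: "n - int i + int (i + q) = n + int q" "m + k - 1 - int (i + q) = m - int i - 1 + k - int q" for q by simp_all
  show ?thesis unfolding h_def conv_top1[OF p gez] Tp_B1 unfolding g_def a ..
 qed
 have Fj: "Sum_any (%s. scale (bc m s) (f j s)) = Tp c (B1 p u (heis p (int j) v) ?e m k (n - int i - int j - 1))" for j
 proof -
  have a: "n + int s - int i - 1 - int j = n - int i - int j - 1 + int s" for s by simp
  show ?thesis unfolding f_def Tp_B1 a ..
 qed
 show ?thesis unfolding F H Fj by (simp add: mult_ac)
qed

lemma recBD:
 assumes J: "\<forall>j\<ge>J. heis p (int j) v = 0"
 shows "Tp c (BD p (heis p (- int i - 1) u) v (st {#} b) m k n)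
  = scale ((-1) ^ i * of_int b) (Tp c (BD p u v (st {#} b) (m - int i - 1) k n))
  + (\<Sum>j<J. scale (bc (- int j - 1) i) (Tp c (BD p u (heis p (int j) v) (st {#} b) m k (n - int i - int j - 1))))"
proof -
 \<comment> \<open>The coefficients in \<open>recB3\<close> differ from those of the other two by
   the symmetry of binomial coefficients and a sign, which the shift of \<open>n\<close> by
   \<open>i + j + 1\<close> in \<open>sg\<close> makes up for.\<close>
 have s: "sg n * bc (- int i - 1) j = - (bc (- int j - 1) i * sg (n - int i - int j - 1))" for j
 proof -
  have "sg (n - int i - int j - 1) = - (sg n * (-1) ^ i * (-1) ^ j)"
   using sg_diff[of n "i + j + 1"] by (simp add: power_add diff_diff_eq add_ac)
  moreover have "(i + j choose i) = (i + j choose j)" using binomial_symmetric[of i "i + j"] by simp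
  ultimately show ?thesis unfolding bc_neg by (simp add: add.commute minus_one_power_iff)
 qed
 show ?thesis
  unfolding BD_def Tp_add Tp_diff Tp_scale recB1[OF J] recB2[OF J] recB3[OF J]
   pm.scale_right_diff_distrib pm.scale_right_distrib pm.scale_sum_right pm.scale_scale s
  by (simp add: sum.distrib sum_subtractf sum_negf pm.scale_minus_left mult_ac)
qed

end

lemma Tp_hm: assumes "hm m b y" "m ~= 0" shows "Tp c y = 0"
 using assms unfolding Tp_0_iff hm_def by (metis lev_simps(1) of_nat_0)

text \<open>The logarithmic derivative of \<open>(1+z)^x\<close>, that is
  \<open>z d/dz (1+z)^x = x (z - z^2 + ...) (1+z)^x\<close>, read off coefficientwise.\<close>

lemma gbinomial_euler: "of_nat J * (x gchoose J) = (\<Sum>k\<in>{1..J}. (-1) ^ (k - 1) * x * (x gchoose (J - k)))" for x :: complex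
proof (cases J)
 case (Suc n)
 have "(\<Sum>k\<in>{1..J}. (-1) ^ (k - 1) * x * (x gchoose (J - k))) = (\<Sum>i\<le>n. (-1) ^ (n - i) * x * (x gchoose i))"
  by (rule sum.reindex_bij_witness[of _ "%i. J - i" "%k. J - k"]) (auto simp: Suc)
 also have "... = (-1) ^ n * x * (\<Sum>i\<le>n. (x gchoose i) * (-1) ^ i)"
  unfolding sum_distrib_left
 proof (intro sum.cong refl)
  fix i assume "i \<in> {..n}"
  hence "(-1::complex) ^ n = (-1) ^ (n - i) * (-1) ^ i" by (simp flip: power_add)
  thus "(-1) ^ (n - i) * x * (x gchoose i) = (-1) ^ n * x * ((x gchoose i) * (-1) ^ i)" by (simp add: minus_one_power_iff)
 qed
 also have "(\<Sum>i\<le>n. (x gchoose i) * (-1) ^ i) = (-1) ^ n * ((x - 1) gchoose n)"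
  using gbinomial_sum_lower_neg[of "x" n] by simp
 also have "(-1) ^ n * x * ((-1) ^ n * ((x - 1) gchoose n)) = x * ((x - 1) gchoose n)"
  by (simp add: minus_one_power_iff)
 also have "... = of_nat J * (x gchoose J)" using Suc_times_gbinomial[of n "x - 1"] Suc by simp
 finally show ?thesis by simp
qed simp

lemma bc_euler: "of_nat J * bc A J = (\<Sum>k\<in>{1..J}. (-1) ^ (k - 1) * of_int A * bc A (J - k))"
 by (rule gbinomial_euler)

text \<open>The hypothesis is the recursion of \<open>gbinomial_euler\<close>, so it forces binomial
  coefficients. In this way top coefficients of products of exponentials are found without expanding
  the exponentials.\<close>

lemma euler_seq:
 fixes f :: "nat => int => fock"
 assumes "!!J r. scale (of_nat J) (f J r) = (\<Sum>k\<in>{1..J}. scale ((-1) ^ (k - 1) * of_int A) (f (J - k) (r - int k)))"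
 shows "f J r = scale (bc A J) (f 0 (r - int J))"
proof (induction J arbitrary: r rule: less_induct)
 case (less J)
 show ?case
 proof (cases "J = 0")
  case False
  have "scale (of_nat J) (f J r) = (\<Sum>k\<in>{1..J}. scale ((-1) ^ (k - 1) * of_int A * bc A (J - k)) (f 0 (r - int J)))"
   unfolding assms
  proof (intro sum.cong refl)
   fix k assume k: "k \<in> {1..J}"
   hence r: "r - int k - int (J - k) = r - int J" by (simp add: of_nat_diff)
   show "scale ((-1) ^ (k - 1) * of_int A) (f (J - k) (r - int k)) = scale ((-1) ^ (k - 1) * of_int A * bc A (J - k)) (f 0 (r - int J))"
    using k by (subst less.IH) (simp_all add: r)
  qed
  also have "... = scale (of_nat J * bc A J) (f 0 (r - int J))"
   by (simp only: bc_euler pm.scale_sum_left)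
  finally have "scale (inverse (of_nat J)) (scale (of_nat J) (f J r)) = scale (inverse (of_nat J)) (scale (of_nat J * bc A J) (f 0 (r - int J)))"
   by simp
  thus ?thesis using False by simp
 qed simp
qed

context
 fixes p :: nat
 assumes p: "p > 0"
begin

lemma cre_euler: "scale (of_nat J) (cre p a (int J) x) = (\<Sum>k\<in>{1..J}. scale (of_int a / of_nat (2 * p)) (heis p (- int (k - 1) - 1) (cre p a (int (J - k)) x)))"
proof -
 have comm: "crx p a j (crx p a k y) = crx p a k (crx p a j y)" for j k y
  by (cases "j = 0 \<or> k = 0") (auto simp: crx_def heis_scale heis_comm[of p "- int j" "- int k"] heis_0 mult.commute)
 have cre_nat: "cre p a (int t) x = exp_coeff (crx p a) t x" for t by (simp add: cre_def)
 have "scale (of_nat J) (cre p a (int J) x) = (\<Sum>k\<in>{1..J}. scale (of_nat k) (crx p a k (cre p a (int (J - k)) x)))"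
  using exp_coeff_euler[of "crx p a" J x, OF crx_lin comm] unfolding cre_nat .
 also have "... = (\<Sum>k\<in>{1..J}. scale (of_int a / of_nat (2 * p)) (heis p (- int (k - 1) - 1) (cre p a (int (J - k)) x)))"
 proof (intro sum.cong refl)
  fix k assume "k \<in> {1..J}"
  moreover from this have "- int (k - 1) - 1 = - int k" by auto
  ultimately show "scale (of_nat k) (crx p a k (cre p a (int (J - k)) x)) = scale (of_int a / of_nat (2 * p)) (heis p (- int (k - 1) - 1) (cre p a (int (J - k)) x))"
   by (simp add: crx_def)
 qed
 finally show ?thesis .
qed

lemma dvd_div: "2 * int p dvd x ==> (of_int x :: complex) / of_nat (2 * p) = of_int (x div (2 * int p))"
proof -
 assume "2 * int p dvd x"
 hence "x = 2 * int p * (x div (2 * int p))" by simp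
 hence "(of_int x :: complex) = of_int (2 * int p * (x div (2 * int p)))" by simp
 also have "... = of_nat (2 * p) * of_int (x div (2 * int p))" by simp
 finally show ?thesis using p by simp
qed

lemma Tp_Z_cre:
 assumes d: "2 * int p dvd a * b"
 shows "Tp c (Z p (cre p a (int J) x) r (st {#} b)) = scale (bc (a * b div (2 * int p)) J) (Tp c (Z p x (r - int J) (st {#} b)))"
proof -
 define f where "f = (%J r. Tp c (Z p (cre p a (int J) x) r (st {#} b)))"
 have "scale (of_nat J) (f J r) = (\<Sum>k\<in>{1..J}. scale ((-1) ^ (k - 1) * of_int (a * b div (2 * int p))) (f (J - k) (r - int k)))" for J r
 proof -
  have "scale (of_nat J) (f J r) = (\<Sum>k\<in>{1..J}. scale (of_int a / of_nat (2 * p)) (Tp c (Z p (heis p (- int (k - 1) - 1) (cre p a (int (J - k)) x)) r (st {#} b))))"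
   unfolding f_def lin_scale[OF lin_comp[OF Tp_lin Z_lin1], symmetric] lin_sum[OF lin_comp[OF Tp_lin Z_lin1], symmetric] cre_euler ..
  also have "... = (\<Sum>k\<in>{1..J}. scale ((-1) ^ (k - 1) * of_int (a * b div (2 * int p))) (f (J - k) (r - int k)))"
  proof (intro sum.cong refl)
   fix k assume "k \<in> {1..J}"
   hence r: "r - int (k - 1) - 1 = r - int k" by auto
   have "(of_int a / of_nat (2 * p)) * ((-1) ^ (k - 1) * of_int b) = ((-1) ^ (k - 1) * of_int (a * b div (2 * int p)) :: complex)"
    unfolding dvd_div[OF d, symmetric] by simp
   thus "scale (of_int a / of_nat (2 * p)) (Tp c (Z p (heis p (- int (k - 1) - 1) (cre p a (int (J - k)) x)) r (st {#} b)))
     = scale ((-1) ^ (k - 1) * of_int (a * b div (2 * int p))) (f (J - k) (r - int k))"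
    unfolding Tp_Z_top_create[OF p] f_def r pm.scale_scale by simp
  qed
  finally show ?thesis .
 qed
 from euler_seq[of f, OF this] show ?thesis by (simp add: f_def)
qed

lemma Tp_Z_exp_neg: "l < 0 ==> Tp c (Z p (st {#} a) M (heis p l y)) = scale (- of_int a) (Tp c (Z p (st {#} a) (M + l) y))"
proof -
 assume l: "l < 0"
 have "0 = Tp c (heis p l (Z p (st {#} a) M y))" using Tp_heis_neg[OF l] by simp
 also have "... = Tp c (Z p (st {#} a) M (heis p l y)) + scale (of_int a) (Tp c (Z p (st {#} a) (M + l) y))"
  by (simp add: Z_exp em_comm[OF p] Tp_add Tp_scale)
 finally show ?thesis by (simp add: pm.scale_minus_left eq_neg_iff_add_eq_0)
qed

lemma Tp_Z_exp_cre:
 assumes d: "2 * int p dvd a * a'"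
 shows "Tp c (Z p (st {#} a) M (cre p a' (int J) x)) = scale ((-1) ^ J * bc (a * a' div (2 * int p)) J) (Tp c (Z p (st {#} a) (M - int J) x))"
proof -
 let ?T = "%M y. Tp c (Z p (st {#} a) M y)"
 have Tl: "lin (?T M)" for M by (rule lin_comp[OF Tp_lin Z_lin2[OF p]])
 define f where "f = (%J M. scale ((-1) ^ J) (?T M (cre p a' (int J) x)))"
 have "scale (of_nat J) (f J r) = (\<Sum>k\<in>{1..J}. scale ((-1) ^ (k - 1) * of_int (a * a' div (2 * int p))) (f (J - k) (r - int k)))" for J r
 proof -
  have "scale (of_nat J) (f J r) = scale ((-1) ^ J) (?T r (scale (of_nat J) (cre p a' (int J) x)))"
   by (simp add: f_def lin_scale[OF Tl] mult.commute)
  also have "... = (\<Sum>k\<in>{1..J}. scale ((-1) ^ J * (of_int a' / of_nat (2 * p))) (?T r (heis p (- int (k - 1) - 1) (cre p a' (int (J - k)) x))))"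
   unfolding cre_euler lin_sum[OF Tl] lin_scale[OF Tl] by (simp add: pm.scale_sum_right)
  also have "... = (\<Sum>k\<in>{1..J}. scale ((-1) ^ (k - 1) * of_int (a * a' div (2 * int p))) (f (J - k) (r - int k)))"
  proof (intro sum.cong refl)
   fix k assume k: "k \<in> {1..J}"
   hence r: "r + (- int (k - 1) - 1) = r - int k" by auto
   have "(-1::complex) ^ J = (-1) ^ (J - k) * (-1) ^ (k - 1) * (-1)"
   proof -
    have "J = (J - k) + (k - 1) + 1" using k by auto
    hence "(-1::complex) ^ J = (-1) ^ ((J - k) + (k - 1) + 1)" by (rule arg_cong)
    thus ?thesis by (simp only: power_add power_one_right)
   qed
   hence "(-1) ^ J * (of_int a' / of_nat (2 * p)) * - of_int a = ((-1) ^ (k - 1) * of_int (a * a' div (2 * int p)) * (-1) ^ (J - k) :: complex)"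
    unfolding dvd_div[OF d, symmetric] by simp
   thus "scale ((-1) ^ J * (of_int a' / of_nat (2 * p))) (?T r (heis p (- int (k - 1) - 1) (cre p a' (int (J - k)) x)))
    = scale ((-1) ^ (k - 1) * of_int (a * a' div (2 * int p))) (f (J - k) (r - int k))"
    by (subst Tp_Z_exp_neg, simp, unfold f_def r pm.scale_scale, simp)
  qed
  finally show ?thesis .
 qed
 from euler_seq[of f, OF this] have "f J M = scale (bc (a * a' div (2 * int p)) J) (f 0 (M - int J))" .
 hence "scale ((-1) ^ J) (f J M) = scale ((-1) ^ J) (scale (bc (a * a' div (2 * int p)) J) (?T (M - int J) x))"
  by (simp add: f_def)
 thus ?thesis by (simp add: f_def flip: power_add)
qed

lemma Tp_Z_exp_top:
 assumes d: "2 * int p dvd a * b"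
 shows "Tp c (Z p (st {#} a) M (st {#} b)) = (if M = - 1 - a * b div (2 * int p) then Tp c (st {#} (a + b)) else 0)"
proof (cases "M = - 1 - a * b div (2 * int p)")
 case False
 have "hm (- M - 1 - a * b div (2 * int p)) (a + b) (Z p (st {#} a) M (st {#} b))"
  using Z_hm_st[OF p hm_st[of "{#}" b], of "{#}" M a] by simp
 thus ?thesis using False Tp_hm by auto
qed (simp add: Z_exp em_top[OF p d])

text \<open>By now \<open>u\<close> is an exponential, so \<alpha>(-j-1) passes it with a single
  correction term; this lowers \<open>n\<close>, and the oscillator acting on the top vector lowers
  \<open>k\<close>.\<close>

lemma recBD_v:
 "Tp c (BD p (st {#} a) (heis p (- int j - 1) v) (st {#} b) m k n)
  = scale ((-1) ^ j * of_int b) (Tp c (BD p (st {#} a) v (st {#} b) m (k - int j - 1) n))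
  - scale (of_int a) (Tp c (BD p (st {#} a) v (st {#} b) m k (n - int j - 1)))"
proof -
 let ?e = "st {#} b" and ?u = "st {#} a"
 let ?E = "%x r. Tp c (Z p x r ?e)"
 have Elin: "lin (%x. ?E x r)" for r by (rule lin_comp[OF Tp_lin Z_lin1])
 note Tl = lin_comp[OF Tp_lin Z_lin2[OF p]]
 have b1: "Tp c (B1 p ?u (heis p (- int j - 1) v) ?e m k n) = scale ((-1) ^ j * of_int b) (Tp c (B1 p ?u v ?e m (k - int j - 1) n))
   - scale (of_int a) (Tp c (B1 p ?u v ?e m k (n - int j - 1)))"
 proof -
  have ez1: "ez (%s. scale (bc m s) (?E (Z p ?u (n' + int s) v) (f s)))" for n' f
   by (rule ez_scale, rule ez_lin[where T = "%s x. ?E x (f s)", OF Elin], rule Z_ez[OF p]) simp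
  have "scale (bc m s) (?E (Z p ?u (n + int s) (heis p (- int j - 1) v)) (m + k - int s))
    = scale ((-1) ^ j * of_int b) (scale (bc m s) (?E (Z p ?u (n + int s) v) (m + (k - int j - 1) - int s)))
    - scale (of_int a) (scale (bc m s) (?E (Z p ?u (n - int j - 1 + int s) v) (m + k - int s)))" for s
  proof -
   have h: "Z p ?u (n + int s) (heis p (- int j - 1) v) = heis p (- int j - 1) (Z p ?u (n + int s) v) - scale (of_int a) (Z p ?u (n - int j - 1 + int s) v)"
    by (simp add: Z_exp em_comm[OF p] algebra_simps)
   have a: "m + k - int s - int j - 1 = m + (k - int j - 1) - int s" by simp
   show ?thesis unfolding h lin_diff[OF Elin] lin_scale[OF Elin] Tp_Z_top_create[OF p] a
    by (simp add: pm.scale_right_diff_distrib mult_ac)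
  qed
  thus ?thesis unfolding Tp_B1[OF p]
   by (simp only: Sum_any_sub[OF ez_scale[OF ez1] ez_scale[OF ez1]] Sum_any_scale[OF ez1])
 qed
 have b2: "Tp c (B2 p ?u (heis p (- int j - 1) v) ?e m k n) = scale ((-1) ^ j * of_int b) (Tp c (B2 p ?u v ?e m (k - int j - 1) n))
   - scale (of_int a) (Tp c (B2 p ?u v ?e m k (n - int j - 1)))"
 proof -
  define g where "g = (%J. Tp c (Z p ?u (m + n - 1 - int J) (Z p v (k - int j + int J) ?e)))"
  have gez: "ez g" unfolding g_def by (rule TZZ_ez[OF p])
  have 1: "Tp c (Z p ?u (m + n - int s) (Z p (heis p (- int j - 1) v) (k + int s) ?e))
   = scale ((-1) ^ j * of_int b) (Tp c (Z p ?u (m + n - int s) (Z p v (k - int j - 1 + int s) ?e)))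
   - scale (of_int a) (Sum_any (%q. scale (bc (int q) j) (g (s + q))))" for s
  proof -
   have m: "k + int s - int j - 1 = k - int j - 1 + int s" by simp
   have x: "scale (bc (int q) j) (Tp c (Z p ?u (m + n - int s) (heis p (- int q - 1) (Z p v (k + int s - int j + int q) ?e)))) = scale (- of_int a) (scale (bc (int q) j) (g (s + q)))" for q
   proof -
    have a: "m + n - int s + (- int q - 1) = m + n - 1 - int (s + q)" "k + int s - int j + int q = k - int j + int (s + q)" by simp_all
    show ?thesis by (subst Tp_Z_exp_neg, simp, unfold a g_def, simp add: mult_ac)
   qed
   show ?thesis unfolding Z_create_top[OF p] lin_add[OF Tl] lin_scale[OF Tl] Sum_any_lin[OF Tl Z_create_top_ez[OF p]] m
    unfolding x Sum_any_scale[OF ez_scale[OF ez_shift'[OF gez]], symmetric]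
    by (simp add: pm.scale_minus_left)
  qed
  define h where "h = (%s. scale ((-1) ^ s * bc n s) (Sum_any (%q. scale (bc (int q) j) (g (s + q)))))"
  have hez: "ez h"
  proof -
   obtain N where N: "!!J. J >= N ==> g J = 0" using gez by (auto simp: ez_def)
   show ?thesis unfolding h_def by (rule ezI[of N]) (simp add: N)
  qed
  have e1: "ez (%s. scale ((-1) ^ s * bc n s) (Tp c (Z p ?u (m + n - int s) (Z p v (k - int j - 1 + int s) ?e))))"
   by (intro ez_scale TZZ_ez[OF p])
  have F: "Tp c (B2 p ?u (heis p (- int j - 1) v) ?e m k n) = scale ((-1) ^ j * of_int b) (Tp c (B2 p ?u v ?e m (k - int j - 1) n)) - scale (of_int a) (Sum_any h)"
   unfolding Tp_B2[OF p] 1 Sum_any_scale[OF hez] Sum_any_scale[OF e1] Sum_any_sub[OF ez_scale[OF e1] ez_scale[OF hez], symmetric]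
   unfolding h_def by (simp only: pm.scale_right_diff_distrib pm.scale_left_commute)
  have a: "m + n - 1 - int (j + q) = m + (n - int j - 1) - int q" "k - int j + int (j + q) = k + int q" for q by simp_all
  have H: "Sum_any h = Tp c (B2 p ?u v ?e m k (n - int j - 1))"
   unfolding h_def conv_top0[OF p gez] Tp_B2[OF p] unfolding g_def a ..
  show ?thesis unfolding F H ..
 qed
 have b3: "Tp c (B3 p ?u (heis p (- int j - 1) v) ?e m k n) = scale ((-1) ^ j * of_int b) (Tp c (B3 p ?u v ?e m (k - int j - 1) n))
   + scale (of_int a * (-1) ^ j) (Tp c (B3 p ?u v ?e m k (n - int j - 1)))"
 proof -
  define g where "g = (%J. Tp c (Z p v (n + k - int j - 1 - int J) (Z p ?u (m + int J) ?e)))"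
  have gez: "ez g" unfolding g_def by (rule TZZ_ez[OF p])
  have 1: "Tp c (Z p (heis p (- int j - 1) v) (n + k - int s) (Z p ?u (m + int s) ?e))
   = scale ((-1) ^ j * of_int b) (Tp c (Z p v (n + (k - int j - 1) - int s) (Z p ?u (m + int s) ?e)))
   + scale (of_int a) (Sum_any (%q. scale (bc (- int q - 1) j * bc (int q) 0) (g (s + q))))" for s
  proof -
   let ?d = "%q::nat. if q = 0 then scale ((-1) ^ j * of_int b) (Tp c (Z p v (n + (k - int j - 1) - int s) (Z p ?u (m + int s) ?e))) else 0"
   have "scale (bc (- int q - 1) j) (Tp c (Z p v (n + k - int s - int j - 1 - int q) (heis p (int q) (Z p ?u (m + int s) ?e))))
    = ?d q + scale (of_int a) (scale (bc (- int q - 1) j * bc (int q) 0) (g (s + q)))" for q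
   proof -
    have a: "n + k - int s - int j - 1 - int q = n + k - int j - 1 - int (s + q)" "m + int s + int q = m + int (s + q)" by simp_all
    have a': "n + (k - int j - 1) - int s = n + k - int j - 1 - int (s + 0)" by simp
    have h: "heis p (int q) (Z p ?u (m + int s) ?e) = (if q = 0 then scale (of_int b) (Z p ?u (m + int s) ?e) else 0) + scale (of_int a) (Z p ?u (m + int (s + q)) ?e)"
     unfolding Z_exp em_comm[OF p] heis_top[OF p] by (simp add: lin_scale[OF em_lin] lin_0[OF em_lin] add.assoc)
    show ?thesis unfolding h a a' lin_add[OF Tl] g_def lin_scale[OF Tl] using bc_m1[OF p, of j]
     by (cases "q = 0") (simp_all add: lin_scale[OF Tl] lin_0[OF Tl] pm.scale_right_distrib mult_ac)
   qed
   hence "Tp c (Z p (heis p (- int j - 1) v) (n + k - int s) (Z p ?u (m + int s) ?e)) = Sum_any (%q. ?d q + scale (of_int a) (scale (bc (- int q - 1) j * bc (int q) 0) (g (s + q))))"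
    unfolding Tp_Z_create[OF p] by simp
   also have "... = Sum_any ?d + Sum_any (%q. scale (of_int a) (scale (bc (- int q - 1) j * bc (int q) 0) (g (s + q))))"
    by (rule Sum_any_add, rule ezI[of 1], simp, intro ez_scale ez_shift'[OF gez])
   also have "Sum_any ?d = ?d 0" by (rule Sum_any_single) simp
   finally show ?thesis by (simp only: Sum_any_scale[OF ez_scale[OF ez_shift'[OF gez]]] if_True simp_thms)
  qed
  define h where "h = (%s. scale ((-1) ^ s * bc n s) (Sum_any (%q. scale (bc (- int q - 1) j * bc (int q) 0) (g (s + q)))))"
  have hez: "ez h"
  proof -
   obtain N where N: "!!J. J >= N ==> g J = 0" using gez by (auto simp: ez_def)
   show ?thesis unfolding h_def by (rule ezI[of N]) (simp add: N)
  qed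
  have e1: "ez (%s. scale ((-1) ^ s * bc n s) (Tp c (Z p v (n + (k - int j - 1) - int s) (Z p ?u (m + int s) ?e))))"
   by (intro ez_scale TZZ_ez[OF p])
  have F: "Tp c (B3 p ?u (heis p (- int j - 1) v) ?e m k n) = scale ((-1) ^ j * of_int b) (Tp c (B3 p ?u v ?e m (k - int j - 1) n)) + scale (of_int a) (Sum_any h)"
   unfolding Tp_B3[OF p] 1 Sum_any_scale[OF hez] Sum_any_scale[OF e1] Sum_any_add[OF ez_scale[OF e1] ez_scale[OF hez], symmetric]
   unfolding h_def by (simp only: pm.scale_right_distrib pm.scale_left_commute)
  have a: "n + k - int j - 1 - int (0 + q) = n - int j - 1 + k - int q" "m + int (0 + q) = m + int q" "n - int j - int 0 - 1 = n - int j - 1" "- int 0 - 1 = - 1" for q by simp_all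
  have H: "Sum_any h = scale ((-1) ^ j) (Tp c (B3 p ?u v ?e m k (n - int j - 1)))"
   unfolding h_def conv_top[OF p gez] Tp_B3[OF p] unfolding g_def a bc_m1[OF p] ..
  show ?thesis unfolding F H by simp
 qed
 have s: "sg n * (of_int a * (-1) ^ j) = - (of_int a * sg (n - int j - 1))"
  using sg_diff[of n "Suc j"] by (simp add: diff_diff_eq add.commute)
 show ?thesis unfolding BD_def Tp_add Tp_diff Tp_scale b1 b2 b3
   pm.scale_right_diff_distrib pm.scale_right_distrib pm.scale_scale s
  by (simp add: pm.scale_minus_left mult_ac)
qed

text \<open>The residue theorem for \<open>t^x (t-1)^z dt\<close> on the projective line. The three
  terms belong to the points 1, infinity and 0; because \<open>x + y + z = - 2\<close>, the exponent
  \<open>y\<close> plays at infinity the part of \<open>x\<close> at 0.\<close>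

lemma residue_identity:
 assumes "x + y + z = - 2"
 shows "(if z < 0 then bc x (nat (- z - 1)) else 0)
  = (if y < 0 then (-1) ^ nat (- y - 1) * bc z (nat (- y - 1)) else 0)
  - sg z * (if x < 0 then (-1) ^ nat (- x - 1) * bc z (nat (- x - 1)) else 0)"
proof (cases "z >= 0")
 case True
 then obtain Zn where z: "z = int Zn" using nonneg_eq_int by blast
 show ?thesis
 proof (cases "x >= 0")
  case True
  hence "y < 0" "nat (- y - 1) > Zn" using assms z by auto
  thus ?thesis using True z bc_nat[of Zn "nat (- y - 1)"] by (simp add: binomial_eq_0)
 next
  case False
  define t where "t = nat (- x - 1)"
  have t: "x = - int t - 1" using False by (simp add: t_def)
  show ?thesis
  proof (cases "t <= Zn")
   case True
   have y: "y = - int (Zn - t) - 1" using assms z t True by (simp add: of_nat_diff)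
   have "(Zn choose (Zn - t)) = (Zn choose t)" using binomial_symmetric[OF True] by simp
   moreover have "(-1::complex) ^ (Zn - t) = sg z * (-1) ^ t" unfolding z sg_def using True
    by (auto simp: minus_one_power_iff)
   ultimately show ?thesis unfolding z t y using bc_nat[of Zn] by simp
  next
   case False
   hence "y >= 0" using assms z t by simp
   thus ?thesis unfolding z t using bc_nat[of Zn t] False by (simp add: binomial_eq_0)
  qed
 qed
next
 case False
 define Zn where "Zn = nat (- z - 1)"
 have z: "z = - int Zn - 1" using False by (simp add: Zn_def)
 have sz: "sg z = - ((-1) ^ Zn)" unfolding z sg_def by (auto simp: minus_one_power_iff)
 have neg: "(-1) ^ t * bc z t = of_nat (Zn + t choose t)" for t
  unfolding z bc_neg by (simp flip: mult.assoc power_add)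
 show ?thesis
 proof (cases "y < 0")
  case y: True
  define t where "t = nat (- y - 1)"
  have t: "y = - int t - 1" "x = int (Zn + t)" using y assms z by (auto simp: t_def)
  have zn: "nat (- z - 1) = Zn" "z < 0" "\<not> x < 0" using z t by auto
  have "(Zn + t choose t) = (Zn + t choose Zn)" using binomial_symmetric[of t "Zn + t"] by simp
  thus ?thesis using y zn neg[of t] bc_nat[of "Zn + t" Zn] unfolding t_def[symmetric] t(2) by simp
 next
  case y: False
  show ?thesis
  proof (cases "x < 0")
   case x: True
   define t where "t = nat (- x - 1)"
   have t: "x = - int t - 1" using x by (simp add: t_def)
   have "(t + Zn choose Zn) = (Zn + t choose t)" using binomial_symmetric[of t "Zn + t"] by (simp add: add.commute)
   hence "bc x Zn = (-1) ^ Zn * of_nat (Zn + t choose t)" unfolding t bc_neg by simp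
   thus ?thesis using x y False neg[of t] unfolding sz by (simp add: Zn_def[symmetric] t_def[symmetric])
  next
   case x: False
   then obtain X where X: "x = int X" using nonneg_eq_int by (metis not_less)
   have "X < Zn" using X x y assms z by simp
   thus ?thesis using x y False bc_nat[of X Zn] by (simp add: Zn_def[symmetric] X binomial_eq_0)
  qed
 qed
qed

end

section \<open>The identity for exponentials and for arbitrary vectors\<close>

context
 fixes p :: nat
 assumes p: "p > 0"
begin

text \<open>The inner product is a creation coefficient on a top vector, and its top coefficient
  under the outer exponential is a binomial coefficient; Vandermonde adds the exponent
  \<open>aa'/2p\<close> to \<open>n\<close>.\<close>

lemma B2_top_exp:
 assumes d: "2 * int p dvd a * b" "2 * int p dvd a' * b" "2 * int p dvd a * a'"
 shows "Tp c (B2 p (st {#} a) (st {#} a') (st {#} b) m k n) =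
  (if m + k + n = - 2 - a * b div (2 * int p) - a' * b div (2 * int p) - a * a' div (2 * int p) \<and> k + a' * b div (2 * int p) < 0
   then scale ((-1) ^ nat (- (k + a' * b div (2 * int p)) - 1) * bc (n + a * a' div (2 * int p)) (nat (- (k + a' * b div (2 * int p)) - 1))) (Tp c (st {#} (a + a' + b))) else 0)"
proof -
 define A A' B where AB: "A = a * b div (2 * int p)" "A' = a' * b div (2 * int p)" "B = a * a' div (2 * int p)"
 let ?X = "Tp c (st {#} (a + a' + b))"
 let ?cond = "m + k + n = - 2 - A - A' - B"
 have dd: "2 * int p dvd a * (a' + b)" using d by (simp add: distrib_left)
 have BA: "a * (a' + b) div (2 * int p) = B + A" using d by (simp add: AB distrib_left div_plus_div_distrib_dvd_left)
 have t: "Tp c (Z p (st {#} a) (m + n - int s) (Z p (st {#} a') (k + int s) (st {#} b)))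
  = (if ?cond \<and> int s <= - (k + A') - 1 then scale ((-1) ^ nat (- (k + A') - 1 - int s) * bc B (nat (- (k + A') - 1 - int s))) ?X else 0)" for s
 proof -
  have e: "Z p (st {#} a') (k + int s) (st {#} b) = cre p a' (- (k + A') - 1 - int s) (st {#} (a' + b))"
   using em_top[OF p d(2), of "k + int s"] by (simp add: Z_exp AB algebra_simps)
  show ?thesis
  proof (cases "int s <= - (k + A') - 1")
   case True
   define J where "J = nat (- (k + A') - 1 - int s)"
   have J: "- (k + A') - 1 - int s = int J" using True by (simp add: J_def)
   have "m + n - int s - int J = - 1 - (B + A) \<longleftrightarrow> ?cond" using J by linarith
   thus ?thesis unfolding e J Tp_Z_exp_cre[OF p d(3)] Tp_Z_exp_top[OF p dd] BA using True by (simp add: AB(3)[symmetric] add_ac)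
  next
   case False
   thus ?thesis unfolding e by (simp add: cre_def lin_0[OF Z_lin2[OF p]] Tp_0)
  qed
 qed
 show ?thesis
 proof (cases "?cond \<and> k + A' < 0")
  case True
  define J where "J = nat (- (k + A') - 1)"
  have J: "- (k + A') - 1 = int J" using True by (simp add: J_def)
  have t': "Tp c (Z p (st {#} a) (m + n - int s) (Z p (st {#} a') (k + int s) (st {#} b))) = (if s <= J then scale ((-1) ^ (J - s) * bc B (J - s)) ?X else 0)" for s
   unfolding t J using True by (auto simp: of_nat_diff nat_diff_distrib)
  have "Tp c (B2 p (st {#} a) (st {#} a') (st {#} b) m k n) = (\<Sum>s<Suc J. scale ((-1) ^ s * bc n s) (if s <= J then scale ((-1) ^ (J - s) * bc B (J - s)) ?X else 0))"
   unfolding Tp_B2[OF p] t' by (rule Sum_any_lessThan) auto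
  also have "... = (\<Sum>s\<le>J. scale ((-1) ^ J * (bc n s * bc B (J - s))) ?X)"
   unfolding lessThan_Suc_atMost
  proof (intro sum.cong refl)
   fix s assume "s \<in> {..J}"
   thus "scale ((-1) ^ s * bc n s) (if s <= J then scale ((-1) ^ (J - s) * bc B (J - s)) ?X else 0) = scale ((-1) ^ J * (bc n s * bc B (J - s))) ?X"
    by (auto simp: minus_one_power_iff)
  qed
  also have "... = scale ((-1) ^ J * bc (n + B) J) ?X"
   by (simp only: pm.scale_sum_left[symmetric] sum_distrib_left[symmetric] bc_Vandermonde)
  finally show ?thesis unfolding AB[symmetric] J using True by simp
 next
  case False
  hence "Tp c (Z p (st {#} a) (m + n - int s) (Z p (st {#} a') (k + int s) (st {#} b))) = 0" for s
   unfolding t by auto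
  thus ?thesis unfolding AB[symmetric] Tp_B2[OF p] using False by auto
 qed
qed

lemma B3_B2: "B3 p u v w m k n = B2 p v u w k m n"
 by (simp add: B3_def B2_def add.commute)

lemma B1_top_exp:
 assumes d: "2 * int p dvd a * b" "2 * int p dvd a' * b" "2 * int p dvd a * a'"
 shows "Tp c (B1 p (st {#} a) (st {#} a') (st {#} b) m k n) =
  (if m + k + n = - 2 - a * b div (2 * int p) - a' * b div (2 * int p) - a * a' div (2 * int p) \<and> n + a * a' div (2 * int p) < 0
   then scale (bc (m + a * b div (2 * int p)) (nat (- (n + a * a' div (2 * int p)) - 1))) (Tp c (st {#} (a + a' + b))) else 0)"
proof -
 define A A' B where AB: "A = a * b div (2 * int p)" "A' = a' * b div (2 * int p)" "B = a * a' div (2 * int p)"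
 let ?X = "Tp c (st {#} (a + a' + b))"
 let ?cond = "m + k + n = - 2 - A - A' - B"
 have dd: "2 * int p dvd (a + a') * b" using d by (simp add: distrib_right)
 have BA: "(a + a') * b div (2 * int p) = A + A'" using d by (simp add: AB distrib_right div_plus_div_distrib_dvd_left)
 have t: "Tp c (Z p (Z p (st {#} a) (n + int s) (st {#} a')) (m + k - int s) (st {#} b))
  = (if ?cond \<and> int s <= - (n + B) - 1 then scale (bc A (nat (- (n + B) - 1 - int s))) ?X else 0)" for s
 proof -
  have e: "Z p (st {#} a) (n + int s) (st {#} a') = cre p a (- (n + B) - 1 - int s) (st {#} (a + a'))"
   using em_top[OF p d(3), of "n + int s"] by (simp add: Z_exp AB algebra_simps)
  show ?thesis
  proof (cases "int s <= - (n + B) - 1")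
   case True
   define J where "J = nat (- (n + B) - 1 - int s)"
   have J: "- (n + B) - 1 - int s = int J" using True by (simp add: J_def)
   have "m + k - int s - int J = - 1 - (A + A') \<longleftrightarrow> ?cond" using J by linarith
   thus ?thesis unfolding e J Tp_Z_cre[OF p d(1)] Tp_Z_exp_top[OF p dd] BA using True by (simp add: AB(1)[symmetric])
  next
   case False
   thus ?thesis unfolding e by (simp add: cre_def Tp_0)
  qed
 qed
 show ?thesis
 proof (cases "?cond \<and> n + B < 0")
  case True
  define J where "J = nat (- (n + B) - 1)"
  have J: "- (n + B) - 1 = int J" using True by (simp add: J_def)
  have t': "Tp c (Z p (Z p (st {#} a) (n + int s) (st {#} a')) (m + k - int s) (st {#} b)) = (if s <= J then scale (bc A (J - s)) ?X else 0)" for s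
   unfolding t J using True by (auto simp: of_nat_diff nat_diff_distrib)
  have "Tp c (B1 p (st {#} a) (st {#} a') (st {#} b) m k n) = (\<Sum>s<Suc J. scale (bc m s) (if s <= J then scale (bc A (J - s)) ?X else 0))"
   unfolding Tp_B1[OF p] t' by (rule Sum_any_lessThan) auto
  also have "... = (\<Sum>s\<le>J. scale (bc m s * bc A (J - s)) ?X)"
   unfolding lessThan_Suc_atMost by (intro sum.cong refl) auto
  also have "... = scale (bc (m + A) J) ?X"
   by (simp only: pm.scale_sum_left[symmetric] bc_Vandermonde)
  finally show ?thesis unfolding AB[symmetric] J using True by simp
 next
  case False
  hence "Tp c (Z p (Z p (st {#} a) (n + int s) (st {#} a')) (m + k - int s) (st {#} b)) = 0" for s
   unfolding t by auto
  thus ?thesis unfolding AB[symmetric] Tp_B1[OF p] using False by auto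
 qed
qed

lemma BD_top_exp:
 assumes d: "2 * int p dvd a * b" "2 * int p dvd a' * b" "4 * int p dvd a * a'"
 shows "Tp c (BD p (st {#} a) (st {#} a') (st {#} b) m k n) = 0"
proof -
 define A A' B where AB: "A = a * b div (2 * int p)" "A' = a' * b div (2 * int p)" "B = a * a' div (2 * int p)"
 let ?X = "Tp c (st {#} (a + a' + b))"
 obtain q where q: "a * a' = 4 * int p * q" using d(3) by (rule dvdE)
 hence "a * a' = 2 * int p * (2 * q)" by simp
 hence B: "B = 2 * q" and d3: "2 * int p dvd a * a'" using p by (auto simp: AB)
 \<comment> \<open>Divisibility by \<open>4p\<close> makes \<open>aa'/2p\<close> even: the two
   exponentials are mutually bosonic, and no extra sign arises.\<close>
 have sB: "sg (n + B) = sg n" by (simp add: sg_def B)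
 have d3': "2 * int p dvd a' * a" and B': "a' * a div (2 * int p) = B" using d3 by (simp_all add: AB mult.commute)
 have X': "Tp c (st {#} (a' + a + b)) = ?X" by (simp add: add_ac)
 show ?thesis
 proof (cases "m + k + n = - 2 - A - A' - B")
  case True
  hence "(m + A) + (k + A') + (n + B) = - 2" by simp
  from residue_identity[OF p this] have R:
   "(if n + B < 0 then bc (m + A) (nat (- (n + B) - 1)) else 0)
   - (if k + A' < 0 then (-1) ^ nat (- (k + A') - 1) * bc (n + B) (nat (- (k + A') - 1)) else 0)
   + sg n * (if m + A < 0 then (-1) ^ nat (- (m + A) - 1) * bc (n + B) (nat (- (m + A) - 1)) else 0) = 0"
   unfolding sB by simp
  have c2: "k + m + n = - 2 - A' - A - B" using True by simp
  have "Tp c (BD p (st {#} a) (st {#} a') (st {#} b) m k n)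
   = scale ((if n + B < 0 then bc (m + A) (nat (- (n + B) - 1)) else 0)
   - (if k + A' < 0 then (-1) ^ nat (- (k + A') - 1) * bc (n + B) (nat (- (k + A') - 1)) else 0)
   + sg n * (if m + A < 0 then (-1) ^ nat (- (m + A) - 1) * bc (n + B) (nat (- (m + A) - 1)) else 0)) ?X"
   unfolding BD_def Tp_add Tp_diff Tp_scale B1_top_exp[OF d(1,2) d3] B2_top_exp[OF d(1,2) d3]
    B3_B2 B2_top_exp[OF d(2,1) d3'] B' AB[symmetric] X' using True c2
   by (auto simp: pm.scale_left_distrib pm.scale_left_diff_distrib)
  thus ?thesis unfolding R by simp
 next
  case False
  hence "k + m + n ~= - 2 - A' - A - B" by simp
  thus ?thesis using False
   unfolding BD_def Tp_add Tp_diff Tp_scale B1_top_exp[OF d(1,2) d3] B2_top_exp[OF d(1,2) d3]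
    B3_B2 B2_top_exp[OF d(2,1) d3'] B' AB[symmetric] X' by simp
 qed
qed

text \<open>\<open>recBD\<close> removes the oscillators of \<open>u\<close>, then
  \<open>recBD_v\<close> those of \<open>v\<close>, until three exponentials remain.\<close>

lemma BD_top:
 assumes d: "2 * int p dvd a * b" "2 * int p dvd a' * b" "4 * int p dvd a * a'"
  and u: "ch a u" and v: "ch a' v"
 shows "Tp c (BD p u v (st {#} b) m k n) = 0"
proof -
 have 1: "Tp c (BD p (st {#} a) (st N a') (st {#} b) m k n) = 0" for N m k n
 proof (induction N arbitrary: m k n)
  case empty thus ?case by (rule BD_top_exp[OF d])
 next
  case (add j N) thus ?case unfolding heis_create[of p, symmetric] recBD_v[OF p] by simp
 qed
 have 2: "Tp c (BD p (st {#} a) v (st {#} b) m k n) = 0" if "ch a' v" for v m k n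
  by (rule ch_eq[OF that lin_comp[OF Tp_lin BD_lin(2)[OF p]] lin_zero]) (rule 1)
 have 3: "Tp c (BD p (st M a) v (st {#} b) m k n) = 0" if "ch a' v" for v m k n M
  using that
 proof (induction M arbitrary: v m k n)
  case empty thus ?case by (rule 2)
 next
  case (add i M)
  obtain J where J: "!!j. j >= J ==> heis p (int j) v = 0" using heis_ez[of p v] unfolding ez_def by blast
  hence J: "\<forall>j\<ge>J. heis p (int j) v = 0" by blast
  show ?case unfolding heis_create[of p, symmetric] recBD[OF p J] by (simp add: add.IH add.prems ch_heis)
 qed
 show ?thesis by (rule ch_eq[OF u lin_comp[OF Tp_lin BD_lin(3)[OF p]] lin_zero]) (rule 3[OF v])
qed

text \<open>Stated in terms of charges rather than for a subspace, so that it also applies to the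
  screening vector \<open>e^{-\<alpha>/p}\<close>, which lies outside of \<open>V_L\<close>.\<close>

theorem borcherds:
 assumes "ch a u" "ch a' v" "ch b w"
  and d: "2 * int p dvd a * b" "2 * int p dvd a' * b" "4 * int p dvd a * a'"
 shows "B1 p u v w m k n = B2 p u v w m k n - scale (sg n) (B3 p u v w m k n)"
proof -
 have "BD p u v w m k n = 0"
  by (rule BD_zero[OF p _ assms(1-3)]) (use BD_top[OF d] Tp_0_iff in blast)
 thus ?thesis by (simp add: BD_def algebra_simps)
qed

end

section \<open>The lattice vertex algebra\<close>

locale lat =
 fixes p :: nat
 assumes pge: "2 <= p"
begin

lemma p0: "p > 0" using pge by simp

abbreviation "pp \<equiv> 2 * int p"
abbreviation "Y \<equiv> Z p"
abbreviation "h \<equiv> heis p"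
abbreviation one :: fock where "one \<equiv> st {#} 0"

lemmas Y_lin = Z_lin2[OF p0]
lemmas Y_0 = lin_0[OF Y_lin] and Y_scale = lin_scale[OF Y_lin]

definition VL :: "fock set" where "VL = {v. \<forall>(M, b)\<in>keys v. pp dvd b}"

lemma VL_lookup: "v \<in> VL \<longleftrightarrow> (\<forall>M b. lookup v (M, b) ~= 0 \<longrightarrow> pp dvd b)"
 by (auto simp: VL_def in_keys_iff)

lemma VL_0 [simp]: "0 \<in> VL" by (simp add: VL_lookup)
lemma VL_scale: "v \<in> VL ==> scale c v \<in> VL" by (auto simp: VL_lookup lookup_scale)
lemma VL_add: "v \<in> VL ==> w \<in> VL ==> v + w \<in> VL"
 unfolding VL_lookup lookup_add by (metis add.right_neutral)
lemma VL_sum: "(!!x. x \<in> A ==> f x \<in> VL) ==> sum f A \<in> VL"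
 by (induction A rule: infinite_finite_induct) (auto intro: VL_add)
lemma VL_st: "pp dvd b ==> st M b \<in> VL" by (simp add: VL_lookup lookup_single when_def)
lemma VL_ch: "ch (pp * k) v ==> v \<in> VL" unfolding VL_lookup ch_def by (metis dvd_triv_left)

lemma VL_eq:
 assumes "v \<in> VL" "lin f" "lin g" "!!M b. pp dvd b ==> f (st M b) = g (st M b)"
 shows "f v = g v"
proof (rule lin_eq_on[OF assms(2,3)])
 fix k assume *: "k \<in> keys v"
 obtain M c where k: "k = (M, c)" by force
 hence "pp dvd c" using assms(1) * unfolding VL_def by auto
 thus "f (single k 1) = g (single k 1)" using assms(4)[of c M] k by simp
qed

lemma VL_lin:
 assumes "v \<in> VL" "lin f" "!!M b. pp dvd b ==> f (st M b) \<in> VL"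
 shows "f v \<in> VL"
proof -
 have "f v = (\<Sum>k\<in>keys v. scale (lookup v k) (f (single k 1)))"
  by (subst poly_mapping_decomp[of v]) (simp add: lin_sum[OF assms(2)] lin_scale[OF assms(2)])
 moreover have "f (single k 1) \<in> VL" if "k \<in> keys v" for k
 proof -
  obtain M c where k: "k = (M, c)" by force
  hence "pp dvd c" using assms(1) that unfolding VL_def by auto
  thus ?thesis using assms(3)[of c M] k by simp
 qed
 ultimately show ?thesis by (simp add: VL_sum VL_scale)
qed

lemma VL_Y: assumes "u \<in> VL" "v \<in> VL" shows "Y u n v \<in> VL"
proof (rule VL_lin[OF assms(1) Z_lin1])
 fix M b assume b: "pp dvd b"
 show "Y (st M b) n v \<in> VL"
 proof (rule VL_lin[OF assms(2) Y_lin])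
  fix N c assume c: "pp dvd c"
  have "ch (b + c) (Y (st M b) n (st N c))" by (rule ch_Z[OF p0 ch_st ch_st])
  moreover have "pp dvd b + c" using b c by simp
  ultimately show "Y (st M b) n (st N c) \<in> VL" by (auto simp: VL_lookup ch_def)
 qed
qed

text \<open>The third argument is arbitrary, since a charge from \<open>V_L\<close> times any charge
  is divisible by \<open>2p\<close>. Thus \<open>W(p)\<close> also acts on the vectors
  \<open>e^{b\<alpha>/2p}\<close> that carry the evaluations.\<close>

theorem borcherds_VL:
 assumes u: "u \<in> VL" and v: "v \<in> VL"
 shows "B1 p u v w m k n = B2 p u v w m k n - scale (sg n) (B3 p u v w m k n)"
proof -
 have 1: "BD p (st M a) (st N a') (single x 1) m k n = 0" if a: "pp dvd a" "pp dvd a'" for M a N a' x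
 proof -
  obtain K b where x: "x = (K, b)" by force
  have "4 * int p dvd a * a'"
  proof -
   obtain s t where "a = pp * s" "a' = pp * t" using a by (auto elim!: dvdE)
   hence "a * a' = 4 * int p * (int p * s * t)" by simp
   thus ?thesis by simp
  qed
  hence "B1 p (st M a) (st N a') (st K b) m k n = B2 p (st M a) (st N a') (st K b) m k n - scale (sg n) (B3 p (st M a) (st N a') (st K b) m k n)"
   by (intro borcherds[OF p0 ch_st ch_st ch_st]) (use a in auto)
  thus ?thesis by (simp add: x BD_def)
 qed
 have 2: "BD p (st M a) (st N a') w m k n = 0" if a: "pp dvd a" "pp dvd a'" for M a N a'
  by (rule lin_eqI[OF BD_lin(1)[OF p0] lin_zero]) (rule 1[OF a])
 have 3: "BD p (st M a) v w m k n = 0" if a: "pp dvd a" for M a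
  by (rule VL_eq[OF v BD_lin(2)[OF p0] lin_zero]) (rule 2[OF a])
 have "BD p u v w m k n = 0"
  by (rule VL_eq[OF u BD_lin(3)[OF p0] lin_zero]) (rule 3)
 thus ?thesis by (simp add: BD_def algebra_simps)
qed

lemma bc_0: "bc 0 j = (if j = 0 then 1 else 0)"
 by (cases j) auto

lemma B1_0: "B1 p u v w 0 k n = Y (Y u n v) k w"
 unfolding B1_def by (subst Sum_any_single[of 0]) (auto simp: bc_0 simp del: of_int_0)

lemma B2_0: "B2 p u v w m k 0 = Y u m (Y v k w)" and B3_0: "B3 p u v w m k 0 = Y v k (Y u m w)"
 unfolding B2_def B3_def by (subst Sum_any_single[of 0]; auto simp: bc_0 simp del: of_int_0)+

lemma Y_comm:
 assumes "u \<in> VL" "v \<in> VL"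
 shows "Y u m (Y v k w) = Y v k (Y u m w) + Sum_any (%j. scale (bc m j) (Y (Y u (int j) v) (m + k - int j) w))"
 using borcherds_VL[OF assms, of w m k 0] unfolding B2_0 B3_0 by (simp add: B1_def sg_def)

lemma Y_iter:
 assumes "u \<in> VL" "v \<in> VL"
 shows "Y (Y u n v) k w = Sum_any (%j. scale ((-1) ^ j * bc n j) (Y u (n - int j) (Y v (k + int j) w)))
   - scale (sg n) (Sum_any (%j. scale ((-1) ^ j * bc n j) (Y v (n + k - int j) (Y u (int j) w))))"
 using borcherds_VL[OF assms, of w 0 k n] unfolding B1_0 by (simp add: B2_def B3_def)

lemma Y_ez1: "ez (%j. scale (c j) (Y u (n + int j) v))"
 by (rule ez_scale, rule Z_ez[OF p0]) simp

subsection \<open>The vacuum\<close>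

lemma exp_coeff_zero: "(!!k v. X k v = 0) ==> exp_coeff X n v = (if n = 0 then v else 0)"
proof -
 assume X: "!!k v. X k v = 0"
 have "epw X l n v = (if l = 0 \<and> n = 0 then v else 0)" for l by (cases l) (auto simp: X)
 moreover have "lin (X k)" for k unfolding lin_def by (simp add: X)
 ultimately have "exp_coeff X n v = (\<Sum>l\<le>n. scale (1 / fact l) (if l = 0 \<and> n = 0 then v else 0))"
  using exp_coeff_epw[of X n n v] by simp
 also have "... = (if n = 0 then v else 0)" by (auto intro: sum.neutral)
 finally show ?thesis .
qed

lemma cre_zero: "cre p 0 j v = (if j = 0 then v else 0)" and ann_zero: "ann p 0 j v = (if j = 0 then v else 0)"
 unfolding cre_def ann_def by (subst exp_coeff_zero; auto simp: crx_def anx_def)+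

lemma Y_one: "Y one n v = (if n = - 1 then v else 0)"
proof (rule lin_eqI[of "%v. Y one n v" "%v. if n = - 1 then v else 0"])
 show "lin (Y one n)" by (rule Y_lin)
 show "lin (%v. if n = - 1 then v else 0)" by (cases "n = - 1") (simp_all add: lin_id lin_zero)
 fix x :: "nat multiset \<times> int"
 obtain M b where x: "x = (M, b)" by force
 show "Y one n (single x 1) = (if n = - 1 then single x 1 else 0)"
  unfolding x Z_exp using em_st[OF p0, of 0 n M b]
  by (auto simp: em'_def cre_zero ann_zero Sum_any_single[of 0])
qed

lemma Y_alpha: "Y (st {#0#} 0) n v = h n v"
proof -
 have "Y (st {#0#} 0) n v = Sum_any (nopt p 0 (Y one) n v)"
  using Z_st_add[OF p0, of 0 "{#}" 0] by (simp add: nop_def)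
 also have "... = nopt p 0 (Y one) n v n"
  by (rule Sum_any_single) (auto simp: nopt_def Y_one heis_0)
 also have "... = h n v" by (simp add: nopt_def Y_one)
 finally show ?thesis .
qed

lemma Y_dalpha: "Y (st {#1#} 0) n v = scale (- of_int n) (h (n - 1) v)"
proof -
 have "Y (st {#1#} 0) n v = Sum_any (nopt p 1 (Y one) n v)"
  using Z_st_add[OF p0, of 1 "{#}" 0] by (simp add: nop_def)
 also have "... = nopt p 1 (Y one) n v (n - 1)"
  by (rule Sum_any_single) (auto simp: nopt_def Y_one heis_0)
 also have "... = scale (- of_int n) (h (n - 1) v)" by (simp add: nopt_def Y_one)
 finally show ?thesis .
qed

subsection \<open>The Virasoro element\<close>

definition om :: fock where
 "om = scale (1 / (4 * of_nat p)) (st {#0, 0#} 0) + scale ((of_nat p - 1) / (2 * of_nat p)) (st {#1#} 0)"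

lemma om_VL: "om \<in> VL" unfolding om_def by (intro VL_add VL_scale VL_st) auto
lemma one_VL: "one \<in> VL" by (intro VL_st) auto

lemma om_hm: "hm 2 0 om"
 unfolding om_def using hm_st[of "{#0,0#}" 0] hm_st[of "{#1#}" 0] by (auto intro!: hm_add hm_scale)

definition L :: "int => fock => fock" where "L n v = Y om (n + 1) v"

lemma L_lin: "lin (L n)" unfolding L_def[abs_def] by (rule Y_lin)
lemmas L_0 = lin_0[OF L_lin] and L_add = lin_add[OF L_lin] and L_scale = lin_scale[OF L_lin]

lemma h_om: "h 0 om = 0" "h 1 om = st {#0#} 0" "h 2 om = scale (2 * (of_nat p - 1)) one" "j >= 3 ==> h (int j) om = 0"
proof -
 show "h 0 om = 0" using heis_0_hm[OF om_hm] by simp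
 have "h 1 (st {#0, 0#} 0) = scale (4 * of_nat p) (st {#0#} 0)" "h 1 (st {#1#} 0) = 0"
  by (simp_all add: heis_pos)
 thus "h 1 om = st {#0#} 0"
  unfolding om_def heis_add heis_scale using p0 by simp
 have "h 2 (st {#0, 0#} 0) = 0" "h 2 (st {#1#} 0) = scale (4 * of_nat p) one"
  by (simp_all add: heis_pos)
 thus "h 2 om = scale (2 * (of_nat p - 1)) one"
  unfolding om_def heis_add heis_scale using p0 by simp
 show "j >= 3 ==> h (int j) om = 0" by (rule hm_neg[OF heis_hm[OF om_hm]]) auto
qed

text \<open>\<open>heis_Z\<close> applied to \<omega>, where only \<alpha>(1)\<omega> and
  \<alpha>(2)\<omega> are nonzero. The scalar term comes from the summand \<alpha>(-2) of \<omega>,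
  the background charge.\<close>

lemma L_h: "L n (h l v) = h l (L n v) - scale (of_int l) (h (n + l) v)
  - scale (if n + l = 0 then of_int (l * (l - 1)) * (of_nat p - 1) else 0) v"
proof -
 have o: "\<forall>j\<ge>3. h (int j) om = 0" using h_om(4) by blast
 have g2: "bc l 2 = of_int (l * (l - 1)) / 2"
  by (simp add: gbinomial_prod_rev numeral_2_eq_2 field_simps)
 have "h l (L n v) = L n (h l v) + (\<Sum>j<3. scale (bc l j) (Y (h (int j) om) (n + 1 + l - int j) v))"
  unfolding L_def by (rule heis_Z_fin[OF p0 o])
 also have "(\<Sum>j<3. scale (bc l j) (Y (h (int j) om) (n + 1 + l - int j) v))
   = scale (of_int l) (h (n + l) v) + scale (if n + l = 0 then of_int (l * (l - 1)) * (of_nat p - 1) else 0) v"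
 proof -
  let ?f = "%j. scale (bc l j) (Y (h (int j) om) (n + 1 + l - int j) v)"
  have "(\<Sum>j<3. ?f j) = ?f 0 + ?f 1 + ?f 2" by (simp add: eval_nat_numeral)
  moreover have "?f 0 = 0" using h_om(1) by simp
  moreover have "?f 1 = scale (of_int l) (h (n + l) v)"
  proof -
   have "n + 1 + l - int 1 = n + l" by simp
   thus ?thesis using h_om(2) by (simp only: of_nat_1 Y_alpha gbinomial_1)
  qed
  moreover have "?f 2 = scale (if n + l = 0 then of_int (l * (l - 1)) * (of_nat p - 1) else 0) v"
  proof -
   have e: "h (int 2) om = scale (2 * (of_nat p - 1)) one" using h_om(3) by simp
   have i: "n + 1 + l - int 2 = - 1 \<longleftrightarrow> n + l = 0" by auto
   show ?thesis unfolding e g2 Z1_scale Y_one i by (cases "n + l = 0") (simp_all add: mult.commute)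
  qed
  ultimately show ?thesis by (simp only: add_0_left)
 qed
 finally show ?thesis by simp
qed

lemma L_top: "n > 0 ==> L n (st {#} b) = 0"
 unfolding L_def by (rule hm_neg[OF Z_hm[OF p0 om_hm hm_st]]) auto

text \<open>The conformal weight of the top vector of charge \<open>b\<close>; the background charge
  makes it symmetric about \<open>p - 1\<close> instead of 0.\<close>

definition wq :: "int => complex" where "wq b = of_int (b * (b - pp + 2)) / (4 * of_nat p)"

lemma om_mode_top:
 "Y om r (st {#} b) = scale (1 / (4 * of_nat p)) (Sum_any (%g::nat. h (- int g - 1) (h (r + int g) (st {#} b))) + scale (of_int b) (h (r - 1) (st {#} b)))
  + scale (- ((of_nat p - 1) / (2 * of_nat p)) * of_int r) (h (r - 1) (st {#} b))"
proof -
 have c: "h (- 1) (st {#0#} 0) = st {#0, 0#} 0" using heis_create[of p 0 "{#0#}" 0] by simp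
 have "Y (st {#0, 0#} 0) r (st {#} b) = Sum_any (%g::nat. h (- int g - 1) (h (r + int g) (st {#} b))) + scale (of_int b) (h (r - 1) (st {#} b))"
  using Z_create_top[OF p0, of 0 "st {#0#} 0" r b] by (simp add: c Y_alpha)
 thus ?thesis unfolding om_def Z1_add Z1_scale Y_dalpha by simp
qed

lemma h_pos_top: "l > 0 ==> h l (st {#} b) = 0"
 by (rule hm_neg[OF heis_hm[OF hm_st]]) auto

lemma L0_top: "L 0 (st {#} b) = scale (wq b) (st {#} b)"
proof -
 have "Sum_any (%g::nat. h (- int g - 1) (h (1 + int g) (st {#} b))) = 0"
  by (simp add: h_pos_top heis_0)
 hence "L 0 (st {#} b) = scale (of_int b * of_int b / (4 * of_nat p) - ((of_nat p - 1) / (2 * of_nat p)) * of_int b) (st {#} b)"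
  unfolding L_def using om_mode_top[of 1 b] by (simp add: heis_zero pm.scale_left_diff_distrib)
 moreover have "of_int b * of_int b / (4 * of_nat p) - ((of_nat p - 1) / (2 * of_nat p)) * of_int b = wq b"
  unfolding wq_def using p0 by (simp add: field_simps)
 ultimately show ?thesis by simp
qed

lemma Lm1_top: "L (- 1) (st {#} b) = scale (of_int b / (2 * of_nat p)) (h (- 1) (st {#} b))"
proof -
 have "Sum_any (%g::nat. h (- int g - 1) (h (0 + int g) (st {#} b))) = h (- int 0 - 1) (h (0 + int 0) (st {#} b))"
  by (rule Sum_any_single) (simp add: h_pos_top heis_0)
 hence "L (- 1) (st {#} b) = scale (1 / (4 * of_nat p)) (scale (of_int b) (h (- 1) (st {#} b)) + scale (of_int b) (h (- 1) (st {#} b)))"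
  unfolding L_def using om_mode_top[of 0 b] by (simp add: heis_zero heis_scale)
 also have "... = scale (of_int b / (2 * of_nat p)) (h (- 1) (st {#} b))"
  by (simp add: pm.scale_left_distrib[symmetric] field_simps)
 finally show ?thesis .
qed

lemma Lm2_top: "L (- 2) (st {#} b) = scale (1 / (4 * of_nat p)) (h (- 1) (h (- 1) (st {#} b)))
  + scale ((of_int b + of_nat p - 1) / (2 * of_nat p)) (h (- 2) (st {#} b))"
proof -
 have "Sum_any (%g::nat. h (- int g - 1) (h (- 1 + int g) (st {#} b))) = (\<Sum>g<2. h (- int g - 1) (h (- 1 + int g) (st {#} b)))"
  by (rule Sum_any_lessThan) (simp add: h_pos_top heis_0)
 also have "... = h (- 1) (h (- 1) (st {#} b)) + scale (of_int b) (h (- 2) (st {#} b))"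
  by (simp add: numeral_2_eq_2 heis_zero heis_scale)
 finally have s: "Sum_any (%g::nat. h (- int g - 1) (h (- 1 + int g) (st {#} b))) = h (- 1) (h (- 1) (st {#} b)) + scale (of_int b) (h (- 2) (st {#} b))" .
 have e: "1 / (4 * of_nat p) * of_int b + 1 / (4 * of_nat p) * of_int b + (of_nat p - 1) / (2 * of_nat p) = (of_int b + of_nat p - 1) / (2 * of_nat p :: complex)"
  using p0 by (simp add: field_simps)
 have a: "- 1 - 1 = (- 2::int)" "- 2 + 1 = (- 1::int)" "- ((of_nat p - 1) / (2 * of_nat p)) * of_int (- 1) = (of_nat p - 1) / (2 * of_nat p :: complex)" by simp_all
 show ?thesis unfolding L_def a using om_mode_top[of "- 1" b] unfolding s e[symmetric] a
  by (simp only: pm.scale_left_distrib pm.scale_right_distrib pm.scale_scale add_ac)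
qed

lemma Lm3_top: "L (- 3) (st {#} b) = scale (1 / (2 * of_nat p)) (h (- 2) (h (- 1) (st {#} b)))
  + scale ((of_int b + 2 * (of_nat p - 1)) / (2 * of_nat p)) (h (- 3) (st {#} b))"
proof -
 have "Sum_any (%g::nat. h (- int g - 1) (h (- 2 + int g) (st {#} b))) = (\<Sum>g<3. h (- int g - 1) (h (- 2 + int g) (st {#} b)))"
  by (rule Sum_any_lessThan) (simp add: h_pos_top heis_0)
 also have "... = h (- 1) (h (- 2) (st {#} b)) + h (- 2) (h (- 1) (st {#} b)) + scale (of_int b) (h (- 3) (st {#} b))"
  by (simp add: numeral_3_eq_3 heis_zero heis_scale)
 also have "h (- 1) (h (- 2) (st {#} b)) = h (- 2) (h (- 1) (st {#} b))" by (subst heis_comm) simp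
 finally have s: "Sum_any (%g::nat. h (- int g - 1) (h (- 2 + int g) (st {#} b))) = h (- 2) (h (- 1) (st {#} b)) + h (- 2) (h (- 1) (st {#} b)) + scale (of_int b) (h (- 3) (st {#} b))" .
 have e: "1 / (4 * of_nat p) * of_int b + 1 / (4 * of_nat p) * of_int b + (of_nat p - 1) / (2 * of_nat p) * 2 = (of_int b + 2 * (of_nat p - 1)) / (2 * of_nat p :: complex)"
  "1 / (4 * of_nat p) + 1 / (4 * of_nat p) = 1 / (2 * of_nat p :: complex)"
  using p0 by (simp_all add: field_simps)
 have a: "- 2 - 1 = (- 3::int)" "- 3 + 1 = (- 2::int)" "- ((of_nat p - 1) / (2 * of_nat p)) * of_int (- 2) = (of_nat p - 1) / (2 * of_nat p) * (2 :: complex)" by simp_all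
 show ?thesis unfolding L_def a using om_mode_top[of "- 2" b] unfolding s e[symmetric] a
  by (simp only: pm.scale_left_distrib pm.scale_right_distrib pm.scale_scale add_ac)
qed

lemma L0_st: "L 0 (st M b) = scale (of_nat (lev M) + wq b) (st M b)"
proof (induction M)
 case empty thus ?case by (simp add: L0_top)
next
 case (add i M)
 have "L 0 (h (- int i - 1) (st M b)) = scale (of_nat (lev M) + wq b + (of_nat i + 1)) (h (- int i - 1) (st M b))"
  unfolding L_h add by (simp add: heis_scale heis_add pm.scale_left_distrib pm.scale_minus_left pm.scale_left_diff_distrib)
 thus ?case by (simp add: heis_create algebra_simps)
qed

lemma L0_hm: "hm m b v ==> L 0 v = scale (of_int m + wq b) v"
proof (rule hm_eq[of m b v])
 fix M assume "int (lev M) = m"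
 hence "of_int m = (of_nat (lev M) :: complex)" by auto
 thus "L 0 (st M b) = scale (of_int m + wq b) (st M b)" by (simp add: L0_st)
qed (simp_all add: L_lin lin_scl lin_id)

end

section \<open>Grading by conformal weight, vacuum and translation\<close>

context lat
begin

text \<open>The conformal weight of \<open>e^{k\<alpha>}\<close>. With it \<open>gr\<close> records
  the conformal weight, and the charge in multiples of \<alpha>, where \<open>hm\<close> records the
  level.\<close>

definition w0 :: "int => int" where "w0 k = k * (int p * k - int p + 1)"
definition gr :: "int => int => fock => bool" where "gr N k v \<longleftrightarrow> hm (N - w0 k) (pp * k) v"

lemma gr_ch: "gr N k v ==> ch (pp * k) v" by (simp add: gr_def hm_ch)
lemma gr_VL: "gr N k v ==> v \<in> VL" by (rule VL_ch[OF gr_ch])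
lemma gr_add: "gr N k v ==> gr N k w ==> gr N k (v + w)" by (simp add: gr_def hm_add)
lemma gr_scale: "gr N k v ==> gr N k (scale c v)" by (simp add: gr_def hm_scale)
lemma gr_0 [simp]: "gr N k 0" by (simp add: gr_def)
lemma gr_neg: "gr N k v ==> N < w0 k ==> v = 0" using hm_neg by (auto simp: gr_def)

lemma w0_add: "w0 (k + l) = w0 k + w0 l + pp * k * l"
 by (simp add: w0_def algebra_simps)

lemma gr_Y: assumes "gr N k u" "gr N' k' v" shows "gr (N + N' - n - 1) (k + k') (Y u n v)"
proof -
 have "pp * k * (pp * k') div pp = pp * k * k'"
  using p0 by (simp add: mult_ac)
 thus ?thesis using Z_hm[OF p0 assms[unfolded gr_def], of n]
  by (simp add: gr_def w0_add algebra_simps)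
qed

lemma gr_one: "gr 0 0 one" using hm_st[of "{#}" 0] by (simp add: gr_def w0_def)
lemma gr_om: "gr 2 0 om" using om_hm by (simp add: gr_def w0_def)
lemma gr_exp: "gr (w0 k) k (st {#} (pp * k))" using hm_st[of "{#}" "pp * k"] by (simp add: gr_def)

lemma gr_L: "gr N k v ==> gr (N - n) k (L n v)"
 using gr_Y[OF gr_om, of N k v "n + 1"] by (simp add: L_def)

lemma gr_L0: "gr N k v ==> L 0 v = scale (of_int N) v"
proof -
 assume "gr N k v"
 hence "L 0 v = scale (of_int (N - w0 k) + wq (pp * k)) v" unfolding gr_def by (rule L0_hm)
 moreover have "wq (pp * k) = of_int (w0 k)"
  using p0 by (simp add: wq_def w0_def field_simps)
 ultimately show ?thesis by simp
qed

text \<open>Weights are nonnegative and weight 0 occurs in charge 0 only, which bounds all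
  inductions on the weight from below.\<close>

lemma w0_pos: "k ~= 0 ==> w0 k >= \<bar>k\<bar>"
proof -
 assume "k ~= 0"
 then consider "k >= 1" | "k <= -1" by linarith
 thus ?thesis
 proof cases
  case 1
  hence "int p * (k - 1) >= 0" by simp
  hence "int p * k - int p + 1 >= 1" by (simp add: algebra_simps)
  hence "k * (int p * k - int p + 1) >= k * 1" using 1 by (intro mult_left_mono) auto
  thus ?thesis using 1 by (simp add: w0_def)
 next
  case 2
  have "int p * (k - 1) <= int p * (-2)" using 2 by (intro mult_left_mono) auto
  hence "int p * k - int p + 1 <= -1" using pge by (simp add: algebra_simps)
  hence "(- k) * (- (int p * k - int p + 1)) >= (- k) * 1" using 2 by (intro mult_left_mono) auto
  hence "w0 k >= - k" by (simp only: w0_def minus_mult_minus mult_1_right)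
  thus ?thesis using 2 by simp
 qed
qed

lemma w0_nonneg: "w0 k >= 0" using w0_pos[of k] by (cases "k = 0") (auto simp: w0_def)

subsection \<open>Creation and translation\<close>

lemma Y_exp_one: "Y (st {#} a) n one = cre p a (- n - 1) (st {#} a)"
 using em_top[OF p0, of a 0 n] by (simp add: Z_exp)

lemma L_m1_h: "L (- 1) (h l v) = h l (L (- 1) v) - scale (of_int l) (h (l - 1) v)"
proof -
 have "(- 1) + l = l - 1" "- 1 + l = 0 ==> l * (l - 1) = 0" by auto
 thus ?thesis unfolding L_h by auto
qed

lemma creation_st: "(n >= 0 \<longrightarrow> Y (st M a) n one = 0) \<and> Y (st M a) (- 1) one = st M a \<and> Y (st M a) (- 2) one = L (- 1) (st M a)"
proof (induction M arbitrary: n)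
 case empty
 have "cre p a 1 (st {#} a) = scale (of_int a / of_nat (2 * p)) (h (- 1) (st {#} a))"
  using cre_euler[OF p0, of 1 a "st {#} a"] by simp
 thus ?case by (simp add: Y_exp_one Lm1_top) (simp add: cre_def)
next
 case (add i M)
 let ?f = "%n g. scale (bc (int g) i) (h (- int g - 1) (Y (st M a) (n - int i + int g) one))"
 have e: "Y (st (add_mset i M) a) n one = Sum_any (?f n)" for n
  using Z_create_top[OF p0, of i "st M a" n 0] by (simp add: heis_create)
 have ez: "ez (?f n)" for n by (rule Z_create_top_ez[OF p0])
 have z: "g < i ==> ?f n g = 0" for n g using bc_nat[of g i] by (simp add: binomial_eq_0)
 have s: "Sum_any (?f n) = Sum_any (%g. ?f n (g + i))" for n by (rule Sum_any_shift[OF ez z])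
 have 1: "Y (st (add_mset i M) a) n one = 0" if "n >= 0"
  unfolding e s using that add.IH by (simp add: heis_0)
 have 2: "Y (st (add_mset i M) a) (- 1) one = st (add_mset i M) a"
 proof -
  have "Sum_any (%g. ?f (- 1) (g + i)) = ?f (- 1) (0 + i)"
   by (rule Sum_any_single) (use add.IH in "auto simp: heis_0")
  also have "... = st (add_mset i M) a" using bc_nat[of i i] add.IH by (simp add: heis_create)
  finally show ?thesis unfolding e s .
 qed
 have 3: "Y (st (add_mset i M) a) (- 2) one = L (- 1) (st (add_mset i M) a)"
 proof -
  have "Sum_any (%g. ?f (- 2) (g + i)) = (\<Sum>g<2. ?f (- 2) (g + i))"
   by (rule Sum_any_lessThan) (use add.IH in "auto simp: heis_0")
  also have "... = ?f (- 2) i + ?f (- 2) (Suc i)" by (simp only: numeral_2_eq_2 sum.lessThan_Suc lessThan_0 sum.empty add_0 add_Suc)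
  also have "?f (- 2) i = h (- int i - 1) (L (- 1) (st M a))" using bc_nat[of i i] add.IH by simp
  also have "?f (- 2) (Suc i) = scale (of_nat (Suc i)) (h (- int i - 2) (st M a))"
  proof -
   have "- int (Suc i) - 1 = - int i - 2" "- 2 - int i + int (Suc i) = - 1" by simp_all
   thus ?thesis using bc_nat[of "Suc i" i] add.IH by (simp only:) simp
  qed
  also have "h (- int i - 1) (L (- 1) (st M a)) + scale (of_nat (Suc i)) (h (- int i - 2) (st M a)) = L (- 1) (st (add_mset i M) a)"
  proof -
   have "(of_nat (Suc i) :: complex) = - of_int (- int i - 1)" "- int i - 1 - 1 = - int i - 2" by simp_all
   thus ?thesis unfolding heis_create[of p, symmetric] L_m1_h by (simp only: pm.scale_minus_left diff_conv_add_uminus)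
  qed
  finally show ?thesis unfolding e s .
 qed
 show ?case using 1 2 3 by blast
qed

lemma Y_m1_one: "Y u (- 1) one = u" and Y_m2_one: "Y u (- 2) one = L (- 1) u" and Y_nn_one: "n >= 0 ==> Y u n one = 0"
proof -
 show "Y u (- 1) one = u"
  by (rule lin_eqI[OF Z_lin1 lin_id]) (use creation_st in "metis prod.collapse")
 show "Y u (- 2) one = L (- 1) u"
  by (rule lin_eqI[OF Z_lin1 L_lin]) (use creation_st in "metis prod.collapse")
 show "n >= 0 ==> Y u n one = 0"
  by (rule lin_eqI[OF Z_lin1 lin_zero]) (use creation_st in "metis prod.collapse")
qed

lemma bc_m2: "bc (- 2) j = (-1) ^ j * of_nat (Suc j)"
 using bc_neg[of 1 j] by simp

text \<open>The Borcherds identity of \<open>u\<close> with the vacuum at \<open>n = - 2\<close>,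
  where \<open>Y u (- 2) one\<close> is \<open>L (- 1) u\<close>; only terms with the vacuum mode -1
  survive. The hypothesis on charges admits vectors \<open>u\<close> outside of \<open>V_L\<close>,
  such as the screening vector.\<close>

lemma translation:
 assumes "ch a u" "ch b w" "pp dvd a * b"
 shows "Y (L (- 1) u) n w = scale (- of_int n) (Y u (n - 1) w)"
proof -
 have e: "Y (L (- 1) u) n w = Sum_any (%j. scale ((-1) ^ j * bc (- 2) j) (Y u (- 2 - int j) (Y one (n + int j) w)))
   - Sum_any (%j. scale ((-1) ^ j * bc (- 2) j) (Y one (- 2 + n - int j) (Y u (int j) w)))"
  using borcherds[OF p0 assms(1) ch_st assms(2), of 0 "{#}" 0 n "- 2"] assms(3)
  by (simp add: B1_0 Y_m2_one B2_def B3_def sg_def del: of_int_minus of_int_numeral)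
 have c: "(-1) ^ j * bc (- 2) j = of_nat (Suc j)" for j
  unfolding bc_m2 by (simp flip: mult.assoc power_add)
 show ?thesis
 proof (cases "n = 0")
  case True
  thus ?thesis unfolding e by (simp add: Y_one Y_0)
 next
  case False
  show ?thesis
  proof (cases "n < 0")
   case True
   have "Sum_any (%j. scale ((-1) ^ j * bc (- 2) j) (Y u (- 2 - int j) (Y one (n + int j) w))) = scale ((-1) ^ nat (- n - 1) * bc (- 2) (nat (- n - 1))) (Y u (- 2 - int (nat (- n - 1))) (Y one (n + int (nat (- n - 1))) w))"
    using True by (intro Sum_any_single) (auto simp: Y_one Y_0)
   also have "... = scale (- of_int n) (Y u (n - 1) w)"
    unfolding c Y_one using True by (simp add: of_nat_diff)
   finally show ?thesis unfolding e using True by (simp add: Y_one del: of_int_minus of_int_numeral)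
  next
   case F: False
   have "Sum_any (%j. scale ((-1) ^ j * bc (- 2) j) (Y one (- 2 + n - int j) (Y u (int j) w))) = scale ((-1) ^ nat (n - 1) * bc (- 2) (nat (n - 1))) (Y one (- 2 + n - int (nat (n - 1))) (Y u (int (nat (n - 1))) w))"
    using F False by (intro Sum_any_single) (auto simp: Y_one)
   also have "... = scale (of_int n) (Y u (n - 1) w)"
    unfolding c Y_one using F False by simp
   finally show ?thesis unfolding e using F False by (simp add: Y_one Y_0 pm.scale_minus_left)
  qed
 qed
qed

lemma translation_VL:
 assumes "u \<in> VL" shows "Y (L (- 1) u) n w = scale (- of_int n) (Y u (n - 1) w)"
proof (rule VL_eq[OF assms])
 show "lin (%u. Y (L (- 1) u) n w)" by (rule lin_comp[OF Z_lin1 L_lin])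
 show "lin (%u. scale (- of_int n) (Y u (n - 1) w))" by (rule lin_scl[OF Z_lin1])
 fix M b assume b: "pp dvd b"
 show "Y (L (- 1) (st M b)) n w = scale (- of_int n) (Y (st M b) (n - 1) w)"
 proof (rule lin_eqI[of "%w. Y (L (- 1) (st M b)) n w" "%w. scale (- of_int n) (Y (st M b) (n - 1) w)"])
  fix x :: "nat multiset \<times> int"
  obtain K c where x: "x = (K, c)" by force
  show "Y (L (- 1) (st M b)) n (single x 1) = scale (- of_int n) (Y (st M b) (n - 1) (single x 1))"
   unfolding x by (rule translation[OF ch_st ch_st]) (use b in simp)
 qed (rule Y_lin, rule lin_scl[OF Y_lin])
qed

lemma L_comm:
 assumes "u \<in> VL"
 shows "L m (Y u n w) = Y u n (L m w) + Sum_any (%j. scale (bc (m + 1) j) (Y (L (int j - 1) u) (m + n + 1 - int j) w))"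
 using Y_comm[OF om_VL assms, of "m + 1" n w] by (simp add: L_def algebra_simps)

lemma L_VL: "v \<in> VL ==> L n v \<in> VL" unfolding L_def by (rule VL_Y[OF om_VL])

lemma Lm1_comm: "u \<in> VL ==> L (- 1) (Y u n w) = Y u n (L (- 1) w) + Y (L (- 1) u) n w"
proof -
 assume u: "u \<in> VL"
 have "L (- 1) (Y u n w) = Y u n (L (- 1) w) + Sum_any (%j. scale (bc 0 j) (Y (L (int j - 1) u) (n - int j) w))"
  using L_comm[OF u, of "- 1" n w] by (simp only: add.commute[of "-1" 1] add_0 right_minus add.commute[of "-1" n] uminus_add_conv_diff diff_add_cancel) simp
 also have "Sum_any (%j. scale (bc 0 j) (Y (L (int j - 1) u) (n - int j) w)) = Y (L (- 1) u) n w"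
  by (subst Sum_any_single[of 0]) (auto simp: bc_0 simp del: of_int_0)
 finally show ?thesis .
qed

lemma Y_desc: "u \<in> VL ==> Y u (- int n - 1) one = scale (1 / fact n) ((L (- 1) ^^ n) u)"
proof (induction n arbitrary: u)
 case 0 thus ?case by (simp add: Y_m1_one)
next
 case (Suc n)
 have "Y (L (- 1) u) (- int n - 1) one = scale (of_nat (Suc n)) (Y u (- int (Suc n) - 1) one)"
  unfolding translation_VL[OF Suc.prems] by (simp add: algebra_simps)
 hence "Y u (- int (Suc n) - 1) one = scale (1 / of_nat (Suc n)) (Y (L (- 1) u) (- int n - 1) one)"
  by (simp del: of_nat_Suc)
 also have "... = scale (1 / fact (Suc n)) ((L (- 1) ^^ Suc n) u)"
  unfolding Suc.IH[OF L_VL[OF Suc.prems]] by (simp add: funpow_swap1)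
 finally show ?case .
qed

text \<open>The Borcherds identity on the vacuum with \<open>m = - 1\<close> and
  \<open>k = 0\<close>: one composition vanishes, the other is the product in opposite order, and
  the iterates become divided powers of \<open>L (- 1)\<close>.\<close>

lemma skew:
 assumes u: "u \<in> VL" and v: "v \<in> VL"
 shows "Y v n u = scale (- sg n) (Sum_any (%j. scale ((-1) ^ j / fact j) ((L (- 1) ^^ j) (Y u (n + int j) v))))"
proof -
 have "B2 p u v one (- 1) 0 n = 0" unfolding B2_def by (simp add: Y_nn_one Y_0)
 moreover have "B3 p u v one (- 1) 0 n = Y v n u"
  unfolding B3_def by (subst Sum_any_single[of 0]) (auto simp: Y_nn_one Y_m1_one Y_0)
 moreover have "B1 p u v one (- 1) 0 n = Sum_any (%j. scale ((-1) ^ j / fact j) ((L (- 1) ^^ j) (Y u (n + int j) v)))"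
 proof -
  have a: "- 1 + 0 - int j = - int j - 1" for j by simp
  show ?thesis unfolding B1_def a bc_m1[OF p0] Y_desc[OF VL_Y[OF u v]] by simp
 qed
 ultimately have "Sum_any (%j. scale ((-1) ^ j / fact j) ((L (- 1) ^^ j) (Y u (n + int j) v))) = - scale (sg n) (Y v n u)"
  using borcherds_VL[OF u v, of one "- 1" 0 n] by simp
 thus ?thesis by (auto simp: sg_def pm.scale_minus_left)
qed

end

context lat begin

section \<open>Screening operators and the triplet algebra\<close>

lemma L_primary:
 assumes u: "u \<in> VL" "!!j. j > 0 ==> L (int j) u = 0" "L 0 u = scale N u"
 shows "L n (Y u m w) = Y u m (L n w) + scale (of_int (n + 1) * N - of_int (n + m + 1)) (Y u (n + m) w)"
proof -
 let ?f = "%j. scale (bc (n + 1) j) (Y (L (int j - 1) u) (n + m + 1 - int j) w)"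
 have "Sum_any ?f = (\<Sum>j<2. ?f j)"
 proof (rule Sum_any_lessThan)
  fix j :: nat assume "2 <= j"
  hence "L (int j - 1) u = 0" using u(2)[of "j - 1"] by (simp add: of_nat_diff)
  thus "?f j = 0" by simp
 qed
 also have "... = ?f 0 + ?f 1" by (simp only: numeral_2_eq_2 sum.lessThan_Suc lessThan_0 sum.empty add_0 One_nat_def)
 also have "?f 0 = scale (- of_int (n + m + 1)) (Y u (n + m) w)" by (simp add: translation_VL[OF u(1)])
 also have "?f 1 = scale (of_int (n + 1) * N) (Y u (n + m) w)" by (simp add: u(3) Z1_scale)
 finally show ?thesis unfolding L_comm[OF u(1)] by (simp only: pm.scale_left_diff_distrib pm.scale_minus_left) simp
qed

lemma Y_exp_exp: "a * b = pp * t ==> Y (st {#} a) n (st {#} b) = cre p a (- n - 1 - t) (st {#} (a + b))"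
 using em_top[OF p0, of a b n] p0 by (simp add: Z_exp)

lemma Y_hm: "a * b = pp * t ==> hm l a u ==> hm m b v ==> hm (m + l - n - 1 - t) (a + b) (Y u n v)"
 using Z_hm[OF p0, of l a u m b v n] p0 by simp

lemma cre_1: "cre p a 1 v = scale (of_int a / of_nat (2 * p)) (h (- 1) v)"
 using cre_euler[OF p0, of 1 a v] by simp

definition S :: fock where "S = st {#} (- 2)"
definition Qt :: "fock => fock" where "Qt = Y S 0"
definition V :: "fock set" where "V = {v \<in> VL. Qt v = 0}"
definition Q :: "fock => fock" where "Q = Y (st {#} pp) 0"

lemma Q_lin: "lin Q" and Qt_lin: "lin Qt" unfolding Q_def Qt_def by (rule Y_lin)+
lemmas Q_0 = lin_0[OF Q_lin] and Q_add = lin_add[OF Q_lin] and Q_scale = lin_scale[OF Q_lin]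

lemma V_VL: "v \<in> V ==> v \<in> VL" by (simp add: V_def)
lemma V_0 [simp]: "0 \<in> V" by (simp add: V_def lin_0[OF Qt_lin])
lemma V_add: "v \<in> V ==> w \<in> V ==> v + w \<in> V" by (simp add: V_def lin_add[OF Qt_lin] VL_add)
lemma V_scale: "v \<in> V ==> scale c v \<in> V" by (simp add: V_def lin_scale[OF Qt_lin] VL_scale)
lemma V_sum: "(!!x. x \<in> A ==> f x \<in> V) ==> sum f A \<in> V"
 by (induction A rule: infinite_finite_induct) (auto intro: V_add)
lemma V_subspace: "pm.subspace V" by (simp add: pm.subspace_def V_add V_scale)

lemma VL_eq2:
 assumes "v \<in> VL" "w \<in> VL" "!!w. lin (%v. f v w)" "!!v. lin (%w. f v w)"
  "!!M N a b. pp dvd a ==> pp dvd b ==> f (st M a) (st N b) = 0"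
 shows "f v w = (0 :: fock)"
 by (rule VL_eq[OF assms(1,3) lin_zero], rule VL_eq[OF assms(2,4) lin_zero], rule assms(5))

text \<open>The charge -2 of \<open>S\<close> times a multiple of \<open>2p\<close> is divisible by
  \<open>4p\<close>, so only integral modes and no signs occur although \<open>S\<close> is not in
  \<open>V_L\<close>.\<close>

lemma borcherds_S:
 assumes "v \<in> VL" "w \<in> VL"
 shows "BD p S v w m k n = 0" and "BD p v S w m k n = 0"
proof -
 have *: "BD p S (st M a) (st N b) m k n = 0 \<and> BD p (st M a) S (st N b) m k n = 0"
  if a: "pp dvd a" "pp dvd b" for M N a b
 proof -
  have "4 * int p dvd - 2 * a" "4 * int p dvd a * - 2" using a(1) by (auto elim!: dvdE)
  moreover have "pp dvd - 2 * b" "pp dvd a * b" using a by auto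
  ultimately show ?thesis
   using borcherds[OF p0 ch_st ch_st ch_st, of "- 2" b a "{#}" M N m k n] borcherds[OF p0 ch_st ch_st ch_st, of a b "- 2" M "{#}" N m k n]
   by (simp add: BD_def S_def)
 qed
 show "BD p S v w m k n = 0"
  by (rule VL_eq2[OF assms, of "%v w. BD p S v w m k n"]) (use * in "auto intro: BD_lin[OF p0]")
 show "BD p v S w m k n = 0"
  by (rule VL_eq2[OF assms, of "%v w. BD p v S w m k n"]) (use * in "auto intro: BD_lin[OF p0]")
qed

lemma Qt_Y:
 assumes "v \<in> VL" "w \<in> VL" shows "Qt (Y v n w) = Y (Qt v) n w + Y v n (Qt w)"
 using borcherds_S(1)[OF assms, of 0 n 0] by (simp add: BD_def B1_0 B2_0 B3_0 sg_def Qt_def algebra_simps)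

lemma V_Y: "u \<in> V ==> v \<in> V ==> Y u n v \<in> V"
 by (simp add: V_def VL_Y Qt_Y Y_0)

lemma one_V: "one \<in> V" by (simp add: V_def one_VL Qt_def Y_nn_one)

lemma L_top_pos: "j > 0 ==> L (int j) (st {#} b) = 0" by (rule L_top) simp

text \<open>\<open>S\<close> is primary of weight 1, and then the contributions of
  \<open>L (- 1) S\<close> and \<open>L 0 S\<close> to the commutator of its zero mode with
  \<open>L n\<close> cancel.\<close>

lemma Qt_L:
 assumes w: "w \<in> VL" shows "Qt (L n w) = L n (Qt w)"
proof -
 let ?f = "%j. scale (bc (n + 1) j) (Y (L (int j - 1) S) (n + 1 - int j) w)"
 have "Sum_any ?f = (\<Sum>j<2. ?f j)"
 proof (rule Sum_any_lessThan)
  fix j :: nat assume "2 <= j"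
  hence "L (int j - 1) S = 0" unfolding S_def by (intro L_top) simp
  thus "?f j = 0" by simp
 qed
 also have "... = ?f 0 + ?f 1" by (simp only: numeral_2_eq_2 sum.lessThan_Suc lessThan_0 sum.empty add_0 One_nat_def)
 also have "?f 0 = scale (- of_int (n + 1)) (Y S n w)"
 proof -
  have "Y (L (- 1) S) (n + 1) w = scale (- of_int (n + 1)) (Y S n w)"
  proof (rule VL_eq[OF w])
   fix M b assume "pp dvd b"
   hence "pp dvd - 2 * b" by (rule dvd_mult)
   from translation[OF ch_st ch_st this, of "{#}" "n + 1" M]
   show "Y (L (- 1) S) (n + 1) (st M b) = scale (- of_int (n + 1)) (Y S n (st M b))"
    unfolding S_def by simp
  qed (rule Y_lin, rule lin_scl[OF Y_lin])
  thus ?thesis by simp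
 qed
 also have "?f 1 = scale (of_int (n + 1)) (Y S n w)"
 proof -
  have "wq (- 2) = 1" using p0 by (simp add: wq_def field_simps)
  hence "L 0 S = S" unfolding S_def L0_top by simp
  thus ?thesis by simp
 qed
 finally have "Sum_any ?f = 0" by (simp only: pm.scale_minus_left left_minus)
 thus ?thesis using borcherds_S(2)[OF om_VL w, of "n + 1" 0 0]
  by (simp add: BD_def B1_def B2_0 B3_0 sg_def Qt_def L_def)
qed

lemma V_L: "v \<in> V ==> L n v \<in> V" by (simp add: V_def L_VL Qt_L L_0)

lemma om_L: "om = L (- 2) one" by (simp add: L_def Y_m1_one)
lemma om_V: "om \<in> V" unfolding om_L by (rule V_L[OF one_V])

lemma e2p_VL: "st {#} pp \<in> VL" by (rule VL_st) simp

lemma Q_Y: "v \<in> VL ==> Q (Y v n w) = Y (Q v) n w + Y v n (Q w)"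
 using borcherds_VL[OF e2p_VL, of v w 0 n 0] by (simp add: B1_0 B2_0 B3_0 sg_def Q_def algebra_simps)

lemma Q_L: "Q (L n w) = L n (Q w)"
proof -
 have "wq pp = 1" using p0 by (simp add: wq_def field_simps)
 hence "L 0 (st {#} pp) = scale 1 (st {#} pp)" by (simp add: L0_top)
 from L_primary[OF e2p_VL L_top_pos this, of n 0 w] show ?thesis by (simp add: Q_def)
qed

text \<open>The commutator of the two zero modes is the zero mode of \<open>Q S\<close>. This vector
  is a multiple of \<open>L (- 1) ?u\<close>, and total derivatives have vanishing zero
  mode.\<close>

lemma Qt_Q: assumes w: "w \<in> VL" shows "Qt (Q w) = Q (Qt w)"
proof -
 let ?e = "st {#} pp" and ?u = "st {#} (pp - 2)"
 have "Y ?e 0 S = scale (of_int pp / of_nat (2 * p)) (h (- 1) ?u)"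
  unfolding S_def by (subst Y_exp_exp[of _ _ "- 2"]) (simp_all add: cre_1)
 hence 1: "Y ?e 0 S = h (- 1) ?u" using p0 by simp
 \<comment> \<open>On a top vector \<alpha>(-1) is a multiple of \<open>L (- 1)\<close> only if the
   charge is nonzero; here it is \<open>2p - 2\<close>.\<close>
 have "(complex_of_int (pp - 2)) ~= 0" using pge by simp
 moreover define c :: complex where "c = of_int (pp - 2) / (2 * of_nat p)"
 ultimately have c: "c ~= 0" "L (- 1) ?u = scale c (h (- 1) ?u)" using p0 Lm1_top[of "pp - 2"] by auto
 have "Y (L (- 1) ?u) 0 w = 0"
 proof (rule VL_eq[OF w Y_lin lin_zero])
  fix M b assume "pp dvd b"
  thus "Y (L (- 1) ?u) 0 (st M b) = 0" using translation[OF ch_st ch_st, of "pp - 2" b "{#}" 0 M] by simp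
 qed
 hence "Y (Y ?e 0 S) 0 w = 0" unfolding c 1 Z1_scale using c(1) by simp
 thus ?thesis using borcherds_S(2)[OF e2p_VL w, of 0 0 0]
  by (simp add: BD_def B1_0 B2_0 B3_0 sg_def Qt_def Q_def)
qed

lemma V_Q: "v \<in> V ==> Q v \<in> V"
 by (simp add: V_def Qt_Q Q_0) (simp add: Q_def VL_Y e2p_VL)

lemma gr_Q: "gr N k v ==> gr N (k + 1) (Q v)"
proof -
 have "w0 1 = 1" by (simp add: w0_def)
 hence "gr 1 1 (st {#} pp)" using gr_exp[of 1] by simp
 thus "gr N k v ==> gr N (k + 1) (Q v)" unfolding Q_def using gr_Y[of 1 1 _ N k v 0] by (simp add: add.commute)
qed

definition F :: fock where "F = st {#} (- 2 * int p)"
definition H :: fock where "H = Q F"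
definition E :: fock where "E = Q H"

definition wF :: int where "wF = pp - 1"

lemma w0_m1: "w0 (- 1) = wF" by (simp add: w0_def wF_def)
lemma w0_2: "w0 2 = pp + 2" and w0_m2: "w0 (- 2) = 6 * int p - 2" by (simp_all add: w0_def algebra_simps)

lemma gr_F: "gr wF (- 1) F" using gr_exp[of "- 1"] by (simp add: F_def w0_m1)
lemma gr_H: "gr wF 0 H" using gr_Q[OF gr_F] by (simp add: H_def)
lemma gr_E: "gr wF 1 E" using gr_Q[OF gr_H] by (simp add: E_def)

text \<open>Charge 2 starts at weight \<open>2p + 2\<close>, above the weight \<open>2p - 1\<close>
  of \<open>E\<close>.\<close>

lemma Q_E: "Q E = 0"
proof -
 have "gr wF 2 (Q E)" using gr_Q[OF gr_E] by simp
 thus ?thesis by (rule gr_neg) (simp add: w0_2 wF_def)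
qed

lemma F_V: "F \<in> V"
proof -
 have "F \<in> VL" by (rule gr_VL[OF gr_F])
 moreover have "Qt F = 0"
 proof -
  show ?thesis unfolding Qt_def F_def S_def by (subst Y_exp_exp[of _ _ 2]) (simp_all add: cre_def)
 qed
 ultimately show ?thesis by (simp add: V_def)
qed
lemma H_V: "H \<in> V" unfolding H_def by (rule V_Q[OF F_V])
lemma E_V: "E \<in> V" unfolding E_def by (rule V_Q[OF H_V])

subsection \<open>Homogeneous components\<close>

definition Pr :: "int => int => fock => fock" where
 "Pr m b = lin_ext (%(M, c). if int (lev M) = m \<and> c = b then st M c else 0)"

lemma Pr_lin: "lin (Pr m b)" by (simp add: Pr_def)

lemma Pr_hm: assumes "hm m b v" shows "Pr m' b' v = (if m' = m \<and> b' = b then v else 0)"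
proof (cases "m' = m \<and> b' = b")
 case True
 have "Pr m b v = v" by (rule hm_eq[OF assms Pr_lin lin_id]) (simp add: Pr_def)
 with True show ?thesis by simp
next
 case False
 have "Pr m' b' v = 0" by (rule hm_eq[OF assms Pr_lin lin_zero]) (use False in "auto simp: Pr_def")
 with False show ?thesis by auto
qed

lemma hm_Pr: "hm m b (Pr m b v)"
proof -
 have "Pr m b v = (\<Sum>k\<in>keys v. scale (lookup v k) (Pr m b (single k 1)))"
  by (subst poly_mapping_decomp[of v]) (simp add: lin_sum[OF Pr_lin] lin_scale[OF Pr_lin])
 moreover have "hm m b (Pr m b (single k 1))" for k
  using hm_st by (cases k) (auto simp: Pr_def)
 ultimately show ?thesis by (auto intro!: hm_sum hm_scale)
qed

lemma Pr_sum: "v = (\<Sum>(m, b)\<in>(%(M, b). (int (lev M), b)) ` keys v. Pr m b v)" (is "v = sum _ ?I")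
proof -
 have "(\<Sum>(m, b)\<in>?I. Pr m b v) = (\<Sum>(m, b)\<in>?I. \<Sum>k\<in>keys v. scale (lookup v k) (Pr m b (single k 1)))"
  by (rule sum.cong[OF refl], clarify, subst poly_mapping_decomp[of v]) (simp add: lin_sum[OF Pr_lin] lin_scale[OF Pr_lin])
 also have "... = (\<Sum>k\<in>keys v. \<Sum>(m, b)\<in>?I. scale (lookup v k) (Pr m b (single k 1)))"
  unfolding case_prod_unfold by (rule sum.swap)
 also have "... = (\<Sum>k\<in>keys v. scale (lookup v k) (single k 1))"
 proof (rule sum.cong[OF refl])
  fix k assume k: "k \<in> keys v"
  obtain M c where kk: "k = (M, c)" by force
  have "(\<Sum>(m, b)\<in>?I. scale (lookup v k) (Pr m b (single k 1))) = (\<Sum>x\<in>?I. if x = (int (lev M), c) then scale (lookup v k) (single k 1) else 0)"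
  proof (rule sum.cong[OF refl])
   fix x assume "x \<in> ?I"
   obtain m b where x: "x = (m, b)" by force
   show "(case x of (m, b) => scale (lookup v k) (Pr m b (single k 1))) = (if x = (int (lev M), c) then scale (lookup v k) (single k 1) else 0)"
    unfolding x kk using Pr_hm[OF hm_st, of m b M c] by auto
  qed
  also have "... = scale (lookup v k) (single k 1)"
  proof -
   have "(int (lev M), c) \<in> ?I" using k unfolding kk by force
   thus ?thesis by (subst sum.delta) simp_all
  qed
  finally show "(\<Sum>(m, b)\<in>?I. scale (lookup v k) (Pr m b (single k 1))) = scale (lookup v k) (single k 1)" .
 qed
 also have "... = v" by (rule poly_mapping_decomp[symmetric])
 finally show ?thesis by simp
qed

lemma Qt_hm: "hm m (pp * k) v ==> hm (m - 1 + 2 * k) (pp * k - 2) (Qt v)"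
 unfolding Qt_def S_def using Y_hm[where a = "- 2" and b = "pp * k" and t = "- 2 * k" and l = 0 and u = "st {#} (- 2)" and n = 0 and m = m and v = v] hm_st[of "{#}" "- 2"] by (simp add: algebra_simps)

text \<open>The screening operator is homogeneous, so its kernel inherits the grading by weight and
  charge. This is what \<open>V_induct\<close> rests on.\<close>

lemma V_Pr: assumes "v \<in> V" shows "Pr m (pp * k) v \<in> V"
proof -
 have "Qt (Pr m (pp * k) v) = Pr (m - 1 + 2 * k) (pp * k - 2) (Qt v)"
 proof (rule VL_eq[OF V_VL[OF assms] lin_comp[OF Qt_lin Pr_lin] lin_comp[OF Pr_lin Qt_lin]])
  fix M c assume "pp dvd c"
  then obtain l where c: "c = pp * l" by auto
  show "Qt (Pr m (pp * k) (st M c)) = Pr (m - 1 + 2 * k) (pp * k - 2) (Qt (st M c))"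
   unfolding c Pr_hm[OF hm_st] Pr_hm[OF Qt_hm[OF hm_st]] using p0 by (auto simp: lin_0[OF Qt_lin])
 qed
 also have "... = 0" using assms by (simp add: V_def lin_0[OF Pr_lin])
 finally show ?thesis using VL_ch[OF hm_ch[OF hm_Pr]] by (auto simp: V_def)
qed

lemma gr_Pr: "gr N k (Pr (N - w0 k) (pp * k) v)" unfolding gr_def by (rule hm_Pr)

lemma V_induct [consumes 1, case_names gr add]:
 assumes v: "v \<in> V" and g: "!!N k x. x \<in> V ==> gr N k x ==> P x" and a: "!!x y. P x ==> P y ==> P (x + y)"
 shows "P v"
proof -
 let ?I = "(%(M, b). (int (lev M), b)) ` keys v"
 have P0: "P 0" by (rule g[of 0 0 0]) auto
 have *: "P (Pr m b v)" if "(m, b) \<in> ?I" for m b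
 proof -
  have d: "pp dvd b" using that V_VL[OF v] by (auto simp: VL_def)
  then obtain k where k: "b = pp * k" by auto
  show ?thesis unfolding k by (rule g[OF V_Pr[OF v]]) (use gr_Pr[of "m + w0 k" k v] in simp)
 qed
 have "finite J ==> J \<subseteq> ?I ==> P (\<Sum>(m, b)\<in>J. Pr m b v)" for J
 proof (induction J rule: finite_induct)
  case (insert x J)
  obtain m b where x: "x = (m, b)" by force
  show ?case using insert *[of m b] by (simp add: x a)
 qed (simp add: P0)
 hence "P (\<Sum>(m, b)\<in>?I. Pr m b v)" by simp
 thus ?thesis using Pr_sum[of v] by simp
qed

lemma gr_0_one: assumes "gr 0 k v" shows "v = scale (lookup v ({#}, 0)) one" and "k ~= 0 ==> v = 0"
proof -
 show k: "k ~= 0 ==> v = 0" using w0_pos[of k] gr_neg[OF assms] by auto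
 show "v = scale (lookup v ({#}, 0)) one"
 proof (cases "k = 0")
  case True
  hence "hm 0 0 v" using assms by (simp add: gr_def w0_def)
  moreover have "lin (%v. scale (lookup v ({#}, 0)) one)" by (simp add: lin_def lookup_add lookup_scale pm.scale_left_distrib)
  ultimately show ?thesis
  proof (rule hm_eq[OF _ lin_id])
   fix M assume "int (lev M) = 0"
   hence "M = {#}" by (cases M) auto
   thus "st M 0 = scale (lookup (st M 0) ({#}, 0)) one" by simp
  qed
 qed (use k in simp)
qed

lemma hm_lin_eq_zero:
 assumes "hm m b v" "lin f" "f v = 0" "!!M. int (lev M) = m ==> M = M0" "f (st M0 b) ~= 0" shows "v = 0"
proof -
 have l: "lin (%v. scale (lookup v (M0, b)) (st M0 b))"
  by (simp add: lin_def lookup_add lookup_scale pm.scale_left_distrib)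
 have v: "v = scale (lookup v (M0, b)) (st M0 b)"
  by (rule hm_eq[OF assms(1) lin_id l]) (use assms(4) in auto)
 hence "f v = scale (lookup v (M0, b)) (f (st M0 b))" using lin_scale[OF assms(2)] by metis
 hence "lookup v (M0, b) = 0" using assms(3,5) by simp
 thus ?thesis using v by simp
qed

lemma lev_0_1: "lev M = 0 ==> M = {#}" "lev M = 1 ==> M = {#0#}"
proof -
 show 0: "lev M = 0 ==> M = {#}" for M by (cases M) auto
 show "lev M = 1 ==> M = {#0#}" using 0 by (cases M) auto
qed

text \<open>In weight 1 the lattice algebra has only the lines of \<alpha>(-1) and
  \<open>e^\<alpha>\<close>, in different charges, and the screening operator is injective on
  each.\<close>

lemma V_gr_1: assumes "v \<in> V" "gr 1 k v" shows "v = 0"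
proof -
 consider "w0 k > 1" | "k = 0" | "k = 1"
 proof -
  have "w0 k > 1" if "k ~= 0" "k ~= 1"
  proof (cases "k = - 1")
   case True thus ?thesis using pge by (simp add: w0_m1 wF_def)
  qed (use that w0_pos[of k] in linarith)
  thus ?thesis using that by blast
 qed
 thus ?thesis
 proof cases
  case 1 thus ?thesis using gr_neg[OF assms(2)] by simp
 next
  case 2
  have hm: "hm 1 0 v" using assms(2) 2 by (simp add: gr_def w0_def)
  have "Qt (st {#0#} 0) = scale 2 S"
  proof -
   have "h (- 1) (Y S 0 one) = Y S 0 (h (- 1) one) + scale (of_int (- 2)) (Y S (- 1) one)"
    unfolding S_def Z_exp using em_comm[OF p0, of "- 1" "- 2" 0 one] by simp
   thus ?thesis using heis_create[of p 0 "{#}" 0]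
    by (simp add: Y_m1_one Y_nn_one heis_0 Qt_def pm.scale_minus_left)
  qed
  thus ?thesis
   by (intro hm_lin_eq_zero[OF hm Qt_lin, of "{#0#}"]) (use assms(1) lev_0_1 in "auto simp: V_def S_def")
 next
  case 3
  hence hm: "hm 0 pp v" using assms(2) by (simp add: gr_def w0_def)
  have "Qt (st {#} pp) = scale (- of_int 2 / of_nat (2 * p)) (h (- 1) (st {#} (pp - 2)))"
   unfolding Qt_def S_def by (subst Y_exp_exp[of _ _ "- 2"]) (simp_all add: cre_1)
  also have "h (- 1) (st {#} (pp - 2)) = st {#0#} (pp - 2)" using heis_create[of p 0] by simp
  finally have "Qt (st {#} pp) ~= 0" using p0 by simp
  thus ?thesis
   by (intro hm_lin_eq_zero[OF hm Qt_lin, of "{#}"]) (use assms(1) lev_0_1 in "auto simp: V_def")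
 qed
qed

end

context lat begin

section \<open>Singular vectors and products of generators\<close>

text \<open>The last equation is the level three singular vector of the Verma module of weight
  \<open>2p - 1\<close> set to 0. \<open>Q\<close> commutes with the Virasoro algebra, so checking
  it for \<open>F\<close> settles \<open>H\<close> and \<open>E\<close>.\<close>

definition prim :: "fock => bool" where
 "prim u \<longleftrightarrow> u \<in> V \<and> (\<forall>j>0. L j u = 0) \<and> L 0 u = scale (of_int wF) u \<and>
   L (- 1) (L (- 1) (L (- 1) u)) - scale (4 * of_nat p) (L (- 2) (L (- 1) u)) + scale (4 * of_nat p * of_nat p - 2 * of_nat p) (L (- 3) u) = 0"

lemma primV: "prim u ==> u \<in> V" and primVL: "prim u ==> u \<in> VL"
 and prim_pos: "prim u ==> j > 0 ==> L j u = 0" and prim_0: "prim u ==> L 0 u = scale (of_int wF) u"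
 using V_VL by (auto simp: prim_def)

text \<open>All three terms are expanded in \<open>?x (?x (?x F))\<close>, \<open>?x (?y F)\<close>
  and \<open>?z F\<close>, a basis of level 3 over \<open>F\<close>, where the coefficients
  cancel.\<close>

lemma prim_F: "prim F"
proof -
 let ?x = "h (- 1)" and ?y = "h (- 2)" and ?z = "h (- 3)"
 let ?p = "of_nat p :: complex"
 have b: "F = st {#} (- 2 * int p)" by (rule F_def)
 have pz: "?p ~= 0" using p0 by simp
 have 1: "L (- 1) F = - ?x F" unfolding b Lm1_top using p0 by (simp add: pm.scale_minus_left)
 have Lx: "L (- 1) (?x v) = ?x (L (- 1) v) + ?y v" and Ly: "L (- 1) (?y v) = ?y (L (- 1) v) + scale 2 (?z v)"
  and L2: "L (- 2) (?x v) = ?x (L (- 2) v) + ?z v" for v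
  unfolding L_m1_h L_h by (simp_all add: pm.scale_minus_left)
 have c: "?y (?x v) = ?x (?y v)" for v by (subst heis_comm) simp
 have 2: "L (- 1) (L (- 1) F) = ?x (?x F) - ?y F"
  unfolding 1 lin_minus[OF L_lin] Lx by (simp add: lin_minus[OF heis_lin])
 have 3: "L (- 1) (L (- 1) (L (- 1) F)) = scale 3 (?x (?y F)) - ?x (?x (?x F)) - scale 2 (?z F)"
 proof -
  have "L (- 1) (L (- 1) (L (- 1) F)) = ?x (?x (- ?x F) + ?y F) + ?y (?x F) - (?y (- ?x F) + scale 2 (?z F))"
   unfolding 2 by (simp only: lin_diff[OF L_lin] Lx Ly 1)
  thus ?thesis unfolding lin_minus[OF heis_lin] heis_add c
   by (auto intro!: poly_mapping_eqI simp: lookup_add lookup_minus lookup_scale)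
 qed
 have 4: "L (- 2) (L (- 1) F) = scale ((?p + 1) / (2 * ?p)) (?x (?y F)) - scale (1 / (4 * ?p)) (?x (?x (?x F))) - ?z F"
 proof -
  have "(of_int (- 2 * int p) + ?p - 1) / (2 * ?p) = - ((?p + 1) / (2 * ?p))" using p0 by (simp add: field_simps)
  hence e: "L (- 2) F = scale (1 / (4 * ?p)) (?x (?x F)) - scale ((?p + 1) / (2 * ?p)) (?y F)"
   unfolding b Lm2_top by (simp only: pm.scale_minus_left diff_conv_add_uminus)
  show ?thesis unfolding 1 lin_minus[OF L_lin] L2 e lin_diff[OF heis_lin] heis_scale by simp
 qed
 have 5: "L (- 3) F = scale (1 / (2 * ?p)) (?x (?y F)) - scale (1 / ?p) (?z F)"
 proof -
  have "(of_int (- 2 * int p) + 2 * (?p - 1)) / (2 * ?p) = - (1 / ?p)" using p0 by (simp add: field_simps)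
  thus ?thesis unfolding b Lm3_top c[symmetric] by (simp only: pm.scale_minus_left diff_conv_add_uminus)
 qed
 have "L (- 1) (L (- 1) (L (- 1) F)) - scale (4 * ?p) (L (- 2) (L (- 1) F)) + scale (4 * ?p * ?p - 2 * ?p) (L (- 3) F) = 0"
  unfolding 3 4 5 by (rule poly_mapping_eqI) (use p0 in "simp add: lookup_add lookup_minus lookup_scale field_simps")
 moreover have "L j F = 0" if "j > 0" for j unfolding b by (rule L_top[OF that])
 ultimately show ?thesis using F_V gr_L0[OF gr_F] by (simp add: prim_def)
qed

lemma prim_Q: "prim u ==> prim (Q u)"
proof -
 assume u: "prim u"
 let ?p = "of_nat p :: complex"
 have "0 = Q (L (- 1) (L (- 1) (L (- 1) u)) - scale (4 * ?p) (L (- 2) (L (- 1) u)) + scale (4 * ?p * ?p - 2 * ?p) (L (- 3) u))"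
  using u by (simp add: prim_def Q_0)
 also have "... = L (- 1) (L (- 1) (L (- 1) (Q u))) - scale (4 * ?p) (L (- 2) (L (- 1) (Q u))) + scale (4 * ?p * ?p - 2 * ?p) (L (- 3) (Q u))"
  by (simp add: Q_add lin_diff[OF Q_lin] Q_scale Q_L)
 finally show ?thesis using u by (auto simp: prim_def V_Q Q_L[symmetric] Q_0 Q_scale)
qed

lemma prim_H: "prim H" and prim_E: "prim E" using prim_Q prim_F by (auto simp: H_def E_def)

lemma Sum_any_subspace: "pm.subspace U ==> (!!j. f j \<in> U) ==> Sum_any f \<in> U"
 by (simp add: Sum_any.expand_set pm.subspace_sum)

lemma om_iter2: "u \<in> VL ==> Y (L (- 2) u) n w =
  Sum_any (%j. L (- 2 - int j) (Y u (n + int j) w)) + Sum_any (%j. Y u (n - 1 - int j) (L (int j - 1) w))"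
proof -
 assume u: "u \<in> VL"
 have c: "(-1) ^ j * bc (- 1) j = 1" for j unfolding bc_m1[OF p0] by (simp flip: power_add)
 have i: "- 2 - int j + 1 = - 1 - int j" "n - 1 - int j = - 1 + n - int j" "int j - 1 + 1 = int j" for j by simp_all
 show ?thesis unfolding L_def i using Y_iter[OF om_VL u, of "- 1" n w] unfolding c
  by (simp add: sg_def pm.scale_minus_left)
qed

lemma om_iter3: "u \<in> VL ==> Y (L (- 3) u) n w =
  Sum_any (%j. scale (of_nat (Suc j)) (L (- 3 - int j) (Y u (n + int j) w)))
  - Sum_any (%j. scale (of_nat (Suc j)) (Y u (n - 2 - int j) (L (int j - 1) w)))"
proof -
 assume u: "u \<in> VL"
 have c: "(-1) ^ j * bc (- 2) j = of_nat (Suc j)" for j unfolding bc_m2 by (simp flip: mult.assoc power_add)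
 have i: "- 3 - int j + 1 = - 2 - int j" "n - 2 - int j = - 2 + n - int j" "int j - 1 + 1 = int j" for j by simp_all
 show ?thesis unfolding L_def i using Y_iter[OF om_VL u, of "- 2" n w] unfolding c
  by (simp add: sg_def)
qed

lemma lin_arr:
 fixes X A B R :: fock
 shows "X + (scale (- of_int (n - 1)) (B + scale (of_int (n - 2)) A) + (scale (- of_int ((n - 2) * N)) A + R))
   = scale (- of_int ((n - 1) * (n - 2) + (n - 2) * N)) A + (X + (scale (- of_int (n - 1)) B + R))"
  and "X - (B + scale (of_int (n - 2)) A + (scale (of_int (2 * N)) A + R)) = scale (- of_int (n - 2 + 2 * N)) A + (X - (B + R))"
 by (rule poly_mapping_eqI, simp add: lookup_add lookup_minus lookup_scale algebra_simps)+

text \<open>The total coefficient of \<open>Y a (n - 3) w\<close> when the singular vector equation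
  of \<open>a\<close> is applied to \<open>w\<close> of weight \<open>N\<close>.\<close>

definition cub :: "int => int => int" where
 "cub n N = - n * (n - 1) * (n - 2) + 4 * int p * (n - 2) * (n - 1 + N) - (4 * int p * int p - pp) * (n - 2 + 2 * N)"

text \<open>The modes of the singular vector express \<open>a\<^sub>n\<^sub>-\<^sub>3 w\<close> by Virasoro modes, unless the indicial polynomial \<open>cub\<close> vanishes.\<close>

lemma cubic:
 assumes a: "prim a" and w: "L 0 w = scale (of_int N) w" and U: "pm.subspace U"
  and 1: "!!j. L (- 1 - int j) (Y a (n - 2 + int j) w) \<in> U"
  and 2: "!!j. Y a (n - 4 - int j) (L (int j + 1) w) \<in> U"
  and c: "cub n N ~= 0"
 shows "Y a (n - 3) w \<in> U"
proof -
 note aV = primVL[OF a]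
 let ?b = "L (- 1) a" and ?A = "Y a (n - 3) w"
 note sub = pm.subspace_add[OF U] pm.subspace_scale[OF U] pm.subspace_diff[OF U] Sum_any_subspace[OF U]
 have tr: "Y ?b m v = scale (- of_int m) (Y a (m - 1) v)" for m v by (rule translation_VL[OF aV])
 have ez: "ez (%j. Y a (m + int j) v)" for m v by (rule Z_ez[OF p0]) simp
 have ezL: "ez (%j. T j (L (int j - 1) w))" if "!!j. lin (T j)" for T
 proof -
  have "ez (%j. L (int j - 1) w)" unfolding L_def by (rule Z_ez[OF p0]) simp
  thus ?thesis by (rule ez_lin[rotated]) (rule that)
 qed
 have m1: "Y a (n - 2) (L (- 1) w) = L (- 1) (Y a (n - 2) w) + scale (of_int (n - 2)) ?A"
  using Lm1_comm[OF aV, of "n - 2" w] unfolding tr pm.scale_minus_left by simp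
 have B: "L (- 1) (Y a (n - 2) w) \<in> U" using 1[of 0] by simp
 \<comment> \<open>The mode \<open>n - 3\<close> itself arises from the terms \<open>j = 0\<close>,
   after commuting with \<open>L (- 1)\<close>, and \<open>j = 1\<close> of the second sum; the rest
   lies in \<open>U\<close>.\<close>
 have "\<exists>s\<in>U. Y (L (- 2) ?b) n w = scale (- of_int ((n - 1) * (n - 2) + (n - 2) * N)) ?A + s"
 proof -
  let ?g = "%j. Y ?b (n - 1 - int j) (L (int j - 1) w)"
  have s1: "Sum_any (%j. L (- 2 - int j) (Y ?b (n + int j) w)) \<in> U"
  proof (rule sub(4))
   fix j
   have "- 1 - int (Suc j) = - 2 - int j" "n - 2 + int (Suc j) = n + int j - 1" by simp_all
   hence "L (- 2 - int j) (Y a (n + int j - 1) w) \<in> U" using 1[of "Suc j"] by simp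
   thus "L (- 2 - int j) (Y ?b (n + int j) w) \<in> U" unfolding tr L_scale by (rule sub(2))
  qed
  have s2: "Sum_any (%j. ?g (Suc (Suc j))) \<in> U"
  proof (rule sub(4))
   fix j
   have e: "int (Suc (Suc j)) - 1 = int j + 1" "n - 1 - int (Suc (Suc j)) - 1 = n - 4 - int j" by simp_all
   show "?g (Suc (Suc j)) \<in> U" unfolding tr e by (rule sub(2)[OF 2])
  qed
  have eg: "ez ?g" by (rule ezL) (rule Y_lin)
  have A: "Sum_any ?g = ?g 0 + (?g 1 + Sum_any (%j. ?g (Suc (Suc j))))"
   using Sum_any_Suc[OF eg] Sum_any_Suc[OF ez_shift[OF eg, of 1, simplified]] by simp
  have g0: "?g 0 = scale (- of_int (n - 1)) (L (- 1) (Y a (n - 2) w) + scale (of_int (n - 2)) ?A)"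
  proof -
   have e: "int 0 - 1 = - 1" "n - 1 - int 0 = n - 1" "n - 1 - 1 = n - 2" by simp_all
   show ?thesis unfolding e tr m1 ..
  qed
  have g1: "?g 1 = scale (- of_int ((n - 2) * N)) ?A"
  proof -
   have e: "int 1 - 1 = 0" "n - 1 - int 1 = n - 2" "n - 2 - 1 = n - 3" by simp_all
   show ?thesis unfolding e tr w Y_scale by (simp only: pm.scale_scale of_int_mult mult_minus_right mult.commute)
  qed
  have "Y (L (- 2) ?b) n w = Sum_any (%j. L (- 2 - int j) (Y ?b (n + int j) w)) +
   (scale (- of_int (n - 1)) (L (- 1) (Y a (n - 2) w) + scale (of_int (n - 2)) ?A) + (scale (- of_int ((n - 2) * N)) ?A + Sum_any (%j. ?g (Suc (Suc j)))))"
   unfolding om_iter2[OF L_VL[OF aV]] A g0 g1 ..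
  also have "... = scale (- of_int ((n - 1) * (n - 2) + (n - 2) * N)) ?A +
   (Sum_any (%j. L (- 2 - int j) (Y ?b (n + int j) w)) + (scale (- of_int (n - 1)) (L (- 1) (Y a (n - 2) w)) + Sum_any (%j. ?g (Suc (Suc j)))))"
   by (rule lin_arr)
  finally have eq: "Y (L (- 2) ?b) n w = scale (- of_int ((n - 1) * (n - 2) + (n - 2) * N)) ?A +
   (Sum_any (%j. L (- 2 - int j) (Y ?b (n + int j) w)) + (scale (- of_int (n - 1)) (L (- 1) (Y a (n - 2) w)) + Sum_any (%j. ?g (Suc (Suc j)))))" .
  show ?thesis by (rule bexI, rule eq) (rule sub(1)[OF s1 sub(1)[OF sub(2)[OF B] s2]])
 qed
 then obtain s where s: "s \<in> U" "Y (L (- 2) ?b) n w = scale (- of_int ((n - 1) * (n - 2) + (n - 2) * N)) ?A + s" by blast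
 have "\<exists>s\<in>U. Y (L (- 3) a) n w = scale (- of_int (n - 2 + 2 * N)) ?A + s"
 proof -
  let ?g = "%j. scale (of_nat (Suc j)) (Y a (n - 2 - int j) (L (int j - 1) w))"
  have s1: "Sum_any (%j. scale (of_nat (Suc j)) (L (- 3 - int j) (Y a (n + int j) w))) \<in> U"
  proof (rule sub(4), rule sub(2))
   fix j
   have "- 1 - int (Suc (Suc j)) = - 3 - int j" "n - 2 + int (Suc (Suc j)) = n + int j" by simp_all
   thus "L (- 3 - int j) (Y a (n + int j) w) \<in> U" using 1[of "Suc (Suc j)"] by simp
  qed
  have s2: "Sum_any (%j. ?g (Suc (Suc j))) \<in> U"
  proof (rule sub(4), rule sub(2))
   fix j
   have e: "int (Suc (Suc j)) - 1 = int j + 1" "n - 2 - int (Suc (Suc j)) = n - 4 - int j" by simp_all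
   show "Y a (n - 2 - int (Suc (Suc j))) (L (int (Suc (Suc j)) - 1) w) \<in> U" unfolding e by (rule 2)
  qed
  have eg: "ez ?g" by (rule ez_scale, rule ezL) (rule Y_lin)
  have A: "Sum_any ?g = ?g 0 + (?g 1 + Sum_any (%j. ?g (Suc (Suc j))))"
   using Sum_any_Suc[OF eg] Sum_any_Suc[OF ez_shift[OF eg, of 1, simplified]] by simp
  have g0: "?g 0 = L (- 1) (Y a (n - 2) w) + scale (of_int (n - 2)) ?A"
  proof -
   have e: "int 0 - 1 = - 1" "n - 2 - int 0 = n - 2" by simp_all
   show ?thesis unfolding e m1 by simp
  qed
  have g1: "?g 1 = scale (of_int (2 * N)) ?A" by (simp add: w Y_scale)
  have "Y (L (- 3) a) n w = Sum_any (%j. scale (of_nat (Suc j)) (L (- 3 - int j) (Y a (n + int j) w))) -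
   (L (- 1) (Y a (n - 2) w) + scale (of_int (n - 2)) ?A + (scale (of_int (2 * N)) ?A + Sum_any (%j. ?g (Suc (Suc j)))))"
   unfolding om_iter3[OF aV] A g0 g1 ..
  also have "... = scale (- of_int (n - 2 + 2 * N)) ?A +
   (Sum_any (%j. scale (of_nat (Suc j)) (L (- 3 - int j) (Y a (n + int j) w))) - (L (- 1) (Y a (n - 2) w) + Sum_any (%j. ?g (Suc (Suc j)))))"
   by (rule lin_arr)
  finally have eq: "Y (L (- 3) a) n w = scale (- of_int (n - 2 + 2 * N)) ?A +
   (Sum_any (%j. scale (of_nat (Suc j)) (L (- 3 - int j) (Y a (n + int j) w))) - (L (- 1) (Y a (n - 2) w) + Sum_any (%j. ?g (Suc (Suc j)))))" .
  show ?thesis by (rule bexI, rule eq) (rule sub(3)[OF s1 sub(1)[OF B s2]])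
 qed
 then obtain t where t: "t \<in> U" "Y (L (- 3) a) n w = scale (- of_int (n - 2 + 2 * N)) ?A + t" by blast
 have b3: "Y (L (- 1) (L (- 1) ?b)) n w = scale (- of_int (n * (n - 1) * (n - 2))) ?A"
 proof -
  have e: "n - 1 - 1 = n - 2" "n - 2 - 1 = n - 3" by simp_all
  show ?thesis
   unfolding translation_VL[OF L_VL[OF L_VL[OF aV]]] translation_VL[OF L_VL[OF aV]] tr e pm.scale_scale
   by (rule arg_cong[where f = "%c. scale c ?A"]) (simp add: algebra_simps)
 qed
 have "0 = Y (L (- 1) (L (- 1) ?b) - scale (4 * of_nat p) (L (- 2) ?b) + scale (4 * of_nat p * of_nat p - 2 * of_nat p) (L (- 3) a)) n w"
  using a by (simp add: prim_def)
 also have "... = scale (of_int (cub n N)) ?A - (scale (4 * of_nat p) s - scale (4 * of_nat p * of_nat p - 2 * of_nat p) t)"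
  unfolding Z1_add lin_diff[OF Z_lin1] Z1_scale b3 s t cub_def
  by (rule poly_mapping_eqI) (simp add: lookup_add lookup_minus lookup_scale algebra_simps)
 finally have "scale (of_int (cub n N)) ?A = scale (4 * of_nat p) s - scale (4 * of_nat p * of_nat p - 2 * of_nat p) t" by simp
 hence "scale (of_int (cub n N)) ?A \<in> U" using s(1) t(1) sub by simp
 hence "scale (1 / of_int (cub n N)) (scale (of_int (cub n N)) ?A) \<in> U" by (rule sub(2))
 thus ?thesis using c by simp
qed

text \<open>Abstract targets for products of generators. The same induction is run with zero spaces,
  with vectors whose evaluations are multiples of that of \<open>H\<close>, with words in the
  generators, and with vectors reducible modulo \<open>O(V)\<close>.\<close>

definition vc :: "(int => fock set) => bool" where
 "vc U \<longleftrightarrow> (\<forall>N. pm.subspace (U N)) \<and> (\<forall>N v k. k >= 1 \<longrightarrow> v \<in> U N \<longrightarrow> L (- k) v \<in> U (N + k))"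

lemma vcs: "vc U ==> pm.subspace (U N)" and vcL: "vc U ==> v \<in> U N ==> k >= 1 ==> M = N + k ==> L (- k) v \<in> U M"
 by (auto simp: vc_def)

lemma vc_trivial: "vc (%_. {0})"
 by (simp add: vc_def L_0 pm.subspace_def)

lemma vc_pow: "vc U ==> v \<in> U N ==> M = N + int j ==> (L (- 1) ^^ j) v \<in> U M"
proof (induction j arbitrary: M)
 case (Suc j)
 show ?case using vcL[OF Suc.prems(1) Suc.IH[OF Suc.prems(1,2) refl], of 1 M] Suc.prems(3) by simp
qed simp

lemma Lm1_pow_lin: "lin (L (- 1) ^^ j)"
 by (induction j) (auto simp: lin_def L_add L_scale)

text \<open>The mode at which the product of two vectors of weight \<open>2p - 1\<close> has weight
  0.\<close>

definition W0 :: int where "W0 = 4 * int p - 3"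

lemma gr_prod: "gr wF k a ==> gr wF l b ==> gr (W0 - m) (k + l) (Y a m b)"
 using gr_Y[of wF k a wF l b m] by (simp add: wF_def W0_def algebra_simps)

text \<open>With \<open>n = m + 3\<close> the roots are the modes \<open>m = W0\<close>,
  \<open>2p - 2\<close> and \<open>- 2p - 1\<close>, where the product has weight 0,
  \<open>2p - 1\<close> and \<open>6p - 2\<close>. The last root is the reason for the bound
  \<open>m >= - 2p\<close> in the product lemmas.\<close>

lemma cub_wF: "cub n wF = - ((n - 4 * int p) * (n - pp - 1) * (n + pp - 2))"
 by (simp add: cub_def wF_def algebra_simps)

text \<open>Downward in \<open>m\<close>: by \<open>cubic\<close> the mode \<open>m\<close> comes
  from Virasoro descendants of higher modes, except at the roots of \<open>cub\<close>, where
  \<open>base\<close> and \<open>gap\<close> supply it.\<close>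

lemma prod_step:
 assumes vc: "vc U" and ab: "prim a" "gr wF k a" "prim b" "gr wF l b"
  and base: "Y a W0 b \<in> U 0" and m1: "m1 < W0"
  and gap: "!!m. m1 <= m ==> m = pp - 2 ==> Y a m b \<in> U (W0 - m)" and lo: "m1 >= - 2 * int p"
 shows "m >= m1 ==> Y a m b \<in> U (W0 - m)"
proof (induction "nat (W0 - m)" arbitrary: m rule: less_induct)
 case less
 note sub = vcs[OF vc, of "W0 - m"]
 consider "m > W0" | "m = W0" | "m = pp - 2" | "m < W0" "m ~= pp - 2" by linarith
 thus ?case
 proof cases
  case 1
  hence "Y a m b = 0" using gr_neg[OF gr_prod[OF ab(2,4), of m]] w0_nonneg[of "k + l"] by simp
  thus ?thesis using pm.subspace_0[OF sub] by simp
 next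
  case 4
  have "Y a (m + 3 - 3) b \<in> U (W0 - m)"
  proof (rule cubic[OF ab(1) prim_0[OF ab(3)] sub])
   fix j :: nat
   have "Y a (m + 1 + int j) b \<in> U (W0 - (m + 1 + int j))" by (rule less.hyps) (use 4 less.prems in auto)
   hence "L (- (1 + int j)) (Y a (m + 1 + int j) b) \<in> U (W0 - m)" by (rule vcL[OF vc]) auto
   thus "L (- 1 - int j) (Y a (m + 3 - 2 + int j) b) \<in> U (W0 - m)" by (simp add: algebra_simps)
   show "Y a (m + 3 - 4 - int j) (L (int j + 1) b) \<in> U (W0 - m)"
    using prim_pos[OF ab(3)] pm.subspace_0[OF sub] by (simp add: Y_0)
  next
   show "cub (m + 3) wF ~= 0" using 4 less.prems lo by (auto simp: cub_wF W0_def)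
  qed
  thus ?thesis by simp
 qed (use base gap less.prems in auto)
qed

lemma prod_all:
 assumes vc: "vc U" and ab: "prim a" "gr wF k a" "prim b" "gr wF l b"
  and base: "Y a W0 b \<in> U 0" "Y a (pp - 2) b \<in> U wF" and m: "m >= - 2 * int p"
 shows "Y a m b \<in> U (W0 - m)"
 by (rule prod_step[OF vc ab base(1) _ _ _ m]) (use base(2) pge in "auto simp: W0_def wF_def")

lemma prod_hi:
 assumes vc: "vc U" and ab: "prim a" "gr wF k a" "prim b" "gr wF l b" and base: "Y a W0 b \<in> U 0" and m: "m >= wF"
 shows "Y a m b \<in> U (W0 - m)"
 by (rule prod_step[OF vc ab base _ _ _ m]) (use pge in "auto simp: W0_def wF_def")

lemma prod_skew:
 assumes vc: "vc U" and ab: "a \<in> VL" "b \<in> VL" and m: "!!j::nat. Y a (m + int j) b \<in> U (W0 - m - int j)"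
 shows "Y b m a \<in> U (W0 - m)"
 unfolding skew[OF ab] by (intro pm.subspace_scale Sum_any_subspace vcs[OF vc] vc_pow[OF vc m]) simp

definition kap :: complex where "kap = lookup (Y E W0 F) ({#}, 0)"
definition kp :: complex where "kp = lookup (Y H (pp - 2) F) ({#}, - 2 * int p)"

lemma EF_top: "Y E W0 F = scale kap one"
 using gr_0_one(1)[of 0 "Y E W0 F"] gr_prod[OF gr_E gr_F, of W0] by (simp add: kap_def)

lemma HF_low: "Y H (pp - 2) F = scale kp F"
proof -
 have "gr wF (- 1) (Y H (pp - 2) F)" using gr_prod[OF gr_H gr_F, of "pp - 2"] by (simp add: W0_def wF_def)
 hence hm: "hm 0 (- 2 * int p) (Y H (pp - 2) F)" by (simp add: gr_def w0_m1)
 have l: "lin (%v. scale (lookup v ({#}, - 2 * int p)) F)" by (simp add: lin_def lookup_add lookup_scale pm.scale_left_distrib)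
 show ?thesis unfolding kp_def by (rule hm_eq[OF hm lin_id l]) (auto simp: F_def dest!: lev_0_1(1))
qed

lemma HF_top: "Y H W0 F = 0" and EH_top: "Y E W0 H = 0" and EE_top: "Y E W0 E = 0" and EE_low: "Y E (pp - 2) E = 0"
proof -
 show "Y H W0 F = 0" "Y E W0 H = 0"
  using gr_prod[OF gr_H gr_F, of W0] gr_prod[OF gr_E gr_H, of W0] by (auto intro: gr_0_one(2))
 show "Y E W0 E = 0" "Y E (pp - 2) E = 0"
  using gr_prod[OF gr_E gr_E, of W0] gr_prod[OF gr_E gr_E, of "pp - 2"]
  by (auto intro!: gr_neg simp: w0_2 W0_def)
qed

lemma HH_EF: "Y H m H = Q (Y H m F) - Y E m F"
 unfolding Q_Y[OF V_VL[OF H_V]] by (simp add: E_def[symmetric] H_def[symmetric])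

lemma HH_top: "Y H W0 H = - scale kap one"
 unfolding HH_EF HF_top EF_top by (simp add: Q_0)

lemma prod_HF:
 assumes "vc U" "F \<in> U wF" "m >= - 2 * int p" shows "Y H m F \<in> U (W0 - m)" and "Y F m H \<in> U (W0 - m)"
proof -
 have 1: "Y H m F \<in> U (W0 - m)" if "m >= - 2 * int p" for m
  by (rule prod_all[OF assms(1) prim_H gr_H prim_F gr_F _ _ that])
    (use assms(2) vcs[OF assms(1)] in "auto simp: HF_top HF_low pm.subspace_0 pm.subspace_scale")
 show "Y H m F \<in> U (W0 - m)" by (rule 1[OF assms(3)])
 have "Y H (m + int j) F \<in> U (W0 - m - int j)" for j using 1[of "m + int j"] assms(3) by (simp add: algebra_simps)
 thus "Y F m H \<in> U (W0 - m)" by (rule prod_skew[OF assms(1) primVL[OF prim_H] primVL[OF prim_F]])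
qed

lemma eq_neg_add: "x = - (x + y) ==> scale 2 x = - (y :: fock)"
proof -
 assume x: "x = - (x + y)"
 have "scale 2 x = x + x" using pm.scale_left_distrib[of 1 1 x] by simp
 also have "... = - y" by (subst x) simp
 finally show ?thesis .
qed

text \<open>At the mode \<open>2p - 2\<close> skew symmetry reads
  \<open>x = - (x + derivatives of higher products)\<close>, which determines \<open>x\<close>. The
  products of \<open>E\<close> and \<open>F\<close> follow through
  \<open>Q (H_m F) = E_m F + H_m H\<close>.\<close>

lemma prod_HH:
 assumes vc: "vc U" and H: "H \<in> U wF" and one: "scale kap one \<in> U 0" and m: "m >= - 2 * int p"
 shows "Y H m H \<in> U (W0 - m)" and "Y E m F \<in> U (W0 - m)" and "Y F m E \<in> U (W0 - m)"
proof -
 let ?m = "pp - 2"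
 note sub = vcs[OF vc, of wF]
 have w: "W0 - ?m = wF" by (simp add: W0_def wF_def)
 have top: "Y H W0 H \<in> U 0" unfolding HH_top by (rule pm.subspace_neg[OF vcs[OF vc] one])
 have hi: "Y H m H \<in> U (W0 - m)" if "m >= wF" for m
  by (rule prod_hi[OF vc prim_H gr_H prim_H gr_H top that])
 let ?g = "%j. scale ((-1) ^ j / fact j) ((L (- 1) ^^ j) (Y H (?m + int j) H))"
 have eg: "ez ?g" by (rule ez_scale, rule ez_lin[where T = "%j. L (- 1) ^^ j"]) (use Y_ez1[of "%_. 1"] in "auto intro: Lm1_pow_lin")
 have "Y H ?m H = - Sum_any ?g" using skew[OF primVL[OF prim_H] primVL[OF prim_H], of ?m] by (simp add: sg_def pm.scale_minus_left)
 also have "Sum_any ?g = Y H ?m H + Sum_any (%j. ?g (Suc j))" using Sum_any_Suc[OF eg] by simp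
 finally have "scale 2 (Y H ?m H) = - Sum_any (%j. ?g (Suc j))"
  by (rule eq_neg_add)
 moreover have "Sum_any (%j. ?g (Suc j)) \<in> U wF"
 proof (intro Sum_any_subspace[OF sub] pm.subspace_scale[OF sub])
  fix j
  show "(L (- 1) ^^ Suc j) (Y H (?m + int (Suc j)) H) \<in> U wF"
   by (rule vc_pow[OF vc hi]) (auto simp: W0_def wF_def)
 qed
 ultimately have "scale 2 (Y H ?m H) \<in> U wF" by (simp add: pm.subspace_neg[OF sub])
 hence "scale (1/2) (scale 2 (Y H ?m H)) \<in> U wF" by (rule pm.subspace_scale[OF sub])
 hence low: "Y H ?m H \<in> U wF" by simp
 show "Y H m H \<in> U (W0 - m)" by (rule prod_all[OF vc prim_H gr_H prim_H gr_H top low m])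
 have "Y E ?m F = scale kp H - Y H ?m H" unfolding HH_EF HF_low by (simp add: Q_scale H_def)
 hence lowE: "Y E ?m F \<in> U wF" using low H sub by (simp add: pm.subspace_diff pm.subspace_scale)
 have 1: "Y E m F \<in> U (W0 - m)" if "m >= - 2 * int p" for m
  by (rule prod_all[OF vc prim_E gr_E prim_F gr_F _ lowE that]) (simp add: EF_top one)
 show "Y E m F \<in> U (W0 - m)" by (rule 1[OF m])
 have "Y E (m + int j) F \<in> U (W0 - m - int j)" for j using 1[of "m + int j"] m by (simp add: algebra_simps)
 thus "Y F m E \<in> U (W0 - m)" by (rule prod_skew[OF vc primVL[OF prim_E] primVL[OF prim_F]])
qed

lemma EH_hi: "m >= wF ==> Y E m H = 0"
 using prod_hi[OF vc_trivial prim_E gr_E prim_H gr_H] EH_top by simp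

text \<open>\<open>Q\<close> applied twice to \<open>HF_low\<close> gives \<open>kp E\<close> as
  twice the product of \<open>E\<close> and \<open>H\<close> plus the product in opposite order.
  Higher products vanish, so by skew symmetry the latter is minus one copy of the former.\<close>

lemma EH_low: "Y E (pp - 2) H = scale kp E"
proof -
 let ?m = "pp - 2"
 have "Y H ?m E = - Y E ?m H"
 proof -
  have "Sum_any (%j. scale ((-1) ^ j / fact j) ((L (- 1) ^^ j) (Y E (?m + int j) H))) = scale ((-1) ^ 0 / fact 0) ((L (- 1) ^^ 0) (Y E (?m + int 0) H))"
  proof (rule Sum_any_single)
   fix j :: nat assume "j ~= 0"
   hence "?m + int j >= wF" by (simp add: wF_def)
   hence "Y E (?m + int j) H = 0" by (rule EH_hi)
   moreover have "(L (- 1) ^^ j) 0 = 0" by (induction j) (auto simp: L_0)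
   ultimately show "scale ((-1) ^ j / fact j) ((L (- 1) ^^ j) (Y E (?m + int j) H)) = 0" by simp
  qed
  thus ?thesis using skew[OF primVL[OF prim_E] primVL[OF prim_H], of ?m] by (simp add: sg_def pm.scale_minus_left)
 qed
 moreover have "scale kp E = Q (Q (Y H ?m F))" by (simp add: HF_low Q_scale H_def[symmetric] E_def[symmetric])
 moreover have "... = Y E ?m H + (Y E ?m H + Y H ?m E)"
  by (simp add: Q_Y primVL[OF prim_H] primVL[OF prim_E] Q_add H_def[symmetric] E_def[symmetric] Q_E)
 ultimately show ?thesis by simp
qed

lemma prod_EH:
 assumes "vc U" "E \<in> U wF" "m >= - 2 * int p" shows "Y E m H \<in> U (W0 - m)" and "Y H m E \<in> U (W0 - m)"
proof -
 have 1: "Y E m H \<in> U (W0 - m)" if "m >= - 2 * int p" for m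
  by (rule prod_all[OF assms(1) prim_E gr_E prim_H gr_H _ _ that])
    (use assms(2) vcs[OF assms(1)] in "auto simp: EH_top EH_low pm.subspace_0 pm.subspace_scale")
 show "Y E m H \<in> U (W0 - m)" by (rule 1[OF assms(3)])
 have "Y E (m + int j) H \<in> U (W0 - m - int j)" for j using 1[of "m + int j"] assms(3) by (simp add: algebra_simps)
 thus "Y H m E \<in> U (W0 - m)" by (rule prod_skew[OF assms(1) primVL[OF prim_E] primVL[OF prim_H]])
qed

lemma prod_EE: "m >= - 2 * int p ==> Y E m E = 0"
 using prod_all[OF vc_trivial prim_E gr_E prim_E gr_E] EE_top EE_low by simp

lemma prod_FF: "m >= - 2 * int p ==> Y F m F = 0"
 using gr_prod[OF gr_F gr_F, of m] by (auto intro!: gr_neg simp: w0_m2 W0_def)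

end

section \<open>Evaluation on Fock modules\<close>

text \<open>The field of \<alpha>(-i-1) is the \<open>i\<close>-th divided derivative of
  \<alpha>(x), in which \<alpha>(0) has the coefficient \<open>(-1)^i x^(-i-1)\<close>; hence the
  factor \<open>(-1)^i b\<close>.\<close>

definition evm :: "nat multiset \<times> int => complex poly" where
 "evm = (%(M, c). if c = 0 then \<Prod>i\<in>#M. [:0, (-1) ^ i:] else 0)"

text \<open>For \<open>v\<close> of charge 0 and weight \<open>N\<close>, the mode \<open>v\<^sub>N\<^sub>-\<^sub>1\<close> multiplies \<open>e\<^sup>b\<close> by \<open>poly (evp v) b\<close>.\<close>

definition evp :: "fock => complex poly" where
 "evp v = (\<Sum>k\<in>keys v. psmult (lookup v k) (evm k))"

definition lf :: "(fock => complex poly) => bool" where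
 "lf f \<longleftrightarrow> (\<forall>x y. f (x + y) = f x + f y) \<and> (\<forall>c x. f (scale c x) = psmult c (f x))"

lemma smult_sum_distrib: "psmult c (sum f A) = (\<Sum>a\<in>A. psmult c (f a))"
 by (induction A rule: infinite_finite_induct) (simp_all add: smult_add_right)

lemma evp_superset:
 assumes "finite A" "keys v \<subseteq> A" shows "evp v = (\<Sum>k\<in>A. psmult (lookup v k) (evm k))"
 unfolding evp_def by (rule sum.mono_neutral_left[OF assms]) (simp add: in_keys_iff)

lemma evp_lf: "lf evp"
 unfolding lf_def
proof (intro conjI allI)
 fix x y :: fock
 have "evp (x + y) = (\<Sum>k\<in>keys x \<union> keys y. psmult (lookup (x + y) k) (evm k))"
  by (rule evp_superset) (auto dest: keys_add[THEN subsetD])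
 thus "evp (x + y) = evp x + evp y"
  by (simp add: evp_superset[of "keys x \<union> keys y" x] evp_superset[of "keys x \<union> keys y" y]
    lookup_add smult_add_left sum.distrib)
next
 fix c and x :: fock
 have "evp (scale c x) = (\<Sum>k\<in>keys x. psmult (lookup (scale c x) k) (evm k))"
  by (rule evp_superset) (auto simp: in_keys_iff lookup_scale)
 thus "evp (scale c x) = psmult c (evp x)" unfolding evp_def by (simp add: lookup_scale smult_sum_distrib)
qed

lemma lf_add: "lf f ==> f (x + y) = f x + f y" and lf_scale: "lf f ==> f (scale c x) = psmult c (f x)"
 by (auto simp: lf_def)

lemma lf_0: "lf f ==> f 0 = 0" using lf_scale[of f 0 0] by simp

lemma lf_sum: "lf f ==> f (sum g A) = (\<Sum>a\<in>A. f (g a))"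
 by (induction A rule: infinite_finite_induct) (auto simp: lf_0 lf_add)

lemma lf_eq:
 assumes "lf f" "lf g" "!!k. k \<in> keys v ==> f (single k 1) = g (single k 1)"
 shows "f v = g v"
 by (subst (1 2) poly_mapping_decomp[of v]) (simp add: lf_sum[OF assms(1)] lf_sum[OF assms(2)] lf_scale[OF assms(1)] lf_scale[OF assms(2)] assms(3))

lemma lf_lin: "lf f ==> lin T ==> lf (%v. f (T v))" by (simp add: lf_def lin_add lin_scale)
lemma lf_mult: "lf f ==> lf (%v. q * f v)" by (simp add: lf_def distrib_left)

lemma lf_eq_hm: "hm m b v ==> lf f ==> lf g ==> (!!M. int (lev M) = m ==> f (st M b) = g (st M b)) ==> f v = g v"
 by (rule lf_eq) (auto simp: hm_def in_keys_iff)

lemma evp_add: "evp (x + y) = evp x + evp y" and evp_scale: "evp (scale c x) = psmult c (evp x)" and evp_0 [simp]: "evp 0 = 0"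
 and evp_sum: "evp (sum g A) = (\<Sum>a\<in>A. evp (g a))"
 using evp_lf by (auto simp: lf_add lf_scale lf_0 lf_sum)

lemma evp_diff: "evp (x - y) = evp x - evp y"
 using evp_add[of x "scale (- 1) y"] evp_scale[of "- 1" y] by (simp add: pm.scale_minus_left)

lemma evp_st: "evp (st M b) = evm (M, b)" by (simp add: evp_def)

lemma evp_Sum_any: assumes "ez f" shows "evp (Sum_any f) = Sum_any (%j. evp (f j))"
proof -
 obtain N where "!!j. j >= N ==> f j = 0" using assms by (auto simp: ez_def)
 thus ?thesis using Sum_any_lessThan[of N f] Sum_any_lessThan[of N "%j. evp (f j)"] by (simp add: evp_sum)
qed

lemma evp_charge: assumes "ch b v" "b ~= 0" shows "evp v = 0"
proof -
 have "evm k = 0" if k: "k \<in> keys v" for k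
 proof -
  obtain M c where kk: "k = (M, c)" by force
  have "c = b" using k assms(1) unfolding ch_def kk by (auto simp: in_keys_iff)
  thus ?thesis using assms(2) by (simp add: evm_def kk)
 qed
 thus ?thesis by (simp add: evp_def)
qed

lemma evp_create: "evp (heis p (- int i - 1) v) = [:0, (-1) ^ i:] * evp v"
proof (rule lf_eq[OF lf_lin[OF evp_lf heis_lin] lf_mult[OF evp_lf]])
 fix k :: "nat multiset \<times> int"
 obtain M b where k: "k = (M, b)" by force
 show "evp (heis p (- int i - 1) (single k 1)) = [:0, (-1) ^ i:] * evp (single k 1)"
  unfolding k heis_create evp_st evm_def by simp
qed

text \<open>Under evaluation the Euler recursion of the creation exponential becomes that of the
  coefficients of \<open>(1+z)^(ax/2p)\<close>.\<close>

lemma evp_cre: assumes p: "p > 0" shows "poly (evp (cre p a (int J) one')) x = ((of_int a / of_nat (2 * p) * x) gchoose J) * poly (evp one') x"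
proof (induction J rule: less_induct)
 case (less J)
 let ?y = "of_int a / of_nat (2 * p) * x" and ?e = "poly (evp one') x"
 show ?case
 proof (cases "J = 0")
  case False
  have "of_nat J * poly (evp (cre p a (int J) one')) x = poly (evp (scale (of_nat J) (cre p a (int J) one'))) x"
   by (simp add: evp_scale)
  also have "... = (\<Sum>k\<in>{1..J}. of_int a / of_nat (2 * p) * ((-1) ^ (k - 1) * x * poly (evp (cre p a (int (J - k)) one')) x))"
   unfolding cre_euler[OF p] evp_sum evp_scale evp_create by (simp add: poly_sum mult_ac)
  also have "... = (\<Sum>k\<in>{1..J}. (-1) ^ (k - 1) * ?y * (?y gchoose (J - k)) * ?e)"
  proof (intro sum.cong refl)
   fix k assume "k \<in> {1..J}"
   hence "J - k < J" by auto
   from less.IH[OF this]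
   show "of_int a / of_nat (2 * p) * ((-1) ^ (k - 1) * x * poly (evp (cre p a (int (J - k)) one')) x) = (-1) ^ (k - 1) * ?y * (?y gchoose (J - k)) * ?e"
    by (simp only: mult_ac)
  qed
  also have "... = of_nat J * (?y gchoose J) * ?e"
   unfolding gbinomial_euler[of J ?y] by (simp add: sum_distrib_right)
  finally show ?thesis using False by simp
 qed simp
qed

context lat begin

text \<open>\<open>wq\<close> extended to complex charges, as the evaluations are polynomials in
  \<open>b\<close>.\<close>

definition hb :: "complex => complex" where "hb b = b * (b - 2 * of_nat p + 2) / (4 * of_nat p)"

abbreviation ev :: "complex => fock => complex" where "ev b v \<equiv> poly (evp v) b"

text \<open>The vacuum values are a hypothesis because the lemma is used twice. For
  \<open>k = 1\<close> they are trivially 0, and the result gives the evaluations of the derivatives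
  of \<open>om\<close>; these provide the vacuum values for all \<open>k\<close> in
  \<open>ev_L\<close>.\<close>

lemma ev_L_step:
 assumes "k >= 1" "!!b. ev b (L (- int k) one) = (-1) ^ k * (of_nat k - 1) * hb b" and v: "gr N 0 v"
 shows "ev b (L (- int k) v) = (-1) ^ k * ((of_nat k - 1) * hb b + of_int N) * ev b v"
proof -
 let ?H = "[:0, (2 - 2 * of_nat p) / (4 * of_nat p), 1 / (4 * of_nat p) :: complex:]"
 let ?q = "%N. psmult ((-1) ^ k) (psmult (of_nat k - 1) ?H + [:of_int N:])"
 have pq: "poly (?q N) b = (-1) ^ k * ((of_nat k - 1) * hb b + of_int N)" for N b
  using p0 by (simp add: hb_def field_simps)
 have *: "ev b (L (- int k) (st M 0)) = (-1) ^ k * ((of_nat k - 1) * hb b + of_nat (lev M)) * ev b (st M 0)" for M b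
 proof (induction M)
  case empty thus ?case using assms(2) by (simp add: evp_st evm_def)
 next
  case (add i M)
  have e: "- int k + (- int i - 1) = - int (k + i) - 1" by simp
  have n: "- int k + (- int i - 1) ~= 0" by simp
  have "L (- int k) (st (add_mset i M) 0) = h (- int i - 1) (L (- int k) (st M 0)) + scale (of_nat (Suc i)) (h (- int (k + i) - 1) (st M 0))"
   unfolding heis_create[of p i M 0, symmetric] L_h e[symmetric] if_not_P[OF n] by (auto intro!: poly_mapping_eqI simp: lookup_add lookup_minus lookup_scale algebra_simps)
  thus ?case unfolding heis_create[of p i M 0, symmetric]
   by (simp only: evp_add evp_scale evp_create poly_add poly_smult poly_mult add.IH) (simp add: power_add algebra_simps)
 qed
 have "evp (L (- int k) v) = ?q N * evp v"
 proof (rule lf_eq_hm[OF _ lf_lin[OF evp_lf L_lin] lf_mult[OF evp_lf]])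
  show "hm N 0 v" using v by (simp add: gr_def w0_def)
  fix M assume M: "int (lev M) = N"
  hence "(of_int N :: complex) = of_nat (lev M)" by (metis of_int_of_nat_eq)
  hence "poly (evp (L (- int k) (st M 0))) x = poly (?q N * evp (st M 0)) x" for x
   unfolding poly_mult pq * by simp
  hence "poly (evp (L (- int k) (st M 0))) = poly (?q N * evp (st M 0))" by (rule ext)
  thus "evp (L (- int k) (st M 0)) = ?q N * evp (st M 0)" by (simp only: poly_eq_poly_eq_iff)
 qed
 thus ?thesis by (simp only: poly_mult pq)
qed

lemma ev_om: "ev b om = hb b"
 using p0 by (simp add: om_def evp_add evp_scale evp_st evm_def hb_def field_simps)

lemma ev_L1: "gr N 0 v ==> ev b (L (- 1) v) = - of_int N * ev b v"
 using ev_L_step[of 1 N v b] by (simp add: L_def Y_nn_one)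

lemma ev_L:
 assumes k: "k >= 1" and v: "gr N 0 v"
 shows "ev b (L (- int k) v) = (-1) ^ k * ((of_nat k - 1) * hb b + of_int N) * ev b v"
proof (rule ev_L_step[OF k _ v])
 fix b
 show "ev b (L (- int k) one) = (-1) ^ k * (of_nat k - 1) * hb b"
 proof (cases "k = 1")
  case False
  define j where "j = k - 2"
  have kj: "k = j + 2" using k False by (simp add: j_def)
  have "gr (2 + int j) 0 ((L (- 1) ^^ j) om) \<and> ev b ((L (- 1) ^^ j) om) = (-1) ^ j * fact (Suc j) * hb b" for j
  proof (induction j)
   case (Suc j)
   hence g: "gr (2 + int j) 0 ((L (- 1) ^^ j) om)" and e: "ev b ((L (- 1) ^^ j) om) = (-1) ^ j * fact (Suc j) * hb b" by auto
   have "gr (2 + int (Suc j)) 0 (L (- 1) ((L (- 1) ^^ j) om))" using gr_L[OF g, of "- 1"] by (simp add: algebra_simps)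
   thus ?case using ev_L1[OF g, of b] unfolding e by (simp add: algebra_simps)
  qed (simp add: gr_om ev_om)
  hence "ev b ((L (- 1) ^^ j) om) = (-1) ^ j * fact (Suc j) * hb b" by blast
  moreover have "L (- int k) one = scale (1 / fact j) ((L (- 1) ^^ j) om)"
  proof -
   have "- int k + 1 = - int j - 1" by (simp add: kj)
   thus ?thesis using Y_desc[OF om_VL, of j] unfolding L_def by (simp only:)
  qed
  ultimately show ?thesis by (simp add: evp_scale kj)
 qed (simp add: L_def Y_nn_one)
qed

text \<open>\<open>H\<close> is the creation coefficient of degree \<open>2p - 1\<close> of
  \<open>e^\<alpha>\<close> on the vacuum, a Schur polynomial in the oscillators.\<close>

lemma ev_H: "ev b H = b gchoose (2 * p - 1)"
proof -
 have e: "H = cre p pp (int (2 * p - 1)) one"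
  unfolding H_def Q_def F_def using p0 Y_exp_exp[of pp "- 2 * int p" "- 2 * int p" 0] by (simp add: of_nat_diff)
 show ?thesis unfolding e evp_cre[OF p0] using p0 by (simp add: evp_st evm_def)
qed

lemma o_ev: assumes "gr N 0 x" shows "Y x (N - 1) (st {#} b) = scale (ev (of_int b) x) (st {#} b)"
proof -
 have *: "Y (st M 0) (int (lev M) - 1) (st {#} b) = scale (ev (of_int b) (st M 0)) (st {#} b)" for M
 proof (induction M)
  case empty thus ?case by (simp add: Y_one evp_st evm_def)
 next
  case (add i M)
  have "Y (st M 0) (int (lev M) + int g) (st {#} b) = 0" for g :: nat
   by (rule hm_neg[OF Y_hm[OF _ hm_st hm_st, of _ _ 0]]) auto
  hence "Sum_any (%g. scale (bc (int g) i) (h (- int g - 1) (Y (st M 0) (int (lev (add_mset i M)) - 1 - int i + int g) (st {#} b)))) = 0"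
   by (simp add: heis_0)
  moreover have "int (lev (add_mset i M)) - 1 - int i - 1 = int (lev M) - 1" by simp
  ultimately have "Y (st (add_mset i M) 0) (int (lev (add_mset i M)) - 1) (st {#} b) = scale ((-1) ^ i * of_int b) (Y (st M 0) (int (lev M) - 1) (st {#} b))"
   unfolding heis_create[of p i M 0, symmetric] Z_create_top[OF p0] by simp
  thus ?case unfolding add.IH heis_create[of p i M 0, symmetric] evp_create by (simp add: mult_ac)
 qed
 let ?f = "%x. single ({#} :: nat multiset, b) (ev (of_int b) x)"
 have "lin ?f" by (simp add: lin_def evp_add evp_scale single_add) (auto intro!: poly_mapping_eqI simp: lookup_single lookup_scale when_def)
 moreover have "?f x = scale (ev (of_int b) x) (st {#} b)" for x by (auto intro!: poly_mapping_eqI simp: lookup_single lookup_scale when_def)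
 ultimately have "lin (%x. scale (ev (of_int b) x) (st {#} b))" by simp
 thus ?thesis using * assms
  by (intro hm_eq[of N 0 x "%x. Y x (N - 1) (st {#} b)" "%x. scale (ev (of_int b) x) (st {#} b)"]) (auto simp: gr_def w0_def Z_lin1)
qed

subsection \<open>Products on top vectors\<close>

text \<open>\<open>J n r u v\<close> is the residue of \<open>Y(u,x) (1+x)\<^sup>n x\<^sup>r v\<close>.\<close>

definition J :: "nat => int => fock => fock => fock" where
 "J n r u v = (\<Sum>j\<le>n. scale (of_nat (n choose j)) (Y u (int j + r) v))"

lemma J_lin1: "lin (%u. J n r u v)" and J_lin2: "lin (J n r u)"
 unfolding J_def[abs_def] by (intro lin_sm lin_scl Z_lin1 Y_lin)+

definition vanish :: "int => fock => fock => bool" where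
 "vanish N u w \<longleftrightarrow> (\<forall>l\<ge>N. Y u l w = 0)"

text \<open>Zhu's computation: on a vector killed by the modes that lower the weight, zero modes
  turn the product into composition and annihilate the circle product. It is the Borcherds identity
  with \<open>m\<close> the weight of \<open>u\<close>, at \<open>n = - 1\<close> and
  \<open>n = - 2\<close>.\<close>

lemma o_J:
 assumes u: "u \<in> VL" "vanish (int n) u w" and v: "v \<in> VL" "vanish (int n') v w"
 shows "(\<Sum>j\<le>n. scale (of_nat (n choose j)) (Y (Y u (int j - 1) v) (int n + int n' - int j - 1) w)) = Y u (int n - 1) (Y v (int n' - 1) w)" (is ?A)
  and "(\<Sum>j\<le>n. scale (of_nat (n choose j)) (Y (Y u (int j - 2) v) (int n + int n' - int j) w)) = 0" (is ?B)
proof -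
 have B1: "B1 p u v w (int n) k r = (\<Sum>j\<le>n. scale (of_nat (n choose j)) (Y (Y u (int j + r) v) (int n + k - int j) w))" for k r
 proof -
  have "B1 p u v w (int n) k r = (\<Sum>j<Suc n. scale (bc (int n) j) (Y (Y u (r + int j) v) (int n + k - int j) w))"
   unfolding B1_def by (rule Sum_any_lessThan) (simp add: bc_nat binomial_eq_0 del: of_int_of_nat_eq)
  thus ?thesis unfolding bc_nat lessThan_Suc_atMost by (simp add: add.commute)
 qed
 have B3: "B3 p u v w (int n) k r = 0" for k r
  unfolding B3_def using u(2) by (simp add: vanish_def Y_0)
 have B2: "B2 p u v w (int n) k r = scale ((-1) ^ 0 * bc r 0) (Y u (int n + r - int 0) (Y v (k + int 0) w))" if "k >= int n' - 1" for k r
  unfolding B2_def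
 proof (rule Sum_any_single)
  fix j :: nat assume "j ~= 0"
  hence "Y v (k + int j) w = 0" using v(2) that by (simp add: vanish_def)
  thus "scale ((-1) ^ j * bc r j) (Y u (int n + r - int j) (Y v (k + int j) w)) = 0" by (simp add: Y_0)
 qed
 show ?A using borcherds_VL[OF u(1) v(1), of w "int n" "int n' - 1" "- 1"] B2[of "int n' - 1" "- 1"]
  unfolding B1 B3 by (simp add: algebra_simps)
 have "Y v (int n') w = 0" using v(2) by (simp add: vanish_def)
 thus ?B using borcherds_VL[OF u(1) v(1), of w "int n" "int n'" "- 2"] B2[of "int n'" "- 2"]
  unfolding B1 B3 by (simp add: algebra_simps Y_0)
qed

lemma ev_J:
 assumes u: "gr (int n) k u" "vanish (int n) u (st {#} b)" and v: "gr (int n') (- k) v" "vanish (int n') v (st {#} b)"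
 shows "scale (ev (of_int b) (J n (- 1) u v)) (st {#} b) = Y u (int n - 1) (Y v (int n' - 1) (st {#} b))"
  and "ev (of_int b) (J n (- 2) u v) = 0"
proof -
 let ?w = "st {#} b"
 have o: "scale (ev (of_int b) (Y u (int j + r) v)) ?w = Y (Y u (int j + r) v) (int n + int n' - int j - r - 2) ?w" for j r
  using o_ev[OF gr_Y[OF u(1) v(1), of "int j + r", simplified], of b] by (simp add: algebra_simps)
 have "scale (ev (of_int b) (J n r u v)) ?w = (\<Sum>j\<le>n. scale (of_nat (n choose j)) (Y (Y u (int j + r) v) (int n + int n' - int j - r - 2) ?w))" for r
  unfolding J_def evp_sum evp_scale poly_sum poly_smult pm.scale_sum_left by (simp add: o[symmetric])
 note * = this
 have e: "int n + int n' - int j - (- 1) - 2 = int n + int n' - int j - 1" for j by simp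
 show "scale (ev (of_int b) (J n (- 1) u v)) ?w = Y u (int n - 1) (Y v (int n' - 1) ?w)"
  using o_J(1)[OF gr_VL[OF u(1)] u(2) gr_VL[OF v(1)] v(2)] *[of "- 1", unfolded e] by simp
 have "scale (ev (of_int b) (J n (- 2) u v)) ?w = 0"
  using o_J(2)[OF gr_VL[OF u(1)] u(2) gr_VL[OF v(1)] v(2)] *[of "- 2"] by simp
 thus "ev (of_int b) (J n (- 2) u v) = 0" by simp
qed

lemma vanish_0: assumes "gr N 0 u" shows "vanish N u (st {#} b)"
 unfolding vanish_def
proof (intro allI impI)
 fix l assume "N <= l"
 have "hm N 0 u" using assms by (simp add: gr_def w0_def)
 thus "Y u l (st {#} b) = 0"
  by (intro hm_neg[OF Y_hm[OF _ _ hm_st, of 0 b 0]]) (use \<open>N <= l\<close> in auto)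
qed

lemma ev_J0:
 assumes "gr (int n) 0 u" "gr (int n') 0 v"
 shows "ev (of_int b) (J n (- 1) u v) = ev (of_int b) u * ev (of_int b) v" and "ev (of_int b) (J n (- 2) u v) = 0"
proof -
 note va = vanish_0[OF assms(1)] vanish_0[OF assms(2)]
 have "gr (int n') (- 0) v" using assms(2) by simp
 note J = ev_J[OF assms(1) va(1) this va(2), of b]
 show "ev (of_int b) (J n (- 2) u v) = 0" by (rule J(2))
 show "ev (of_int b) (J n (- 1) u v) = ev (of_int b) u * ev (of_int b) v"
  using J(1) unfolding o_ev[OF assms(2)] Y_scale o_ev[OF assms(1)] by (simp add: mult.commute)
qed

definition nF :: nat where "nF = 2 * p - 1"
lemma nF: "int nF = wF" using p0 by (simp add: nF_def wF_def of_nat_diff)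

text \<open>If \<open>kap\<close> were 0, the vacuum would not occur in the products of
  \<open>H\<close> with itself, and the evaluation of \<open>H star H\<close> would be that of
  \<open>H\<close> times a polynomial in the weight. It is also the square, so \<open>ev b H\<close>
  would depend on the weight only, wherever it is nonzero; but \<open>b = 2p - 1\<close> and
  \<open>b = - 1\<close> have equal weight and the values 1 and -1.\<close>

lemma kap_nz: "kap ~= 0"
proof
 assume k: "kap = 0"
 define U where "U N = {v. gr N 0 v \<and> (\<exists>R. \<forall>b. ev b v = poly R (hb b) * ev b H)}" for N
 have s: "pm.subspace (U N)" for N
  unfolding pm.subspace_def
 proof (intro conjI ballI allI)
  show "0 \<in> U N" by (auto simp: U_def intro!: exI[of _ 0])
  show "x + y \<in> U N" if h: "x \<in> U N" "y \<in> U N" for x y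
  proof -
   obtain R R' where "!!b. ev b x = poly R (hb b) * ev b H" "!!b. ev b y = poly R' (hb b) * ev b H" using h by (auto simp: U_def)
   thus ?thesis using h by (auto simp: U_def gr_add evp_add algebra_simps intro!: exI[of _ "R + R'"])
  qed
  show "scale c x \<in> U N" if h: "x \<in> U N" for c x
  proof -
   obtain R where "!!b. ev b x = poly R (hb b) * ev b H" using h by (auto simp: U_def)
   thus ?thesis using h by (auto simp: U_def gr_scale evp_scale intro!: exI[of _ "psmult c R"])
  qed
 qed
 have "vc U"
  unfolding vc_def
 proof (intro conjI allI impI s)
  fix N v and k :: int assume "1 <= k" and v: "v \<in> U N"
  then obtain m where m: "k = int m" "m >= 1" by (metis nonneg_int_cases zero_le_one order_trans of_nat_1 of_nat_le_iff)
  obtain R where g: "gr N 0 v" and R: "!!b. ev b v = poly R (hb b) * ev b H" using v by (auto simp: U_def)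
  have "ev b (L (- k) v) = poly ([:(-1) ^ m * of_int N, (-1) ^ m * (of_nat m - 1):] * R) (hb b) * ev b H" for b
   unfolding m(1) ev_L[OF m(2) g] R by (simp add: algebra_simps)
  hence "\<exists>R. \<forall>b. ev b (L (- k) v) = poly R (hb b) * ev b H" by blast
  thus "L (- k) v \<in> U (N + k)" using gr_L[OF g, of "- k"] by (simp add: U_def)
 qed
 moreover have "H \<in> U wF" using gr_H by (auto simp: U_def intro!: exI[of _ 1])
 moreover have "scale kap one \<in> U 0" using pm.subspace_0[OF s] by (simp add: k)
 ultimately have "Y H (int j + - 1) H \<in> U (W0 - (int j + - 1))" for j
  by (rule prod_HH(1)) (use pge in auto)
 hence "\<exists>R. \<forall>b. ev b (Y H (int j + - 1) H) = poly R (hb b) * ev b H" for j by (auto simp: U_def)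
 then obtain R where R: "!!j b. ev b (Y H (int j + - 1) H) = poly (R j) (hb b) * ev b H" by metis
 have "ev b (J nF (- 1) H H) = poly (\<Sum>j\<le>nF. psmult (of_nat (nF choose j)) (R j)) (hb b) * ev b H" for b
  unfolding J_def evp_sum evp_scale poly_sum poly_smult R sum_distrib_right by (simp add: mult_ac)
 then obtain R' where R': "!!b. ev b (J nF (- 1) H H) = poly R' (hb b) * ev b H" by blast
 have HH: "ev (of_int b) (J nF (- 1) H H) = ev (of_int b) H * ev (of_int b) H" for b :: int
  using ev_J0(1)[of nF H nF H b] gr_H nF by simp
 have 1: "ev (of_int b) H = poly R' (hb (of_int b))" if "ev (of_int b) H ~= 0" for b :: int
  using R'[of "of_int b"] HH[of b] that by simp
 have e: "ev (of_int (pp - 1)) H = 1" "ev (of_int (- 1)) H = - 1"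
 proof -
  have "(of_int (pp - 1) :: complex) = of_nat (2 * p - 1)" using p0 by (simp add: of_nat_diff)
  thus "ev (of_int (pp - 1)) H = 1" unfolding ev_H by (simp flip: binomial_gbinomial)
  show "ev (of_int (- 1)) H = - 1" unfolding ev_H bc_m1[OF p0] using p0 by simp
 qed
 have "hb (of_int (pp - 1)) = hb (of_int (- 1))" by (simp add: hb_def field_simps)
 hence "ev (of_int (pp - 1)) H = ev (of_int (- 1)) H" using 1[of "pp - 1"] 1[of "- 1"] e by simp
 thus False using e by simp
qed

end

section \<open>Strong generation\<close>

context lat begin

definition gen :: "fock => int => int => bool" where
 "gen a n k \<longleftrightarrow> a = om \<and> n = 2 \<and> k = 0 \<or> a = F \<and> n = wF \<and> k = - 1 \<or> a = H \<and> n = wF \<and> k = 0 \<or> a = E \<and> n = wF \<and> k = 1"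

lemma gen_V: "gen a n k ==> a \<in> V" and gen_gr: "gen a n k ==> gr n k a" and gen_pos: "gen a n k ==> n >= 2"
proof -
 have "wF >= 2" using pge by (simp add: wF_def)
 thus "gen a n k ==> a \<in> V" "gen a n k ==> gr n k a" "gen a n k ==> n >= 2"
  by (auto simp: gen_def om_V F_V H_V E_V gr_om gr_F gr_H gr_E)
qed

text \<open>\<open>SG w N k\<close>: combinations of words of negative modes whose letters have total weight at most \<open>w\<close>.\<close>

inductive SG :: "int => int => int => fock => bool" where
 SG_one: "SG 0 0 0 one"
| SG_zero: "SG w N k 0"
| SG_add: "SG w N k u ==> SG w N k v ==> SG w N k (u + v)"
| SG_scale: "SG w N k v ==> SG w N k (scale c v)"
| SG_mode: "gen a n ka ==> SG w N k v ==> q >= 1 ==> SG (w + n) (N + n + q - 1) (ka + k) (Y a (- q) v)"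
| SG_mono: "SG w N k v ==> w <= w' ==> SG w' N k v"

lemma SG_gr: "SG w N k v ==> gr N k v \<and> v \<in> V \<and> (w < 0 \<longrightarrow> v = 0)"
proof (induction rule: SG.induct)
 case (SG_mode a n ka w N k v q)
 thus ?case using gr_Y[OF gen_gr[OF SG_mode.hyps(1)], of N k v "- q"] gen_pos[OF SG_mode.hyps(1)] gen_V[OF SG_mode.hyps(1)]
  by (auto simp: V_Y Y_0 algebra_simps)
qed (auto simp: gr_one one_V gr_add V_add gr_scale V_scale)

lemma SG_subspace: "pm.subspace {v. SG w N k v}"
 by (simp add: pm.subspace_def SG_zero SG_add SG_scale)

lemma SG_Sum_any: "(!!j. SG w N k (f j)) ==> SG w N k (Sum_any f)"
 using Sum_any_subspace[OF SG_subspace, of f w N k] by simp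

lemma SG_minus: "SG w N k u ==> SG w N k v ==> SG w N k (u - v)"
 using pm.subspace_diff[OF SG_subspace, of u w N k v] by simp

lemma SG_modeI: "gen a n ka ==> SG w N k v ==> q <= - 1 ==> w' >= w + n ==> N' = N + n - q - 1 ==> k' = ka + k ==> SG w' N' k' (Y a q v)"
 using SG_mono[OF SG_mode[of a n ka w N k v "- q"], of w'] by simp

lemma SG_gen: "gen a n k ==> SG n n k a"
 using SG_modeI[OF _ SG_one, of a n k "- 1" n n k] by (simp add: Y_m1_one)

lemma SG_Lm1: "SG w N k v ==> SG w (N + 1) k (L (- 1) v)"
proof (induction rule: SG.induct)
 case (SG_mode a n ka w N k v q)
 have a: "a \<in> VL" by (rule V_VL[OF gen_V[OF SG_mode.hyps(1)]])
 have "L (- 1) (Y a (- q) v) = Y a (- q) (L (- 1) v) + scale (of_int q) (Y a (- q - 1) v)"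
  unfolding Lm1_comm[OF a] translation_VL[OF a] by simp
 moreover have "SG (w + n) (N + n + q - 1 + 1) (ka + k) (Y a (- q) (L (- 1) v))"
  by (rule SG_modeI[OF SG_mode.hyps(1) SG_mode.IH]) (use SG_mode.hyps(3) in auto)
 moreover have "SG (w + n) (N + n + q - 1 + 1) (ka + k) (Y a (- q - 1) v)"
  by (rule SG_modeI[OF SG_mode.hyps(1,2)]) (use SG_mode.hyps(3) in auto)
 ultimately show ?case by (simp add: SG_add SG_scale)
next
 case SG_one
 thus ?case by (simp add: L_def Y_nn_one SG_zero)
qed (auto simp: L_add L_scale L_0 intro: SG_zero SG_add SG_scale SG_mono)

lemma gen_om: "gen om 2 0" and gen_F: "gen F wF (- 1)" and gen_H: "gen H wF 0" and gen_E: "gen E wF 1"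
 by (auto simp: gen_def)

lemma SG_vc: "vc (%N. {v. SG N N k v})"
 unfolding vc_def
proof (intro conjI allI impI SG_subspace)
 fix N v and l :: int assume l: "1 <= l" and "v \<in> {v. SG N N k v}"
 hence v: "SG N N k v" by simp
 show "L (- l) v \<in> {v. SG (N + l) (N + l) k v}"
 proof (cases "l = 1")
  case True
  thus ?thesis using SG_mono[OF SG_Lm1[OF v]] by simp
 next
  case False
  thus ?thesis unfolding L_def using l by (auto intro!: SG_modeI[OF gen_om v])
 qed
qed

text \<open>For nonnegative modes the product of two generators costs one unit of letter weight less
  than its factors. This gain makes the reordering in \<open>SG_Y_aux\<close> terminate.\<close>

lemma SG_gen_gen:
 assumes a: "gen a n k" and b: "gen b m l" and j: "j >= 0"
 shows "SG (n + m - 1) (n + m - 1 - j) (k + l) (Y a j b)"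
proof -
 have L: "SG m (m + 1 - j) l (Y om j b)" if b: "gen b m l" and "j >= 0" for j b m l
 proof -
  note S = SG_gen[OF b]
  \<comment> \<open>The products of \<open>om\<close> with itself at these modes have weight 1, 0
    and less; \<open>V\<close> has nothing in weight 1 and only scalars in weight 0.\<close>
  have om: "Y om 2 om = 0" "Y om 3 om = scale (lookup (Y om 3 om) ({#}, 0)) one" "j >= 4 ==> Y om j om = 0"
  proof -
   have g: "gr (3 - j) 0 (Y om j om)" for j using gr_Y[OF gr_om gr_om, of j] by simp
   show "Y om 2 om = 0" using V_gr_1[OF V_Y[OF om_V om_V]] g[of 2] by simp
   show "Y om 3 om = scale (lookup (Y om 3 om) ({#}, 0)) one" using gr_0_one(1) g[of 3] by simp
   show "j >= 4 ==> Y om j om = 0" using gr_neg[OF g[of j]] by (simp add: w0_def)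
  qed
  have "j = 0 \<or> j = 1 \<or> j >= 2" using \<open>j >= 0\<close> by linarith
  moreover have "prim b \<or> b = om \<and> m = 2 \<and> l = 0" using b prim_F prim_H prim_E by (auto simp: gen_def)
  ultimately consider (0) "j = 0" | (1) "j = 1" | (2) "j >= 2" "prim b" | (3) "j >= 2" "b = om" "m = 2" "l = 0" by blast
  hence "Y om j b = 0 \<or> SG m (m + 1 - j) l (Y om j b)"
  proof cases
   case 0 thus ?thesis using SG_Lm1[OF S] by (simp add: L_def)
  next
   case 1 thus ?thesis using SG_scale[OF S] gr_L0[OF gen_gr[OF b]] by (simp add: L_def)
  next
   case 2 thus ?thesis using prim_pos[of b "j - 1"] by (simp add: L_def)
  next
   case 3
   then consider "j = 2" | "j = 3" | "j >= 4" by linarith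
   thus ?thesis
   proof cases
    case 2
    have "SG 2 0 0 one" by (rule SG_mono[OF SG_one]) simp
    hence "SG 2 0 0 (Y om 3 om)" by (subst om(2)) (rule SG_scale)
    thus ?thesis using 2 3 by simp
   qed (use om 3 in auto)
  qed
  thus ?thesis using SG_zero by auto
 qed
 consider (1) "a = om" "n = 2" "k = 0" | (2) "b = om" "m = 2" "l = 0"
  | (3) "n = wF" "m = wF" "a = F \<and> k = - 1 \<or> a = H \<and> k = 0 \<or> a = E \<and> k = 1" "b = F \<and> l = - 1 \<or> b = H \<and> l = 0 \<or> b = E \<and> l = 1"
  using a b unfolding gen_def by blast
 thus ?thesis
 proof cases
  case 1
  thus ?thesis using SG_mono[OF L[OF b j], of "n + m - 1"] by (simp add: algebra_simps)
 next
  case 2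
  have P: "SG w N k v ==> SG w (N + int i) k ((L (- 1) ^^ i) v)" for w N k v i
  proof (induction i)
   case (Suc i) thus ?case using SG_Lm1[of w "N + int i" k] by (simp add: algebra_simps)
  qed simp
  have "SG n (n + 1 - j) k (Y a j om)"
   unfolding skew[OF om_VL V_VL[OF gen_V[OF a]]]
  proof (rule SG_scale, rule SG_Sum_any, rule SG_scale)
   fix i :: nat
   show "SG n (n + 1 - j) k ((L (- 1) ^^ i) (Y om (j + int i) a))"
    using P[OF L[OF a, of "j + int i"], of i] j by (simp add: algebra_simps)
  qed
  thus ?thesis using SG_mono[of n "n + 1 - j" k _ "n + m - 1"] 2 by (simp add: algebra_simps)
 next
  case 3
  note nm = 3(1,2)
  have e: "n + m - 1 - j = W0 - j" by (simp add: nm wF_def W0_def)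
  have z: "Y E j E = 0" "Y F j F = 0" using prod_EE[of j] prod_FF[of j] j by auto
  have jj: "j >= - 2 * int p" using j by linarith
  have FF: "F \<in> {v. SG wF wF (- 1) v}" and HH: "H \<in> {v. SG wF wF 0 v}" and EE: "E \<in> {v. SG wF wF 1 v}"
   using SG_gen gen_F gen_H gen_E by auto
  have o: "scale kap one \<in> {v. SG 0 0 0 v}" by (simp add: SG_scale SG_one)
  have "SG (W0 - j) (W0 - j) (k + l) (Y a j b)"
   using 3 z prod_HF[OF SG_vc FF jj] prod_HH[OF SG_vc HH o jj] prod_EH[OF SG_vc EE jj]
   by (auto simp: gen_def SG_zero)
  thus ?thesis using SG_mono[of "W0 - j" "W0 - j" "k + l" _ "n + m - 1"] j unfolding e by (simp add: nm wF_def W0_def)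
 qed
qed

text \<open>Reordering of words, by induction on a bound for the total letter weight. The claim that
  nonnegative modes lower this weight by one is carried along, since it is what makes the hypothesis
  applicable to commutators.\<close>

lemma SG_Y_aux:
 "SG w' N' k' u ==> SG w N k v ==> w' + w <= int T - 1 ==>
   SG (w' + w) (N' + N - n - 1) (k' + k) (Y u n v) \<and> (n >= 0 \<longrightarrow> SG (w' + w - 1) (N' + N - n - 1) (k' + k) (Y u n v))"
proof (induction T arbitrary: w' N' k' u w N k v n)
 case 0
 hence "u = 0 \<or> v = 0" using SG_gr[OF 0(1)] SG_gr[OF 0(2)] by linarith
 thus ?case by (auto simp: SG_zero Y_0)
next
 case (Suc T)
 \<comment> \<open>First a generator against a word: each commutator term contains a product of two
   generators, which by \<open>SG_gen_gen\<close> is cheap enough for the hypothesis at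
   \<open>T\<close>.\<close>
 have A: "SG (w + na - 1) (na + N - m - 1) (ka + k) (Y a m v)"
  if "SG w N k v" and a: "gen a na ka" and "w + na <= int T" "m >= 0" for w N k v a na ka m
  using that(1,3,4)
 proof (induction arbitrary: m rule: SG.induct)
  case (SG_mode b nb kb w N k v q)
  note na = gen_pos[OF a]
  have aV: "a \<in> VL" "b \<in> VL" using gen_V a SG_mode.hyps(1) V_VL by auto
  have 1: "SG (w + na - 1) (na + N - m - 1) (ka + k) (Y a m v)"
   by (rule SG_mode.IH) (use SG_mode.prems gen_pos[OF SG_mode.hyps(1)] in auto)
  have "SG (w + nb + na - 1) (na + (N + nb + q - 1) - m - 1) (ka + (kb + k)) (Y b (- q) (Y a m v))"
   by (rule SG_modeI[OF SG_mode.hyps(1) 1]) (use SG_mode.hyps in auto)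
  moreover have "SG (w + nb + na - 1) (na + (N + nb + q - 1) - m - 1) (ka + (kb + k)) (Y (Y a (int j) b) (m + - q - int j) v)" for j
  proof -
   have "na + nb - 1 + w <= int T - 1" using SG_mode.prems by linarith
   from Suc.IH[OF SG_gen_gen[OF a SG_mode.hyps(1), of "int j"] SG_mode.hyps(2) this, of "m + - q - int j"]
   show ?thesis by (simp add: algebra_simps)
  qed
  ultimately show ?case unfolding Y_comm[OF aV] by (intro SG_add SG_Sum_any SG_scale)
 next
  case (SG_mono w N k v w')
  thus ?case using SG.SG_mono[of "w + na - 1" _ _ _ "w' + na - 1"] by auto
 next
  case SG_one
  thus ?case by (simp add: Y_nn_one SG_zero)
 next
  case (SG_add w N k u v)
  thus ?case by (simp add: lin_add[OF Y_lin] SG.SG_add)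
 next
  case (SG_scale w N k v c)
  thus ?case by (simp add: Y_scale SG.SG_scale)
 qed (simp add: Y_0 SG_zero)
 have "w' + w <= int T" using Suc.prems(3) by simp
 from Suc.prems(1,2) this show ?case
 proof (induction arbitrary: w N k v n rule: SG.induct)
  case (SG_mode a na ka w' N' k' u q)
  have aV: "a \<in> VL" "u \<in> VL" using gen_V SG_mode.hyps(1) SG_gr[OF SG_mode.hyps(2)] V_VL by auto
  note na = gen_pos[OF SG_mode.hyps(1)]
  have le: "w' + w <= int T" using SG_mode.prems na by linarith
  note IH = SG_mode.IH[OF SG_mode.prems(1) le]
  have 1: "SG (w' + na + w) (N' + na + q - 1 + N - n - 1) (ka + k' + k) (Y a (- q - int j) (Y u (n + int j) v))
    \<and> (n >= 0 \<longrightarrow> SG (w' + na + w - 1) (N' + na + q - 1 + N - n - 1) (ka + k' + k) (Y a (- q - int j) (Y u (n + int j) v)))" for j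
   using SG_modeI[OF SG_mode.hyps(1) IH[of "n + int j", THEN conjunct1], of "- q - int j" "w' + na + w" "N' + na + q - 1 + N - n - 1" "ka + k' + k"]
    SG_modeI[OF SG_mode.hyps(1) IH[of "n + int j", THEN conjunct2, THEN mp], of "- q - int j" "w' + na + w - 1" "N' + na + q - 1 + N - n - 1" "ka + k' + k"]
    SG_mode.hyps(3) by auto
  have 2: "SG (w' + na + w - 1) (N' + na + q - 1 + N - n - 1) (ka + k' + k) (Y u (- q + n - int j) (Y a (int j) v))" for j
  proof -
   show ?thesis
   proof (cases "w' < 0")
    case True
    hence "u = 0" using SG_gr[OF SG_mode.hyps(2)] by simp
    thus ?thesis by (simp add: SG_zero)
   next
    case False
    hence "w + na <= int T" using SG_mode.prems by linarith
    from A[OF SG_mode.prems(1) SG_mode.hyps(1) this, of "int j"]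
    have "SG (w + na - 1) (na + N - int j - 1) (ka + k) (Y a (int j) v)" by simp
    from SG_mode.IH[OF this, of "- q + n - int j"] SG_mode.prems show ?thesis by (simp add: algebra_simps)
   qed
  qed
  have 3: "SG (w' + na + w) (N' + na + q - 1 + N - n - 1) (ka + k' + k) (Y u (- q + n - int j) (Y a (int j) v))" for j
   by (rule SG.SG_mono[OF 2]) simp
  show ?case unfolding Y_iter[OF aV]
   by (intro conjI impI SG_minus SG_Sum_any SG_scale 2 3 1[THEN conjunct1] 1[THEN conjunct2, THEN mp])
 next
  case SG_one
  thus ?case by (auto simp: Y_one SG_zero)
 next
  case (SG_mono w1 N1 k1 u w2)
  hence "w1 + w <= int T" by simp
  with SG_mono show ?case using SG.SG_mono[of "w1 + w" _ _ _ "w2 + w"] SG.SG_mono[of "w1 + w - 1" _ _ _ "w2 + w - 1"] by auto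
 next
  case (SG_add w1 N1 k1 u u')
  thus ?case by (simp add: Z1_add SG.SG_add)
 next
  case (SG_scale w1 N1 k1 u c)
  thus ?case by (simp add: Z1_scale SG.SG_scale)
 qed (simp add: SG_zero)
qed

definition G :: "int => int => fock set" where "G N k = {v. \<exists>w. SG w N k v}"

lemma G_subspace: "pm.subspace (G N k)"
 unfolding pm.subspace_def
proof (intro conjI ballI allI)
 show "0 \<in> G N k" using SG_zero by (auto simp: G_def)
 show "scale c x \<in> G N k" if "x \<in> G N k" for c x using that unfolding G_def by (blast intro: SG_scale)
 show "x + y \<in> G N k" if "x \<in> G N k" "y \<in> G N k" for x y
 proof -
  from that(1) obtain w where "SG w N k x" by (auto simp: G_def)
  moreover from that(2) obtain w' where "SG w' N k y" by (auto simp: G_def)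
  ultimately have "SG (max w w') N k (x + y)" by (intro SG_add) (auto elim: SG_mono)
  thus ?thesis by (auto simp: G_def)
 qed
qed

lemma G_mode:
 assumes "gen a n ka" "v \<in> G N k" "N' = n + N - m - 1" "k' = ka + k" shows "Y a m v \<in> G N' k'"
proof -
 obtain w where w: "SG w N k v" using assms(2) by (auto simp: G_def)
 have "n + w <= int (nat (n + w + 1)) - 1" by simp
 from SG_Y_aux[OF SG_gen[OF assms(1)] w this, of m] show ?thesis using assms(3,4) by (auto simp: G_def)
qed

lemma G_L: "v \<in> G N k ==> N' = N - n ==> L n v \<in> G N' k"
 unfolding L_def by (rule G_mode[OF gen_om]) auto

text \<open>The arguments are those met for \<open>E_m F_n u\<close> in
  \<open>strong_generation\<close>. As \<open>(e - 1) (e - 2p + 1) = (e - p)^2 - (p - 1)^2\<close>,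
  the last factor is the quadratic condition on \<open>e\<close>.\<close>

lemma cub_shift: "cub (pp + 1 + e) (N + e) = - e * ((e - 1) * (e - pp + 1) - 4 * int p * N)"
 by (simp add: cub_def algebra_simps)

text \<open>\<open>p\<close> divides one of the factors, and the bounds on \<open>e\<close> leave
  few multiples. They give \<open>N <= 1\<close>, or an equation modulo 4 that makes
  \<open>p\<close> even; then \<open>p = 2\<close>, which contradicts \<open>N >= 2\<close> or the
  bound on \<open>e\<close>.\<close>

lemma no_root:
 assumes pr: "prime p" and e: "1 <= e" "e <= 4 * int p - 2" and N: "N >= 2"
 shows "(e - 1) * (e - pp + 1) ~= 4 * int p * N"
proof
 assume eq: "(e - 1) * (e - pp + 1) = 4 * int p * N"
 have pp: "int p > 0" using p0 by simp
 have odd: "odd p \<or> p = 2" using pr prime_odd_nat[of p] pge by force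
 have "int p dvd (e - 1) * (e - pp + 1)" unfolding eq by (simp add: mult.assoc)
 then consider "int p dvd e - 1" | "int p dvd e - pp + 1" using pr by (auto simp: prime_dvd_mult_iff)
 thus False
 proof cases
  case 1
  then obtain t where t: "e - 1 = int p * t" by auto
  have "int p * t < int p * 4" "int p * t > int p * (- 1)" using t e pp by linarith+
  hence "t < 4" "t > - 1" using pp by (simp_all only: mult_less_cancel_left_pos)
  moreover have "int p * (t * (int p * t + 2 - pp)) = int p * (4 * N)"
  proof -
   have "e - pp + 1 = int p * t + 2 - pp" using t by simp
   thus ?thesis using eq t by (simp only: mult.assoc mult.left_commute)
  qed
  hence q: "t * (int p * t + 2 - pp) = 4 * N" using pp by (simp only: mult_cancel_left) simp
  ultimately consider "t = 0" | "t = 1" | "t = 2" | "t = 3" by linarith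
  thus False
  proof cases
   case 4
   hence "e = 3 * int p + 1" "3 * (int p + 2) = 4 * N" using q t by auto
   hence "p ~= 2" "even (3 * (int p + 2))" using e by auto
   thus False using odd by auto
  qed (use q N pge in auto)
 next
  case 2
  then obtain s where s: "e - pp + 1 = int p * s" by auto
  have "int p * s < int p * 2" "int p * s > int p * (- 2)" using s e pp by linarith+
  hence "s < 2" "s > - 2" using pp by (simp_all only: mult_less_cancel_left_pos)
  moreover have "int p * ((int p * s + pp - 2) * s) = int p * (4 * N)"
  proof -
   have "e - 1 = int p * s + pp - 2" using s by simp
   thus ?thesis using eq s by (simp only: mult.assoc mult.left_commute mult.commute)
  qed
  hence q: "(int p * s + pp - 2) * s = 4 * N" using pp by (simp only: mult_cancel_left) simp
  ultimately consider "s = - 1" | "s = 0" | "s = 1" by linarith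
  thus False
  proof cases
   case 3
   hence "3 * int p - 2 = 4 * N" using q by simp
   hence "even (int p)" "p ~= 2" using N by presburger+
   thus False using odd by auto
  qed (use q N pge in auto)
 qed
qed

theorem strong_generation:
 assumes pr: "prime p"
 shows "u \<in> V ==> gr N k u ==> u \<in> G N k"
proof (induction "nat N" arbitrary: N k u rule: less_induct)
 case less
 note IH1 = less.hyps
 from less.prems show ?case
 proof (induction "nat (k + N)" arbitrary: k u rule: less_induct)
  case less
  note IH2 = less.hyps
  note u = less.prems
  note sub = G_subspace[of N k]
  consider "u = 0" | "N = 0" | "N = 1" | "N >= 2" "w0 k <= N"
   using gr_neg[OF u(2)] w0_nonneg[of k] by linarith
  thus ?case
  proof cases
   case 1 thus ?thesis using pm.subspace_0[OF sub] by simp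
  next
   case 3
   have "u = 0" by (rule V_gr_1[OF u(1), of k]) (use u(2) 3 in simp)
   thus ?thesis using pm.subspace_0[OF sub] by simp
  next
   case 2
   show ?thesis
   proof (cases "k = 0")
    case True
    have "one \<in> G N k" using SG_one 2 True by (auto simp: G_def)
    thus ?thesis using gr_0_one(1)[of k u] u(2) 2 pm.subspace_scale[OF sub] by metis
   next
    case False
    thus ?thesis using gr_0_one(2)[of k u] u(2) 2 pm.subspace_0[OF sub] by simp
   qed
  next
   case 4
   note small = IH1
   have low: "x \<in> G N' k'" if "x \<in> V" "gr N' k' x" "N' < N" for x N' k'
   proof (cases "N' < 0")
    case True
    hence "x = 0" using gr_neg[OF that(2)] w0_nonneg[of k'] by simp
    thus ?thesis using pm.subspace_0[OF G_subspace] by simp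
   qed (use small[of N' x k'] that 4 in auto)
   \<comment> \<open>\<open>f m\<close> passes through weight \<open>N + m\<close> and charge
     \<open>k - 1\<close> and returns to weight \<open>N\<close> and charge
     \<open>k\<close>.\<close>
   define f where "f m = Y E (wF - 1 + m) (Y F (wF - 1 - m) u)" for m
   have gF: "gr (N + m) (k - 1) (Y F (wF - 1 - m) u)" for m using gr_Y[OF gr_F u(2), of "wF - 1 - m"] by (simp add: algebra_simps)
   have VF: "Y F m u \<in> V" for m by (rule V_Y[OF F_V u(1)])
   have E: "Y E m x \<in> G N k" if "x \<in> G N' (k - 1)" "N = wF + N' - m - 1" for x N' m
    by (rule G_mode[OF gen_E that]) simp
   \<comment> \<open>For \<open>m < 0\<close> the intermediate weight is smaller; for
     \<open>m = 0\<close> it is still \<open>N\<close> but the charge has dropped, which is the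
     inner induction.\<close>
   have nonpos: "f m \<in> G N k" if "m <= 0" for m
   proof -
    have "Y F (wF - 1 - m) u \<in> G (N + m) (k - 1)"
    proof (cases "m = 0")
     case True
     show ?thesis
     proof (cases "k + N > 0")
      case True
      hence "nat (k - 1 + N) < nat (k + N)" by simp
      from IH2[OF this VF] show ?thesis using gF[of 0] \<open>m = 0\<close> by simp
     next
      case False
      hence "gr N (k - 1) (Y F (wF - 1 - m) u)" "N < w0 (k - 1)"
       using gF[of 0] \<open>m = 0\<close> w0_pos[of "k - 1"] 4 by auto
      hence "Y F (wF - 1 - m) u = 0" by (rule gr_neg)
      thus ?thesis using pm.subspace_0[OF G_subspace] by simp
     qed
    qed (use low[OF VF gF] that in auto)
    thus ?thesis unfolding f_def by (rule E) simp
   qed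
   show ?thesis
   proof (rule ccontr)
    assume notu: "u \<notin> G N k"
    have "\<exists>m. 1 <= m \<and> m <= 4 * int p - 2 \<and> f m \<notin> G N k"
    proof (rule ccontr)
     assume "\<not> ?thesis"
     hence all: "f m \<in> G N k" if "m <= 4 * int p - 2" for m using nonpos[of m] that by force
     \<comment> \<open>At \<open>n = W0\<close> the only surviving product of \<open>E\<close> and
       \<open>F\<close> is the scalar \<open>kap\<close>. Since \<open>wF - 2p = - 1\<close>, the
       vacuum acts here as the identity. In \<open>B3\<close> the vector \<open>E_{wF+j} u\<close>
       has lower weight than \<open>u\<close>, and the terms of \<open>B2\<close> are
       \<open>f m\<close> with \<open>m <= 4p - 2\<close>.\<close>
     have "B1 p E F u wF (- 2 * int p) W0 = scale kap u"
     proof -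
      have "B1 p E F u wF (- 2 * int p) W0 = scale (bc wF 0) (Y (Y E (W0 + int 0) F) (wF + - 2 * int p - int 0) u)"
       unfolding B1_def
      proof (rule Sum_any_single)
       fix j :: nat assume "j ~= 0"
       hence "Y E (W0 + int j) F = 0" using gr_neg[OF gr_prod[OF gr_E gr_F, of "W0 + int j"]] by (simp add: w0_def)
       thus "scale (bc wF j) (Y (Y E (W0 + int j) F) (wF + - 2 * int p - int j) u) = 0" by simp
      qed
      thus ?thesis using EF_top by (simp add: Z1_scale Y_one wF_def)
     qed
     moreover have "B2 p E F u wF (- 2 * int p) W0 \<in> G N k"
      unfolding B2_def
     proof (rule Sum_any_subspace[OF sub], rule pm.subspace_scale[OF sub])
      fix j
      have e: "wF + W0 - int j = wF - 1 + (4 * int p - 2 - int j)" "- 2 * int p + int j = wF - 1 - (4 * int p - 2 - int j)"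
       by (simp_all add: wF_def W0_def)
      show "Y E (wF + W0 - int j) (Y F (- 2 * int p + int j) u) \<in> G N k"
       unfolding e using all[of "4 * int p - 2 - int j"] unfolding f_def by simp
     qed
     moreover have "B3 p E F u wF (- 2 * int p) W0 \<in> G N k"
      unfolding B3_def
     proof (rule Sum_any_subspace[OF sub], rule pm.subspace_scale[OF sub])
      fix j
      have "gr (N - int j - 1) (k + 1) (Y E (wF + int j) u)" using gr_Y[OF gr_E u(2), of "wF + int j"] by (simp add: algebra_simps)
      hence "Y E (wF + int j) u \<in> G (N - int j - 1) (k + 1)" by (rule low[OF V_Y[OF E_V u(1)]]) simp
      thus "Y F (W0 + - 2 * int p - int j) (Y E (wF + int j) u) \<in> G N k"
       by (rule G_mode[OF gen_F]) (auto simp: wF_def W0_def)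
     qed
     ultimately have "scale kap u \<in> G N k"
      using borcherds_VL[OF V_VL[OF E_V] V_VL[OF F_V], of u wF "- 2 * int p" W0] sub
      by (simp add: pm.subspace_diff pm.subspace_scale)
     hence "scale (1 / kap) (scale kap u) \<in> G N k" by (rule pm.subspace_scale[OF sub])
     thus False using kap_nz notu by simp
    qed
    then obtain m0 where m0: "1 <= m0" "m0 <= 4 * int p - 2" "f m0 \<notin> G N k" by blast
    \<comment> \<open>The least bad exponent, so that terms with smaller exponents are available in
      \<open>G N k\<close> below.\<close>
    define e where "e = (LEAST i::nat. f (int i) \<notin> G N k)"
    have "f (int (nat m0)) \<notin> G N k" using m0 by simp
    hence e: "f (int e) \<notin> G N k" "e <= nat m0" unfolding e_def by (rule LeastI, rule Least_le)
    have less: "f m \<in> G N k" if "m < int e" for m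
    proof (cases "m <= 0")
     case False
     hence "nat m < e" using that by simp
     hence "f (int (nat m)) \<in> G N k" unfolding e_def using not_less_Least by blast
     thus ?thesis using False by simp
    qed (use nonpos in simp)
    have e1: "1 <= int e" "int e <= 4 * int p - 2" using e nonpos[of 0] m0 by (cases e; auto)+
    let ?w = "Y F (wF - 1 - int e) u"
    \<comment> \<open>Higher modes of \<open>E\<close> land in lower weight, and
      \<open>L (j + 1)\<close> either lowers the weight of \<open>u\<close> or moves the mode of
      \<open>F\<close>, which gives a smaller exponent. So only the indicial polynomial can
      obstruct.\<close>
    have "Y E (pp + 1 + int e - 3) ?w \<in> G N k"
    proof (rule cubic[OF prim_E gr_L0[OF gF] sub])
     fix j :: nat
     let ?n = "pp + 1 + int e - 2 + int j"
     have "gr (N - 1 - int j) k (Y E ?n ?w)" using gr_Y[OF gr_E gF[of "int e"], of ?n] by (simp add: wF_def algebra_simps)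
     hence "Y E ?n ?w \<in> G (N - 1 - int j) k" by (rule low[OF V_Y[OF E_V VF]]) simp
     thus "L (- 1 - int j) (Y E ?n ?w) \<in> G N k" by (rule G_L) simp
     let ?n = "pp + 1 + int e - 4 - int j"
     have c: "L (int j + 1) ?w = Y F (wF - 1 - int e) (L (int j + 1) u) +
       scale (of_int (int j + 1 + 1) * of_int wF - of_int (int j + 1 + (wF - 1 - int e) + 1)) (Y F (int j + 1 + (wF - 1 - int e)) u)"
      by (rule L_primary[OF V_VL[OF F_V] _ prim_0[OF prim_F]]) (simp add: prim_pos[OF prim_F])
     have "L (int j + 1) u \<in> G (N - (int j + 1)) k" by (rule low[OF V_L[OF u(1)] gr_L[OF u(2)]]) simp
     hence "Y F (wF - 1 - int e) (L (int j + 1) u) \<in> G (N - (int j + 1) + int e) (k - 1)" by (rule G_mode[OF gen_F]) simp_all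
     hence 1: "Y E ?n (Y F (wF - 1 - int e) (L (int j + 1) u)) \<in> G N k" by (rule E) (simp add: wF_def)
     have e': "?n = wF - 1 + (int e - 1 - int j)" "int j + 1 + (wF - 1 - int e) = wF - 1 - (int e - 1 - int j)" by (simp_all add: wF_def)
     have 2: "Y E ?n (Y F (int j + 1 + (wF - 1 - int e)) u) \<in> G N k"
      unfolding e' using less[of "int e - 1 - int j"] unfolding f_def by simp
     show "Y E ?n (L (int j + 1) ?w) \<in> G N k"
      unfolding c lin_add[OF Y_lin] Y_scale
      by (intro pm.subspace_add[OF sub] pm.subspace_scale[OF sub] 1 2)
    next
     show "cub (pp + 1 + int e) (N + int e) ~= 0"
      unfolding cub_shift using no_root[OF pr e1 4(1)] e1 by simp
    qed
    moreover have "pp + 1 + int e - 3 = wF - 1 + int e" by (simp add: wF_def)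
    ultimately show False using e(1) by (simp add: f_def)
   qed
  qed
 qed
qed

end

section \<open>Zhu products\<close>

text \<open>Binomial sums, the effect of a factor \<open>(1+x)^n\<close> under a residue.\<close>

definition bs :: "nat => (nat => fock) => fock" where
 "bs n f = (\<Sum>j\<le>n. scale (of_nat (n choose j)) (f j))"

lemma bs_0 [simp]: "bs 0 f = f 0" by (simp add: bs_def)

lemma bs_Suc: "bs (Suc n) f = bs n f + bs n (%j. f (Suc j))"
proof -
 have "bs (Suc n) f = f 0 + (\<Sum>j\<le>n. scale (of_nat (n choose Suc j)) (f (Suc j)) + scale (of_nat (n choose j)) (f (Suc j)))"
  unfolding bs_def sum.atMost_Suc_shift by (simp add: pm.scale_left_distrib add.commute)
 also have "f 0 + (\<Sum>j\<le>n. scale (of_nat (n choose Suc j)) (f (Suc j))) = (\<Sum>j\<le>Suc n. scale (of_nat (n choose j)) (f j))"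
  unfolding sum.atMost_Suc_shift by simp
 hence "f 0 + (\<Sum>j\<le>n. scale (of_nat (n choose Suc j)) (f (Suc j)) + scale (of_nat (n choose j)) (f (Suc j))) = bs n f + bs n (%j. f (Suc j))"
  by (simp add: bs_def sum.distrib binomial_eq_0 add.assoc[symmetric])
 finally show ?thesis .
qed

lemma bs_add: "bs n (%j. f j + g j) = bs n f + bs n g"
 by (simp add: bs_def pm.scale_right_distrib sum.distrib)

lemma bs_bs: "bs A (%a. bs B (%b. g (a + b))) = bs (A + B) g"
proof (induction A arbitrary: g)
 case (Suc A)
 show ?case using Suc.IH[of g] Suc.IH[of "%l. g (Suc l)"] by (simp add: bs_Suc)
qed simp

lemma bs_trinomial:
 "bs n (%m. \<Sum>i\<le>m. scale (of_nat (m choose i)) (t i (m - i))) = (\<Sum>i\<le>n. scale (of_nat (n choose i)) (bs (n - i) (t i)))"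
proof -
 have "bs n (%m. \<Sum>i\<le>m. scale (of_nat (m choose i)) (t i (m - i))) = (\<Sum>m\<le>n. \<Sum>i\<le>m. scale (of_nat ((n choose m) * (m choose i))) (t i (m - i)))"
  by (simp add: bs_def pm.scale_sum_right)
 also have "... = (\<Sum>(m, i)\<in>Sigma {..n} (%m. {..m}). scale (of_nat ((n choose m) * (m choose i))) (t i (m - i)))"
  by (rule sum.Sigma) auto
 also have "... = (\<Sum>(i, j)\<in>Sigma {..n} (%i. {..n - i}). scale (of_nat ((n choose i) * ((n - i) choose j))) (t i j))"
  by (rule sum.reindex_bij_witness[of _ "%(i, j). (i + j, i)" "%(m, i). (i, m - i)"]) (auto simp: choose_mult simp del: of_nat_mult)
 also have "... = (\<Sum>i\<le>n. \<Sum>j\<le>n - i. scale (of_nat ((n choose i) * ((n - i) choose j))) (t i j))"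
  by (rule sum.Sigma[symmetric]) auto
 finally show ?thesis by (simp add: bs_def pm.scale_sum_right)
qed

lemma bs_Sum_any: "(!!m. ez (f m)) ==> bs n (%m. Sum_any (f m)) = Sum_any (%j. bs n (%m. f m j))"
 unfolding bs_def by (simp add: Sum_any_scale Sum_any_finsum_swap[symmetric] ez_scale)

lemma bs_lin: "lin T ==> T (bs n f) = bs n (%j. T (f j))"
 by (simp add: bs_def lin_sum lin_scale)

lemma bs_diff: "bs n (%j. f j - g j) = bs n f - bs n g"
 by (simp add: bs_def pm.scale_right_diff_distrib sum_subtractf)

lemma bs_ez: "(!!m. ez (f m)) ==> ez (%j. bs n (%m. f m j))"
 unfolding bs_def by (intro ez_sum ez_scale) auto

context lat begin

lemma J_bs: "J n r u v = bs n (%j. Y u (int j + r) v)" by (simp add: J_def bs_def)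

lemma J_Suc: "J (Suc n) r u v = J n r u v + J n (r + 1) u v"
 by (simp add: J_bs bs_Suc algebra_simps)

text \<open>The Borcherds identities for all \<open>m\<close> up to \<open>n\<close> and
  \<open>k\<close> from \<open>s\<close> to \<open>s + M\<close>, added with binomial weights, as if
  multiplied by \<open>(1+x)^n (1+y)^M\<close>. Zhu's lemmas below are the cases
  \<open>r = - 1\<close> and \<open>r = - 2\<close>.\<close>

lemma J_iter:
 assumes "u \<in> VL" "v \<in> VL"
 shows "(\<Sum>i\<le>n. scale (of_nat (n choose i)) (J (n - i + M) s (Y u (int i + r) v) c)) =
   Sum_any (%j. scale ((-1) ^ j * bc r j) (J n (r - int j) u (J M (s + int j) v c)))
   - scale (sg r) (Sum_any (%j. scale ((-1) ^ j * bc r j) (J M (r + s - int j) v (J n (int j) u c))))"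
proof -
 let ?B = "%B. bs n (%m. bs M (%k. B p u v c (int m) (s + int k) r))"
 have 1: "?B B1 = (\<Sum>i\<le>n. scale (of_nat (n choose i)) (J (n - i + M) s (Y u (int i + r) v) c))"
 proof -
  let ?t = "%i x. bs M (%k. Y (Y u (int i + r) v) (int (x + k) + s) c)"
  have "bs M (%k. B1 p u v c (int m) (s + int k) r) = (\<Sum>i\<le>m. scale (of_nat (m choose i)) (?t i (m - i)))" for m
  proof -
   have "B1 p u v c (int m) (s + int k) r = (\<Sum>i\<le>m. scale (of_nat (m choose i)) (Y (Y u (int i + r) v) (int (m - i + k) + s) c))" for k
   proof -
    have "B1 p u v c (int m) (s + int k) r = (\<Sum>i<Suc m. scale (bc (int m) i) (Y (Y u (r + int i) v) (int m + (s + int k) - int i) c))"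
     unfolding B1_def by (rule Sum_any_lessThan) (simp add: bc_nat binomial_eq_0 del: of_int_of_nat_eq)
    also have "... = (\<Sum>i\<le>m. scale (of_nat (m choose i)) (Y (Y u (int i + r) v) (int (m - i + k) + s) c))"
     unfolding bc_nat lessThan_Suc_atMost by (intro sum.cong refl) (simp add: of_nat_diff algebra_simps)
    finally show ?thesis .
   qed
   thus ?thesis unfolding bs_def by (simp only: pm.scale_sum_right pm.scale_scale mult.commute) (rule sum.swap)
  qed
  hence "?B B1 = bs n (%m. \<Sum>i\<le>m. scale (of_nat (m choose i)) (?t i (m - i)))" by (simp only:)
  also have "... = (\<Sum>i\<le>n. scale (of_nat (n choose i)) (bs (n - i) (?t i)))" by (rule bs_trinomial[of n ?t])
  also have "... = (\<Sum>i\<le>n. scale (of_nat (n choose i)) (J (n - i + M) s (Y u (int i + r) v) c))"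
   unfolding J_bs bs_bs[symmetric] ..
  finally show ?thesis .
 qed
 have ez: "ez (%j. scale (d j) (Y x (f j) (Y y (k + int j) c)))" for d x y f k by (rule B23_ez[OF p0])
 have 2: "?B B2 = Sum_any (%j. scale ((-1) ^ j * bc r j) (J n (r - int j) u (J M (s + int j) v c)))"
 proof -
  let ?g = "%m k j. scale ((-1) ^ j * bc r j) (Y u (int m + r - int j) (Y v (s + int k + int j) c))"
  have e: "ez (?g m k)" for m k by (rule ez)
  have "?B B2 = Sum_any (%j. bs n (%m. bs M (%k. ?g m k j)))"
   unfolding B2_def by (simp only: bs_Sum_any[OF e] bs_Sum_any[OF bs_ez[OF e]])
  moreover have "bs n (%m. bs M (%k. ?g m k j)) = scale ((-1) ^ j * bc r j) (J n (r - int j) u (J M (s + int j) v c))" for j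
   unfolding J_bs bs_lin[OF lin_scl[OF lin_id]] bs_lin[OF Y_lin] by (simp add: algebra_simps)
  ultimately show ?thesis by simp
 qed
 have 3: "?B B3 = Sum_any (%j. scale ((-1) ^ j * bc r j) (J M (r + s - int j) v (J n (int j) u c)))"
 proof -
  let ?g = "%k m j. scale ((-1) ^ j * bc r j) (Y v (r + (s + int k) - int j) (Y u (int m + int j) c))"
  have e: "ez (?g k m)" for m k by (rule ez)
  have "?B B3 = bs M (%k. bs n (%m. B3 p u v c (int m) (s + int k) r))"
   unfolding bs_def pm.scale_sum_right by (subst sum.swap) (simp add: mult.commute)
  also have "... = Sum_any (%j. bs M (%k. bs n (%m. ?g k m j)))"
   unfolding B3_def by (simp only: bs_Sum_any[OF e] bs_Sum_any[OF bs_ez[OF e]])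
  finally have "?B B3 = Sum_any (%j. bs M (%k. bs n (%m. ?g k m j)))" .
  moreover have "bs M (%k. bs n (%m. ?g k m j)) = scale ((-1) ^ j * bc r j) (J M (r + s - int j) v (J n (int j) u c))" for j
   unfolding J_bs bs_lin[OF lin_scl[OF lin_id]] bs_lin[OF Y_lin] by (simp add: algebra_simps)
  ultimately show ?thesis by simp
 qed
 have "?B B1 = ?B B2 - scale (sg r) (?B B3)"
  unfolding borcherds_VL[OF assms] bs_diff bs_lin[OF lin_scl[OF lin_id], symmetric] ..
 thus ?thesis unfolding 1 2 3 .
qed

subsection \<open>Weight components\<close>

text \<open>Projection to conformal weight \<open>n\<close>; on \<open>V\<close> it agrees with
  \<open>components\<close>, while being linear by construction.\<close>

definition Pw :: "int => fock => fock" where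
 "Pw n = lin_ext (%(M, c). if int (lev M) + w0 (c div pp) = n then st M c else 0)"

lemma Pw_lin: "lin (Pw n)" by (simp add: Pw_def)
lemmas Pw_add = lin_add[OF Pw_lin]

lemma Pw_gr: "gr N k v ==> Pw n v = (if n = N then v else 0)"
proof -
 assume g: "gr N k v"
 have l: "lin (%v. if n = N then v else 0)" by (cases "n = N") (simp_all add: lin_id lin_zero)
 show ?thesis by (rule hm_eq[OF g[unfolded gr_def] Pw_lin l]) (use p0 in "auto simp: Pw_def")
qed

lemma Pw_V: "v \<in> V ==> Pw n v \<in> V"
 by (induction rule: V_induct) (auto simp: Pw_gr Pw_add V_add)

lemma Pw_neg: "v \<in> V ==> n < 0 ==> Pw n v = 0"
proof (induction rule: V_induct)
 case (gr N k x)
 thus ?case using gr_neg[of N k x] w0_nonneg[of k] by (auto simp: Pw_gr)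
qed (simp add: Pw_add)

lemma Pw_finite: "finite {n. Pw n v ~= 0}"
proof -
 let ?I = "(%(M, c). int (lev M) + w0 (c div pp)) ` keys v"
 have "Pw n v = 0" if n: "n \<notin> ?I" for n
 proof (rule lin_eq_on[OF Pw_lin lin_zero])
  fix k assume k: "k \<in> keys v"
  obtain M c where kk: "k = (M, c)" by force
  have "int (lev M) + w0 (c div pp) ~= n" using n k unfolding kk by force
  thus "Pw n (single k 1) = 0" by (simp add: Pw_def kk)
 qed
 hence "{n. Pw n v ~= 0} \<subseteq> ?I" by blast
 thus ?thesis by (rule finite_subset) simp
qed

lemma Pw_ez: "ez (%n. Pw (int n) v)"
proof -
 have "finite {n. Pw (int n) v ~= 0}"
  by (rule finite_imageD[of int], rule finite_subset[OF _ Pw_finite[of v]]) auto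
 then obtain N where "\<forall>n\<in>{n. Pw (int n) v ~= 0}. n < N" unfolding finite_nat_set_iff_bounded ..
 thus ?thesis unfolding ez_def by (metis (mono_tags, lifting) mem_Collect_eq not_less)
qed

definition zp :: "int => fock => fock => fock" where
 "zp r a b = Sum_any (%n::nat. J n r (Pw (int n) a) b)"

lemma zp_ez: "ez (%n. J n r (Pw (int n) a) b)"
 using ez_lin[OF J_lin1 Pw_ez] .

lemma zp_lin1: "lin (%a. zp r a b)"
 unfolding zp_def by (rule lin_Sum_any[OF lin_comp[OF J_lin1 Pw_lin] zp_ez])
lemmas zp1_add = lin_add[OF zp_lin1] and zp1_scale = lin_scale[OF zp_lin1]

lemma zp_lin2: "lin (zp r a)"
 unfolding zp_def[abs_def] by (rule lin_Sum_any[OF J_lin2 zp_ez])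
lemmas zp2_0 = lin_0[OF zp_lin2] and zp2_add = lin_add[OF zp_lin2] and zp2_scale = lin_scale[OF zp_lin2]

lemma zp_gr: "gr (int n) k a ==> zp r a b = J n r a b"
proof -
 assume g: "gr (int n) k a"
 have "zp r a b = J n r (Pw (int n) a) b"
  unfolding zp_def by (rule Sum_any_single) (simp add: Pw_gr[OF g] lin_0[OF J_lin1])
 thus ?thesis by (simp add: Pw_gr[OF g])
qed

lemma gr_nat: assumes "gr N k x" obtains "x = 0" | n where "N = int n"
 using gr_neg[OF assms] w0_nonneg[of k] by (metis nonneg_int_cases not_less order_trans)

lemma V_nat_induct [consumes 1, case_names gr add]:
 assumes v: "v \<in> V" and g: "!!n k x. x \<in> V ==> gr (int n) k x ==> P x" and a: "!!x y. P x ==> P y ==> P (x + y)"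
 shows "P v"
 using v
proof (induction rule: V_induct)
 case (gr N k x)
 show ?case
  by (rule gr_nat[OF gr(2)]) (use g[of 0 0 0] g[of x _ k] gr in auto)
qed (rule a)

lemma J_V: "u \<in> V ==> v \<in> V ==> J n r u v \<in> V"
 unfolding J_def by (intro V_sum V_scale V_Y)

lemma zp_V: "a \<in> V ==> b \<in> V ==> zp r a b \<in> V"
 by (induction rule: V_nat_induct) (auto simp: zp_gr J_V zp1_add V_add)

section \<open>The subspace \<open>O(V)\<close>, and associativity modulo it\<close>

definition OV :: "fock set" where "OV = pm.span {zp (- 2) a b | a b. a \<in> V \<and> b \<in> V}"

lemma OV_subspace: "pm.subspace OV" by (simp add: OV_def)
lemmas OV_0 = pm.subspace_0[OF OV_subspace] and OV_add = pm.subspace_add[OF OV_subspace]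
 and OV_scale = pm.subspace_scale[OF OV_subspace] and OV_diff = pm.subspace_diff[OF OV_subspace]
 and OV_neg = pm.subspace_neg[OF OV_subspace] and OV_sum = pm.subspace_sum[OF OV_subspace]
 and OV_Sum_any = Sum_any_subspace[OF OV_subspace]

lemma OV_V: "x \<in> OV ==> x \<in> V"
proof -
 have "OV \<subseteq> V" unfolding OV_def by (rule pm.span_minimal[OF _ V_subspace]) (auto intro: zp_V)
 thus "x \<in> OV ==> x \<in> V" by blast
qed

lemma J2_OV: "u \<in> V ==> gr (int n) k u ==> v \<in> V ==> J n (- 2) u v \<in> OV"
proof -
 assume a: "u \<in> V" "gr (int n) k u" "v \<in> V"
 show ?thesis unfolding zp_gr[OF a(2), symmetric] OV_def by (rule pm.span_base) (use a in blast)
qed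

lemma OV_induct [consumes 1, case_names zero J add]:
 assumes x: "x \<in> OV" and 0: "P 0" and J: "!!n k u n' k' v c. u \<in> V ==> gr (int n) k u ==> v \<in> V ==> gr (int n') k' v ==> P (scale c (J n (- 2) u v))"
  and add: "!!x y. P x ==> P y ==> P (x + y)"
 shows "P x"
 using x unfolding OV_def
proof (induction rule: pm.span_induct_alt)
 case (step c x y)
 then obtain a b where ab: "x = zp (- 2) a b" "a \<in> V" "b \<in> V" by auto
 have "P (scale c (zp (- 2) a b))" using ab(2)
 proof (induction rule: V_nat_induct)
  case (gr n k a)
  show ?case unfolding zp_gr[OF gr(2)] using ab(3)
  proof (induction rule: V_nat_induct)
   case (gr n' k' b)
   thus ?case using J \<open>a \<in> V\<close> \<open>gr (int n) k a\<close> by blast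
  qed (simp add: lin_add[OF J_lin2] pm.scale_right_distrib add)
 qed (simp add: zp1_add pm.scale_right_distrib add)
 thus ?case using add step.IH ab(1) by simp
qed (rule 0)

lemma J_Lm1:
 assumes "u \<in> VL"
 shows "J (Suc n) r (L (- 1) u) v = - (scale (of_int r) (J n (r - 1) u v) + scale (of_int (r + int n + 1)) (J n r u v))"
proof -
 define g where "g i = Y u (int i + r - 1) v" for i
 have "J (Suc n) r (L (- 1) u) v = - (\<Sum>i\<le>Suc n. scale (of_nat (Suc n choose i) * of_int (int i + r)) (g i))"
  unfolding J_def translation_VL[OF assms] g_def by (simp only: pm.scale_scale mult_minus_right pm.scale_minus_left pm.scale_minus_right sum_negf)
 also have "(\<Sum>i\<le>Suc n. scale (of_nat (Suc n choose i) * of_int (int i + r)) (g i))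
  = scale (of_int r) (g 0) + (\<Sum>i\<le>n. scale (of_nat (Suc n choose Suc i) * of_int (int (Suc i) + r)) (g (Suc i)))"
  unfolding sum.atMost_Suc_shift by simp
 also have "... = scale (of_int r) (g 0 + (\<Sum>i\<le>n. scale (of_nat (n choose Suc i)) (g (Suc i)))) + scale (of_int (r + int n + 1)) (\<Sum>i\<le>n. scale (of_nat (n choose i)) (g (Suc i)))"
 proof -
  have "of_nat (Suc n choose Suc i) * of_int (int (Suc i) + r) = of_int r * of_nat (n choose Suc i) + of_int (r + int n + 1) * (of_nat (n choose i) :: complex)" for i
  proof -
   have "of_nat (Suc i) * (of_nat (Suc n choose Suc i) :: complex) = of_nat (Suc n) * of_nat (n choose i)"
    by (simp only: of_nat_mult[symmetric] Suc_times_binomial_eq mult.commute)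
   moreover have "(of_nat (Suc n choose Suc i) :: complex) = of_nat (n choose i) + of_nat (n choose Suc i)" by simp
   ultimately show ?thesis by (simp add: algebra_simps)
  qed
  thus ?thesis by (simp only: pm.scale_right_distrib pm.scale_sum_right pm.scale_scale pm.scale_left_distrib sum.distrib add.assoc)
 qed
 also have "g 0 + (\<Sum>i\<le>n. scale (of_nat (n choose Suc i)) (g (Suc i))) = (\<Sum>i\<le>Suc n. scale (of_nat (n choose i)) (g i))"
  unfolding sum.atMost_Suc_shift by simp
 also have "... = J n (r - 1) u v" by (simp add: J_def g_def binomial_eq_0 algebra_simps)
 also have "(\<Sum>i\<le>n. scale (of_nat (n choose i)) (g (Suc i))) = J n r u v" by (simp add: J_def g_def algebra_simps)
 finally show ?thesis .
qed

text \<open>\<open>L (- 1) u\<close> has weight \<open>n + 1\<close>, so by \<open>J_Lm1\<close> its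
  product of index \<open>r\<close> yields the product of \<open>u\<close> of index
  \<open>r - 1\<close> modulo that of index \<open>r\<close>; the factor \<open>r\<close> is nonzero
  for \<open>r <= - 2\<close>.\<close>

lemma JO:
 assumes v: "v \<in> V"
 shows "u \<in> V ==> gr (int n) k u ==> q <= - 2 ==> J n q u v \<in> OV"
proof -
 have "u \<in> V ==> gr (int n) k u ==> J n (- 2 - int t) u v \<in> OV" for t u n
 proof (induction t arbitrary: u n)
  case 0 thus ?case using J2_OV v by simp
 next
  case (Suc t)
  let ?r = "- 2 - int t"
  have "gr (int (Suc n)) k (L (- 1) u)" using gr_L[OF Suc.prems(2), of "- 1"] by (simp add: algebra_simps)
  hence "J (Suc n) ?r (L (- 1) u) v \<in> OV" by (rule Suc.IH[OF V_L[OF Suc.prems(1)]])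
  hence "- (scale (of_int ?r) (J n (?r - 1) u v) + scale (of_int (?r + int n + 1)) (J n ?r u v)) \<in> OV"
   unfolding J_Lm1[OF V_VL[OF Suc.prems(1)]] .
  from OV_diff[OF OV_neg[OF this] OV_scale[OF Suc.IH[OF Suc.prems], of "of_int (?r + int n + 1)"]]
  have "scale (of_int ?r) (J n (?r - 1) u v) \<in> OV" by (simp only: minus_minus add_diff_cancel)
  hence "scale (1 / of_int ?r) (scale (of_int ?r) (J n (?r - 1) u v)) \<in> OV" by (rule OV_scale)
  moreover have "(of_int ?r :: complex) ~= 0" by (simp add: of_int_eq_0_iff del: of_int_diff of_int_minus)
  moreover have "?r - 1 = - 2 - int (Suc t)" by simp
  ultimately show ?case by (simp del: of_int_diff of_int_minus)
 qed
 from this[of _ _ "nat (- 2 - q)"] show "u \<in> V ==> gr (int n) k u ==> q <= - 2 ==> J n q u v \<in> OV" by simp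
qed

lemma sub_swap: "x - y - z = x - z - (y :: fock)" by (simp add: algebra_simps)

lemma OV_diffD: "x \<in> OV ==> x - y \<in> OV ==> y \<in> OV"
 using OV_diff[of x "x - y"] by simp

text \<open>In \<open>J_iter\<close> at \<open>r = - 1\<close> every term but the first one has
  outer index at most -2, hence lies in \<open>O(V)\<close>.\<close>

lemma J_iter_OV:
 assumes u: "u \<in> V" "gr (int n) k u" and v: "v \<in> V" "gr (int n') k' v" and c: "c \<in> V" and s: "s <= - 1"
 shows "(\<Sum>i\<le>n. scale (of_nat (n choose i)) (J (n - i + n') s (Y u (int i - 1) v) c)) - J n (- 1) u (J n' s v c) \<in> OV"
proof -
 let ?f = "%j. scale ((-1) ^ j * bc (- 1) j) (J n (- 1 - int j) u (J n' (s + int j) v c))"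
 let ?g = "%j. scale ((-1) ^ j * bc (- 1) j) (J n' (- 1 + s - int j) v (J n (int j) u c))"
 have g: "Sum_any ?g \<in> OV" by (intro OV_Sum_any OV_scale JO[OF J_V[OF u(1) c] v]) (use s in simp)
 have "ez ?f"
 proof (rule ez_scale, rule ez_lin[where T = "%j. J n (- 1 - int j) u", OF J_lin2])
  show "ez (%j. J n' (s + int j) v c)" unfolding J_bs by (rule bs_ez, rule Z_ez[OF p0]) (simp add: add.assoc)
 qed
 hence "Sum_any ?f = ?f 0 + Sum_any (%j. ?f (Suc j))" by (rule Sum_any_Suc)
 moreover have "Sum_any (%j. ?f (Suc j)) \<in> OV" by (intro OV_Sum_any OV_scale JO[OF J_V[OF v(1) c] u]) simp
 ultimately have "Sum_any ?f - J n (- 1) u (J n' s v c) \<in> OV" by simp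
 hence h: "Sum_any ?f - J n (- 1) u (J n' s v c) - scale (sg (- 1)) (Sum_any ?g) \<in> OV"
  by (rule OV_diff[OF _ OV_scale[OF g]])
 have e: "int i + - 1 = int i - 1" for i by simp
 have eq: "(\<Sum>i\<le>n. scale (of_nat (n choose i)) (J (n - i + n') s (Y u (int i - 1) v) c)) = Sum_any ?f - scale (sg (- 1)) (Sum_any ?g)"
  using J_iter[OF V_VL[OF u(1)] V_VL[OF v(1)], where n = n and M = n' and s = s and r = "- 1" and c = c] unfolding e .
 show ?thesis unfolding eq by (subst sub_swap) (rule h)
qed

lemma gr_Yi: "gr (int n) k u ==> gr (int n') k' v ==> i <= n ==> gr (int (n - i + n')) (k + k') (Y u (int i - 1) v)"
 using gr_Y[of "int n" k u "int n'" k' v "int i - 1"] by (simp add: of_nat_diff algebra_simps)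

abbreviation star :: "fock => fock => fock" where "star \<equiv> zp (- 1)"

lemma zp_star_gr:
 assumes "gr (int n) k u" "gr (int n') k' v"
 shows "zp s (star u v) c = (\<Sum>i\<le>n. scale (of_nat (n choose i)) (J (n - i + n') s (Y u (int i - 1) v) c))"
 unfolding zp_gr[OF assms(1)] J_def[of n] lin_sum[OF zp_lin1] zp1_scale
 by (intro sum.cong refl) (simp add: zp_gr[OF gr_Yi[OF assms]])

lemma star_OV: "a \<in> V ==> x \<in> OV ==> star a x \<in> OV"
proof (induction rule: V_nat_induct)
 case (gr m l a)
 from gr(3) show ?case
 proof (induction rule: OV_induct)
  case (J n k u n' k' v c)
  have "(\<Sum>i\<le>m. scale (of_nat (m choose i)) (J (m - i + n) (- 2) (Y a (int i - 1) u) v)) \<in> OV"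
   by (intro OV_sum OV_scale J2_OV[OF V_Y[OF gr(1) J(1)] gr_Yi[OF gr(2) J(2)] J(3)]) simp
  moreover have "(\<Sum>i\<le>m. scale (of_nat (m choose i)) (J (m - i + n) (- 2) (Y a (int i - 1) u) v)) - J m (- 1) a (J n (- 2) u v) \<in> OV"
   by (rule J_iter_OV[OF gr(1,2) J(1-3)]) simp
  ultimately have "J m (- 1) a (J n (- 2) u v) \<in> OV" by (rule OV_diffD)
  thus ?case by (simp add: zp_gr[OF gr(2)] lin_scale[OF J_lin2] OV_scale)
 qed (simp_all add: zp2_0 OV_0 zp2_add OV_add)
qed (simp add: zp1_add OV_add)

lemma OV_star: "x \<in> OV ==> c \<in> V ==> star x c \<in> OV"
proof (induction rule: OV_induct)
 case (J n k u n' k' v d)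
 let ?f = "%j. scale ((-1) ^ j * bc (- 2) j) (J n (- 2 - int j) u (J (Suc n') (- 1 + int j) v c))"
 let ?g = "%j. scale ((-1) ^ j * bc (- 2) j) (J (Suc n') (- 2 + - 1 - int j) v (J n (int j) u c))"
 \<comment> \<open>The components of a circle product have weight one more than those of the
   product, whence \<open>Suc n'\<close>.\<close>
 have gi: "gr (int (n - i + Suc n')) (k + k') (Y u (int i - 2) v)" if "i <= n" for i
  using gr_Y[OF J(2,4), of "int i - 2"] that by (simp add: of_nat_diff algebra_simps)
 have "star (J n (- 2) u v) c = (\<Sum>i\<le>n. scale (of_nat (n choose i)) (J (n - i + Suc n') (- 1) (Y u (int i + - 2) v) c))"
  unfolding J_def[of n "- 2" u] lin_sum[OF zp_lin1] zp1_scale by (intro sum.cong refl) (simp add: zp_gr[OF gi] del: add_Suc_right)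
 also have "... = Sum_any ?f - scale (sg (- 2)) (Sum_any ?g)"
  by (rule J_iter[OF V_VL[OF J(1)] V_VL[OF J(3)]])
 also have "... \<in> OV"
 proof (intro OV_diff OV_scale OV_Sum_any)
  show "J n (- 2 - int j) u (J (Suc n') (- 1 + int j) v c) \<in> OV" for j
   by (rule JO[OF J_V[OF J(3) \<open>c \<in> V\<close>] J(1,2)]) simp
  \<comment> \<open>The surplus factor \<open>1 + x\<close> splits this into the indices
    \<open>- 3 - j\<close> and \<open>- 2 - j\<close>, both covered by \<open>JO\<close>.\<close>
  show "J (Suc n') (- 2 + - 1 - int j) v (J n (int j) u c) \<in> OV" for j
   unfolding J_Suc by (intro OV_add JO[OF J_V[OF J(1) \<open>c \<in> V\<close>] J(3,4)]) simp_all
 qed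
 finally show ?case by (simp add: zp1_scale OV_scale)
qed (simp_all add: lin_0[OF zp_lin1] OV_0 zp1_add OV_add)

lemma star_assoc: "a \<in> V ==> b \<in> V ==> c \<in> V ==> star (star a b) c - star a (star b c) \<in> OV"
proof (induction rule: V_nat_induct)
 case (gr n k a)
 from gr(3,4) show ?case
 proof (induction rule: V_nat_induct)
  case g: (gr n' k' b)
  show ?case unfolding zp_star_gr[OF gr(2) g(2)] zp_gr[OF g(2)] unfolding zp_gr[OF gr(2)]
   by (rule J_iter_OV[OF gr(1,2) g]) simp
 next
  case (add x y)
  thus ?case using OV_add by (simp add: zp1_add zp2_add add_diff_add)
 qed
next
 case (add x y)
 thus ?case using OV_add by (simp add: zp1_add zp2_add add_diff_add)
qed

lemma one_star: "star one b = b"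
proof -
 have g: "gr (int 0) 0 one" using gr_one by simp
 show ?thesis unfolding zp_gr[OF g] by (simp add: J_def Y_one)
qed

lemma star_one: "a \<in> V ==> star a one = a"
proof (induction rule: V_nat_induct)
 case (gr n k a)
 have "J n (- 1) a one = (\<Sum>j\<le>n. if j = 0 then a else 0)"
  unfolding J_def by (intro sum.cong refl) (auto simp: Y_m1_one Y_nn_one)
 thus ?case by (simp add: zp_gr[OF gr(2)])
qed (simp add: zp1_add)

text \<open>This is the circle product of \<open>u\<close> with the vacuum.\<close>

lemma OV_Lm1: "u \<in> V ==> gr N k u ==> L (- 1) u + scale (of_int N) u \<in> OV"
proof -
 assume u: "u \<in> V" "gr N k u"
 show ?thesis
 proof (rule gr_nat[OF u(2)])
  fix n assume n: "N = int n"
  have "J n (- 2) u one = (\<Sum>j\<le>n. (if j = 0 then L (- 1) u else 0) + (if j = 1 then scale (of_nat n) u else 0))"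
   unfolding J_def by (intro sum.cong refl) (auto simp: Y_m1_one Y_nn_one Y_m2_one)
  also have "... = L (- 1) u + scale (of_nat n) u" by (auto simp: sum.distrib)
  finally show ?thesis using J2_OV[OF u(1) u(2)[unfolded n] one_V] by (simp add: n)
 qed (simp add: L_0 OV_0)
qed

end

context lat begin

section \<open>Polynomials in the class of the conformal vector\<close>

abbreviation Wo :: "fock => fock" where "Wo \<equiv> star om"

lemma Wo_eq: "Wo v = L (- 2) v + scale 2 (L (- 1) v) + L 0 v"
proof -
 have g: "gr (int 2) 0 om" using gr_om by simp
 show ?thesis unfolding zp_gr[OF g] L_def by (simp add: J_def numeral_2_eq_2)
qed

lemma Wo_V: "v \<in> V ==> Wo v \<in> V" by (rule zp_V[OF om_V])
lemma Wo_OV: "v \<in> OV ==> Wo v \<in> OV" by (rule star_OV[OF om_V])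
lemma Q_Wo: "Q (Wo v) = Wo (Q v)" by (simp add: Wo_eq Q_add Q_scale Q_L)

lemma ev_Wo: "v \<in> V ==> ev b (Wo v) = hb b * ev b v"
proof (induction rule: V_induct)
 case (gr N k v)
 show ?case
 proof (cases "k = 0")
  case True
  note g = gr(2)[unfolded True]
  have "ev b (L (- 2) v) = (hb b + of_int N) * ev b v" "ev b (L (- 1) v) = - of_int N * ev b v"
   using ev_L[OF _ g, of 2 b] ev_L[OF _ g, of 1 b] by simp_all
  thus ?thesis unfolding Wo_eq gr_L0[OF g] evp_add evp_scale poly_add poly_smult by (simp add: algebra_simps)
 next
  case False
  hence z: "gr M k x ==> evp x = 0" for M x by (intro evp_charge[OF gr_ch]) (use p0 in auto)
  show ?thesis unfolding Wo_eq evp_add evp_scale using z[OF gr(2)] z[OF gr_L[OF gr(2)]] by simp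
 qed
qed (simp add: zp2_add evp_add distrib_left)

text \<open>The counterpart of \<open>ev_L\<close> in Zhu's algebra.\<close>

lemma L_OV:
 assumes v: "v \<in> V" "gr N k v"
 shows "l >= 1 ==> L (- int l) v - scale ((-1) ^ l) (scale (of_nat l - 1) (Wo v) + scale (of_int N) v) \<in> OV"
proof (induction l rule: less_induct)
 case (less l)
 let ?R = "%l. L (- int l) v - scale ((-1) ^ l) (scale (of_nat l - 1) (Wo v) + scale (of_int N) v)"
 have L1: "L (- 1) v + scale (of_int N) v \<in> OV" by (rule OV_Lm1[OF v])
 consider "l = 1" | "l = 2" | m where "l = Suc (Suc m)" "m >= 1" using less.prems by (metis Suc_1 One_nat_def Suc_le_D le_SucE not_less_eq_eq)
 thus ?case
 proof cases
  case 1 thus ?thesis using L1 by (simp add: pm.scale_minus_left)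
 next
  case 2
  have "?R l = - scale 2 (L (- 1) v + scale (of_int N) v)"
   unfolding 2 Wo_eq gr_L0[OF v(2)] by (auto intro!: poly_mapping_eqI simp: lookup_add lookup_minus lookup_scale)
  thus ?thesis using OV_neg[OF OV_scale[OF L1]] by simp
 next
  case 3
  have g: "gr (int 2) 0 om" using gr_om by simp
  have "J 2 (- int (Suc m)) om v \<in> OV" by (rule JO[OF v(1) om_V g]) (use 3 in simp)
  moreover have e: "J 2 (- int (Suc m)) om v = L (- int l) v + scale 2 (L (- int (Suc m)) v) + L (- int m) v"
   unfolding L_def 3 by (simp add: J_def numeral_2_eq_2)
  ultimately have A: "L (- int l) v + scale 2 (L (- int (Suc m)) v) + L (- int m) v \<in> OV" by (simp only:)
  have "?R m \<in> OV" by (rule less.IH) (use 3 in auto)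
  moreover have "?R (Suc m) \<in> OV" by (rule less.IH) (use 3 in auto)
  ultimately have "L (- int l) v + scale 2 (L (- int (Suc m)) v) + L (- int m) v - scale 2 (?R (Suc m)) - ?R m \<in> OV"
   by (intro OV_diff[OF OV_diff[OF A OV_scale]])
  also have "L (- int l) v + scale 2 (L (- int (Suc m)) v) + L (- int m) v - scale 2 (?R (Suc m)) - ?R m = ?R l"
   unfolding 3 by (rule poly_mapping_eqI) (simp add: lookup_add lookup_minus lookup_scale algebra_simps)
  finally show ?thesis .
 qed
qed

text \<open>Left multiplication by a polynomial in the class of \<open>om\<close>, on vectors rather
  than classes, so that it can be combined with \<open>Q\<close> and the evaluations.\<close>

definition pw :: "complex poly => fock => fock" where
 "pw P v = (\<Sum>i\<le>degree P. scale (poly.coeff P i) ((Wo ^^ i) v))"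

lemma pw_0 [simp]: "pw 0 v = 0" by (simp add: pw_def)

lemma pw_pCons: "pw (pCons a P) v = scale a v + Wo (pw P v)"
proof (cases "P = 0")
 case False
 have "pw (pCons a P) v = (\<Sum>i\<le>Suc (degree P). scale (poly.coeff (pCons a P) i) ((Wo ^^ i) v))"
  by (simp only: pw_def degree_pCons_eq[OF False])
 also have "... = scale (poly.coeff (pCons a P) 0) ((Wo ^^ 0) v) + (\<Sum>i\<le>degree P. scale (poly.coeff (pCons a P) (Suc i)) ((Wo ^^ Suc i) v))"
  by (rule sum.atMost_Suc_shift)
 finally show ?thesis by (simp add: pw_def lin_sum[OF zp_lin2] zp2_scale)
qed (simp add: pw_def zp2_0)

lemma pw_add: "pw (P + R) v = pw P v + pw R v"
proof (induction P R rule: poly_induct2)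
 case (pCons a P b R)
 thus ?case by (simp add: pw_pCons zp2_add pm.scale_left_distrib)
qed simp

lemma pw_smult: "pw (psmult c P) v = scale c (pw P v)"
 by (induction P) (simp_all add: pw_pCons zp2_scale pm.scale_right_distrib)

lemma pw_mult: "pw (P * R) v = pw P (pw R v)"
 by (induction P) (simp_all add: pw_pCons pw_add pw_smult)

lemma pw_lin: "lin (pw P)"
proof (induction P)
 case (pCons a P)
 thus ?case unfolding pw_pCons[abs_def] by (intro lin_plus lin_scl lin_id) (rule lin_comp[OF zp_lin2])
qed (simp add: lin_zero)

lemma pw_1 [simp]: "pw 1 v = v" by (simp add: one_pCons pw_pCons zp2_0)
lemma pw_V: "v \<in> V ==> pw P v \<in> V" by (induction P) (simp_all add: pw_pCons V_add V_scale Wo_V)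
lemma pw_OV: "v \<in> OV ==> pw P v \<in> OV" by (induction P) (simp_all add: pw_pCons OV_0 OV_add OV_scale Wo_OV)
lemma Q_pw: "Q (pw P v) = pw P (Q v)" by (induction P) (simp_all add: pw_pCons Q_0 Q_add Q_scale Q_Wo)
lemma ev_pw: "v \<in> V ==> ev b (pw P v) = poly P (hb b) * ev b v"
 by (induction P) (simp_all add: pw_pCons evp_add evp_scale ev_Wo pw_V algebra_simps)

lemma OV_cong_trans: "x - y \<in> OV ==> y - z \<in> OV ==> x - z \<in> OV"
 using OV_add[of "x - y" "y - z"] by simp

lemma star_cong: "a \<in> V ==> x - y \<in> OV ==> star a x - star a y \<in> OV"
 using star_OV[of a "x - y"] by (simp add: lin_diff[OF zp_lin2])

lemma cong_star: "c \<in> V ==> x - y \<in> OV ==> star x c - star y c \<in> OV"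
 using OV_star[of "x - y" c] by (simp add: lin_diff[OF zp_lin1])

lemma pw_cong: "x - y \<in> OV ==> pw P x - pw P y \<in> OV"
 using pw_OV[of "x - y" P] by (simp add: lin_diff[OF pw_lin])

lemma pw_star: "x \<in> V ==> y \<in> V ==> star (pw P x) y - pw P (star x y) \<in> OV"
proof (induction P)
 case (pCons a P)
 have "star (Wo (pw P x)) y - Wo (star (pw P x) y) \<in> OV" using star_assoc[OF om_V pw_V pCons.prems(2)] pCons.prems by simp
 from OV_cong_trans[OF this star_cong[OF om_V pCons.IH[OF pCons.prems]]]
 show ?case by (simp add: pw_pCons zp1_add zp1_scale)
qed (simp add: lin_0[OF zp_lin1] OV_0)

text \<open>The commutation of the class of \<open>om\<close> with those of the generators. As
  \<open>X\<close> is primary, \<open>X star om\<close> is a combination of \<open>L (- 2) X\<close>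
  and derivatives of \<open>X\<close>, and modulo \<open>O(V)\<close> each \<open>L (- 1)\<close> is
  minus the weight.\<close>

lemma prim_om: assumes X: "prim X" "gr wF k X" shows "star X om - Wo X \<in> OV"
proof -
 let ?N = "of_int wF :: complex"
 have V: "X \<in> V" by (rule primV[OF X(1)])
 have n2: "nF = Suc (Suc (nF - 2))" using pge by (simp add: nF_def)
 have m: "Y X m om = L (- 2) (Y X m one) + scale (of_int (wF + m - 1)) (Y X (m - 2) one)" for m
 proof -
  have e: "- 2 + m = m - 2" by simp
  have "L (- 2) (Y X m one) = Y X m om + scale (of_int (- 2 + 1) * ?N - of_int (- 2 + m + 1)) (Y X (- 2 + m) one)"
   using L_primary[OF V_VL[OF V] _ prim_0[OF X(1)], of "- 2" m one] prim_pos[OF X(1)] by (simp add: om_L)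
  thus ?thesis unfolding e by (auto intro!: poly_mapping_eqI simp: lookup_add lookup_scale algebra_simps)
 qed
 have y3: "Y X (- 3) one = scale (1/2) (L (- 1) (L (- 1) X))" using Y_desc[OF V_VL[OF V], of 2] by (simp add: numeral_2_eq_2)
 let ?f = "%j. scale (of_nat (nF choose j)) (Y X (int j - 1) om)"
 have "star X om = J nF (- 1) X om" using zp_gr[of nF k X] X(2) nF by simp
 also have "... = (\<Sum>j<Suc (Suc (Suc (nF - 2))). ?f j)" unfolding J_def using n2 by (simp add: lessThan_Suc_atMost)
 also have "... = (\<Sum>j<3. ?f j)"
  by (rule sum.mono_neutral_right) (auto simp: m Y_nn_one L_0)
 also have "... = ?f 0 + ?f 1 + ?f 2" by (simp only: numeral_3_eq_3 numeral_2_eq_2 sum.lessThan_Suc lessThan_0 sum.empty add_0 One_nat_def)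
 also have "?f 0 = L (- 2) X + scale ((?N - 2) / 2) (L (- 1) (L (- 1) X))" by (simp add: m Y_m1_one y3)
 also have "?f 1 = scale (?N * (?N - 1)) (L (- 1) X)"
  by (simp add: m Y_m2_one Y_nn_one L_0 nF[symmetric])
 also have "?f 2 = scale (?N * (?N - 1) / 2 * ?N) X"
 proof -
  have "(of_nat (nF choose 2) :: complex) = ?N * (?N - 1) / 2"
   using bc_nat[of nF 2] nF by (simp add: gbinomial_prod_rev numeral_2_eq_2)
  thus ?thesis by (simp add: m Y_m1_one Y_nn_one L_0)
 qed
 finally have s: "star X om = L (- 2) X + scale ((?N - 2) / 2) (L (- 1) (L (- 1) X)) + scale (?N * (?N - 1)) (L (- 1) X) + scale (?N * (?N - 1) / 2 * ?N) X" .
 have g1: "gr (wF + 1) k (L (- 1) X)" using gr_L[OF X(2), of "- 1"] by simp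
 have 1: "L (- 2) X - (Wo X + scale ?N X) \<in> OV" using L_OV[OF V X(2), of 2] by simp
 have 2: "L (- 1) X + scale ?N X \<in> OV" by (rule OV_Lm1[OF V X(2)])
 have 3: "L (- 1) (L (- 1) X) + scale (of_int (wF + 1)) (L (- 1) X) \<in> OV" by (rule OV_Lm1[OF V_L[OF V] g1])
 \<comment> \<open>The coefficients are chosen so that the difference splits into multiples of the
   elements \<open>1\<close>, \<open>3\<close> and \<open>2\<close> of \<open>O(V)\<close>.\<close>
 have eq: "star X om - Wo X = (L (- 2) X - (Wo X + scale ?N X)) + scale ((?N - 2) / 2) (L (- 1) (L (- 1) X) + scale (of_int (wF + 1)) (L (- 1) X))
  + scale (?N * (?N - 1) - (?N - 2) / 2 * (?N + 1)) (L (- 1) X + scale ?N X)"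
  unfolding s by (rule poly_mapping_eqI) (simp add: lookup_add lookup_minus lookup_scale field_simps)
 show ?thesis unfolding eq by (rule OV_add[OF OV_add[OF 1 OV_scale[OF 3]] OV_scale[OF 2]])
qed

lemma prim_pw: assumes X: "prim X" "gr wF k X" and y: "y \<in> V" shows "star X (pw P y) - pw P (star X y) \<in> OV"
proof (induction P)
 case (pCons a P)
 let ?z = "pw P y"
 have V: "X \<in> V" "?z \<in> V" using primV[OF X(1)] pw_V[OF y] by auto
 have "star X (Wo ?z) - star (star X om) ?z \<in> OV" using OV_neg[OF star_assoc[OF V(1) om_V V(2)]] by simp
 also have "star (star X om) ?z - star (Wo X) ?z \<in> OV" by (rule cong_star[OF V(2) prim_om[OF X]])
 note OV_cong_trans[OF calculation this]
 from OV_cong_trans[OF this star_assoc[OF om_V V]]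
 have "star X (Wo ?z) - Wo (star X ?z) \<in> OV" .
 from OV_cong_trans[OF this star_cong[OF om_V pCons.IH]]
 show ?case by (simp add: pw_pCons zp2_add zp2_scale)
qed (simp add: zp2_0 OV_0)

lemma Q_J: "u \<in> VL ==> Q (J n r u v) = J n r (Q u) v + J n r u (Q v)"
 by (simp add: J_def lin_sum[OF Q_lin] Q_scale Q_Y pm.scale_right_distrib sum.distrib)

text \<open>\<open>Q\<close> is a derivation of all modes and preserves weights, so it descends to
  Zhu's algebra and carries relations of \<open>F\<close> to \<open>H\<close> and
  \<open>E\<close>.\<close>

lemma Q_OV: "x \<in> OV ==> Q x \<in> OV"
proof (induction rule: OV_induct)
 case (J n k u n' k' v c)
 thus ?case
  using OV_add[OF J2_OV[OF V_Q[OF J(1)] gr_Q[OF J(2)] J(3)] J2_OV[OF J(1,2) V_Q[OF J(3)]]]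
  by (simp add: Q_scale Q_J V_VL OV_scale)
qed (simp_all add: Q_0 OV_0 Q_add OV_add)

subsection \<open>Reduction of products of generators\<close>

text \<open>\<open>red A D k N\<close>: vectors of weight \<open>N\<close> and charge \<open>k\<close> congruent modulo \<open>O(V)\<close> to an element of \<open>A N\<close>
 on which, after applying \<open>D\<close>, every evaluation agrees.\<close>

definition red :: "(int => fock set) => (fock => fock) => int => int => fock set" where
 "red A D k N = {v \<in> V. gr N k v \<and> (\<exists>x\<in>A N. v - x \<in> OV \<and> (\<forall>b. ev b (D v) = ev b (D x)))}"

definition redA :: "(int => fock set) => bool" where
 "redA A \<longleftrightarrow> (\<forall>N. pm.subspace (A N) \<and> A N \<subseteq> V \<and> A N \<subseteq> A (N + 1) \<and> Wo ` A N \<subseteq> A (N + 2))"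

lemma redA_mono: "redA A ==> x \<in> A N ==> N <= M ==> x \<in> A M"
proof -
 assume A: "redA A" "x \<in> A N"
 have "x \<in> A (N + int j)" for j
 proof (induction j)
  case (Suc j)
  hence "x \<in> A (N + int j + 1)" using A(1) unfolding redA_def by blast
  thus ?case by (simp add: algebra_simps)
 qed (use A in simp)
 from this[of "nat (M - N)"] show "N <= M ==> x \<in> A M" by simp
qed

text \<open>Modulo \<open>O(V)\<close> the operator \<open>L (- l)\<close> is a linear polynomial in
  \<open>Wo\<close> (\<open>L_OV\<close>), and on evaluations it is the same polynomial in
  \<open>hb\<close> (\<open>ev_L\<close>); so congruence and evaluation can be carried along
  together.\<close>

lemma red_vc:
 assumes A: "redA A" and D: "lin D" "!!n v. D (L n v) = L n (D v)" "!!v. v \<in> V ==> D v \<in> V" "!!N v. gr N k v ==> gr N 0 (D v)"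
 shows "vc (red A D k)"
 unfolding vc_def
proof (intro conjI allI impI)
 have sA: "pm.subspace (A N)" and AV: "x \<in> A N ==> x \<in> V" and AW: "x \<in> A N ==> Wo x \<in> A (N + 2)" for N x
  using A unfolding redA_def by blast+
 show "pm.subspace (red A D k N)" for N
  unfolding pm.subspace_def
 proof (intro conjI ballI allI)
  show "0 \<in> red A D k N" using pm.subspace_0[OF sA] OV_0 by (auto simp: red_def intro!: bexI[of _ 0])
  show "x + y \<in> red A D k N" if h: "x \<in> red A D k N" "y \<in> red A D k N" for x y
  proof -
   from h(1) obtain x' where x': "x' \<in> A N" "x - x' \<in> OV" "!!b. ev b (D x) = ev b (D x')" by (auto simp: red_def)
   from h(2) obtain y' where y': "y' \<in> A N" "y - y' \<in> OV" "!!b. ev b (D y) = ev b (D y')" by (auto simp: red_def)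
   have "x + y - (x' + y') \<in> OV" using OV_add[OF x'(2) y'(2)] by (simp add: algebra_simps)
   thus ?thesis using h x'(1,3) y'(1,3) pm.subspace_add[OF sA]
    by (auto simp: red_def V_add gr_add lin_add[OF D(1)] evp_add intro!: bexI[of _ "x' + y'"])
  qed
  show "scale c x \<in> red A D k N" if h: "x \<in> red A D k N" for c x
  proof -
   from h obtain x' where x': "x' \<in> A N" "x - x' \<in> OV" "!!b. ev b (D x) = ev b (D x')" by (auto simp: red_def)
   have "scale c x - scale c x' \<in> OV" using OV_scale[OF x'(2), of c] by (simp add: pm.scale_right_diff_distrib)
   thus ?thesis using h x'(1,3) pm.subspace_scale[OF sA]
    by (auto simp: red_def V_scale gr_scale lin_scale[OF D(1)] evp_scale intro!: bexI[of _ "scale c x'"])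
  qed
 qed
 fix N v and l :: int assume "1 <= l" and v: "v \<in> red A D k N"
 then obtain m where m: "l = int m" "m >= 1" by (metis nonneg_int_cases zero_le_one order_trans of_nat_1 of_nat_le_iff)
 from v obtain x where x: "x \<in> A N" "v - x \<in> OV" "!!b. ev b (D v) = ev b (D x)" and vV: "v \<in> V" "gr N k v" by (auto simp: red_def)
 let ?T = "%v. scale ((-1) ^ m) (scale (of_nat m - 1) (Wo v) + scale (of_int N) v)"
 have "?T v - ?T x = ?T (v - x)" by (simp add: lin_diff[OF zp_lin2] pm.scale_right_diff_distrib pm.scale_right_distrib algebra_simps)
 moreover have "?T (v - x) \<in> OV" by (intro OV_scale OV_add Wo_OV x(2))
 ultimately have 1: "L (- l) v - ?T x \<in> OV" using OV_cong_trans[OF L_OV[OF vV m(2)]] m(1) by simp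
 have 2: "?T x \<in> A (N + l)"
 proof (rule pm.subspace_scale[OF sA], rule pm.subspace_add[OF sA])
  show "scale (of_int N) x \<in> A (N + l)" by (rule pm.subspace_scale[OF sA redA_mono[OF A x(1)]]) (use m in simp)
  show "scale (of_nat m - 1) (Wo x) \<in> A (N + l)"
  proof (cases "m = 1")
   case True thus ?thesis using pm.subspace_0[OF sA] by simp
  next
   case False
   hence "Wo x \<in> A (N + l)" by (intro redA_mono[OF A AW[OF x(1)]]) (use m in auto)
   thus ?thesis by (rule pm.subspace_scale[OF sA])
  qed
 qed
 have DW: "D (Wo x) = Wo (D x)" by (simp add: Wo_eq lin_add[OF D(1)] lin_scale[OF D(1)] D(2))
 have 3: "ev b (D (L (- l) v)) = ev b (D (?T x))" for b
  unfolding D(2) m(1) ev_L[OF m(2) D(4)[OF vV(2)]] lin_scale[OF D(1)] lin_add[OF D(1)] DW evp_scale evp_add poly_smult poly_add ev_Wo[OF D(3)[OF AV[OF x(1)]]] x(3)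
  by (simp add: algebra_simps)
 show "L (- l) v \<in> red A D k (N + l)"
  using 1 2 3 V_L[OF vV(1)] gr_L[OF vV(2), of "- l"] by (auto simp: red_def)
qed

lemma red_J:
 assumes A: "redA A" and D: "lin D" and s: "!!N. pm.subspace (red A D k N)"
  and r: "!!j. Y u (int j + r) v \<in> red A D k (W0 - (int j + r))"
 obtains x where "x \<in> A (W0 - r)" "J nF r u v - x \<in> OV" "!!b. ev b (D (J nF r u v)) = ev b (D x)"
proof -
 have "\<exists>x. \<forall>j. x j \<in> A (W0 - r) \<and> Y u (int j + r) v - x j \<in> OV \<and> (\<forall>b. ev b (D (Y u (int j + r) v)) = ev b (D (x j)))"
 proof (rule choice, rule allI)
  fix j
  from r[of j] obtain x where "x \<in> A (W0 - (int j + r))" "Y u (int j + r) v - x \<in> OV" "\<forall>b. ev b (D (Y u (int j + r) v)) = ev b (D x)"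
   by (auto simp: red_def)
  moreover from this(1) have "x \<in> A (W0 - r)" by (rule redA_mono[OF A]) simp
  ultimately show "\<exists>x. x \<in> A (W0 - r) \<and> Y u (int j + r) v - x \<in> OV \<and> (\<forall>b. ev b (D (Y u (int j + r) v)) = ev b (D x))" by blast
 qed
 then obtain x where x: "!!j. x j \<in> A (W0 - r)" "!!j. Y u (int j + r) v - x j \<in> OV" "!!j b. ev b (D (Y u (int j + r) v)) = ev b (D (x j))" by blast
 have "pm.subspace (A (W0 - r))" using A unfolding redA_def by blast
 hence 1: "bs nF x \<in> A (W0 - r)" unfolding bs_def by (intro pm.subspace_sum pm.subspace_scale x(1))
 have "bs nF (%j. Y u (int j + r) v - x j) \<in> OV" unfolding bs_def by (intro OV_sum OV_scale x(2))
 hence 2: "J nF r u v - bs nF x \<in> OV" by (simp add: J_bs bs_diff)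
 have 3: "ev b (D (J nF r u v)) = ev b (D (bs nF x))" for b
  unfolding J_bs bs_lin[OF D] unfolding bs_def evp_sum evp_scale by (simp add: poly_sum x(3))
 show ?thesis by (rule that[OF 1 2 3])
qed

definition A0 :: "int => fock set" where "A0 N = {pw P one + pw R H | P R. True}"
text \<open>The bound on the degree, half of the weight in excess of that of \<open>F\<close>, makes
  the relation found in \<open>HF_circ\<close> have degree at most \<open>p\<close>.\<close>

definition AF :: "int => fock set" where "AF N = {pw T F | T. T = 0 \<or> 2 * int (degree T) <= N - wF}"
definition AE :: "int => fock set" where "AE N = {pw T E | T. True}"

lemma redA_A0: "redA A0"
 unfolding redA_def
proof (intro allI conjI subsetI)
 fix N x
 show "pm.subspace (A0 N)"
  unfolding pm.subspace_def A0_def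
 proof (intro conjI ballI allI)
  show "0 \<in> {pw P one + pw R H | P R. True}" by (auto intro!: exI[of _ "0 :: complex poly"])
  show "u + v \<in> {pw P one + pw R H | P R. True}" if h: "u \<in> {pw P one + pw R H | P R. True}" "v \<in> {pw P one + pw R H | P R. True}" for u v
  proof -
   from h obtain P R P' R' where "u = pw P one + pw R H" "v = pw P' one + pw R' H" by blast
   hence "u + v = pw (P + P') one + pw (R + R') H" by (simp add: pw_add algebra_simps)
   thus ?thesis by blast
  qed
  show "scale c u \<in> {pw P one + pw R H | P R. True}" if "u \<in> {pw P one + pw R H | P R. True}" for c u
  proof -
   from that obtain P R where "u = pw P one + pw R H" by blast
   hence "scale c u = pw (psmult c P) one + pw (psmult c R) H" by (simp add: pw_smult pm.scale_right_distrib)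
   thus ?thesis by blast
  qed
 qed
 show "x \<in> A0 N ==> x \<in> V" by (auto simp: A0_def V_add pw_V one_V H_V)
 show "x \<in> A0 N ==> x \<in> A0 (N + 1)" by (simp add: A0_def)
 assume "x \<in> Wo ` A0 N"
 then obtain P R where "x = Wo (pw P one + pw R H)" by (auto simp: A0_def)
 hence "x = pw (pCons 0 P) one + pw (pCons 0 R) H" by (simp add: zp2_add pw_pCons)
 thus "x \<in> A0 (N + 2)" by (auto simp: A0_def)
qed

lemma redA_AF: "redA AF"
 unfolding redA_def
proof (intro allI conjI subsetI)
 fix N x
 let ?d = "%T :: complex poly. T = 0 \<or> 2 * int (degree T) <= N - wF"
 show "pm.subspace (AF N)"
  unfolding pm.subspace_def
 proof (intro conjI ballI allI)
  show "0 \<in> AF N" by (auto simp: AF_def intro!: exI[of _ "0 :: complex poly"])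
  show "u + v \<in> AF N" if h: "u \<in> AF N" "v \<in> AF N" for u v
  proof -
   from h(1) obtain T where T: "u = pw T F" "?d T" unfolding AF_def by blast
   from h(2) obtain T' where T': "v = pw T' F" "?d T'" unfolding AF_def by blast
   have "?d (T + T')" using T(2) T'(2) degree_add_le_max[of T T'] by (cases "T = 0"; cases "T' = 0"; auto)
   moreover have "u + v = pw (T + T') F" by (simp add: T T' pw_add)
   ultimately show ?thesis unfolding AF_def by blast
  qed
  show "scale c u \<in> AF N" if h: "u \<in> AF N" for c u
  proof -
   from h obtain T where T: "u = pw T F" "?d T" unfolding AF_def by blast
   have "?d (psmult c T)" using T(2) degree_smult_le[of c T] by auto
   moreover have "scale c u = pw (psmult c T) F" by (simp add: T pw_smult)
   ultimately show ?thesis unfolding AF_def by blast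
  qed
 qed
 show "x \<in> AF N ==> x \<in> V" by (auto simp: AF_def pw_V F_V)
 show "x \<in> AF N ==> x \<in> AF (N + 1)" by (fastforce simp: AF_def)
 assume "x \<in> Wo ` AF N"
 then obtain T where T: "x = Wo (pw T F)" "?d T" by (auto simp: AF_def)
 have "x = pw (pCons 0 T) F" by (simp add: T pw_pCons)
 moreover have "pCons 0 T = 0 \<or> 2 * int (degree (pCons 0 T)) <= N + 2 - wF" using T(2) by auto
 ultimately show "x \<in> AF (N + 2)" unfolding AF_def by blast
qed

lemma redA_AE: "redA AE"
 unfolding redA_def
proof (intro allI conjI subsetI)
 fix N x
 show "pm.subspace (AE N)"
  unfolding pm.subspace_def AE_def
 proof (intro conjI ballI allI)
  show "0 \<in> {pw T E | T. True}" by (auto intro!: exI[of _ "0 :: complex poly"])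
  show "u + v \<in> {pw T E | T. True}" if "u \<in> {pw T E | T. True}" "v \<in> {pw T E | T. True}" for u v
   using that by (auto simp: pw_add[symmetric])
  show "scale c u \<in> {pw T E | T. True}" if "u \<in> {pw T E | T. True}" for c u
   using that by (auto simp: pw_smult[symmetric])
 qed
 show "x \<in> AE N ==> x \<in> V" by (auto simp: AE_def pw_V E_V)
 show "x \<in> AE N ==> x \<in> AE (N + 1)" by (simp add: AE_def)
 show "x \<in> Wo ` AE N ==> x \<in> AE (N + 2)" by (auto simp: AE_def intro: exI[of _ "pCons 0 _"] pw_pCons[of 0, simplified, symmetric])
qed

lemma red0_vc: "vc (red A0 (%v. v) 0)" by (rule red_vc[OF redA_A0 lin_id]) auto
lemma redF_vc: "vc (red AF Q (- 1))"
 by (rule red_vc[OF redA_AF Q_lin Q_L V_Q]) (use gr_Q in fastforce)+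
lemma redE_vc: "vc (red AE (%_. 0) 1)" by (rule red_vc[OF redA_AE lin_zero]) (auto simp: L_0)

lemma red_gen: "H \<in> red A0 (%v. v) 0 wF" "scale c one \<in> red A0 (%v. v) 0 0" "F \<in> red AF Q (- 1) wF" "E \<in> red AE (%_. 0) 1 wF"
proof -
 have "H = pw 0 one + pw 1 H" by simp
 hence "H \<in> A0 wF" unfolding A0_def by blast
 thus "H \<in> red A0 (%v. v) 0 wF" by (auto simp: red_def H_V gr_H OV_0 intro!: bexI[of _ H])
 have "scale c one = pw [:c:] one + pw 0 H" by (simp add: pw_pCons zp2_0)
 hence "scale c one \<in> A0 0" unfolding A0_def by blast
 thus "scale c one \<in> red A0 (%v. v) 0 0" by (auto simp: red_def V_scale one_V gr_scale gr_one OV_0 intro!: bexI[of _ "scale c one"])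
 have "F \<in> AF wF" unfolding AF_def by (auto intro!: exI[of _ "1 :: complex poly"])
 thus "F \<in> red AF Q (- 1) wF" by (auto simp: red_def F_V gr_F OV_0 intro!: bexI[of _ F])
 have "E \<in> AE wF" unfolding AE_def by (auto intro!: exI[of _ "1 :: complex poly"])
 thus "E \<in> red AE (%_. 0) 1 wF" by (auto simp: red_def E_V gr_E OV_0 intro!: bexI[of _ E])
qed

text \<open>Vectors of charge -1 evaluate to 0, so evaluations are taken after \<open>Q\<close>,
  which maps \<open>H \<circ> F\<close> to \<open>E \<circ> F + H \<circ> H\<close>, where the
  second term evaluates to 0. The weight exceeds that of \<open>F\<close> by at most
  \<open>2p\<close>, whence the degree.\<close>

lemma HF_circ: obtains T where "T = 0 \<or> degree T <= p" "pw T F \<in> OV" "!!b. ev (of_int b) (J nF (- 2) E F) = poly T (hb (of_int b)) * ev (of_int b) H"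
proof -
 have "Y H (int j + - 2) F \<in> red AF Q (- 1) (W0 - (int j + - 2))" for j
  by (rule prod_HF(1)[OF redF_vc red_gen(3)]) (use pge in simp)
 from red_J[OF redA_AF Q_lin vcs[OF redF_vc] this]
 obtain x where x: "x \<in> AF (W0 + 2)" "J nF (- 2) H F - x \<in> OV" "!!b. ev b (Q (J nF (- 2) H F)) = ev b (Q x)" by auto
 from x(1) obtain T where T: "x = pw T F" "T = 0 \<or> 2 * int (degree T) <= W0 + 2 - wF" unfolding AF_def by blast
 have d: "T = 0 \<or> degree T <= p" using T(2) by (auto simp: W0_def wF_def)
 have "J nF (- 2) H F \<in> OV" by (rule J2_OV[OF H_V _ F_V, of _ 0]) (simp add: nF gr_H)
 hence "pw T F \<in> OV" using OV_diffD x(2) T(1) by blast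
 moreover have "ev (of_int b) (J nF (- 2) E F) = poly T (hb (of_int b)) * ev (of_int b) H" for b
 proof -
  have "ev (of_int b) (J nF (- 2) H H) = 0" using ev_J0(2)[of nF H nF H b] gr_H nF by simp
  thus ?thesis using x(3)[of "of_int b"]
   by (simp add: Q_J V_VL[OF H_V] E_def[symmetric] H_def[symmetric] evp_add T(1) Q_pw ev_pw[OF H_V])
 qed
 ultimately show ?thesis using that d by blast
qed

lemma HH_star: obtains P R where "star H H - (pw P one + pw R H) \<in> OV" "!!b. ev (of_int b) H * ev (of_int b) H = poly P (hb (of_int b)) + poly R (hb (of_int b)) * ev (of_int b) H"
proof -
 have "Y H (int j + - 1) H \<in> red A0 (%v. v) 0 (W0 - (int j + - 1))" for j
  by (rule prod_HH(1)[OF red0_vc red_gen(1,2)]) (use pge in simp)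
 from red_J[OF redA_A0 lin_id vcs[OF red0_vc] this]
 obtain x where x: "x \<in> A0 (W0 + 1)" "J nF (- 1) H H - x \<in> OV" "!!b. ev b (J nF (- 1) H H) = ev b x" by auto
 from x(1) obtain P R where PR: "x = pw P one + pw R H" unfolding A0_def by blast
 have g: "gr (int nF) 0 H" using gr_H nF by simp
 have "ev (of_int b) H * ev (of_int b) H = poly P (hb (of_int b)) + poly R (hb (of_int b)) * ev (of_int b) H" for b
  using x(3)[of "of_int b"] ev_J0(1)[OF g g, of b] by (simp add: PR evp_add ev_pw one_V H_V evp_st evm_def)
 thus ?thesis using that x(2) by (simp add: zp_gr[OF g] PR)
qed

section \<open>Four elements span Zhu's algebra over the polynomials\<close>

definition spanned :: "fock => bool" where
 "spanned v \<longleftrightarrow> (\<exists>P R T1 T2. v - (pw P one + pw R H + pw T1 E + pw T2 F) \<in> OV)"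

lemma spanned_add: "spanned u ==> spanned v ==> spanned (u + v)"
proof -
 assume "spanned u" "spanned v"
 then obtain P R T1 T2 P' R' T1' T2' where "u - (pw P one + pw R H + pw T1 E + pw T2 F) \<in> OV" "v - (pw P' one + pw R' H + pw T1' E + pw T2' F) \<in> OV"
  unfolding spanned_def by blast
 from OV_add[OF this] have "u + v - (pw (P + P') one + pw (R + R') H + pw (T1 + T1') E + pw (T2 + T2') F) \<in> OV"
  by (simp add: pw_add algebra_simps)
 thus ?thesis unfolding spanned_def by blast
qed

lemma spanned_pw: "spanned v ==> spanned (pw T v)"
proof -
 assume "spanned v"
 then obtain P R T1 T2 where "v - (pw P one + pw R H + pw T1 E + pw T2 F) \<in> OV" unfolding spanned_def by blast
 from pw_OV[OF this, of T] have "pw T v - (pw (T * P) one + pw (T * R) H + pw (T * T1) E + pw (T * T2) F) \<in> OV"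
  by (simp add: lin_diff[OF pw_lin] lin_add[OF pw_lin] pw_mult)
 thus ?thesis unfolding spanned_def by blast
qed

lemma spanned_cong: "u - v \<in> OV ==> spanned v ==> spanned u"
 unfolding spanned_def using OV_cong_trans by blast

lemma spanned_scale: "spanned v ==> spanned (scale c v)"
 using spanned_pw[of v "[:c:]"] by (simp add: pw_pCons zp2_0)

lemma spanned_OV: "v \<in> OV ==> spanned v"
 unfolding spanned_def by (auto intro!: exI[of _ "0 :: complex poly"])

lemma spanned_sum: "(!!i. i \<in> I ==> spanned (f i)) ==> spanned (sum f I)"
 by (induction I rule: infinite_finite_induct) (auto intro: spanned_add spanned_OV OV_0)

lemma spanned_gens: "spanned (pw T one)" "spanned (pw T H)" "spanned (pw T E)" "spanned (pw T F)"
proof -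
 have "one - (pw 1 one + pw 0 H + pw 0 E + pw 0 F) \<in> OV" "H - (pw 0 one + pw 1 H + pw 0 E + pw 0 F) \<in> OV"
  "E - (pw 0 one + pw 0 H + pw 1 E + pw 0 F) \<in> OV" "F - (pw 0 one + pw 0 H + pw 0 E + pw 1 F) \<in> OV" by (simp_all add: OV_0)
 hence "spanned one" "spanned H" "spanned E" "spanned F" unfolding spanned_def by blast+
 thus "spanned (pw T one)" "spanned (pw T H)" "spanned (pw T E)" "spanned (pw T F)" by (auto intro: spanned_pw)
qed

end

context lat begin

lemma star_prod: "X = E \<or> X = F \<or> X = H ==> X' = E \<or> X' = F \<or> X' = H ==> spanned (star X X')"
proof -
 have j: "int j + - 1 >= - 2 * int p" for j using pge by simp
 have st: "star X Y' = J nF (- 1) X Y'" if "X = E \<or> X = F \<or> X = H" for X Y'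
  using that zp_gr[of nF _ X "- 1" Y'] gr_E gr_F gr_H nF by metis
 have A0: "x \<in> A0 N ==> spanned x" for x N unfolding A0_def by (auto intro: spanned_add spanned_gens)
 have AF: "x \<in> AF N ==> spanned x" for x N unfolding AF_def by (auto intro: spanned_gens)
 have AE: "x \<in> AE N ==> spanned x" for x N unfolding AE_def by (auto intro: spanned_gens)
 have 0: "spanned (J nF (- 1) u v)" if r: "!!j. Y u (int j + - 1) v \<in> red A0 (%v. v) 0 (W0 - (int j + - 1))" for u v
  by (rule red_J[OF redA_A0 lin_id vcs[OF red0_vc] r]) (rule spanned_cong[OF _ A0])
 have 1: "spanned (J nF (- 1) u v)" if r: "!!j. Y u (int j + - 1) v \<in> red AF Q (- 1) (W0 - (int j + - 1))" for u v
  by (rule red_J[OF redA_AF Q_lin vcs[OF redF_vc] r]) (rule spanned_cong[OF _ AF])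
 have 2: "spanned (J nF (- 1) u v)" if r: "!!j. Y u (int j + - 1) v \<in> red AE (%_. 0) 1 (W0 - (int j + - 1))" for u v
  by (rule red_J[OF redA_AE lin_zero vcs[OF redE_vc] r]) (rule spanned_cong[OF _ AE])
 have z: "J nF (- 1) E E = 0" "J nF (- 1) F F = 0"
  unfolding J_def using prod_EE[OF j] prod_FF[OF j] by simp_all
 assume "X = E \<or> X = F \<or> X = H" "X' = E \<or> X' = F \<or> X' = H"
 thus ?thesis
  using 0[OF prod_HH(1)[OF red0_vc red_gen(1,2) j]] 0[OF prod_HH(2)[OF red0_vc red_gen(1,2) j]] 0[OF prod_HH(3)[OF red0_vc red_gen(1,2) j]]
   1[OF prod_HF(1)[OF redF_vc red_gen(3) j]] 1[OF prod_HF(2)[OF redF_vc red_gen(3) j]]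
   2[OF prod_EH(1)[OF redE_vc red_gen(4) j]] 2[OF prod_EH(2)[OF redE_vc red_gen(4) j]] z spanned_OV[OF OV_0]
  by (auto simp: st)
qed

lemma spanned_star: "gen a n k ==> spanned v ==> spanned (star a v)"
proof -
 assume a: "gen a n k" and "spanned v"
 then obtain P R T1 T2 where v: "v - (pw P one + pw R H + pw T1 E + pw T2 F) \<in> OV" unfolding spanned_def by blast
 have c: "star a v - star a (pw P one + pw R H + pw T1 E + pw T2 F) \<in> OV" by (rule star_cong[OF gen_V[OF a] v])
 show ?thesis
 proof (cases "a = om")
  case True
  hence "star a v = pw [:0, 1:] v" by (simp add: pw_pCons zp2_0)
  thus ?thesis using spanned_pw[OF \<open>spanned v\<close>] by simp
 next
  case False
  hence p: "prim a" "gr wF k a" "a = E \<or> a = F \<or> a = H" using a prim_F prim_H prim_E gr_F gr_H gr_E by (auto simp: gen_def)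
  have X: "spanned (star a (pw T X'))" if "X' = E \<or> X' = F \<or> X' = H" for T X'
   by (rule spanned_cong[OF prim_pw[OF p(1,2)] spanned_pw[OF star_prod[OF p(3) that]]]) (use that E_V F_V H_V in auto)
  have "spanned (star a (pw P one))"
   by (rule spanned_cong[OF prim_pw[OF p(1,2) one_V]]) (use p(3) star_one[OF gen_V[OF a]] spanned_gens in auto)
  thus ?thesis
   by (intro spanned_cong[OF c]) (auto simp: zp2_add intro!: spanned_add X)
 qed
qed

text \<open>Up to vectors of lower weight, the word \<open>a_{-q} v'\<close> is the product
  \<open>J\<close> of index \<open>-q\<close>. For \<open>q >= 2\<close> this lies in
  \<open>O(V)\<close>, and for \<open>q = 1\<close> it is \<open>star a v'\<close>, with
  \<open>v'\<close> of lower weight.\<close>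

theorem spanned_V:
 assumes pr: "prime p" and v: "v \<in> V" shows "spanned v"
 using v
proof (induction rule: V_induct)
 case (gr N k v)
 thus ?case
 proof (induction "nat N" arbitrary: N k v rule: less_induct)
  case less
  obtain w where "SG w N k v" using strong_generation[OF pr less.prems] by (auto simp: G_def)
  hence "N <= N ==> spanned v"
  proof (induction M \<equiv> N k v rule: SG.induct)
   case (SG_mode a n ka w' N' k' v' q)
   have q: "1 <= q" using SG_mode by simp
   note na = gen_pos[OF SG_mode.hyps(1)] and v' = SG_gr[OF SG_mode.hyps(2)]
   have aV: "a \<in> V" "gr (int (nat n)) ka a" using gen_V[OF SG_mode.hyps(1)] gen_gr[OF SG_mode.hyps(1)] na by auto
   have low: "spanned x" if "x \<in> V" "gr N'' k'' x" "N'' < N" for x N'' k''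
   proof (cases "N'' < 0")
    case True
    hence "x = 0" using gr_neg[OF that(2)] w0_nonneg[of k''] by simp
    thus ?thesis using spanned_OV[OF OV_0] by simp
   qed (use less.hyps[of N'' x k''] that in auto)
   let ?f = "%j. scale (of_nat (nat n choose j)) (Y a (int j + - q) v')"
   have "J (nat n) (- q) a v' = ?f 0 + (\<Sum>j\<in>{0<..nat n}. ?f j)"
    unfolding J_def by (subst sum.remove[of _ 0]) (auto intro!: sum.cong)
   hence e: "Y a (- q) v' = J (nat n) (- q) a v' - (\<Sum>j\<in>{0<..nat n}. ?f j)" by simp
   have "spanned (?f j)" if "j \<in> {0<..nat n}" for j
   proof (rule spanned_scale, rule low)
    show "Y a (int j + - q) v' \<in> V" using aV v' by (intro V_Y) auto
    show "gr (n + N' - (int j + - q) - 1) (ka + k') (Y a (int j + - q) v')" using gr_Y[OF gen_gr[OF SG_mode.hyps(1)], of N' k' v'] v' by simp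
   qed (use that SG_mode in auto)
   hence s: "spanned (\<Sum>j\<in>{0<..nat n}. ?f j)" by (rule spanned_sum)
   have "spanned (J (nat n) (- q) a v')"
   proof (cases "q = 1")
    case True
    have "spanned v'" by (rule low[of v' N' k']) (use v' SG_mode na in auto)
    from spanned_star[OF SG_mode.hyps(1) this] show ?thesis using zp_gr[OF aV(2), of "- 1" v'] True by simp
   next
    case False
    thus ?thesis using JO[of v' a "nat n" ka "- q"] aV v' q by (intro spanned_OV) auto
   qed
   thus ?case unfolding e using spanned_add[OF _ spanned_scale[OF s, of "- 1"]] by (simp add: pm.scale_minus_left)
  qed (use spanned_gens(1)[of 1] spanned_OV[OF OV_0] in "auto intro: spanned_add spanned_scale")
  thus ?case by simp
 qed
qed (rule spanned_add)

section \<open>Evaluations that vanish on \<open>O(V)\<close>\<close>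

text \<open>For such \<open>b\<close> the vector \<open>e^{b\<alpha>/2p}\<close> satisfies the
  hypotheses of Zhu's formulas for zero modes.\<close>

definition topb :: "int => bool" where
 "topb b \<longleftrightarrow> (\<forall>N k a. a \<in> V \<longrightarrow> gr N k a \<longrightarrow> vanish N a (st {#} b))"

lemma hm_e: "hm 0 b (st {#} b)" using hm_st[of "{#}" b] by simp

lemma F_on: "hm m b w ==> hm (m - l - 1 + b) (b - pp) (Y F l w)"
 using Y_hm[of "- 2 * int p" b "- b" 0 F m w l] hm_st[of "{#}" "- 2 * int p"] by (simp add: F_def algebra_simps)

lemma Q_on: "hm m b w ==> hm (m - 1 - b) (b + pp) (Q w)"
 unfolding Q_def using Y_hm[of pp b b 0 "st {#} pp" m w 0] hm_e[of pp] by (simp add: algebra_simps)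

text \<open>\<open>E\<close> is obtained from \<open>F\<close> by the derivation \<open>Q\<close>;
  all terms but one vanish, because \<open>F\<close> kills the vector and its image under
  \<open>Q\<close> by level and \<open>H\<close> kills the vector itself.\<close>

lemma E_on:
 assumes l: "l >= wF" and b: "b <= pp - 1" shows "Y F l (st {#} b) = 0" "Y E l (st {#} b) = Y F l (Q (Q (st {#} b)))"
proof -
 let ?e = "st {#} b"
 show F0: "Y F l ?e = 0" by (rule hm_neg[OF F_on[OF hm_e]]) (use l b in "simp add: wF_def")
 have FQ: "Y F l (Q ?e) = 0" by (rule hm_neg[OF F_on[OF Q_on[OF hm_e]]]) (use l in "simp add: wF_def")
 have "Y H l ?e = 0" using vanish_0[OF gr_H, of b] l by (simp add: vanish_def)
 moreover have "Y E l ?e = Q (Y H l ?e) - Y H l (Q ?e)" using Q_Y[OF V_VL[OF H_V], of l ?e] by (simp add: E_def)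
 moreover have "Y H l (Q ?e) = Q (Y F l (Q ?e)) - Y F l (Q (Q ?e))" using Q_Y[OF V_VL[OF F_V], of l "Q ?e"] by (simp add: H_def)
 ultimately show "Y E l ?e = Y F l (Q (Q ?e))" by (simp add: FQ Q_0)
qed

lemma QQ_hm: "hm (- 2 - 2 * b - pp) (b + 4 * int p) (Q (Q (st {#} b)))"
 using Q_on[OF Q_on[OF hm_e[of b]]] by (simp add: algebra_simps)

text \<open>The upper bound on \<open>b\<close> makes \<open>F\<close> annihilate; the lower bound
  puts \<open>Q (Q ?e)\<close> into negative level, so that \<open>E\<close> annihilates too. Words
  in the generators follow by induction on the weight: the Borcherds identity with \<open>m\<close>
  the weight of the first letter leaves a single iterate.\<close>

lemma topb_range:
 assumes pr: "prime p" and b: "- int p <= b" "b <= pp - 1" shows "topb b"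
proof -
 let ?e = "st {#} b"
 have QQ: "Q (Q ?e) = 0" by (rule hm_neg[OF QQ_hm]) (use b in simp)
 have gens: "vanish n a ?e" if "gen a n k" for a n k
  using that vanish_0[OF gr_om] vanish_0[OF gr_H] E_on[OF _ b(2)]
  by (auto simp: gen_def vanish_def QQ Y_0)
 have "a \<in> V ==> gr N k a ==> vanish N a ?e" for N k a
 proof (induction "nat N" arbitrary: N k a rule: less_induct)
  case less
  have low: "vanish N' x ?e" if "x \<in> V" "gr N' k' x" "N' < N" for x N' k'
  proof (cases "N' < 0")
   case True
   hence "x = 0" using gr_neg[OF that(2)] w0_nonneg[of k'] by simp
   thus ?thesis by (simp add: vanish_def)
  qed (use less.hyps[of N' x k'] that in auto)
  obtain w where "SG w N k a" using strong_generation[OF pr less.prems] by (auto simp: G_def)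
  hence "N <= N ==> vanish N a ?e"
  proof (induction M \<equiv> N k a rule: SG.induct)
   case SG_one thus ?case by (auto simp: vanish_def Y_one)
  next
   case (SG_mode g n kg w' N' k' v q)
   have q: "1 <= q" using SG_mode by simp
   note na = gen_pos[OF SG_mode.hyps(1)] and v = SG_gr[OF SG_mode.hyps(2)]
   have gV: "g \<in> V" "gr n kg g" using gen_V[OF SG_mode.hyps(1)] gen_gr[OF SG_mode.hyps(1)] by auto
   have N: "N = N' + n + q - 1" using SG_mode by simp
   have vv: "vanish N' v ?e" by (rule low[of v N' k']) (use v SG_mode na in auto)
   have "Y (Y g (- q) v) l ?e = 0" if l: "N' + n + q - 1 <= l" for l
   proof -
    have "Y v (l - n + int j) ?e = 0" for j using vv l q by (simp add: vanish_def)
    hence "B2 p g v ?e n (l - n) (- q) = 0" unfolding B2_def by (simp add: Y_0)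
    moreover have "B3 p g v ?e n (l - n) (- q) = 0" unfolding B3_def
     using gens[OF SG_mode.hyps(1)] by (simp add: vanish_def Y_0)
    moreover have "B1 p g v ?e n (l - n) (- q) = scale (bc n 0) (Y (Y g (- q + int 0) v) (n + (l - n) - int 0) ?e)"
     unfolding B1_def
    proof (rule Sum_any_single)
     fix j :: nat assume "j ~= 0"
     have "gr (n + N' - (- q + int j) - 1) (kg + k') (Y g (- q + int j) v)" using gr_Y[OF gV(2)] v by blast
     hence "vanish (n + N' - (- q + int j) - 1) (Y g (- q + int j) v) ?e"
      by (rule low[rotated]) (use \<open>j ~= 0\<close> N V_Y gV v in auto)
     hence "Y (Y g (- q + int j) v) (n + (l - n) - int j) ?e = 0" unfolding vanish_def using l by auto
     thus "scale (bc n j) (Y (Y g (- q + int j) v) (n + (l - n) - int j) ?e) = 0" by simp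
    qed
    ultimately show ?thesis
     using borcherds_VL[OF V_VL[OF gV(1)] V_VL, of v ?e n "l - n" "- q"] v by simp
   qed
   thus ?case using N by (simp add: vanish_def)
  qed (auto simp: vanish_def Z1_add Z1_scale)
  thus ?case by simp
 qed
 thus ?thesis by (auto simp: topb_def)
qed

lemma evp_J_charge: "gr (int n) k u ==> gr (int n') k' v ==> k + k' ~= 0 ==> evp (J n r u v) = 0"
proof -
 assume g: "gr (int n) k u" "gr (int n') k' v" "k + k' ~= 0"
 have "evp (Y u m v) = 0" for m
  by (rule evp_charge[OF gr_ch[OF gr_Y[OF g(1,2)]]]) (use g(3) p0 in simp)
 thus ?thesis by (simp add: J_def evp_sum evp_scale)
qed

lemma ev_OV: assumes t: "topb b" shows "x \<in> OV ==> ev (of_int b) x = 0"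
proof (induction rule: OV_induct)
 case (J n k u n' k' v c)
 show ?case
 proof (cases "k + k' = 0")
  case True
  hence "k' = - k" by simp
  thus ?thesis using ev_J(2)[OF J(2) _ _ , of b n' v] t J by (simp add: topb_def evp_scale)
 next
  case False
  thus ?thesis using evp_J_charge[OF J(2,4)] by (simp add: evp_scale)
 qed
qed (simp_all add: evp_add)

lemma gr_nF: "gr (int nF) (- 1) F" "gr (int nF) 0 H" "gr (int nF) 1 E" using gr_F gr_H gr_E by (simp_all add: nF)

text \<open>\<open>Q\<close> applied twice to \<open>F star F = 0\<close> gives
  \<open>E star F + 2 H star H + F star E = 0\<close>. For \<open>b < 0\<close> the zero mode of
  \<open>F\<close> kills the top vector, so \<open>E star F\<close> evaluates to 0.\<close>

lemma ev_FE:
 assumes t: "topb b" and b: "b < 0" shows "ev (of_int b) (J nF (- 1) F E) = - 2 * (ev (of_int b) H)\<^sup>2"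
proof -
 have j: "int j + - 1 >= - 2 * int p" for j using pge by simp
 have "0 = Q (Q (J nF (- 1) F F))" unfolding J_def using prod_FF[OF j] by (simp add: Q_0)
 also have "... = J nF (- 1) E F + J nF (- 1) H H + (J nF (- 1) H H + J nF (- 1) F E)"
  by (simp add: Q_J V_VL F_V H_V Q_add H_def[symmetric] E_def[symmetric])
 finally have "0 = ev (of_int b) (J nF (- 1) E F + J nF (- 1) H H + (J nF (- 1) H H + J nF (- 1) F E))" by simp
 also have "... = ev (of_int b) (J nF (- 1) E F) + 2 * (ev (of_int b) H)\<^sup>2 + ev (of_int b) (J nF (- 1) F E)"
  using ev_J0(1)[OF gr_nF(2) gr_nF(2), of b] by (simp add: evp_add power2_eq_square)
 also have "ev (of_int b) (J nF (- 1) E F) = 0"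
 proof -
  have v: "vanish (int nF) E (st {#} b)" "vanish (int nF) F (st {#} b)" using t gr_nF E_V F_V by (auto simp: topb_def)
  have "Y F (int nF - 1) (st {#} b) = 0" by (rule hm_neg[OF F_on[OF hm_e]]) (use b p0 in "simp add: nF wF_def")
  thus ?thesis using ev_J(1)[OF gr_nF(3) v(1) gr_nF(1) v(2)] by (simp add: Y_0)
 qed
 finally show ?thesis by (simp add: eq_neg_iff_add_eq_0 add.commute)
qed

lemma Tp_exp_cre: "a * a' = pp * t ==> Tp c (Y (st {#} a) M (cre p a' (int i) x)) = scale ((-1) ^ i * bc t i) (Tp c (Y (st {#} a) (M - int i) x))"
 using Tp_Z_exp_cre[OF p0, of a a' c M i x] p0 by simp

lemma Tp_exp_top: "a * b = pp * t ==> Tp (a + b) (Y (st {#} a) (- 1 - t) (st {#} b)) = st {#} (a + b)"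
 using Tp_Z_exp_top[OF p0, of a b "a + b" "- 1 - t"] p0 by (simp add: Tp_def)

text \<open>At this charge \<open>F\<close> still annihilates but \<open>E\<close> does not:
  \<open>Q (Q ?e)\<close> is a nonzero multiple of the top vector of charge \<open>3p - 1\<close>.
  The Borcherds identity at \<open>n = - 2\<close> leaves \<open>p\<close> terms, which Vandermonde
  adds up to a multiple of the binomial coefficient of \<open>2p - 2\<close> over
  \<open>p - 1\<close>.\<close>

lemma ev_EF_nz: "ev (of_int (- int p - 1)) (J nF (- 2) E F) ~= 0"
proof -
 let ?b = "- int p - 1" and ?t = "3 * int p - 1"
 let ?e = "st {#} ?b"
 have Q1: "Q ?e = cre p pp (int p) (st {#} (int p - 1))"
  unfolding Q_def by (subst Y_exp_exp[of _ _ ?b]) simp_all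
 obtain q where q: "Q (Q ?e) = scale q (st {#} ?t)" "q ~= 0"
 proof -
  have "hm 0 ?t (Q (Q ?e))" using QQ_hm[of ?b] by simp
  hence "Q (Q ?e) = Tp ?t (Q (Q ?e))"
   by (rule hm_eq[OF _ lin_id Tp_lin]) (auto simp: Tp_def dest: lev_0_1(1))
  also have "... = scale ((-1) ^ p * bc pp p) (st {#} ?t)"
   unfolding Q1 unfolding Q_def Tp_exp_cre[OF refl] using Tp_exp_top[OF refl, of "int p - 1"] by simp
  finally have e: "Q (Q ?e) = scale ((-1) ^ p * bc pp p) (st {#} ?t)" .
  have "bc pp p = of_nat ((2 * p) choose p)" using bc_nat[of "2 * p" p] by simp
  thus ?thesis using that[OF e] by simp
 qed
 have vF: "vanish (int nF) F ?e" using E_on(1)[of _ ?b] by (auto simp: vanish_def nF)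
 let ?s = "%j. scale ((- 1) ^ j * bc (- 2) j) (Y F (int nF - 2 - int j) (Y E (int nF + int j) ?e))"
 have "scale (ev (of_int ?b) (J nF (- 2) E F)) ?e = B1 p E F ?e (int nF) (int nF) (- 2)"
 proof -
  have o: "scale (ev (of_int ?b) (Y E (int j + - 2) F)) ?e = Y (Y E (int j + - 2) F) (int nF + int nF - int j) ?e" for j
   using o_ev[OF gr_Y[OF gr_nF(3,1), of "int j + - 2", simplified], of ?b] by (simp add: algebra_simps)
  have "B1 p E F ?e (int nF) (int nF) (- 2) = (\<Sum>j<Suc nF. scale (bc (int nF) j) (Y (Y E (- 2 + int j) F) (int nF + int nF - int j) ?e))"
   unfolding B1_def by (rule Sum_any_lessThan) (simp add: bc_nat binomial_eq_0 del: of_int_of_nat_eq)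
  also have "... = (\<Sum>j\<le>nF. scale (of_nat (nF choose j)) (scale (ev (of_int ?b) (Y E (int j + - 2) F)) ?e))"
   unfolding bc_nat lessThan_Suc_atMost o add.commute[of "- 2"] ..
  finally show ?thesis unfolding J_def evp_sum evp_scale poly_sum poly_smult pm.scale_sum_left pm.scale_scale ..
 qed
 also have "... = - Sum_any ?s"
 proof -
  have "B2 p E F ?e (int nF) (int nF) (- 2) = 0" unfolding B2_def using vF by (simp add: vanish_def Y_0)
  thus ?thesis using borcherds_VL[OF V_VL[OF E_V] V_VL[OF F_V], of ?e "int nF" "int nF" "- 2"]
   by (simp add: B3_def sg_def add.commute[of "- 2"])
 qed
 finally have "Tp ?b (scale (ev (of_int ?b) (J nF (- 2) E F)) ?e) = - Tp ?b (Sum_any ?s)" by (simp add: lin_minus[OF Tp_lin])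
 also have "Sum_any ?s = (\<Sum>j<p. ?s j)"
 proof (rule Sum_any_lessThan)
  fix j assume "p <= j"
  have "Y F (int nF + int j) (st {#} ?t) = 0"
   by (rule hm_neg[OF F_on[OF hm_e]]) (use \<open>p <= j\<close> in "simp add: nF wF_def")
  thus "?s j = 0" using E_on(2)[of "int nF + int j" ?b] by (simp add: nF q(1) Y_0 Y_scale)
 qed
 also have "Tp ?b (\<Sum>j<p. ?s j) = (\<Sum>j<p. scale ((- 1) ^ (p - 1) * q * (bc (- 2) j * bc pp (p - 1 - j))) ?e)"
  unfolding Tp_sum Tp_scale
 proof (rule sum.cong[OF refl])
  fix j assume "j \<in> {..<p}"
  hence j: "int (p - 1 - j) = int p - 1 - int j" "int (p - Suc j) = int p - 1 - int j" and s: "(-1 :: complex) ^ j * (-1) ^ (p - 1 - j) = (-1) ^ (p - 1)" by (auto simp: of_nat_diff simp flip: power_add)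
  have "Y E (int nF + int j) ?e = scale q (Y F (int nF + int j) (st {#} ?t))"
   using E_on(2)[of "int nF + int j" ?b] by (simp add: nF q(1) Y_scale)
  also have "Y F (int nF + int j) (st {#} ?t) = cre p (- 2 * int p) (int (p - 1 - j)) (st {#} (int p - 1))"
   unfolding F_def by (subst Y_exp_exp[of _ _ "- ?t"]) (simp_all add: j nF wF_def algebra_simps)
  finally have c: "Y E (int nF + int j) ?e = scale q (cre p (- 2 * int p) (int (p - 1 - j)) (st {#} (int p - 1)))" .
  have "- 2 * int p * (- 2 * int p) = pp * pp" by simp
  from Tp_exp_cre[OF this] have "Tp ?b (Y F (int nF - 2 - int j) (Y E (int nF + int j) ?e)) = scale (q * ((-1) ^ (p - 1 - j) * bc pp (p - 1 - j))) (Tp ?b (Y F (int nF - 2 - int j - int (p - 1 - j)) (st {#} (int p - 1))))"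
   unfolding c F_def Y_scale Tp_scale by (simp only: pm.scale_scale)
  also have "Tp ?b (Y F (int nF - 2 - int j - int (p - 1 - j)) (st {#} (int p - 1))) = ?e"
  proof -
   have e: "int nF - 2 - int j - int (p - 1 - j) = int p - 2" "- 1 - - (int p - 1) = int p - 2" "- 2 * int p + (int p - 1) = ?b" by (simp_all add: j nF wF_def)
   have "- 2 * int p * (int p - 1) = pp * (- (int p - 1))" by (simp only: minus_mult_left minus_mult_right)
   from Tp_exp_top[OF this] show ?thesis unfolding e F_def .
  qed
  finally show "scale ((- 1) ^ j * bc (- 2) j) (Tp ?b (Y F (int nF - 2 - int j) (Y E (int nF + int j) ?e))) = scale ((- 1) ^ (p - 1) * q * (bc (- 2) j * bc pp (p - 1 - j))) ?e"
   using s by (simp add: mult_ac)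
 qed
 also have "... = scale ((- 1) ^ (p - 1) * q * bc (pp - 2) (p - 1)) ?e"
 proof -
  have "(\<Sum>j<p. bc (- 2) j * bc pp (p - 1 - j)) = bc (pp - 2) (p - 1)"
   using bc_Vandermonde[of "- 2" pp "p - 1"] p0 by (simp add: lessThan_Suc_atMost[symmetric])
  thus ?thesis by (simp only: pm.scale_sum_left[symmetric] sum_distrib_left[symmetric])
 qed
 finally have "Tp ?b (scale (ev (of_int ?b) (J nF (- 2) E F)) ?e) = - scale ((- 1) ^ (p - 1) * q * bc (pp - 2) (p - 1)) ?e" .
 moreover have "bc (pp - 2) (p - 1) ~= 0"
 proof -
  have "pp - 2 = int (2 * p - 2)" using pge by (simp add: of_nat_diff)
  thus ?thesis using pge by (simp only: bc_nat of_nat_eq_0_iff) (simp add: binomial_eq_0_iff)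
 qed
 ultimately show ?thesis using q(2) by (auto simp: Tp_0)
qed

end

section \<open>Derivatives of the evaluations\<close>

definition bcI :: "complex => int => complex" where "bcI x N = (if N < 0 then 0 else x gchoose nat N)"

text \<open>The coefficientwise form of \<open>d/dt (1+z)^t = log(1+z) (1+z)^t\<close>. Any
  truncation of the logarithm from degree \<open>M\<close> on is allowed, so that one
  \<open>J\<close> serves for several \<open>M\<close>.\<close>

lemma bcI_deriv:
 assumes "int J >= M"
 shows "((%t. bcI t M) has_field_derivative (\<Sum>j<J. (-1) ^ j / of_nat (Suc j) * bcI x (M - int j - 1))) (at x)"
proof (cases "M < 0")
 case False
 define m where "m = nat M"
 have M: "M = int m" "m <= J" using False assms by (auto simp: m_def)
 define gp :: "nat => complex poly" where "gp n = psmult (1 / fact n) (\<Prod>i = 0..<n. [:- of_nat i, 1:])" for n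
 have gp: "poly (gp n) t = t gchoose n" for n t by (simp add: gp_def gbinomial_prod_rev poly_prod)
 \<comment> \<open>At \<open>t = x\<close> only the linear factor \<open>t - x\<close> has to be
   differentiated; the others form a binomial coefficient with upper index -1.\<close>
 have dj: "((%t. (t - x) gchoose j) has_field_derivative (if j = 0 then 0 else (-1) ^ (j - 1) / of_nat j)) (at x)" for j
 proof (cases j)
  case (Suc i)
  have "(%t. (t - x) gchoose j) = (%t. (t - x) * poly (gp i) (t - x - 1) / of_nat (Suc i))"
  proof
   fix t
   have "of_nat (Suc i) * ((t - x) gchoose j) = (t - x) * ((t - x - 1) gchoose i)"
    using Suc_times_gbinomial[of i "t - x - 1"] Suc by simp
   thus "(t - x) gchoose j = (t - x) * poly (gp i) (t - x - 1) / of_nat (Suc i)" by (simp add: gp field_simps del: of_nat_Suc)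
  qed
  moreover have "((%t. poly (gp i) (t - x - 1)) has_field_derivative poly (pderiv (gp i)) (x - x - 1) * 1) (at x)"
   by (rule DERIV_chain2[OF poly_DERIV]) (auto intro!: derivative_eq_intros)
  hence "((%t. (t - x) * poly (gp i) (t - x - 1) / of_nat (Suc i)) has_field_derivative (poly (gp i) (- 1) / of_nat (Suc i))) (at x)"
   by (auto intro!: derivative_eq_intros simp del: of_nat_Suc)
  moreover have "poly (gp i) (- 1) = (-1) ^ i" using gbinomial_negated_upper[of "- 1 :: complex" i] by (simp add: gp flip: binomial_gbinomial)
  ultimately show ?thesis using Suc by simp
 qed simp
 have "(t gchoose m) = (\<Sum>j\<le>m. ((t - x) gchoose j) * (x gchoose (m - j)))" for t :: complex
  using gbinomial_Vandermonde[of "t - x" x m] by (simp add: atLeast0AtMost)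
 hence "(%t. bcI t M) = (%t. \<Sum>j\<le>m. ((t - x) gchoose j) * (x gchoose (m - j)))" by (simp add: bcI_def M)
 moreover have "((%t. \<Sum>j\<le>m. ((t - x) gchoose j) * (x gchoose (m - j))) has_field_derivative (\<Sum>j\<le>m. (if j = 0 then 0 else (-1) ^ (j - 1) / of_nat j) * (x gchoose (m - j)))) (at x)"
  by (intro DERIV_sum DERIV_cmult_right dj)
 moreover have "(\<Sum>j\<le>m. (if j = 0 then 0 else (-1) ^ (j - 1) / of_nat j) * (x gchoose (m - j))) = (\<Sum>j<J. (-1) ^ j / of_nat (Suc j) * bcI x (M - int j - 1))"
 proof -
  have "(\<Sum>j\<le>m. (if j = 0 then 0 else (-1) ^ (j - 1) / of_nat j) * (x gchoose (m - j))) = (\<Sum>j<m. (-1) ^ j / of_nat (Suc j) * (x gchoose (m - Suc j)))"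
   unfolding lessThan_Suc_atMost[symmetric] sum.lessThan_Suc_shift by simp
  also have "... = (\<Sum>j<m. (-1) ^ j / of_nat (Suc j) * bcI x (M - int j - 1))"
  proof (rule sum.cong[OF refl])
   fix j assume "j \<in> {..<m}"
   hence "nat (M - int j - 1) = m - Suc j" "\<not> M - int j - 1 < 0" using M by auto
   thus "(-1) ^ j / of_nat (Suc j) * (x gchoose (m - Suc j)) = (-1) ^ j / of_nat (Suc j) * bcI x (M - int j - 1)" by (simp add: bcI_def)
  qed
  also have "... = (\<Sum>j<J. (-1) ^ j / of_nat (Suc j) * bcI x (M - int j - 1))"
   by (rule sum.mono_neutral_left) (use M in "auto simp: bcI_def")
  finally show ?thesis .
 qed
 ultimately show ?thesis by simp
qed (simp add: bcI_def)

context lat begin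

text \<open>A coefficient of \<open>(1+x)^(kb + w0 k)\<close>: the part \<open>kb\<close> comes from
  the exponential of charge \<open>k\<close>, the part \<open>w0 k\<close> from its weight in Zhu's
  residue. The index \<open>r\<close> enters through the degree only.\<close>

definition Wb :: "int => int => nat => complex => complex" where
 "Wb k r i b = bcI (of_int k * b + of_int (w0 k)) (pp * k * k - 1 + int i - r)"

text \<open>The coefficients \<open>c i\<close> do not depend on \<open>r\<close>.\<close>

definition Wc :: "int => (int => complex => complex) => bool" where
 "Wc k f \<longleftrightarrow> (\<exists>c :: nat => complex poly. \<exists>I. \<forall>J\<ge>I. \<forall>r b. f r b = (\<Sum>i<J. poly (c i) b * Wb k r i b))"

lemma Wc_0: "Wc k (%r b. 0)" unfolding Wc_def by (rule exI[of _ "%_. 0"]) simp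

lemma Wc_add: "Wc k f ==> Wc k g ==> Wc k (%r b. f r b + g r b)"
proof -
 assume "Wc k f" "Wc k g"
 then obtain c I d I' where c: "\<forall>J\<ge>I. \<forall>r b. f r b = (\<Sum>i<J. poly (c i) b * Wb k r i b)"
  "\<forall>J\<ge>I'. \<forall>r b. g r b = (\<Sum>i<J. poly (d i) b * Wb k r i b)" unfolding Wc_def by blast
 have "f r b + g r b = (\<Sum>i<J. poly (c i + d i) b * Wb k r i b)" if "J >= max I I'" for J r b
  using c(1)[rule_format, of J r b] c(2)[rule_format, of J r b] that by (simp add: sum.distrib distrib_right)
 thus ?thesis unfolding Wc_def by (intro exI[of _ "%i. c i + d i"] exI[of _ "max I I'"]) blast
qed

lemma Wc_mult: "Wc k f ==> Wc k (%r b. poly q b * f r b)"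
proof -
 assume "Wc k f"
 then obtain c I where c: "\<forall>J\<ge>I. \<forall>r b. f r b = (\<Sum>i<J. poly (c i) b * Wb k r i b)" unfolding Wc_def by blast
 have "poly q b * f r b = (\<Sum>i<J. poly (q * c i) b * Wb k r i b)" if "J >= I" for J r b
  using c that by (simp add: sum_distrib_left mult.assoc)
 thus ?thesis unfolding Wc_def by (intro exI[of _ "%i. q * c i"] exI[of _ I]) blast
qed

lemma Wc_scale: "Wc k f ==> Wc k (%r b. a * f r b)" using Wc_mult[of k f "[:a:]"] by simp

lemma Wc_sum: "(!!x. x \<in> A ==> Wc k (f x)) ==> Wc k (%r b. \<Sum>x\<in>A. f x r b)"
 by (induction A rule: infinite_finite_induct) (auto intro: Wc_0 Wc_add)

lemma Wc_shift: assumes "Wc k f" "!!r. s r = r - int d" shows "Wc k (%r b. f (s r) b)"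
proof -
 obtain c I where c: "\<forall>J\<ge>I. \<forall>r b. f r b = (\<Sum>i<J. poly (c i) b * Wb k r i b)" using assms(1) unfolding Wc_def by blast
 have "f (s r) b = (\<Sum>i<J. poly (if i < d then 0 else c (i - d)) b * Wb k r i b)" if "J >= I + d" for J r b
 proof -
  have "f (s r) b = (\<Sum>i<J - d. poly (c i) b * Wb k (r - int d) i b)" using c that assms(2) by simp
  also have "... = (\<Sum>i\<in>{d..<J}. poly (if i < d then 0 else c (i - d)) b * Wb k r i b)"
   by (rule sum.reindex_bij_witness[of _ "%i. i - d" "%i. i + d"]) (auto simp: Wb_def algebra_simps)
  also have "... = (\<Sum>i<J. poly (if i < d then 0 else c (i - d)) b * Wb k r i b)"
   by (rule sum.mono_neutral_left) auto
  finally show ?thesis .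
 qed
 thus ?thesis unfolding Wc_def by (intro exI[of _ "%i. if i < d then 0 else c (i - d)"] exI[of _ "I + d"]) blast
qed

lemma Wc_cong: "Wc k f ==> (!!r b. f r b = g r b) ==> Wc k g" unfolding Wc_def by simp

lemma Wc_base: "Wc k (%r b. Wb k r 0 b)"
proof -
 have "Wb k r 0 b = (\<Sum>i<J. poly (if i = 0 then 1 else 0) b * Wb k r i b)" if "J >= 1" for J r b
 proof -
  have "(\<Sum>i<J. poly (if i = 0 then 1 else 0) b * Wb k r i b) = (\<Sum>i<J. if i = 0 then Wb k r 0 b else 0)" by (rule sum.cong) auto
  thus ?thesis using that by (simp add: sum.delta)
 qed
 thus ?thesis unfolding Wc_def by (intro exI[of _ "%i. if i = 0 then 1 else 0"] exI[of _ 1]) blast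
qed

lemma evp_bs: "evp (bs n f) = (\<Sum>j\<le>n. psmult (of_nat (n choose j)) (evp (f j)))"
 by (simp add: bs_def evp_sum evp_scale)

text \<open>Evaluation identifies \<alpha>(-g-1) with \<open>(-1)^g\<close> \<alpha>(-1), so the
  creation half collapses to the factor \<open>(-1)^i b\<close>; the annihilation half only shifts
  \<open>r\<close> down.\<close>

lemma evp_J_create:
 assumes G: "!!g. g >= K ==> h (int g) v = 0"
 shows "evp (J (Suc i + N) r (h (- int i - 1) u) v) = [:0, (-1) ^ i:] * evp (J N r u v)
  + (\<Sum>g<K. \<Sum>t\<le>Suc i. psmult (bc (- int g - 1) i * of_nat (Suc i choose t)) (evp (J N (r - int (g + (Suc i - t))) u (h (int g) v))))"
proof -
 let ?Y = "Y u"
 have f: "fld ?Y" by (rule fld_Z[OF p0])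
 define y where "y x = Y u (r - int i + int x) v" for x
 have ezy: "ez y" unfolding y_def by (rule Z_ez[OF p0]) simp
 have 1: "evp (Sum_any (nopc p i ?Y (int j + r) v)) = evp (h (- 1) (Sum_any (%g. scale ((-1) ^ g * bc (int g) i) (y (j + g)))))" for j
 proof -
  have e: "evp (nopc p i ?Y (int j + r) v g) = evp (h (- 1) (scale ((-1) ^ g * bc (int g) i) (y (j + g))))" for g
  proof -
   have i: "int j + r + int g - int i = r - int i + int (j + g)" by simp
   have "nopc p i ?Y (int j + r) v g = scale (bc (int g) i) (h (- int g - 1) (y (j + g)))" unfolding nopc_def y_def i ..
   thus ?thesis using evp_create[of p 0] by (simp add: evp_scale evp_create heis_scale smult_add_right mult.commute)
  qed
  have ez: "ez (%g. scale ((-1) ^ g * bc (int g) i) (y (j + g)))" by (rule ez_scale, rule ez_shift'[OF ezy])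
  show ?thesis unfolding evp_Sum_any[OF nopc_ez[OF f]] e Sum_any_lin[OF heis_lin ez] evp_Sum_any[OF ez_lin[where T = "%_. h (- 1)", OF heis_lin ez]] ..
 qed
 have 2: "bs (Suc i + N) (%j. Sum_any (%g. scale ((-1) ^ g * bc (int g) i) (y (j + g)))) = scale ((-1) ^ i) (J N r u v)"
 proof -
  have b: "bs n g' = Sum_any (%s. scale (bc (int n) s) (g' s))" for n g'
  proof -
   have "Sum_any (%s. scale (bc (int n) s) (g' s)) = (\<Sum>s<Suc n. scale (bc (int n) s) (g' s))"
    by (rule Sum_any_lessThan) (simp add: bc_nat binomial_eq_0 del: of_int_of_nat_eq)
   thus ?thesis by (simp add: bs_def bc_nat lessThan_Suc_atMost del: of_int_of_nat_eq)
  qed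
  have e: "int (Suc i + N) - int i - 1 = int N" by simp
  have y: "y (i + j) = Y u (int j + r) v" for j by (simp add: y_def add.commute)
  show ?thesis unfolding J_bs b conv_top1[OF p0 ezy] e y ..
 qed
 have 3: "bs (Suc i + N) (%j. Sum_any (nopa p i ?Y (int j + r) v)) = (\<Sum>g<K. scale (bc (- int g - 1) i) (bs (Suc i) (%t. J N (r - int g - int i - 1 + int t) u (h (int g) v))))"
 proof -
  have "Sum_any (nopa p i ?Y (int j + r) v) = (\<Sum>g<K. scale (bc (- int g - 1) i) (Y u (int j + r - int g - int i - 1) (h (int g) v)))" for j
   unfolding nopa_def by (rule Sum_any_lessThan) (simp add: G Y_0)
  hence "bs (Suc i + N) (%j. Sum_any (nopa p i ?Y (int j + r) v)) = (\<Sum>g<K. scale (bc (- int g - 1) i) (bs (Suc i + N) (%j. Y u (int j + r - int g - int i - 1) (h (int g) v))))"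
   unfolding bs_def by (simp only: pm.scale_sum_right pm.scale_scale mult.commute) (rule sum.swap)
  moreover have "bs (Suc i + N) (%j. Y u (int j + r - int g - int i - 1) (h (int g) v)) = bs (Suc i) (%t. J N (r - int g - int i - 1 + int t) u (h (int g) v))" for g
   unfolding bs_bs[symmetric] J_bs by (simp add: algebra_simps)
  ultimately show ?thesis by simp
 qed
 have "J (Suc i + N) r (h (- int i - 1) u) v = bs (Suc i + N) (%j. Sum_any (nopc p i ?Y (int j + r) v)) + bs (Suc i + N) (%j. Sum_any (nopa p i ?Y (int j + r) v))"
  unfolding J_bs Z_create[OF p0] nop_split[OF f] bs_add ..
 moreover have "evp (bs (Suc i + N) (%j. Sum_any (nopc p i ?Y (int j + r) v))) = [:0, (-1) ^ i:] * evp (J N r u v)"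
 proof -
  have "evp (bs (Suc i + N) (%j. Sum_any (nopc p i ?Y (int j + r) v))) = evp (h (- 1) (bs (Suc i + N) (%j. Sum_any (%g. scale ((-1) ^ g * bc (int g) i) (y (j + g))))))"
   unfolding bs_lin[OF heis_lin] evp_bs 1 ..
  thus ?thesis unfolding 2 using evp_create[of p 0 "scale ((-1) ^ i) (J N r u v)"] by (simp add: evp_scale)
 qed
 moreover have "evp (bs (Suc i + N) (%j. Sum_any (nopa p i ?Y (int j + r) v))) = (\<Sum>g<K. \<Sum>t\<le>Suc i. psmult (bc (- int g - 1) i * of_nat (Suc i choose t)) (evp (J N (r - int (g + (Suc i - t))) u (h (int g) v))))"
  unfolding 3 evp_sum evp_scale evp_bs smult_sum_distrib smult_smult
 proof (intro sum.cong refl)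
  fix g t assume "t \<in> {..Suc i}"
  hence "r - int g - int i - 1 + int t = r - int (g + (Suc i - t))" by (simp add: of_nat_diff)
  thus "psmult (bc (- int g - 1) i * of_nat (Suc i choose t)) (evp (J N (r - int g - int i - 1 + int t) u (h (int g) v))) =
   psmult (bc (- int g - 1) i * of_nat (Suc i choose t)) (evp (J N (r - int (g + (Suc i - t))) u (h (int g) v)))" by (simp only:)
 qed
 ultimately show ?thesis by (simp only: evp_add)
qed

lemma Wc_hm:
 assumes "hm N a v" "!!M. int (lev M) = N ==> Wc k (%r b. ev b (T r (st M a)))" "!!r. lin (T r)"
 shows "Wc k (%r b. ev b (T r v))"
proof -
 have "ev b (T r v) = (\<Sum>x\<in>keys v. lookup v x * ev b (T r (single x 1)))" for r b
  by (subst poly_mapping_decomp[of v]) (simp add: lin_sum[OF assms(3)] lin_scale[OF assms(3)] evp_sum evp_scale poly_sum)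
 moreover have "Wc k (%r b. \<Sum>x\<in>keys v. lookup v x * ev b (T r (single x 1)))"
 proof (intro Wc_sum Wc_scale)
  fix x assume x: "x \<in> keys v"
  obtain M c where xx: "x = (M, c)" by force
  have "int (lev M) = N" "c = a" using assms(1) x unfolding hm_def xx by (auto simp: in_keys_iff)
  thus "Wc k (%r b. ev b (T r (single x 1)))" using assms(2)[of M] xx by simp
 qed
 ultimately show ?thesis by (auto intro: Wc_cong)
qed

text \<open>For two exponentials the products evaluate to coefficients of \<open>(1+x)^(kb)\<close>,
  and Vandermonde absorbs the factor \<open>(1+x)^(w0 k)\<close>. Oscillators on the second one
  multiply by \<open>b\<close> or shift \<open>r\<close>.\<close>

lemma Wc_J_exp: "Wc k (%r b. ev b (J (nat (w0 k)) r (st {#} (pp * k)) (st M (- (pp * k)))))"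
proof (induction M)
 case empty
 let ?n = "nat (w0 k)"
 have e: "ev b (Y (st {#} (pp * k)) m (st {#} (- (pp * k)))) = bcI (of_int k * b) (pp * k * k - 1 - m)" for m b
 proof -
  have 1: "Y (st {#} (pp * k)) m (st {#} (- (pp * k))) = cre p (pp * k) (pp * k * k - 1 - m) one"
   by (subst Y_exp_exp[of _ _ "- (pp * k * k)"]) (simp_all add: algebra_simps)
  show ?thesis
  proof (cases "pp * k * k - 1 - m < 0")
   case False
   then obtain i where i: "pp * k * k - 1 - m = int i" by (metis nonneg_int_cases not_less)
   show ?thesis unfolding 1 i evp_cre[OF p0] using p0 by (simp add: bcI_def evp_st evm_def)
  qed (simp add: 1 bcI_def cre_def)
 qed
 have "ev b (J ?n r (st {#} (pp * k)) (st {#} (- (pp * k)))) = Wb k r 0 b" for r b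
 proof -
  let ?D = "pp * k * k - 1 - r"
  have "ev b (J ?n r (st {#} (pp * k)) (st {#} (- (pp * k)))) = (\<Sum>j\<le>?n. bc (int ?n) j * bcI (of_int k * b) (?D - int j))"
   unfolding J_def evp_sum evp_scale poly_sum poly_smult e bc_nat by (simp add: algebra_simps)
  also have "... = bcI (of_int k * b + of_nat ?n) ?D"
  proof (cases "?D < 0")
   case False
   then obtain d where d: "?D = int d" by (metis nonneg_int_cases not_less)
   have "(\<Sum>j\<le>?n. bc (int ?n) j * bcI (of_int k * b) (int d - int j)) = (\<Sum>j\<le>d. bc (int ?n) j * bcI (of_int k * b) (int d - int j))"
   proof (rule sum.mono_neutral_cong)
    show "bc (int ?n) j * bcI (of_int k * b) (int d - int j) = 0" if "j \<in> {..?n} - {..d}" for j using that by (auto simp: bcI_def)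
    show "bc (int ?n) j * bcI (of_int k * b) (int d - int j) = 0" if "j \<in> {..d} - {..?n}" for j
     unfolding bc_nat using that by (simp add: binomial_eq_0)
   qed auto
   also have "... = (\<Sum>j\<le>d. (of_nat ?n gchoose j) * ((of_int k * b) gchoose (d - j)))"
   proof (rule sum.cong[OF refl])
    fix j assume "j \<in> {..d}"
    hence "nat (int d - int j) = d - j" "\<not> int d - int j < 0" by auto
    thus "bc (int ?n) j * bcI (of_int k * b) (int d - int j) = (of_nat ?n gchoose j) * ((of_int k * b) gchoose (d - j))"
     by (simp only: bcI_def if_False of_int_of_nat_eq)
   qed
   also have "... = (of_nat ?n + of_int k * b) gchoose d"
    using gbinomial_Vandermonde[of "of_nat ?n" "of_int k * b" d] by (simp add: atLeast0AtMost)
   finally show ?thesis unfolding d by (simp add: bcI_def add.commute)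
  qed (simp add: bcI_def)
  finally show ?thesis using w0_nonneg[of k] by (simp add: Wb_def algebra_simps)
 qed
 thus ?case by (rule Wc_cong[OF Wc_base, OF sym])
next
 case (add j M)
 let ?a = "pp * k" and ?n = "nat (w0 k)"
 have "J ?n r (st {#} ?a) (st (add_mset j M) (- ?a)) = h (- int j - 1) (J ?n r (st {#} ?a) (st M (- ?a))) - scale (of_int ?a) (J ?n (r - int (Suc j)) (st {#} ?a) (st M (- ?a)))" for r
 proof -
  have "Y (st {#} ?a) m (st (add_mset j M) (- ?a)) = h (- int j - 1) (Y (st {#} ?a) m (st M (- ?a))) - scale (of_int ?a) (Y (st {#} ?a) (m - int (Suc j)) (st M (- ?a)))" for m
  proof -
   have "m + (- int j - 1) = m - int (Suc j)" by simp
   thus ?thesis unfolding Z_exp heis_create[of p, symmetric] using em_comm[OF p0, of "- int j - 1" ?a m "st M (- ?a)"] by (simp only:) simp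
  qed
  thus ?thesis unfolding J_bs by (simp only: bs_diff bs_lin[OF heis_lin] bs_lin[OF lin_scl[OF lin_id]] add_diff_eq)
 qed
 hence "ev b (J ?n r (st {#} ?a) (st (add_mset j M) (- ?a))) = poly [:0, (-1) ^ j:] b * ev b (J ?n r (st {#} ?a) (st M (- ?a)))
   + (- of_int ?a) * ev b (J ?n (r - int (Suc j)) (st {#} ?a) (st M (- ?a)))" for r b
  by (simp add: evp_diff evp_scale evp_create)
 thus ?case
  by (intro Wc_cong[OF Wc_add[OF Wc_mult[OF add.IH] Wc_scale[OF Wc_shift[OF add.IH refl]]] sym])
qed

lemma Wc_J_st: "hm N (- (pp * k)) v ==> Wc k (%r b. ev b (J (lev M + nat (w0 k)) r (st M (pp * k)) v))"
proof (induction M arbitrary: N v)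
 case empty
 show ?case by (rule Wc_hm[OF empty]) (simp_all add: Wc_J_exp J_lin2)
next
 case (add i M)
 let ?a = "pp * k" and ?n = "lev M + nat (w0 k)"
 have "h (int g) v = 0" if "g >= Suc (nat N)" for g by (rule hm_neg[OF heis_hm[OF add.prems]]) (use that in linarith)
 from evp_J_create[OF this]
 have *: "evp (J (Suc i + ?n) r (h (- int i - 1) (st M ?a)) v) = [:0, (-1) ^ i:] * evp (J ?n r (st M ?a) v)
  + (\<Sum>g<Suc (nat N). \<Sum>t\<le>Suc i. psmult (bc (- int g - 1) i * of_nat (Suc i choose t)) (evp (J ?n (r - int (g + (Suc i - t))) (st M ?a) (h (int g) v))))" for r .
 have e: "lev (add_mset i M) + nat (w0 k) = Suc i + ?n" by simp
 have "ev b (J (lev (add_mset i M) + nat (w0 k)) r (st (add_mset i M) ?a) v) = poly [:0, (-1) ^ i:] b * ev b (J ?n r (st M ?a) v)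
  + (\<Sum>g<Suc (nat N). \<Sum>t\<le>Suc i. (bc (- int g - 1) i * of_nat (Suc i choose t)) * ev b (J ?n (r - int (g + (Suc i - t))) (st M ?a) (h (int g) v)))" for r b
  unfolding e heis_create[of p i M ?a, symmetric] * by (simp only: poly_add poly_mult poly_sum poly_smult)
 thus ?case
  by (intro Wc_cong[OF Wc_add[OF Wc_mult[OF add.IH[OF add.prems]] Wc_sum[OF Wc_sum[OF Wc_scale[OF Wc_shift[OF add.IH[OF heis_hm[OF add.prems]] refl]]]]] sym])
qed

lemma Wc_J: assumes "gr (int n) k u" "gr (int n') (- k) v" shows "Wc k (%r b. ev b (J n r u v))"
proof (rule Wc_hm[where T = "%r u. J n r u v"])
 show "hm (int n - w0 k) (pp * k) u" using assms(1) by (simp add: gr_def)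
 fix M assume "int (lev M) = int n - w0 k"
 hence n: "n = lev M + nat (w0 k)" using w0_nonneg[of k] by linarith
 have "hm (int n' - w0 (- k)) (- (pp * k)) v" using assms(2) by (simp add: gr_def)
 thus "Wc k (%r b. ev b (J n r (st M (pp * k)) v))" unfolding n by (rule Wc_J_st)
qed (rule J_lin1)

text \<open>In the form given by \<open>Wc_J\<close> for \<open>r = - 2\<close>, the binomial
  coefficients vanish at both points, since their upper index is a smaller natural number; only
  their derivatives remain. Expanding the logarithm turns these into \<open>k\<close> times a
  combination of the residues with \<open>r = j - 1\<close>, \<open>j >= 0\<close>, with the same
  coefficients at both points, and there \<open>sym\<close> applies.\<close>

lemma pderiv_J:
 assumes u: "u \<in> V" "gr (int n) k u" and v: "v \<in> V" "gr (int n') (- k) v" and c: "\<bar>c\<bar> <= int p" "\<bar>c'\<bar> <= int p"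
  and sym: "!!x. x \<in> V ==> ev (of_int (c + int p - 1)) x = ev (of_int (c' + int p - 1)) x"
 shows "poly (pderiv (evp (J n (- 2) u v))) (of_int (c + int p - 1)) = poly (pderiv (evp (J n (- 2) u v))) (of_int (c' + int p - 1))"
proof -
 obtain w I where w: "!!r b. ev b (J n r u v) = (\<Sum>i<I. poly (w i) b * Wb k r i b)"
  using Wc_J[OF u(2) v(2)] unfolding Wc_def by blast
 let ?x = "%b. of_int k * b + of_int (w0 k) :: complex" and ?D = "pp * k * k + 1"
 define B where "B = nat ?D + I"
 have "poly (pderiv (evp (J n (- 2) u v))) (of_int (c + int p - 1)) = (\<Sum>j<B. (-1) ^ j / of_nat (Suc j) * of_int k * ev (of_int (c + int p - 1)) (J n (int j - 1) u v))"
  if c: "\<bar>c\<bar> <= int p" for c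
 proof -
  let ?b = "of_int (c + int p - 1) :: complex"
  have z: "bcI (?x ?b) (?D + int i) = 0" for i
  proof -
   \<comment> \<open>The bound on \<open>c\<close> keeps the upper index between 0 and
     \<open>2p k^2\<close>, below the lower index.\<close>
   have "int p * k * k >= \<bar>c\<bar> * \<bar>k\<bar>"
   proof -
    have "\<bar>k\<bar> <= \<bar>k\<bar> * \<bar>k\<bar>" using mult_left_mono[of 1 "\<bar>k\<bar>" "\<bar>k\<bar>"] by (cases "k = 0") auto
    hence "\<bar>c\<bar> * \<bar>k\<bar> <= int p * (\<bar>k\<bar> * \<bar>k\<bar>)" using c by (intro mult_mono) auto
    thus ?thesis by (simp add: abs_mult_self_eq mult.assoc)
   qed
   hence "int p * k * k >= \<bar>k * c\<bar>" by (simp add: abs_mult mult.commute)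
   hence k: "0 <= k * c + int p * k * k" "k * c + int p * k * k < ?D" by linarith+
   have x: "?x ?b = of_nat (nat (k * c + int p * k * k))"
    using k(1) by (simp add: w0_def algebra_simps)
   have "nat (k * c + int p * k * k) < nat (?D + int i)" using k by (subst nat_mono_iff) linarith+
   thus ?thesis unfolding x bcI_def binomial_gbinomial[symmetric] by (simp only: binomial_eq_0 of_nat_0 if_cancel)
  qed
  have d: "((%b. bcI (?x b) (?D + int i)) has_field_derivative (\<Sum>j<B. (-1) ^ j / of_nat (Suc j) * bcI (?x ?b) (?D + int i - int j - 1)) * of_int k) (at ?b)" if "i < I" for i
   by (rule DERIV_chain2[OF bcI_deriv]) (use that in "auto simp: B_def intro!: derivative_eq_intros")
  have "((%b. \<Sum>i<I. poly (w i) b * bcI (?x b) (?D + int i)) has_field_derivative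
   (\<Sum>i<I. poly (pderiv (w i)) ?b * bcI (?x ?b) (?D + int i) + (\<Sum>j<B. (-1) ^ j / of_nat (Suc j) * bcI (?x ?b) (?D + int i - int j - 1)) * of_int k * poly (w i) ?b)) (at ?b)"
   by (intro DERIV_sum DERIV_mult poly_DERIV d) simp
  moreover have "(%b. \<Sum>i<I. poly (w i) b * bcI (?x b) (?D + int i)) = poly (evp (J n (- 2) u v))"
   by (rule ext) (simp add: w Wb_def algebra_simps)
  ultimately have "poly (pderiv (evp (J n (- 2) u v))) ?b = (\<Sum>i<I. poly (pderiv (w i)) ?b * bcI (?x ?b) (?D + int i) + (\<Sum>j<B. (-1) ^ j / of_nat (Suc j) * bcI (?x ?b) (?D + int i - int j - 1)) * of_int k * poly (w i) ?b)"
   using DERIV_unique[OF poly_DERIV] by simp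
  also have "... = (\<Sum>i<I. \<Sum>j<B. (-1) ^ j / of_nat (Suc j) * of_int k * (poly (w i) ?b * bcI (?x ?b) (?D + int i - int j - 1)))"
   unfolding z by (simp add: sum_distrib_right sum_distrib_left mult_ac)
  also have "... = (\<Sum>j<B. (-1) ^ j / of_nat (Suc j) * of_int k * ev ?b (J n (int j - 1) u v))"
  proof -
   have e: "pp * k * k - 1 + int i - (int j - 1) = ?D + int i - int j - 1" for i j by simp
   show ?thesis unfolding w Wb_def e sum_distrib_left by (rule sum.swap)
  qed
  finally show ?thesis .
 qed
 note D = this
 show ?thesis unfolding D[OF c(1)] D[OF c(2)] using sym[OF J_V[OF u(1) v(1)]] by simp
qed

lemma pderiv_OV:
 assumes c: "\<bar>c\<bar> <= int p" "\<bar>c'\<bar> <= int p" and sym: "!!x. x \<in> V ==> ev (of_int (c + int p - 1)) x = ev (of_int (c' + int p - 1)) x"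
 shows "x \<in> OV ==> poly (pderiv (evp x)) (of_int (c + int p - 1)) = poly (pderiv (evp x)) (of_int (c' + int p - 1))"
proof (induction rule: OV_induct)
 case (J n k u n' k' v a)
 show ?case
 proof (cases "k + k' = 0")
  case True
  hence "k' = - k" by simp
  hence "gr (int n') (- k) v" using J(4) by simp
  from pderiv_J[OF J(1,2,3) this c sym] show ?thesis by (simp only: evp_scale pderiv_smult poly_smult)
 qed (use evp_J_charge[OF J(2,4)] in "simp add: evp_scale")
qed (simp_all add: evp_add pderiv_add)

end

section \<open>Relations and independence\<close>

lemma root_dvd:
 assumes "finite I" "inj_on f I" "!!i. i \<in> I ==> poly P (f i) = (0 :: complex)"
 shows "(\<Prod>i\<in>I. [:- f i, 1:]) dvd P"
 using assms
proof (induction I rule: finite_induct)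
 case (insert j I)
 then obtain K where K: "P = (\<Prod>i\<in>I. [:- f i, 1:]) * K" by auto
 have "poly (\<Prod>i\<in>I. [:- f i, 1:]) (f j) ~= 0" using insert by (auto simp: poly_prod prod_zero_iff inj_on_def)
 hence "poly K (f j) = 0" using insert.prems(2)[of j] by (simp add: K)
 hence "[:- f j, 1:] dvd K" by (simp add: poly_eq_0_iff_dvd)
 thus ?case using insert.hyps by (simp add: K mult.commute[of "[:- f j, 1:]"] mult_dvd_mono del: mult_pCons_left mult_pCons_right)
qed simp

lemma degree_prod_lin: "degree (\<Prod>i\<in>I. [:- f i, 1 :: complex:]) = card I"
 by (subst degree_prod_eq_sum_degree) auto

lemma root_zero:
 assumes "finite I" "inj_on f I" "!!i. i \<in> I ==> poly P (f i) = (0 :: complex)" "degree P < card I" shows "P = 0"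
 using dvd_imp_degree_le[OF root_dvd[OF assms(1-3)]] assms(4) by (auto simp: degree_prod_lin)

context lat begin

lemma hb_diff: "hb x - hb y = (x - y) * (x - (2 * of_nat p - 2 - y)) / (4 * of_nat p)"
 using p0 by (simp add: hb_def field_simps)

lemma hb_eq: "hb x = hb y \<longleftrightarrow> x = y \<or> x = 2 * of_nat p - 2 - y"
proof -
 have "hb x = hb y \<longleftrightarrow> hb x - hb y = 0" by simp
 also have "... \<longleftrightarrow> x - y = 0 \<or> x - (2 * of_nat p - 2 - y) = 0" unfolding hb_diff using p0 by (simp del: right_minus_eq)
 finally show ?thesis by (simp only: right_minus_eq)
qed

lemma h_wt_hb: "h_wt p j = hb (of_nat j - 1)"
 using p0 by (simp add: h_wt_def hb_def field_simps)

lemma h_wt_eq: "h_wt p i = h_wt p j \<longleftrightarrow> i = j \<or> i + j = 2 * p"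
proof -
 have "(of_nat i - 1 :: complex) = 2 * of_nat p - 2 - (of_nat j - 1) \<longleftrightarrow> (of_nat (i + j) :: complex) = of_nat (2 * p)"
  by (simp add: eq_diff_eq)
 thus ?thesis unfolding h_wt_hb hb_eq of_nat_eq_iff by simp
qed

lemma h_wt_inj: "inj_on (h_wt p) {p..}" by (auto simp: inj_on_def h_wt_eq)

lemma inf_zero: assumes "!!n. n >= 2 * p ==> poly P (h_wt p n) = 0" shows "P = 0"
 by (rule root_zero[of "{2 * p..<2 * p + Suc (degree P)}" "h_wt p"]) (use assms h_wt_inj in "auto intro: inj_on_subset")

lemma ev_H_zero: "0 <= b ==> b <= pp - 2 ==> ev (of_int b) H = 0"
 unfolding ev_H using bc_nat[of "nat b" "2 * p - 1"] by (simp add: binomial_eq_0)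

lemma ev_H_neg: "b < 0 ==> ev (of_int b) H ~= 0"
proof -
 assume "b < 0"
 hence b: "b = - int (nat (- b - 1)) - 1" by simp
 show ?thesis unfolding ev_H by (subst b, subst bc_neg) (simp add: binomial_eq_0_iff)
qed

lemma ev_H_sym: "ev (2 * of_nat p - 2 - x) H = - ev x H"
proof -
 have e: "of_nat (2 * p - 1) - x - 1 = 2 * of_nat p - 2 - x" using p0 by (simp add: of_nat_diff)
 have o: "(- 1 :: complex) ^ (2 * p - 1) = - 1" using p0 by simp
 show ?thesis unfolding ev_H gbinomial_negated_upper[of x "2 * p - 1"] e o by simp
qed

definition TT :: "complex poly" where "TT = (\<Prod>j\<in>{2 * p..<3 * p}. [:- h_wt p j, 1:])"
definition M1 :: "complex poly" where "M1 = (\<Prod>j\<in>{1..<2 * p}. [:- h_wt p j, 1:])"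

text \<open>\<open>b = 2p - 1 - j\<close> is the negative charge of weight \<open>h_wt p j\<close>;
  the bound \<open>j < 3p\<close> keeps it within \<open>topb_range\<close>.\<close>

lemma top_j: assumes "prime p" "j \<in> {2 * p..<3 * p}"
 obtains b where "topb b" "b < 0" "hb (of_int b) = h_wt p j"
proof -
 have "hb (of_int (pp - 1 - int j)) = h_wt p j" unfolding h_wt_hb hb_eq by simp
 moreover have "topb (pp - 1 - int j)" by (rule topb_range[OF assms(1)]) (use assms(2) in auto)
 ultimately show ?thesis using that assms(2) by force
qed

lemma TT_zero:
 assumes "!!j. j \<in> {2 * p..<3 * p} ==> poly P (h_wt p j) = 0" "degree P < p" shows "P = 0"
 by (rule root_zero[of "{2 * p..<3 * p}" "h_wt p"]) (use assms h_wt_inj in "auto intro: inj_on_subset")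

text \<open>The polynomial of \<open>HF_circ\<close> has degree at most \<open>p\<close>, has the
  \<open>p\<close> roots of \<open>TT\<close>, and is nonzero by \<open>ev_EF_nz\<close>; so it is a
  constant multiple of \<open>TT\<close>.\<close>

lemma rel_T: assumes pr: "prime p" shows "pw TT F \<in> OV" "pw TT H \<in> OV" "pw TT E \<in> OV"
proof -
 obtain T where T: "T = 0 \<or> degree T <= p" "pw T F \<in> OV" "!!b. ev (of_int b) (J nF (- 2) E F) = poly T (hb (of_int b)) * ev (of_int b) H"
  using HF_circ by blast
 have "T ~= 0" using T(3)[of "- int p - 1"] ev_EF_nz by auto
 have "TT dvd T"
  unfolding TT_def
 proof (rule root_dvd)
  show "inj_on (h_wt p) {2 * p..<3 * p}" using h_wt_inj by (rule inj_on_subset) auto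
  fix j assume "j \<in> {2 * p..<3 * p}"
  from top_j[OF pr this] obtain b where b: "topb b" "b < 0" "hb (of_int b) = h_wt p j" .
  have "ev (of_int b) (J nF (- 2) E F) = 0" by (rule ev_OV[OF b(1) J2_OV[OF E_V gr_nF(3) F_V]])
  thus "poly T (h_wt p j) = 0" using T(3)[of b] ev_H_neg[OF b(2)] b(3) by simp
 qed simp
 then obtain K where K: "T = TT * K" by auto
 have "degree TT = p" by (simp add: TT_def degree_prod_lin)
 hence "degree K = 0" "K ~= 0" using T(1) \<open>T ~= 0\<close> degree_mult_eq[of TT K] by (auto simp: K)
 then obtain k where k: "K = [:k:]" "k ~= 0" by (metis degree_eq_zeroE pCons_0_0)
 have "scale (1 / k) (pw T F) = pw TT F" using k by (simp add: K pw_smult)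
 thus F: "pw TT F \<in> OV" using OV_scale[OF T(2), of "1 / k"] by simp
 show "pw TT H \<in> OV" using Q_OV[OF F] by (simp add: Q_pw H_def)
 thus "pw TT E \<in> OV" using Q_OV by (fastforce simp: Q_pw E_def)
qed

text \<open>\<open>ev x H\<close> has the roots \<open>0, ..., 2p - 2\<close>, a set symmetric under
  the reflection that preserves the weight. Pairing each root with its mirror image gives the
  square.\<close>

lemma M1_H: "poly M1 (hb x) = (fact (2 * p - 1))\<^sup>2 / (4 * of_nat p) ^ (2 * p - 1) * (ev x H)\<^sup>2"
proof -
 have "poly M1 (hb x) = (\<Prod>j\<in>{1..<2 * p}. (x - (of_nat j - 1)) * (x - (of_nat (2 * p - j) - 1)) / (4 * of_nat p))"
  unfolding M1_def poly_prod
 proof (rule prod.cong[OF refl])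
  fix j assume "j \<in> {1..<2 * p}"
  thus "poly [:- h_wt p j, 1:] (hb x) = (x - (of_nat j - 1)) * (x - (of_nat (2 * p - j) - 1)) / (4 * of_nat p)"
   using hb_diff[of x "of_nat j - 1"] by (simp add: h_wt_hb of_nat_diff algebra_simps)
 qed
 also have "... = (\<Prod>j\<in>{1..<2 * p}. x - (of_nat j - 1)) * (\<Prod>j\<in>{1..<2 * p}. x - (of_nat (2 * p - j) - 1)) / (4 * of_nat p) ^ (2 * p - 1)"
  by (simp add: prod_dividef prod.distrib)
 also have "(\<Prod>j\<in>{1..<2 * p}. x - (of_nat (2 * p - j) - 1)) = (\<Prod>j\<in>{1..<2 * p}. x - (of_nat j - 1))"
  by (rule prod.reindex_bij_witness[of _ "%j. 2 * p - j" "%j. 2 * p - j"]) auto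
 also have "(\<Prod>j\<in>{1..<2 * p}. x - (of_nat j - 1)) = (\<Prod>i\<in>{0..<2 * p - 1}. x - of_nat i)"
  by (rule prod.reindex_bij_witness[of _ Suc "%j. j - 1"]) (auto simp: of_nat_diff)
 also have "... = fact (2 * p - 1) * ev x H" by (simp add: ev_H gbinomial_prod_rev)
 finally show ?thesis by (simp add: power2_eq_square)
qed

text \<open>\<open>ev b H\<close> is odd under the reflection \<open>b -> 2p - 2 - b\<close> and the
  weight is even, so \<open>H star H\<close> has no component along \<open>H\<close>, and its
  polynomial part is proportional to \<open>M1\<close>. Since \<open>TT\<close> kills
  \<open>H\<close>, it kills \<open>H star H\<close>.\<close>

lemma rel_M: assumes pr: "prime p" shows "pw (TT * M1) one \<in> OV"
proof -
 obtain P R where HH: "star H H - (pw P one + pw R H) \<in> OV" and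
  e: "!!b. ev (of_int b) H * ev (of_int b) H = poly P (hb (of_int b)) + poly R (hb (of_int b)) * ev (of_int b) H"
  using HH_star by blast
 have R: "poly R (h_wt p n) = 0" and P: "(ev (of_nat n - 1) H)\<^sup>2 = poly P (h_wt p n)" if "n >= 2 * p" for n
 proof -
  let ?b = "int n - 1" and ?b' = "pp - 2 - (int n - 1)"
  have s: "hb (of_int ?b') = hb (of_int ?b)" unfolding hb_eq by simp
  have ev': "ev (of_int ?b') H = - ev (of_int ?b) H" using ev_H_sym[of "of_int ?b"] by simp
  have "ev (of_int ?b') H ~= 0" by (rule ev_H_neg) (use that p0 in linarith)
  moreover have "poly R (hb (of_int ?b)) * ev (of_int ?b) H = 0" using e[of ?b] e[of ?b'] unfolding s ev' by (simp add: algebra_simps)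
  ultimately have r: "poly R (hb (of_int ?b)) = 0" unfolding ev' by simp
  thus "poly R (h_wt p n) = 0" by (simp add: h_wt_hb)
  show "(ev (of_nat n - 1) H)\<^sup>2 = poly P (h_wt p n)" using e[of ?b] r by (simp add: h_wt_hb power2_eq_square)
 qed
 have R0: "R = 0" by (rule inf_zero[OF R])
 define c :: complex where "c = (fact (2 * p - 1))\<^sup>2 / (4 * of_nat p) ^ (2 * p - 1)"
 have "M1 - psmult c P = 0"
  by (rule inf_zero) (simp add: P[symmetric], simp add: h_wt_hb M1_H c_def)
 hence M: "M1 = psmult c P" by simp
 have "star (pw TT H) H - pw TT (star H H) \<in> OV" by (rule pw_star[OF H_V H_V])
 hence "pw TT (star H H) \<in> OV" by (rule OV_diffD[rotated]) (rule OV_star[OF rel_T(2)[OF pr] H_V])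
 moreover have "pw TT (star H H) - pw TT (pw P one) \<in> OV" by (rule pw_cong) (use HH R0 in simp)
 ultimately have "pw TT (pw P one) \<in> OV" by (rule OV_diffD)
 from OV_scale[OF this, of c] show ?thesis unfolding pw_mult M pw_smult lin_scale[OF pw_lin] .
qed

lemma ev_one: "ev b one = 1" by (simp add: evp_st evm_def)
lemma evp_EF: "evp E = 0" "evp F = 0" using evp_charge[OF gr_ch[OF gr_E]] evp_charge[OF gr_ch[OF gr_F]] p0 by simp_all
lemma Q_one: "Q one = 0" by (simp add: Q_def Y_nn_one)

text \<open>For \<open>0 <= b <= 2p - 2\<close> the evaluation of \<open>H\<close> is 0, so by
  \<open>spanned_V\<close> evaluations depend on the weight only. This provides the pairs of points
  for \<open>pderiv_OV\<close>.\<close>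

lemma ev_flip:
 assumes pr: "prime p" and j: "j \<in> {1..<2 * p}" and x: "x \<in> V"
 shows "ev (of_int (int j - 1)) x = ev (of_int (pp - 1 - int j)) x"
proof -
 obtain P R T1 T2 where s: "x - (pw P one + pw R H + pw T1 E + pw T2 F) \<in> OV"
  using spanned_V[OF pr x] unfolding spanned_def by blast
 have "ev (of_int b) x = poly P (hb (of_int b))" if b: "0 <= b" "b <= pp - 2" for b
  using ev_OV[OF topb_range[OF pr] s, of b] b ev_H_zero[OF b]
  by (simp add: evp_diff evp_add ev_pw one_V H_V E_V F_V evp_EF ev_one)
 from this[of "int j - 1"] this[of "pp - 1 - int j"] show ?thesis
  using j hb_eq[of "of_int (int j - 1)" "of_int (pp - 1 - int j)"] by auto
qed

text \<open>\<open>Q\<close> and left multiplication by \<open>F\<close> move \<open>T2\<close>,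
  \<open>R\<close> and \<open>T1\<close> in turn to a place where the evaluations at
  \<open>p\<close> weights see them. For \<open>P\<close> there are \<open>2p\<close> values, and
  derivatives double the roots \<open>h_wt p j\<close> with \<open>p < j < 2p\<close>: in all
  \<open>3p - 1\<close>.\<close>

theorem independence:
 assumes pr: "prime p" and x: "pw P one + pw R H + pw T1 E + pw T2 F \<in> OV"
  and d: "degree P < 3 * p - 1" "degree R < p" "degree T1 < p" "degree T2 < p"
 shows "P = 0 \<and> R = 0 \<and> T1 = 0 \<and> T2 = 0"
proof -
 have E0: "star F E = J nF (- 1) F E" by (rule zp_gr[OF gr_nF(1)])
 have FE: "\<exists>b. topb b \<and> hb (of_int b) = h_wt p j \<and> ev (of_int b) (star F E) ~= 0 \<and> ev (of_int b) H ~= 0" if j: "j \<in> {2 * p..<3 * p}" for j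
 proof -
  from top_j[OF pr j] obtain b where b: "topb b" "b < 0" "hb (of_int b) = h_wt p j" .
  thus ?thesis using ev_FE[OF b(1,2)] ev_H_neg[OF b(2)] unfolding E0 by auto
 qed
 have V: "star F E \<in> V" by (rule zp_V[OF F_V E_V])
 have "T2 = 0"
 proof (rule TT_zero[OF _ d(4)])
  fix j assume "j \<in> {2 * p..<3 * p}"
  from FE[OF this] obtain b where b: "topb b" "hb (of_int b) = h_wt p j" "ev (of_int b) H ~= 0" by blast
  \<comment> \<open>\<open>Q\<close> kills \<open>one\<close> and \<open>E\<close> and turns
    \<open>R\<close> into a coefficient of \<open>E\<close>, which evaluates to 0.\<close>
  show "poly T2 (h_wt p j) = 0" using ev_OV[OF b(1) Q_OV[OF x]] b(2,3)
   by (simp add: Q_add Q_pw Q_one H_def[symmetric] E_def[symmetric] Q_E lin_0[OF pw_lin] evp_add ev_pw H_V E_V evp_EF)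
 qed
 with x have x: "pw P one + pw R H + pw T1 E \<in> OV" by simp
 have "R = 0"
 proof (rule TT_zero[OF _ d(2)])
  fix j assume "j \<in> {2 * p..<3 * p}"
  from FE[OF this] obtain b where b: "topb b" "hb (of_int b) = h_wt p j" "ev (of_int b) (star F E) ~= 0" by blast
  have "pw R E \<in> OV" using Q_OV[OF x] by (simp add: Q_add Q_pw Q_one E_def[symmetric] Q_E lin_0[OF pw_lin])
  hence "pw R (star F E) \<in> OV" using OV_diffD[OF star_OV[OF F_V] prim_pw[OF prim_F gr_F E_V]] by blast
  from ev_OV[OF b(1) this] show "poly R (h_wt p j) = 0" using b by (simp add: ev_pw[OF V])
 qed
 with x have x: "pw P one + pw T1 E \<in> OV" by simp
 have "T1 = 0"
 proof (rule TT_zero[OF _ d(3)])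
  fix j assume "j \<in> {2 * p..<3 * p}"
  from FE[OF this] obtain b where b: "topb b" "hb (of_int b) = h_wt p j" "ev (of_int b) (star F E) ~= 0" by blast
  have "star F (pw P one) - pw P F + (star F (pw T1 E) - pw T1 (star F E)) \<in> OV"
   using OV_add[OF prim_pw[OF prim_F gr_F one_V] prim_pw[OF prim_F gr_F E_V]] by (simp add: star_one[OF F_V])
  moreover have "star F (pw P one) - pw P F + (star F (pw T1 E) - pw T1 (star F E)) = star F (pw P one + pw T1 E) - (pw P F + pw T1 (star F E))"
   by (simp add: zp2_add)
  ultimately have "pw P F + pw T1 (star F E) \<in> OV" using OV_diffD[OF star_OV[OF F_V x]] by simp
  from ev_OV[OF b(1) this] show "poly T1 (h_wt p j) = 0" using b by (simp add: evp_add ev_pw[OF V] ev_pw[OF F_V] evp_EF)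
 qed
 with x have x: "pw P one \<in> OV" by simp
 have ev1: "ev b (pw P one) = poly P (hb b)" for b by (simp add: ev_pw[OF one_V] ev_one)
 have root: "poly P (h_wt p j) = 0" if j: "j \<in> {p..<3 * p}" for j
 proof (cases "j < 2 * p")
  case True
  have "topb (int j - 1)" by (rule topb_range[OF pr]) (use j True pge in auto)
  from ev_OV[OF this x] show ?thesis by (simp add: ev1 h_wt_hb)
 next
  case False
  then obtain b where "topb b" "hb (of_int b) = h_wt p j" using top_j[OF pr, of j] j by auto
  thus ?thesis using ev_OV[OF _ x, of b] by (simp add: ev1)
 qed
 have inj: "inj_on (h_wt p) {p..<3 * p}" using h_wt_inj by (rule inj_on_subset) auto
 obtain K where K: "P = (\<Prod>j\<in>{p..<3 * p}. [:- h_wt p j, 1:]) * K" using root_dvd[OF _ inj root] by auto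
 have "poly K (h_wt p j) = 0" if j: "j \<in> {p<..<2 * p}" for j
 proof -
  define c where "c = int j - int p"
  define N where "N = (\<Prod>i\<in>{p..<3 * p} - {j}. [:- h_wt p i, 1:])"
  have PN: "P = [:- h_wt p j, 1:] * (N * K)" unfolding K N_def using j by (subst prod.remove[of _ j]) (auto simp: mult.assoc simp del: mult_pCons_left)
  \<comment> \<open>The chain rule for \<open>P(hb b)\<close>. The inner derivative is
    \<open>c/2p\<close> at one point and \<open>- c/2p\<close> at the other, so equal derivatives
    force that of \<open>P\<close> to vanish.\<close>
  have d: "poly (pderiv (evp (pw P one))) b = poly (pderiv P) (hb b) * ((2 * b - 2 * of_nat p + 2) / (4 * of_nat p))" for b
  proof -
   have "(hb has_field_derivative (2 * b - 2 * of_nat p + 2) / (4 * of_nat p)) (at b)"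
    unfolding hb_def[abs_def] using p0 by (auto intro!: derivative_eq_intros simp: field_simps)
   from DERIV_unique[OF poly_DERIV[of "evp (pw P one)" b, unfolded ev1[abs_def]] DERIV_chain2[OF poly_DERIV this]] show ?thesis .
  qed
  have cc: "c + int p - 1 = int j - 1" "- c + int p - 1 = pp - 1 - int j" by (simp_all add: c_def)
  have "poly (pderiv (evp (pw P one))) (of_int (c + int p - 1)) = poly (pderiv (evp (pw P one))) (of_int (- c + int p - 1))"
   by (rule pderiv_OV[OF _ _ _ x], unfold cc, rule_tac [3] ev_flip[OF pr]) (use j in "auto simp: c_def")
  moreover have "hb (of_int (- c + int p - 1)) = h_wt p j" "hb (of_int (c + int p - 1)) = h_wt p j" unfolding cc h_wt_hb hb_eq by simp_all
  ultimately have "poly (pderiv P) (h_wt p j) * of_int c = 0" unfolding d using p0 by (simp add: field_simps)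
  hence "poly (pderiv P) (h_wt p j) = 0" using j by (simp add: c_def)
  moreover have "poly (pderiv P) (h_wt p j) = poly N (h_wt p j) * poly K (h_wt p j)"
   unfolding PN pderiv_mult by (simp add: pderiv_pCons)
  moreover have "poly N (h_wt p j) ~= 0" using j by (auto simp: N_def poly_prod prod_zero_iff h_wt_eq)
  ultimately show ?thesis by simp
 qed
 moreover have "inj_on (h_wt p) {p<..<2 * p}" using h_wt_inj by (rule inj_on_subset) auto
 ultimately have "(\<Prod>j\<in>{p<..<2 * p}. [:- h_wt p j, 1:]) dvd K" by (intro root_dvd) auto
 hence dv: "(\<Prod>j\<in>{p..<3 * p}. [:- h_wt p j, 1:]) * (\<Prod>j\<in>{p<..<2 * p}. [:- h_wt p j, 1:]) dvd P" unfolding K by (rule mult_dvd_mono[OF dvd_refl])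
 have "degree ((\<Prod>j\<in>{p..<3 * p}. [:- h_wt p j, 1:]) * (\<Prod>j\<in>{p<..<2 * p}. [:- h_wt p j, 1:])) = 3 * p - 1"
  using pge by (subst degree_mult_eq) (auto simp: degree_prod_lin)
 hence "P = 0" using dvd_imp_degree_le[OF dv] d(1) by force
 thus ?thesis using \<open>R = 0\<close> \<open>T1 = 0\<close> \<open>T2 = 0\<close> by simp
qed

end

section \<open>Zhu's algebra\<close>

context lat begin

lemma triplet_simps [simp]: "space (triplet p) = V" "mode (triplet p) = Y" "vacuum (triplet p) = one" "conformal (triplet p) = om"
proof -
 have "screening p = Qt" by (simp add: screening_def[abs_def] Qt_def S_def Z_def[abs_def])
 thus "space (triplet p) = V" by (simp add: triplet_def lattice_voa_def V_def VL_def)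
 show "mode (triplet p) = Y" by (simp add: triplet_def lattice_voa_def Z_def[abs_def])
 have "scale c (st M b) = single (M, b) c" for c M b
  by (rule poly_mapping_eqI) (simp add: lookup_scale lookup_single when_def)
 thus "vacuum (triplet p) = one" "conformal (triplet p) = om" by (simp_all add: triplet_def lattice_voa_def om_def)
qed

lemma homogeneous_eq: "homogeneous (triplet p) n a \<longleftrightarrow> a \<in> V \<and> L 0 a = scale (of_int n) a"
 by (simp add: homogeneous_def L_def)

lemma L0_Pw: "v \<in> V ==> L 0 (Pw n v) = scale (of_int n) (Pw n v) \<and> Pw n (L 0 v) = scale (of_int n) (Pw n v)"
 by (induction rule: V_induct) (auto simp: Pw_gr gr_L0 Pw_add L_add L_0 lin_scale[OF Pw_lin] pm.scale_right_distrib)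

lemma sum_Pw: "v \<in> V ==> Sum_any (%n. Pw n v) = v"
proof (induction rule: V_induct)
 case (gr N k x)
 have "Sum_any (%n. Pw n x) = Pw N x" by (rule Sum_any_single) (simp add: Pw_gr[OF gr(2)])
 thus ?case by (simp add: Pw_gr[OF gr(2)])
qed (simp add: Pw_add Sum_any.distrib Pw_finite)

lemma Pw_eigen: assumes x: "x \<in> V" "L 0 x = scale (of_int n) x" shows "Pw m x = (if m = n then x else 0)"
proof -
 have *: "Pw m x = 0" if "m ~= n" for m
 proof -
  have "scale (of_int n - of_int m) (Pw m x) = 0" using L0_Pw[OF x(1), of m] x(2) by (simp add: lin_scale[OF Pw_lin] pm.scale_left_diff_distrib)
  thus ?thesis using that by simp
 qed
 have "Pw n x = x" using Sum_any_single[of n "%n. Pw n x"] * sum_Pw[OF x(1)] by metis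
 with * show ?thesis by simp
qed

text \<open>The definite description needs uniqueness, which holds because \<open>L 0\<close> has
  different eigenvalues on different weights.\<close>

lemma components_eq: assumes a: "a \<in> V" shows "components (triplet p) a = (%n. Pw n a)"
 unfolding components_def homogeneous_eq
proof (rule the_equality)
 show "(\<forall>n. Pw n a \<in> V \<and> L 0 (Pw n a) = scale (of_int n) (Pw n a)) \<and> finite {n. Pw n a ~= 0} \<and> a = Sum_any (%n. Pw n a)"
  using a by (simp add: Pw_V L0_Pw Pw_finite sum_Pw)
 fix c assume c: "(\<forall>n. c n \<in> V \<and> L 0 (c n) = scale (of_int n) (c n)) \<and> finite {n. c n ~= 0} \<and> a = Sum_any c"
 have "Pw n a = c n" for n
 proof -
  have "Pw n a = (\<Sum>m | c m ~= 0. Pw n (c m))" using c by (simp add: Sum_any.expand_set lin_sum[OF Pw_lin])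
  also have "... = (\<Sum>m | c m ~= 0. if n = m then c m else 0)" by (rule sum.cong) (use c Pw_eigen in auto)
  finally show ?thesis using c by (simp add: sum.delta)
 qed
 thus "c = (%n. Pw n a)" by simp
qed

text \<open>Weights in \<open>V\<close> are nonnegative, so the generalized binomial coefficients
  are ordinary ones and the negative half of the outer sum is 0.\<close>

lemma zhu_product_eq: assumes a: "a \<in> V" shows "zhu_product (triplet p) s a b = zp (- s) a b"
proof -
 let ?g = "%n::int. Sum_any (%j::nat. scale (of_int n gchoose j) (Y (Pw n a) (int j - s) b))"
 have J: "?g (int m) = J m (- s) (Pw (int m) a) b" for m
  unfolding J_def lessThan_Suc_atMost[symmetric]
  by (subst Sum_any_lessThan[of "Suc m"]) (simp_all add: binomial_gbinomial[symmetric] binomial_eq_0)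
 have 0: "?g (- int j - 1) = 0" for j by (simp add: Pw_neg[OF a] lin_0[OF Z_lin1])
 have "Sum_any ?g = Sum_any (%j. ?g (- int j - 1)) + Sum_any (%j. ?g (int j))"
  by (rule Sum_any_int_split) (unfold J 0, rule zp_ez, rule ezI, rule refl)
 thus ?thesis unfolding zhu_product_def components_eq[OF a] triplet_simps unfolding J 0 zp_def by simp
qed

lemma zhu_O_eq: "zhu_O (triplet p) = OV"
proof -
 have "{zhu_circ (triplet p) a b | a b. a \<in> V \<and> b \<in> V} = {zp (- 2) a b | a b. a \<in> V \<and> b \<in> V}"
  unfolding zhu_circ_def by (rule Collect_cong) (metis zhu_product_eq)
 thus ?thesis by (simp add: zhu_O_def OV_def)
qed

abbreviation A :: "(complex, fock set) module" where "A \<equiv> A_triplet p"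
abbreviation cl :: "fock => fock set" where "cl \<equiv> zhu_class (triplet p)"

lemma cl_def': "cl v = (%o'. o' + v) ` OV"
 unfolding zhu_class_def zhu_O_eq a_r_coset_def r_coset_def star_algebra_def by auto

lemma mem_cl: "x \<in> cl v \<longleftrightarrow> x - v \<in> OV"
 unfolding cl_def' by (auto intro: image_eqI[of _ _ "x - v"])

lemma cl_self: "v \<in> cl v" by (simp add: mem_cl OV_0)

lemma cl_eq: "cl v = cl w \<longleftrightarrow> v - w \<in> OV"
proof
 assume "cl v = cl w"
 thus "v - w \<in> OV" using cl_self[of v] by (simp add: mem_cl)
next
 assume "v - w \<in> OV"
 thus "cl v = cl w" using OV_cong_trans[of _ v w] OV_cong_trans[of _ w v] OV_neg[of "v - w"] by (auto simp: mem_cl)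
qed

lemma UN_cl: assumes "!!x. x \<in> cl v ==> cl (f x) = c" shows "(\<Union>x\<in>cl v. cl (f x)) = c"
proof -
 have "(\<Union>x\<in>cl v. cl (f x)) = (\<Union>x\<in>cl v. c)" by (rule SUP_cong[OF refl assms])
 thus ?thesis using cl_self by auto
qed

lemma A_carrier: "carrier A = cl ` V"
 by (auto simp: zhu_algebra_def ring.defs FactRing_def A_RCOSETS_defs a_r_coset_def zhu_O_eq star_algebra_def zhu_class_def)

lemma A_one: "\<one>\<^bsub>A\<^esub> = cl one"
 by (simp add: zhu_algebra_def ring.defs FactRing_def zhu_O_eq star_algebra_def zhu_class_def)

lemma A_zero: "\<zero>\<^bsub>A\<^esub> = cl 0"
 by (simp add: zhu_algebra_def ring.defs FactRing_def zhu_O_eq cl_def')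

lemma A_add: "cl v \<oplus>\<^bsub>A\<^esub> cl w = cl (v + w)"
proof -
 have "cl v \<oplus>\<^bsub>A\<^esub> cl w = {x + y | x y. x \<in> cl v \<and> y \<in> cl w}"
  by (auto simp: zhu_algebra_def ring.defs FactRing_def star_algebra_def set_add_defs)
 also have "... = cl (v + w)"
 proof (intro equalityI subsetI)
  fix z assume "z \<in> cl (v + w)"
  hence "z = (z - w) + w" "z - w \<in> cl v" "w \<in> cl w" by (simp_all add: mem_cl OV_0 diff_diff_add add.commute)
  thus "z \<in> {x + y | x y. x \<in> cl v \<and> y \<in> cl w}" by blast
 next
  fix z assume "z \<in> {x + y | x y. x \<in> cl v \<and> y \<in> cl w}"
  then obtain x y where "z = x + y" "x - v \<in> OV" "y - w \<in> OV" by (auto simp: mem_cl)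
  thus "z \<in> cl (v + w)" using OV_add[of "x - v" "y - w"] by (simp add: mem_cl algebra_simps)
 qed
 finally show ?thesis .
qed

lemma A_smult: "c \<odot>\<^bsub>A\<^esub> cl v = cl (scale c v)"
proof -
 have "c \<odot>\<^bsub>A\<^esub> cl v = (\<Union>x\<in>cl v. cl (scale c x))" by (simp add: zhu_algebra_def ring.defs module.defs)
 also have "... = cl (scale c v)"
  by (rule UN_cl) (use OV_scale[of _ c] in "auto simp: mem_cl cl_eq pm.scale_right_diff_distrib[symmetric]")
 finally show ?thesis .
qed

lemma A_mult: assumes v: "v \<in> V" and w: "w \<in> V" shows "cl v \<otimes>\<^bsub>A\<^esub> cl w = cl (star v w)"
proof -
 have V: "x \<in> V" if "x \<in> cl u" "u \<in> V" for x u using V_add[OF OV_V that(2)] that(1) by (fastforce simp: mem_cl)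
 have e: "zhu_star (triplet p) x y = star x y" if "x \<in> V" for x y using zhu_product_eq[OF that, of 1 y] by (simp add: zhu_star_def)
 have "cl v \<otimes>\<^bsub>A\<^esub> cl w = (\<Union>x\<in>cl v. \<Union>y\<in>cl w. cl (zhu_star (triplet p) x y))"
  by (simp add: zhu_algebra_def ring.defs FactRing_def rcoset_mult_def star_algebra_def zhu_class_def)
 also have "... = (\<Union>x\<in>cl v. \<Union>y\<in>cl w. cl (star v w))"
 proof (intro SUP_cong refl)
  fix x y assume x: "x \<in> cl v" and y: "y \<in> cl w"
  have "star x y - star v w \<in> OV"
   by (rule OV_cong_trans[OF cong_star star_cong]) (use x y V v w in "auto simp: mem_cl")
  thus "cl (zhu_star (triplet p) x y) = cl (star v w)" using V[OF x v] by (simp add: e cl_eq)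
 qed
 also have "... = cl (star v w)" using cl_self[of v] cl_self[of w] by blast
 finally show ?thesis .
qed

lemma cl_assoc: "a \<in> V ==> b \<in> V ==> c \<in> V ==> cl (star (star a b) c) = cl (star a (star b c))"
 by (simp add: cl_eq star_assoc)

lemmas A_simps = A_one A_zero A_add A_smult A_mult

lemma A_ring: "ring A"
proof (intro ringI abelian_groupI monoidI, unfold A_carrier)
 fix x assume "x \<in> cl ` V"
 then obtain v where v: "x = cl v" "v \<in> V" by blast
 have "cl (scale (- 1) v) \<oplus>\<^bsub>A\<^esub> x = \<zero>\<^bsub>A\<^esub>" by (simp add: v A_simps pm.scale_minus_left)
 thus "\<exists>y\<in>cl ` V. y \<oplus>\<^bsub>A\<^esub> x = \<zero>\<^bsub>A\<^esub>" using V_scale[OF v(2)] by blast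
qed (auto simp: A_simps V_0 V_add one_V zp_V add_ac one_star star_one cl_assoc zp1_add zp2_add OV_0)

lemma A_module: "Module.module class_ring A"
proof -
 interpret ring A by (rule A_ring)
 show ?thesis
  by unfold_locales (auto simp: A_carrier A_simps V_scale pm.scale_left_distrib pm.scale_right_distrib)
qed

lemma A_vs: "vectorspace class_ring A"
 by (intro vectorspace.intro A_module class_field)

lemma A_finsum: "finite I ==> f ` I \<subseteq> V ==> (\<Oplus>\<^bsub>A\<^esub>i\<in>I. cl (f i)) = cl (sum f I)"
proof (induction I rule: finite_induct)
 interpret ring A by (rule A_ring)
 { case empty show ?case by (simp add: A_zero) }
 { case (insert i I) thus ?case by (subst finsum_insert) (auto simp: A_carrier A_add) }
qed

lemma A_pow: "cl om [^]\<^bsub>A\<^esub> (k::nat) = cl ((Wo ^^ k) one)"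
proof (induction k)
 interpret ring A by (rule A_ring)
 case 0 show ?case by (simp add: A_one)
next
 interpret ring A by (rule A_ring)
 case (Suc k)
 have "cl om \<in> carrier A" by (simp add: A_carrier om_V)
 hence "cl om [^]\<^bsub>A\<^esub> Suc k = cl om \<otimes>\<^bsub>A\<^esub> cl om [^]\<^bsub>A\<^esub> k" by (rule nat_pow_Suc2)
 moreover have "(Wo ^^ k) one \<in> V" by (induction k) (simp_all add: one_V Wo_V)
 ultimately show ?case by (simp only: Suc A_mult om_V funpow.simps o_apply)
qed

lemma A_poly: "alg_poly A P (cl om) = cl (pw P one)"
proof -
 have "(Wo ^^ k) one \<in> V" for k by (induction k) (simp_all add: one_V Wo_V)
 thus ?thesis unfolding alg_poly_def A_pow A_smult pw_def by (subst A_finsum) (auto intro: V_scale)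
qed

lemma span_cl:
 assumes "finite I" "x ` I \<subseteq> V" "inj_on (%i. cl (x i)) I"
 shows "LinearCombinations.module.span class_ring A ((%i. cl (x i)) ` I) = {cl (\<Sum>i\<in>I. scale (c i) (x i)) | c. True}" (is "_ = ?R")
  and "(!!c. (\<Sum>i\<in>I. scale (c i) (x i)) \<in> OV ==> \<forall>i\<in>I. c i = 0) ==> \<not> LinearCombinations.module.lin_dep class_ring A ((%i. cl (x i)) ` I)"
proof -
 let ?g = "%i. cl (x i)"
 interpret vectorspace class_ring A by (rule A_vs)
 have S: "?g ` I \<subseteq> carrier A" using assms(2) by (auto simp: A_carrier)
 have l: "lincomb a (?g ` I) = cl (\<Sum>i\<in>I. scale (a (?g i)) (x i))" for a
 proof -
  have "lincomb a (?g ` I) = (\<Oplus>\<^bsub>A\<^esub>i\<in>I. a (?g i) \<odot>\<^bsub>A\<^esub> ?g i)" unfolding lincomb_def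
   by (rule finsum_reindex) (use assms in "auto simp: A_carrier A_smult V_scale")
  thus ?thesis unfolding A_smult using assms by (subst (asm) A_finsum) (auto intro: V_scale)
 qed
 show "span (?g ` I) = ?R"
 proof (intro equalityI subsetI)
  fix v assume "v \<in> span (?g ` I)"
  thus "v \<in> ?R" using assms(1) by (auto simp: finite_span[OF _ S] l)
 next
  fix v assume "v \<in> ?R"
  then obtain c where c: "v = cl (\<Sum>i\<in>I. scale (c i) (x i))" by blast
  have "(\<Sum>i\<in>I. scale (c i) (x i)) = (\<Sum>i\<in>I. scale (c (the_inv_into I ?g (?g i))) (x i))"
   by (rule sum.cong) (simp_all add: the_inv_into_f_f[OF assms(3)])
  hence "v = lincomb (%w. c (the_inv_into I ?g w)) (?g ` I)" by (simp only: c l)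
  thus "v \<in> span (?g ` I)" using assms(1) by (auto simp: finite_span[OF _ S])
 qed
 assume i: "!!c. (\<Sum>i\<in>I. scale (c i) (x i)) \<in> OV ==> \<forall>i\<in>I. c i = 0"
 show "lin_indpt (?g ` I)"
 proof (rule finite_lin_indpt2[OF _ S])
  fix a assume "lincomb a (?g ` I) = \<zero>\<^bsub>A\<^esub>"
  thus "\<forall>v\<in>?g ` I. a v = \<zero>\<^bsub>class_ring\<^esub>" using i[of "%i. a (?g i)"] by (simp add: l A_zero cl_eq)
 qed (use assms in simp)
qed

lemma inj_cl:
 assumes I: "finite I" and i: "!!c. (\<Sum>i\<in>I. scale (c i) (x i)) \<in> OV ==> \<forall>i\<in>I. c i = (0 :: complex)"
 shows "inj_on (%i. cl (x i)) I"
proof (rule inj_onI, rule ccontr)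
 fix k l assume k: "k \<in> I" "l \<in> I" "cl (x k) = cl (x l)" "k ~= l"
 have "(\<Sum>j\<in>I. scale ((if j = k then 1 else 0) - (if j = l then 1 else 0)) (x j)) = (\<Sum>j\<in>I. (if j = k then x k else 0) - (if j = l then x l else 0))"
  by (rule sum.cong) auto
 also have "... = x k - x l" using k I by (simp add: sum_subtractf)
 finally show False using i[of "%j. (if j = k then 1 else 0) - (if j = l then 1 else 0)"] k by (force simp: cl_eq)
qed

text \<open>Serves for the whole algebra and for the ideals. Independence modulo \<open>O(V)\<close>
  also makes the classes distinct, so the index set can be counted.\<close>

lemma dim_cl:
 assumes I: "finite I" "x ` I \<subseteq> V" and i: "!!c. (\<Sum>i\<in>I. scale (c i) (x i)) \<in> OV ==> \<forall>i\<in>I. c i = 0"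
  and C: "C = {cl (\<Sum>i\<in>I. scale (c i) (x i)) | c. True}"
 shows "vectorspace.fin_dim class_ring (A\<lparr>carrier := C\<rparr>) \<and> vectorspace.dim class_ring (A\<lparr>carrier := C\<rparr>) = card I"
proof -
 let ?g = "%i. cl (x i)"
 interpret vectorspace class_ring A by (rule A_vs)
 note inj = inj_cl[OF I(1) i]
 have S: "?g ` I \<subseteq> carrier A" using I by (auto simp: A_carrier)
 note sp = span_cl(1)[OF I inj, folded C]
 have sub: "submodule class_ring C A" using span_is_submodule[OF S] by (simp add: sp)
 have SC: "?g ` I \<subseteq> C" using in_own_span[OF S] by (simp add: sp)
 interpret w: vectorspace class_ring "A\<lparr>carrier := C\<rparr>"
  by (rule subspace_is_vs[OF VectorSpace.subspace.intro[OF A_vs sub]])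
 have b: "w.basis (?g ` I)"
  using span_cl(2)[OF I inj i] span_li_not_depend[OF SC sub] SC sp by (auto simp: w.basis_def)
 have "w.dim = card (?g ` I)" using b I by (intro w.dim_basis) auto
 moreover have "w.fin_dim" unfolding w.fin_dim_def using b I by (intro exI[of _ "?g ` I"]) (auto simp: w.basis_def)
 ultimately show ?thesis by (simp add: card_image[OF inj])
qed

end

section \<open>The dimension of Zhu's algebra\<close>

context lat begin

lemma pw_dvd: "D dvd B ==> pw D v \<in> OV ==> pw B v \<in> OV"
 by (elim dvdE) (simp add: mult.commute[of D] pw_mult pw_OV)

lemma pw_mod: assumes "pw D v \<in> OV" shows "pw P v - pw (P mod D) v \<in> OV"
proof -
 have "pw P v = pw (P div D * D) v + pw (P mod D) v" by (simp flip: pw_add)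
 thus ?thesis using pw_dvd[OF _ assms, of "P div D * D"] by simp
qed

lemma pw_sum: "pw (sum g I) v = (\<Sum>i\<in>I. pw (g i) v)"
 by (induction I rule: infinite_finite_induct) (simp_all add: pw_add)

abbreviation comb :: "(nat => complex poly) => fock" where
 "comb P \<equiv> pw (P 0) one + pw (P 1) H + pw (P 2) E + pw (P 3) F"

abbreviation gens :: "nat => fock" where "gens m \<equiv> [one, H, E, F] ! m"
abbreviation nums :: "nat => nat" where "nums m \<equiv> if m = 0 then 3 * p - 1 else p"

lemma comb_sum:
 "(\<Sum>i\<in>Sigma {..<4} (%m. {..<nums m}). scale (c i) (pw (monom 1 (snd i)) (gens (fst i)))) = comb (%m. \<Sum>k<nums m. monom (c (m, k)) k)"
proof -
 have "(\<Sum>k<n. scale (c (m, k)) (pw (monom 1 k) v)) = pw (\<Sum>k<n. monom (c (m, k)) k) v" for n m v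
  by (simp add: pw_sum smult_monom flip: pw_smult)
 moreover have "(\<Sum>i\<in>Sigma {..<4} (%m. {..<nums m}). scale (c i) (pw (monom 1 (snd i)) (gens (fst i)))) = (\<Sum>m<4. \<Sum>k<nums m. scale (c (m, k)) (pw (monom 1 k) (gens m)))"
  by (subst sum.Sigma) (auto simp: split_def)
 moreover have "{..<4} = {0, 1, 2, 3 :: nat}" by auto
 ultimately show ?thesis by (simp add: add.assoc)
qed

lemma dim_A: assumes pr: "prime p"
 shows "vectorspace.fin_dim class_ring A \<and> vectorspace.dim class_ring A = 6 * p - 1"
proof -
 let ?I = "Sigma {..<4} (%m. {..<nums m})"
 let ?x = "%i. pw (monom 1 (snd i)) (gens (fst i))"
 have gV: "gens m \<in> V" if "m < 4" for m using that one_V H_V E_V F_V by (auto simp: less_Suc_eq numeral_eq_Suc)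
 have x: "?x ` ?I \<subseteq> V" using gV by (auto intro: pw_V)
 have cf: "poly.coeff (\<Sum>k<n. monom (c k) k) j = (if j < n then c j else 0)" for c :: "nat => complex" and n j
  by (simp add: coeff_sum sum.delta)
 have dg: "degree (\<Sum>k<n. monom (c k) k) < n" if "n > 0" for c :: "nat => complex" and n
  by (rule degree_lessI) (use that cf in auto)
 have n0: "nums m > 0" for m using pge by simp
 have ind: "\<forall>i\<in>?I. c i = 0" if c: "(\<Sum>i\<in>?I. scale (c i) (?x i)) \<in> OV" for c
 proof -
  let ?P = "%m. \<Sum>k<nums m. monom (c (m, k)) k"
  have "?P 0 = 0 \<and> ?P 1 = 0 \<and> ?P 2 = 0 \<and> ?P 3 = 0"
   by (rule independence[OF pr c[unfolded comb_sum]]) (use dg pge in simp_all)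
  moreover have "m = 0 \<or> m = 1 \<or> m = 2 \<or> m = 3" if "m < 4" for m :: nat using that by linarith
  ultimately have P: "?P m = 0" if "m < 4" for m using that by blast
  show ?thesis
  proof
   fix i assume i: "i \<in> ?I"
   thus "c i = 0" using cf[of "%k. c (fst i, k)" "nums (fst i)" "snd i"] P[of "fst i"] by auto
  qed
 qed
 have C: "carrier A = {cl (\<Sum>i\<in>?I. scale (c i) (?x i)) | c. True}"
 proof (intro equalityI subsetI)
  fix X assume "X \<in> carrier A"
  then obtain v where v: "v \<in> V" "X = cl v" by (auto simp: A_carrier)
  obtain P R T1 T2 where s: "v - (pw P one + pw R H + pw T1 E + pw T2 F) \<in> OV"
   using spanned_V[OF pr v(1)] unfolding spanned_def by blast
  \<comment> \<open>Division with remainder by the relations \<open>rel_M\<close> and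
    \<open>rel_T\<close> gives a normal form.\<close>
  define G where "G m = (if m = 0 then P mod (TT * M1) else [P, R, T1, T2] ! m mod TT)" for m
  define c where "c = (%(m, k). poly.coeff (G m) k)"
  have nz: "TT ~= 0" "M1 ~= 0" by (simp_all add: TT_def M1_def)
  have "degree TT = p" "degree (TT * M1) = 3 * p - 1" using pge nz by (simp_all add: degree_mult_eq TT_def M1_def degree_prod_lin)
  hence dG: "degree (G m) < nums m" for m using degree_mod_less'[of TT] degree_mod_less'[of "TT * M1"] nz pge
   by (cases "G m = 0") (auto simp: G_def)
  have G: "G m = (\<Sum>k<nums m. monom (c (m, k)) k)" for m
   by (rule poly_eqI) (use dG[of m] in "auto simp: cf c_def intro!: coeff_eq_0")
  have "pw P one - pw (G 0) one \<in> OV" "pw R H - pw (G 1) H \<in> OV" "pw T1 E - pw (G 2) E \<in> OV" "pw T2 F - pw (G 3) F \<in> OV"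
   using pw_mod[OF rel_M[OF pr]] pw_mod[OF rel_T(2)[OF pr]] pw_mod[OF rel_T(3)[OF pr]] pw_mod[OF rel_T(1)[OF pr]]
   by (simp_all add: G_def numeral_eq_Suc)
  from OV_add[OF s OV_add[OF OV_add[OF this(1,2)] OV_add[OF this(3,4)]]] have "v - comb G \<in> OV" by (simp add: algebra_simps)
  moreover have "comb G = (\<Sum>i\<in>?I. scale (c i) (?x i))" unfolding comb_sum G[symmetric] ..
  ultimately show "X \<in> {cl (\<Sum>i\<in>?I. scale (c i) (?x i)) | c. True}" using v(2) by (auto simp: cl_eq)
 next
  fix X assume "X \<in> {cl (\<Sum>i\<in>?I. scale (c i) (?x i)) | c. True}"
  then obtain c where "X = cl (\<Sum>i\<in>?I. scale (c i) (?x i))" by blast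
  moreover have "(\<Sum>i\<in>?I. scale (c i) (?x i)) \<in> V" by (rule V_sum) (use x V_scale in blast)
  ultimately show "X \<in> carrier A" by (auto simp: A_carrier)
 qed
 have "card ?I = 6 * p - 1"
 proof -
  have "{..<4} = {0, 1, 2, 3 :: nat}" by auto
  thus ?thesis using pge by simp
 qed
 moreover have "finite ?I" by simp
 moreover have "A\<lparr>carrier := carrier A\<rparr> = A" by simp
 ultimately show ?thesis using dim_cl[OF _ x ind C] by metis
qed

section \<open>The ideals\<close>

context
 fixes i assumes pr: "prime p" and i: "i \<in> {1..p - 1}"
begin

abbreviation "hi \<equiv> h_wt p i"
abbreviation "fi \<equiv> f_poly p i"
text \<open>The first order Taylor polynomial of \<open>1/fi\<close> at \<open>hi\<close>, so that
  \<open>Ki * fi\<close> is 1 modulo the square of \<open>X - hi\<close>.\<close>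

abbreviation "Ki \<equiv> [:nu_coeff p i, lambda_coeff p i:]"

text \<open>\<open>i\<close> and \<open>2p - i\<close> have the same weight, so \<open>hi\<close> is
  a double root of \<open>TT * M1\<close>, and \<open>fi\<close> is the cofactor. All
  \<open>j >= 2p\<close> remain in it, whence the divisibility by \<open>TT\<close>.\<close>

lemma f_facts: "poly fi hi ~= 0" "degree fi = 3 * p - 3" "TT dvd fi"
 "(\<Prod>j\<in>{1..3 * p - 1} - {i}. [:- h_wt p j, 1:]) = [:- hi, 1:] * fi" "[:- hi, 1:] * ([:- hi, 1:] * fi) = TT * M1"
proof -
 have i': "i ~= 2 * p - i" "2 * p - i \<in> {1..3 * p - 1}" "i \<in> {1..3 * p - 1}" using i by auto
 have hh: "h_wt p (2 * p - i) = hi" unfolding h_wt_eq using i by auto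
 have "hi ~= h_wt p j" if "j \<notin> {i, 2 * p - i}" for j unfolding h_wt_eq using that by auto
 thus "poly fi hi ~= 0" by (auto simp: f_poly_def poly_prod prod_zero_iff)
 show "degree fi = 3 * p - 3" unfolding f_poly_def degree_prod_lin using i' by (simp add: card_Diff_subset)
 show "TT dvd fi" unfolding TT_def f_poly_def by (rule prod_dvd_prod_subset) (use i in auto)
 have "{1..3 * p - 1} - {i} - {2 * p - i} = {1..3 * p - 1} - {i, 2 * p - i}" by auto
 thus e: "(\<Prod>j\<in>{1..3 * p - 1} - {i}. [:- h_wt p j, 1:]) = [:- hi, 1:] * fi"
  unfolding f_poly_def by (subst prod.remove[of _ "2 * p - i"]) (use i' hh in "auto simp del: mult_pCons_left")
 have "[:- hi, 1:] * ([:- hi, 1:] * fi) = (\<Prod>j\<in>{1..3 * p - 1}. [:- h_wt p j, 1:])"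
  unfolding e[symmetric] using i' by (subst prod.remove[of "{1..3 * p - 1}" i]) auto
 also have "{1..3 * p - 1} = {2 * p..<3 * p} \<union> {1..<2 * p}" using pge by auto
 also have "(\<Prod>j\<in>{2 * p..<3 * p} \<union> {1..<2 * p}. [:- h_wt p j, 1:]) = TT * M1"
  unfolding TT_def M1_def by (rule prod.union_disjoint) auto
 finally show "[:- hi, 1:] * ([:- hi, 1:] * fi) = TT * M1" .
qed

lemma Ki_h: "poly Ki hi = 1 / poly fi hi"
 by (simp add: nu_coeff_def lambda_coeff_def field_simps)

lemma v_w: "v_elem p i = cl (pw (Ki * fi) one)" "w_elem p i = cl (pw ([:- hi, 1:] * fi) one)"
proof -
 have "v_elem p i = cl (star (scale (lambda_coeff p i) om + scale (nu_coeff p i) one) (pw fi one))"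
  unfolding v_elem_def omega_class_def triplet_simps A_poly A_one A_smult A_add
  by (rule A_mult) (auto intro: V_add V_scale om_V one_V pw_V)
 also have "star (scale (lambda_coeff p i) om + scale (nu_coeff p i) one) (pw fi one) = pw (Ki * fi) one"
  unfolding pw_mult by (simp add: zp1_add zp1_scale zp2_scale zp2_0 one_star pw_pCons add.commute)
 finally show "v_elem p i = cl (pw (Ki * fi) one)" .
 show "w_elem p i = cl (pw ([:- hi, 1:] * fi) one)"
  by (simp only: w_elem_def omega_class_def triplet_simps A_poly f_facts(4))
qed

abbreviation "xi k \<equiv> pw ((if k = 0 then Ki else [:- hi, 1:]) * fi) one" for k :: nat

lemma xi_sum: "(\<Sum>k\<in>{0, 1}. scale (c k) (xi k)) = pw ((psmult (c 0) Ki + psmult (c 1) [:- hi, 1:]) * fi) one"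
 by (simp add: distrib_right pw_add mult_smult_left pw_smult del: smult_pCons mult_pCons_left mult_pCons_right add_pCons)

text \<open>The combination has degree at most \<open>3p - 2\<close>, below that of the relation
  \<open>TT * M1\<close>; evaluating at \<open>hi\<close> then separates the two
  coefficients.\<close>

lemma xi_ind: assumes c: "(\<Sum>k\<in>{0, 1 :: nat}. scale (c k) (xi k)) \<in> OV" shows "\<forall>k\<in>{0, 1}. c k = 0"
proof -
 define K where "K = psmult (c 0) Ki + psmult (c 1) [:- hi, 1:]"
 have "degree K <= 1" unfolding K_def by (intro degree_add_le degree_smult_le[THEN order_trans]) auto
 hence "degree (K * fi) < 3 * p - 1" using f_facts(2) pge degree_mult_le[of K fi] by linarith
 hence "K * fi = 0" using independence[OF pr, of "K * fi" 0 0 0] c[unfolded xi_sum, folded K_def] pge by simp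
 moreover have "fi ~= 0" using f_facts(1) by auto
 ultimately have K: "K = 0" by simp
 have "poly K hi = c 0 / poly fi hi" unfolding K_def poly_add poly_smult Ki_h by simp
 hence c0: "c 0 = 0" using K f_facts(1) by simp
 hence "c 1 = 0" using K by (simp add: K_def)
 with c0 show ?thesis by simp
qed

lemma I_eq: "I_ideal p i = {cl (\<Sum>k\<in>{0, 1 :: nat}. scale (c k) (xi k)) | c. True}"
proof -
 have x: "xi ` {0, 1} \<subseteq> V" by (auto intro: pw_V one_V)
 have "(%k. cl (xi k)) ` {0, 1 :: nat} = {v_elem p i, w_elem p i}" by (simp add: v_w del: mult_pCons_left mult_pCons_right)
 thus ?thesis unfolding I_ideal_def using span_cl(1)[OF _ x inj_cl[OF _ xi_ind]] by simp
qed

text \<open>Modulo the square of \<open>X - hi\<close>, whose product with \<open>fi\<close> is the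
  relation \<open>TT * M1\<close>, every polynomial is a combination of \<open>Ki\<close> and
  \<open>X - hi\<close>, because \<open>Ki\<close> does not vanish at \<open>hi\<close>. In this
  form the ideal property is within reach.\<close>

lemma I_eq': "I_ideal p i = {cl (pw (K * fi) one) | K. True}"
proof (intro equalityI subsetI)
 fix X assume "X \<in> I_ideal p i" thus "X \<in> {cl (pw (K * fi) one) | K. True}" unfolding I_eq xi_sum by blast
next
 fix X assume "X \<in> {cl (pw (K * fi) one) | K. True}"
 then obtain K where X: "X = cl (pw (K * fi) one)" by blast
 have div: "\<exists>R. P = [:poly P hi:] + [:- hi, 1:] * R" for P
 proof -
  have "[:- hi, 1:] dvd P - [:poly P hi:]" by (simp add: poly_eq_0_iff_dvd[symmetric])
  then obtain R where "P - [:poly P hi:] = [:- hi, 1:] * R" by (elim dvdE)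
  thus ?thesis by (metis add_diff_cancel_left' diff_add_cancel add.commute)
 qed
 let ?c0 = "poly K hi * poly fi hi"
 let ?K = "K - psmult ?c0 Ki"
 have "poly ?K hi = 0" unfolding poly_diff poly_smult Ki_h using f_facts(1) by simp
 then obtain R where R: "?K = [:- hi, 1:] * R" using div[of ?K] by auto
 obtain R' where R': "R = [:poly R hi:] + [:- hi, 1:] * R'" using div by blast
 define c where "c k = (if k = 0 then ?c0 else poly R hi)" for k :: nat
 have c: "c 0 = ?c0" "c 1 = poly R hi" by (simp_all add: c_def)
 have "K = psmult (c 0) Ki + psmult (c 1) [:- hi, 1:] + R' * ([:- hi, 1:] * [:- hi, 1:])"
 proof -
  have "K = psmult ?c0 Ki + [:- hi, 1:] * R" using R by (simp only: diff_eq_eq add.commute)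
  also have "[:- hi, 1:] * R = [:- hi, 1:] * [:poly R hi:] + [:- hi, 1:] * ([:- hi, 1:] * R')" by (subst R') (simp only: distrib_left)
  also have "[:- hi, 1:] * [:poly R hi:] = psmult (c 1) [:- hi, 1:]" by (simp add: c_def)
  finally show ?thesis unfolding c(1) by (simp only: add.assoc mult_ac)
 qed
 hence "K * fi = (psmult (c 0) Ki + psmult (c 1) [:- hi, 1:]) * fi + R' * (TT * M1)"
  unfolding f_facts(5)[symmetric] by (simp only: distrib_right mult.assoc)
 hence "pw (K * fi) one = (\<Sum>k\<in>{0, 1 :: nat}. scale (c k) (xi k)) + pw R' (pw (TT * M1) one)"
  unfolding xi_sum by (simp only: pw_add pw_mult)
 hence "X = cl (\<Sum>k\<in>{0, 1 :: nat}. scale (c k) (xi k))" using pw_OV[OF rel_M[OF pr], of R'] by (simp add: X cl_eq)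
 thus "X \<in> I_ideal p i" unfolding I_eq by blast
qed

lemma dim_I: "vectorspace.fin_dim class_ring (A\<lparr>carrier := I_ideal p i\<rparr>) \<and> vectorspace.dim class_ring (A\<lparr>carrier := I_ideal p i\<rparr>) = 2"
proof -
 have c: "card {0, 1 :: nat} = 2" by simp
 show ?thesis by (rule dim_cl[OF _ _ xi_ind I_eq, unfolded c]) (auto intro: pw_V one_V)
qed

text \<open>\<open>TT\<close> divides \<open>fi\<close>, so \<open>H\<close>, \<open>E\<close> and
  \<open>F\<close> act by 0 from both sides, and only the polynomial part of \<open>y\<close>
  contributes.\<close>

lemma I_mult:
 assumes "y \<in> V" obtains P where "star (pw (K * fi) one) y - pw (P * fi) one \<in> OV" "star y (pw (K * fi) one) - pw (P * fi) one \<in> OV"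
proof -
 let ?G = "K * fi" and ?u = "pw (K * fi) one"
 obtain P R T1 T2 where s: "y - (pw P one + pw R H + pw T1 E + pw T2 F) \<in> OV"
  using spanned_V[OF pr assms] unfolding spanned_def by blast
 let ?z = "pw P one + pw R H + pw T1 E + pw T2 F"
 have u: "?u \<in> V" by (rule pw_V[OF one_V])
 have G: "pw ?G X \<in> OV" if "X \<in> {H, E, F}" for X
  by (rule pw_dvd[of TT]) (use rel_T[OF pr] f_facts(3) that in auto)
 have GR: "pw ?G (pw R X) \<in> OV" if "X \<in> {H, E, F}" for R X
  using pw_OV[OF G[OF that], of R] by (simp add: pw_mult[symmetric] mult.commute)
 have P: "pw (P * ?G) one = pw ?G (pw P one)" by (simp add: pw_mult[symmetric] mult.commute)
 have "star ?u y - pw ?G y \<in> OV" using pw_star[OF one_V assms, of ?G] by (simp add: one_star)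
 from OV_cong_trans[OF this pw_cong[OF s]] have 1: "star ?u y - pw ?G ?z \<in> OV" .
 have "pw ?G ?z - pw (P * ?G) one = pw ?G (pw R H) + pw ?G (pw T1 E) + pw ?G (pw T2 F)" by (simp add: P lin_add[OF pw_lin])
 hence "pw ?G ?z - pw (P * ?G) one \<in> OV" using GR by (auto intro!: OV_add)
 from OV_cong_trans[OF 1 this] have l: "star ?u y - pw (P * ?G) one \<in> OV" .
 have X: "star (pw R X) ?u \<in> OV" if "X \<in> {H, E, F}" for R X
 proof -
  have X: "prim X" "\<exists>k. gr wF k X" "X \<in> V" using that prim_F prim_H prim_E gr_F gr_H gr_E F_V H_V E_V by auto
  then obtain k where k: "gr wF k X" by blast
  have "star X ?u - pw ?G X \<in> OV" using prim_pw[OF X(1) k one_V, of ?G] by (simp add: star_one[OF X(3)])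
  hence "star X ?u \<in> OV" using OV_add[OF _ G[OF that]] by fastforce
  from pw_OV[OF this, of R] pw_star[OF X(3) u, of R] show ?thesis using OV_add by fastforce
 qed
 have "star (pw P one) ?u - pw P ?u \<in> OV" using pw_star[OF one_V u, of P] by (simp add: one_star)
 hence 2: "star (pw P one) ?u - pw (P * ?G) one \<in> OV" by (simp add: pw_mult)
 have e: "star ?z ?u - pw (P * ?G) one = (star (pw P one) ?u - pw (P * ?G) one) + star (pw R H) ?u + star (pw T1 E) ?u + star (pw T2 F) ?u"
  by (simp add: zp1_add)
 have "star ?z ?u - pw (P * ?G) one \<in> OV" unfolding e by (intro OV_add 2 X) auto
 from OV_cong_trans[OF cong_star[OF u s] this] have "star y ?u - pw (P * ?G) one \<in> OV" .
 thus ?thesis using that[of "P * K"] l by (simp add: mult.assoc)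
qed

lemma I_ideal: "ideal (I_ideal p i) A"
proof (rule idealI[OF A_ring])
 interpret ring A by (rule A_ring)
 show "subgroup (I_ideal p i) (add_monoid A)"
 proof (rule add.subgroupI)
  show "I_ideal p i \<subseteq> carrier A" by (auto simp: I_eq' A_carrier intro!: pw_V one_V)
  show "I_ideal p i ~= {}" by (auto simp: I_eq')
  fix X assume "X \<in> I_ideal p i"
  then obtain K where X: "X = cl (pw (K * fi) one)" by (auto simp: I_eq')
  have "\<ominus>\<^bsub>A\<^esub> X = cl (pw ((- K) * fi) one)"
  proof (rule minus_equality)
   have "pw (- K * fi) one + pw (K * fi) one = 0" by (simp flip: pw_add)
   thus "cl (pw (- K * fi) one) \<oplus>\<^bsub>A\<^esub> X = \<zero>\<^bsub>A\<^esub>" by (simp only: X A_simps)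
  qed (auto simp: X A_carrier intro!: pw_V one_V)
  thus "\<ominus>\<^bsub>A\<^esub> X \<in> I_ideal p i" unfolding I_eq' by blast
  fix X' assume "X' \<in> I_ideal p i"
  then obtain K' where X': "X' = cl (pw (K' * fi) one)" by (auto simp: I_eq')
  have "X \<oplus>\<^bsub>A\<^esub> X' = cl (pw ((K + K') * fi) one)" by (simp add: X X' A_add distrib_right pw_add)
  thus "X \<oplus>\<^bsub>A\<^esub> X' \<in> I_ideal p i" unfolding I_eq' by blast
 qed
 fix X y' assume "X \<in> I_ideal p i" "y' \<in> carrier A"
 then obtain K y where X: "X = cl (pw (K * fi) one)" and y: "y' = cl y" "y \<in> V" by (auto simp: I_eq' A_carrier)
 obtain P where P: "star (pw (K * fi) one) y - pw (P * fi) one \<in> OV" "star y (pw (K * fi) one) - pw (P * fi) one \<in> OV"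
  using I_mult[OF y(2)] .
 have "X \<otimes>\<^bsub>A\<^esub> y' = cl (pw (P * fi) one)" "y' \<otimes>\<^bsub>A\<^esub> X = cl (pw (P * fi) one)"
  using P by (simp_all add: X y A_mult pw_V one_V cl_eq)
 thus "y' \<otimes>\<^bsub>A\<^esub> X \<in> I_ideal p i" "X \<otimes>\<^bsub>A\<^esub> y' \<in> I_ideal p i" unfolding I_eq' by blast+
qed

end

end

theorem theoremC:
  fixes p :: nat
  assumes "prime p"
  shows "(\<forall>i\<in>{1..p - 1}.
           ideal (I_ideal p i) (A_triplet p) \<and>
           vectorspace.fin_dim class_ring (A_triplet p\<lparr>carrier := I_ideal p i\<rparr>) \<and>
           vectorspace.dim class_ring (A_triplet p\<lparr>carrier := I_ideal p i\<rparr>) = 2) \<and>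
         vectorspace.fin_dim class_ring (A_triplet p) \<and>
         vectorspace.dim class_ring (A_triplet p) = 6 * p - 1"
proof -
  interpret lat p by unfold_locales (use assms prime_ge_2_nat in blast)
  show ?thesis using I_ideal[OF assms] dim_I[OF assms] dim_A[OF assms] by blast
qed

end
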